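(* Let $d\in\mathbb{N}$, $d\ge2$, $\sigma>0$, and assume that $V \in C^\infty(\mathbb{R}^d)$. Then the spherical velocity Langevin operator $(L,C_c^\infty(\mathbb{M}))$ is essentially m-dissipative on $L^2(\mathbb{M},\mu)$. Thus its closure $(L,D(L))$ generates a strongly continuous contraction semigroup $(T(t))_{t \geq 0}$ on $L^2(\mathbb{M},\mu)$.
   Context: $\mathbb{S}$ is the unit sphere in $\mathbb{R}^d$, $\mathbb{M}=\mathbb{R}^d\times\mathbb{S}$ with points $(x,\omega)$, $\nu$ is the normalized surface measure on $\mathbb{S}$, and $\mu=e^{-V}\mathrm{d}x\otimes\nu$ (not assumed to be finite). $L^2$-spaces are real. On $C_c^\infty(\mathbb{M})$ (smooth compactly supported functions) define $$L= \omega \cdot \nabla_x - \text{grad}_{\mathbb{S}} \Phi \cdot \nabla_\omega + \tfrac{1}{2} \sigma^2 \, \Delta_{\mathbb{S}},\qquad \Phi(x,\omega)= \tfrac{1}{d-1} \,\nabla V(x) \cdot \omega,$$ where $\Delta_{\mathbb{S}}$ is the Laplace–Beltrami operator on $\mathbb{S}$ acting on $\omega$, and $\text{grad}_{\mathbb{S}}\Phi(x,\omega)=\frac{1}{d-1}(I-\omega\omega^T)\nabla V(x)$ is the spherical gradient in $\omega$; $\text{grad}_{\mathbb{S}} \Phi \cdot \nabla_\omega f$ is the derivative of $f(x,\cdot)$ in the direction of this tangent vector. A densely defined operator is essentially m-dissipative if it is dissipative and its closure is m-dissipative (equivalently, it is dissipative and the range of $I-L$ is dense). *)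

theory Defs
  imports "HOL-Analysis.Analysis"
begin

section \<open>Smooth functions\<close>

fun Ck_on :: "nat \<Rightarrow> ('a::real_normed_vector \<Rightarrow> 'b::real_normed_vector) \<Rightarrow> 'a set \<Rightarrow> bool" where
  "Ck_on 0 f S \<longleftrightarrow> continuous_on S f"
| "Ck_on (Suc k) f S \<longleftrightarrow> (\<forall>x\<in>S. f differentiable (at x)) \<and>
     (\<forall>v. Ck_on k (\<lambda>x. frechet_derivative f (at x) v) S)"

text \<open>Meant for open \<open>S\<close> only, since derivatives are taken in the ambient space.\<close>

definition smooth_on :: "'a::real_normed_vector set \<Rightarrow> ('a \<Rightarrow> 'b::real_normed_vector) \<Rightarrow> bool" where
  "smooth_on S f \<longleftrightarrow> (\<forall>k. Ck_on k f S)"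

text \<open>Smoothness on an embedded submanifold \<open>M\<close> of the ambient space: near each of its points the
  function is the restriction of a smooth function defined on an ambient neighbourhood.  Values
  outside \<open>M\<close> are irrelevant.\<close>

definition smooth_on_submanifold ::
    "'a::real_normed_vector set \<Rightarrow> ('a \<Rightarrow> 'b::real_normed_vector) \<Rightarrow> bool" where
  "smooth_on_submanifold M f \<longleftrightarrow>
     (\<forall>p\<in>M. \<exists>U F. open U \<and> p \<in> U \<and> smooth_on U F \<and> (\<forall>q\<in>U \<inter> M. F q = f q))"

definition grad :: "('a::euclidean_space \<Rightarrow> real) \<Rightarrow> 'a \<Rightarrow> 'a" where
  "grad f x = (\<Sum>b\<in>Basis. frechet_derivative f (at x) b *\<^sub>R b)"


section \<open>Calculus on the unit sphere\<close>

abbreviation unit_sphere :: "'a::real_normed_vector set" where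
  "unit_sphere \<equiv> sphere 0 1"

text \<open>\<open>sgn y = y /\<^sub>R norm y\<close> is the radial retraction onto the sphere.  Its derivative at a unit
  vector \<open>\<omega>\<close> is the orthogonal projection onto the tangent space at \<open>\<omega>\<close>, so \<open>sphere_deriv f \<omega> v\<close>
  is the derivative of \<open>f\<close> at \<open>\<omega>\<close> along the tangential part of \<open>v\<close>; it depends only on the values
  of \<open>f\<close> on the sphere.\<close>

definition sphere_deriv ::
    "('a::euclidean_space \<Rightarrow> 'b::real_normed_vector) \<Rightarrow> 'a \<Rightarrow> 'a \<Rightarrow> 'b" where
  "sphere_deriv f \<omega> v = frechet_derivative (\<lambda>y. f (sgn y)) (at \<omega>) v"

lemma has_derivative_sgn_unit:
  fixes \<omega> :: "'a::euclidean_space"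
  assumes "norm \<omega> = 1"
  shows "(sgn has_derivative (\<lambda>v. v - (v \<bullet> \<omega>) *\<^sub>R \<omega>)) (at \<omega>)"
proof -
  have nz: "\<omega> \<noteq> 0" using assms by auto
  have "((\<lambda>y. inverse (norm y) *\<^sub>R y) has_derivative
     (\<lambda>v. inverse (norm \<omega>) *\<^sub>R v + (- (inverse (norm \<omega>) * (v \<bullet> sgn \<omega>) * inverse (norm \<omega>))) *\<^sub>R \<omega>)) (at \<omega>)"
    using nz by (auto intro!: derivative_eq_intros has_derivative_norm)
  moreover have "sgn = (\<lambda>y::'a. inverse (norm y) *\<^sub>R y)" by (auto simp: sgn_div_norm)
  ultimately show ?thesis using assms by (simp add: sgn_div_norm)
qed

definition sphere_grad :: "('a::euclidean_space \<Rightarrow> real) \<Rightarrow> 'a \<Rightarrow> 'a" where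
  "sphere_grad f \<omega> = (\<Sum>b\<in>Basis. sphere_deriv f \<omega> b *\<^sub>R b)"

text \<open>The divergence of a tangent vector field \<open>X\<close> on the sphere.  The Levi-Civita derivative
  \<open>\<nabla>\<^sub>\<tau> X\<close> is the tangential part of the ambient derivative \<open>D\<^sub>\<tau> X\<close>, so the
  divergence is the sum of \<open>D\<^sub>\<tau> X \<bullet> \<tau>\<close> over an orthonormal basis of the tangent space.  As
  \<open>sphere_deriv X \<omega>\<close> annihilates \<open>\<omega>\<close>, this is the trace over any orthonormal basis of the ambient
  space.\<close>

definition sphere_div :: "('a::euclidean_space \<Rightarrow> 'a) \<Rightarrow> 'a \<Rightarrow> real" where
  "sphere_div X \<omega> = (\<Sum>b\<in>Basis. sphere_deriv X \<omega> b \<bullet> b)"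

definition laplace_beltrami :: "('a::euclidean_space \<Rightarrow> real) \<Rightarrow> 'a \<Rightarrow> real" where
  "laplace_beltrami f \<omega> = sphere_div (sphere_grad f) \<omega>"

text \<open>The normalized surface measure gives a Borel set \<open>A\<close> of the sphere the normalized Lebesgue
  measure of the cone \<open>{r \<omega> | 0 < r < 1, \<omega> \<in> A}\<close>.\<close>

definition sphere_measure :: "'a::euclidean_space measure" where
  "sphere_measure =
     restrict_space (distr (uniform_measure lborel (ball 0 1)) borel sgn) unit_sphere"

lemma emeasure_sphere_measure:
  "emeasure (sphere_measure :: 'a::euclidean_space measure) unit_sphere = 1"
proof -
  let ?U = "uniform_measure lborel (ball (0::'a) 1)"
  have m: "emeasure (sphere_measure :: 'a measure) unit_sphere = emeasure (distr ?U borel sgn) unit_sphere"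
    unfolding sphere_measure_def by (rule emeasure_restrict_space) auto
  have s: "sgn -` unit_sphere = - {0::'a}" by (auto simp: norm_sgn)
  have ms: "(sgn :: 'a \<Rightarrow> 'a) \<in> measurable borel borel" unfolding sgn_div_norm[abs_def] by measurable
  have "emeasure (distr ?U borel sgn) unit_sphere = emeasure ?U (- {0})"
    using ms s by (subst emeasure_distr) auto
  also have "\<dots> = emeasure lborel (ball (0::'a) 1 \<inter> - {0}) / emeasure lborel (ball (0::'a) 1)"
    by (subst emeasure_uniform_measure) auto
  also have "emeasure lborel (ball (0::'a) 1 \<inter> - {0}) = emeasure lborel (ball (0::'a) 1)"
    using emeasure_Diff_null_set[of "{0::'a}" lborel "ball 0 1"] by (simp add: Diff_eq null_sets_def)
  also have "emeasure lborel (ball (0::'a) 1) / emeasure lborel (ball (0::'a) 1) = 1"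
  proof (rule ennreal_divide_self)
    show "emeasure lborel (ball (0::'a) 1) < top"
      using emeasure_bounded_finite[of "ball (0::'a) 1"] by (simp add: top.not_eq_extremum)
    show "emeasure lborel (ball (0::'a) 1) \<noteq> 0" 
      using emeasure_ball[of 1 "0::'a"] less_imp_neq[OF unit_ball_vol_pos[of "real DIM('a)"]]
      by (simp add: ennreal_eq_0_iff not_le)
  qed
  finally show ?thesis using m by simp
qed


section \<open>Real \<open>L\<^sup>2\<close> spaces\<close>

text \<open>The points of the Hilbert space are the classes of square-integrable functions modulo
  equality almost everywhere; the carrier is \<open>L2_space M\<close>.\<close>

definition L2_funs :: "'m measure \<Rightarrow> ('m \<Rightarrow> real) set" where
  "L2_funs M = {f \<in> borel_measurable M. integrable M (\<lambda>x. (f x)\<^sup>2)}"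

definition L2_class :: "'m measure \<Rightarrow> ('m \<Rightarrow> real) \<Rightarrow> ('m \<Rightarrow> real) set" where
  "L2_class M f = {g \<in> L2_funs M. AE x in M. g x = f x}"

definition L2_space :: "'m measure \<Rightarrow> ('m \<Rightarrow> real) set set" where
  "L2_space M = L2_class M ` L2_funs M"

definition L2_rep :: "('m \<Rightarrow> real) set \<Rightarrow> 'm \<Rightarrow> real" where
  "L2_rep u = (SOME f. f \<in> u)"

definition L2_add ::
    "'m measure \<Rightarrow> ('m \<Rightarrow> real) set \<Rightarrow> ('m \<Rightarrow> real) set \<Rightarrow> ('m \<Rightarrow> real) set" where
  "L2_add M u v = L2_class M (\<lambda>x. L2_rep u x + L2_rep v x)"

definition L2_scale :: "'m measure \<Rightarrow> real \<Rightarrow> ('m \<Rightarrow> real) set \<Rightarrow> ('m \<Rightarrow> real) set" where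
  "L2_scale M c u = L2_class M (\<lambda>x. c * L2_rep u x)"

definition L2_diff ::
    "'m measure \<Rightarrow> ('m \<Rightarrow> real) set \<Rightarrow> ('m \<Rightarrow> real) set \<Rightarrow> ('m \<Rightarrow> real) set" where
  "L2_diff M u v = L2_add M u (L2_scale M (-1) v)"

definition L2_inner :: "'m measure \<Rightarrow> ('m \<Rightarrow> real) set \<Rightarrow> ('m \<Rightarrow> real) set \<Rightarrow> real" where
  "L2_inner M u v = (\<integral>x. L2_rep u x * L2_rep v x \<partial>M)"

definition L2_norm :: "'m measure \<Rightarrow> ('m \<Rightarrow> real) set \<Rightarrow> real" where
  "L2_norm M u = sqrt (L2_inner M u u)"

definition L2_tendsto ::
    "'m measure \<Rightarrow> ('t \<Rightarrow> ('m \<Rightarrow> real) set) \<Rightarrow> ('m \<Rightarrow> real) set \<Rightarrow> 't filter \<Rightarrow> bool" where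
  "L2_tendsto M u l F \<longleftrightarrow> ((\<lambda>t. L2_norm M (L2_diff M (u t) l)) \<longlongrightarrow> 0) F"


section \<open>Unbounded operators on \<open>L\<^sup>2\<close> spaces\<close>

text \<open>An operator is identified with its graph.\<close>

type_synonym 'm L2_graph = "(('m \<Rightarrow> real) set \<times> ('m \<Rightarrow> real) set) set"

definition linear_operator :: "'m measure \<Rightarrow> 'm L2_graph \<Rightarrow> bool" where
  "linear_operator M A \<longleftrightarrow>
     A \<subseteq> L2_space M \<times> L2_space M \<and> A \<noteq> {} \<and> single_valued A \<and>
     (\<forall>(u, v)\<in>A. \<forall>(u', v')\<in>A. (L2_add M u u', L2_add M v v') \<in> A) \<and>
     (\<forall>c. \<forall>(u, v)\<in>A. (L2_scale M c u, L2_scale M c v) \<in> A)"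

definition densely_defined :: "'m measure \<Rightarrow> 'm L2_graph \<Rightarrow> bool" where
  "densely_defined M A \<longleftrightarrow>
     (\<forall>u\<in>L2_space M. \<exists>w. (\<forall>n::nat. w n \<in> Domain A) \<and> L2_tendsto M w u sequentially)"

definition dissipative :: "'m measure \<Rightarrow> 'm L2_graph \<Rightarrow> bool" where
  "dissipative M A \<longleftrightarrow> (\<forall>(u, v)\<in>A. L2_inner M v u \<le> 0)"

definition m_dissipative :: "'m measure \<Rightarrow> 'm L2_graph \<Rightarrow> bool" where
  "m_dissipative M A \<longleftrightarrow>
     linear_operator M A \<and> dissipative M A \<and> {L2_diff M u v | u v. (u, v) \<in> A} = L2_space M"

definition op_closure :: "'m measure \<Rightarrow> 'm L2_graph \<Rightarrow> 'm L2_graph" where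
  "op_closure M A = {(u, v). u \<in> L2_space M \<and> v \<in> L2_space M \<and>
     (\<exists>w z. (\<forall>n::nat. (w n, z n) \<in> A) \<and>
        L2_tendsto M w u sequentially \<and> L2_tendsto M z v sequentially)}"

text \<open>Closability of \<open>A\<close> is part of the definition: \<open>m_dissipative\<close> requires the closure of the
  graph to be the graph of an operator.\<close>

definition essentially_m_dissipative :: "'m measure \<Rightarrow> 'm L2_graph \<Rightarrow> bool" where
  "essentially_m_dissipative M A \<longleftrightarrow>
     linear_operator M A \<and> densely_defined M A \<and> dissipative M A \<and> m_dissipative M (op_closure M A)"

definition C0_contraction_semigroup ::
    "'m measure \<Rightarrow> (real \<Rightarrow> ('m \<Rightarrow> real) set \<Rightarrow> ('m \<Rightarrow> real) set) \<Rightarrow> bool" where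
  "C0_contraction_semigroup M T \<longleftrightarrow>
     (\<forall>t\<ge>0. \<forall>u\<in>L2_space M. T t u \<in> L2_space M \<and> L2_norm M (T t u) \<le> L2_norm M u) \<and>
     (\<forall>t\<ge>0. \<forall>u\<in>L2_space M. \<forall>v\<in>L2_space M. T t (L2_add M u v) = L2_add M (T t u) (T t v)) \<and>
     (\<forall>t\<ge>0. \<forall>c. \<forall>u\<in>L2_space M. T t (L2_scale M c u) = L2_scale M c (T t u)) \<and>
     (\<forall>u\<in>L2_space M. T 0 u = u) \<and>
     (\<forall>s\<ge>0. \<forall>t\<ge>0. \<forall>u\<in>L2_space M. T (s + t) u = T s (T t u)) \<and>
     (\<forall>u\<in>L2_space M. L2_tendsto M (\<lambda>t. T t u) u (at_right 0))"

definition infinitesimal_generator ::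
    "'m measure \<Rightarrow> (real \<Rightarrow> ('m \<Rightarrow> real) set \<Rightarrow> ('m \<Rightarrow> real) set) \<Rightarrow> 'm L2_graph" where
  "infinitesimal_generator M T = {(u, v). u \<in> L2_space M \<and> v \<in> L2_space M \<and>
     L2_tendsto M (\<lambda>t. L2_scale M (1 / t) (L2_diff M (T t u) u)) v (at_right 0)}"


section \<open>The spherical velocity Langevin operator\<close>

definition state_space :: "('a::euclidean_space \<times> 'a) set" where
  "state_space = UNIV \<times> unit_sphere"

definition state_measure :: "('a::euclidean_space \<Rightarrow> real) \<Rightarrow> ('a \<times> 'a) measure" where
  "state_measure V = density lborel (\<lambda>x. ennreal (exp (- V x))) \<Otimes>\<^sub>M sphere_measure"

definition test_functions :: "('a::euclidean_space \<times> 'a \<Rightarrow> real) set" where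
  "test_functions = {f. smooth_on_submanifold state_space f \<and>
     compact (closure {p \<in> state_space. f p \<noteq> 0})}"

definition potential :: "('a::euclidean_space \<Rightarrow> real) \<Rightarrow> 'a \<Rightarrow> 'a \<Rightarrow> real" where
  "potential V x \<omega> = 1 / (real DIM('a) - 1) * (grad V x \<bullet> \<omega>)"

lemma sphere_grad_potential:
  assumes "norm \<omega> = 1"
  shows "sphere_grad (potential V x) \<omega> =
    (1 / (real DIM('a) - 1)) *\<^sub>R (grad V x - (grad V x \<bullet> \<omega>) *\<^sub>R (\<omega>::'a::euclidean_space))"
proof -
  let ?k = "1 / (real DIM('a) - 1)"
  let ?w = "?k *\<^sub>R (grad V x - (grad V x \<bullet> \<omega>) *\<^sub>R \<omega>)"
  have "((\<lambda>y. potential V x (sgn y)) has_derivative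
      (\<lambda>v. ?k * (grad V x \<bullet> (v - (v \<bullet> \<omega>) *\<^sub>R \<omega>)))) (at \<omega>)"
    unfolding potential_def
    by (intro has_derivative_mult_right has_derivative_inner_right has_derivative_sgn_unit assms)
  then have d: "sphere_deriv (potential V x) \<omega> v = ?w \<bullet> v" for v
    unfolding sphere_deriv_def
    by (subst frechet_derivative_at[symmetric]) (auto simp: algebra_simps inner_commute)
  show ?thesis unfolding sphere_grad_def d by (rule euclidean_representation)
qed

definition langevin ::
    "('a::euclidean_space \<Rightarrow> real) \<Rightarrow> real \<Rightarrow> ('a \<times> 'a \<Rightarrow> real) \<Rightarrow> 'a \<times> 'a \<Rightarrow> real" where
  "langevin V \<sigma> f = (\<lambda>(x, \<omega>).
     \<omega> \<bullet> grad (\<lambda>y. f (y, \<omega>)) x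
     - sphere_grad (potential V x) \<omega> \<bullet> sphere_grad (\<lambda>\<eta>. f (x, \<eta>)) \<omega>
     + 1 / 2 * \<sigma>\<^sup>2 * laplace_beltrami (\<lambda>\<eta>. f (x, \<eta>)) \<omega>)"

definition langevin_operator ::
    "('a::euclidean_space \<Rightarrow> real) \<Rightarrow> real \<Rightarrow> ('a \<times> 'a) L2_graph" where
  "langevin_operator V \<sigma> =
     (\<lambda>f. (L2_class (state_measure V) f, L2_class (state_measure V) (langevin V \<sigma> f)))
       ` test_functions"

end

theory Submission
 imports Defs
begin

text \<open>
 Replacing \<open>f\<close> by \<open>e\<^sup>-\<^sup>V\<^sup>/\<^sup>2 f\<close> maps the weighted space unitarily onto the unweighted space over
 \<open>dx \<otimes> d\<nu>\<close> and turns \<open>L\<close> into \<open>S + \<sigma>\<^sup>2/2 \<Delta>\<close>, where \<open>\<Delta>\<close> is the spherical Laplacian and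
 \<open>S = \<omega> \<bullet> \<nabla>\<^sub>x - 1/(d-1) \<nabla>V \<bullet> \<nabla>\<^sub>\<omega> + 1/2 \<omega> \<bullet> \<nabla>V\<close> is a first-order operator that is skew-symmetric,
 because the multiplication term is half the divergence of the vector field.  This gives
 dissipativity.  By the Hilbert space form of the Lumer-Phillips theorem (\<open>generation\<close>) it remains
 to see that a square-integrable \<open>g\<close> vanishes if it is orthogonal to the range of \<open>I - L\<close>
 (\<open>range_orthogonal_trivial\<close>), and likewise for the domain.

 Such a \<open>g\<close> solves the adjoint equation \<open>g + S g - \<sigma>\<^sup>2/2 \<Delta> g = 0\<close> in the weak sense.  If it were smooth with
 compact support, pairing with \<open>g\<close> would finish the proof, as \<open>S\<close> is skew and \<open>- \<Delta>\<close> is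
 nonnegative.  Regularity theory is avoided by smoothing: let \<open>J\<^sub>n g\<close> be the convolution of \<open>g\<close> with a
 mollifier of width \<open>1/n\<close> in \<open>x\<close> and with a rotation invariant kernel of width about \<open>1/n\<close> in
 \<open>\<omega>\<close>.  The Laplacian commutes with \<open>J\<^sub>n\<close>, since the kernel depends on \<open>\<omega> \<bullet> \<eta>\<close> alone, and the commutator
 of \<open>J\<^sub>n\<close> with \<open>S\<close> is controlled as in Friedrichs' lemma: its kernel has integrals over the absolute
 value bounded uniformly in \<open>n\<close> and locally in \<open>x\<close> (\<open>commutator_bound\<close>), its total mass tends to zero
 (\<open>commutator_mass\<close>), and therefore it converges to zero strongly (\<open>kernel_approximation\<close>).

 Only a cutoff \<open>a(x)\<close> in the position is needed, the sphere being compact.  It is not differentiated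
 by \<open>\<Delta>\<close>, so the energy identity for \<open>J\<^sub>n g\<close> with weight \<open>a\<close> gives in the limit
 \<open>\<integral> a g\<^sup>2 \<le> 1/2 \<integral> (\<nabla>a \<bullet> \<omega>) g\<^sup>2\<close> (\<open>energy_inequality\<close>); this involves the derivative of \<open>a\<close>
 only along the unit vector \<open>\<omega>\<close>, whatever the growth of \<open>V\<close>.  Cutoffs \<open>a(x/m)\<close> make the right-hand
 side of order \<open>1/m\<close>, hence \<open>g = 0\<close>.
\<close>

text \<open>The Bochner integral shares these names with the gauge integral.\<close>

lemmas lint_cong = Bochner_Integration.integral_cong[OF refl]
lemmas lint_add = Bochner_Integration.integral_add
lemmas lint_diff = Bochner_Integration.integral_diff
lemmas lint_mult_right_zero = Bochner_Integration.integral_mult_right_zero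
lemmas lint_sum = Bochner_Integration.integral_sum

section \<open>Endomorphisms of a Banach space as a Banach algebra\<close>

text \<open>Exponentials are available in Banach algebras; the bounded operators from one space to itself form
 one under composition, which needs a type of their own.\<close>

typedef (overloaded) 'a endo = "UNIV :: ('a::real_normed_vector \<Rightarrow>\<^sub>L 'a) set"
 morphisms blinfun_of_endo Endo ..

setup_lifting type_definition_endo

instantiation endo :: (real_normed_vector) real_normed_vector
begin
lift_definition zero_endo :: "'a endo" is 0 .
lift_definition plus_endo :: "'a endo => 'a endo => 'a endo" is "(+)" .
lift_definition minus_endo :: "'a endo => 'a endo => 'a endo" is "(-)" .
lift_definition uminus_endo :: "'a endo => 'a endo" is "uminus" .
lift_definition scaleR_endo :: "real => 'a endo => 'a endo" is "(*\<^sub>R)" .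
lift_definition norm_endo :: "'a endo => real" is norm .
definition dist_endo :: "'a endo => 'a endo => real" where "dist_endo a b = norm (a - b)"
definition sgn_endo :: "'a endo => 'a endo" where "sgn_endo a = scaleR (inverse (norm a)) a"
definition uniformity_endo :: "('a endo \<times> 'a endo) filter" where
 "uniformity_endo = (INF e\<in>{0<..}. principal {(x, y). dist x y < e})"
definition open_endo :: "'a endo set => bool" where
 "open_endo S = (\<forall>x\<in>S. \<forall>\<^sub>F (x', y) in uniformity. x' = x \<longrightarrow> y \<in> S)"
instance
proof
 fix a b c :: "'a endo" and r q :: real
 show "a + b + c = a + (b + c)" "a + b = b + a" "0 + a = a" "- a + a = 0" "a - b = a + - b"
  "r *\<^sub>R (a + b) = r *\<^sub>R a + r *\<^sub>R b" "(r + q) *\<^sub>R a = r *\<^sub>R a + q *\<^sub>R a"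
  "r *\<^sub>R q *\<^sub>R a = (r * q) *\<^sub>R a" "1 *\<^sub>R a = a"
  by (transfer; simp add: scaleR_add_right scaleR_add_left)+
 show "norm a = 0 \<longleftrightarrow> a = 0" "norm (a + b) \<le> norm a + norm b" "norm (r *\<^sub>R a) = \<bar>r\<bar> * norm a"
  by (transfer; simp add: norm_triangle_ineq)+
qed (simp_all add: dist_endo_def sgn_endo_def uniformity_endo_def open_endo_def)
end

instantiation endo :: ("{real_normed_vector, perfect_space}") real_normed_algebra_1
begin
lift_definition times_endo :: "'a endo => 'a endo => 'a endo" is "(o\<^sub>L)" .
lift_definition one_endo :: "'a endo" is id_blinfun .
instance
proof
 fix a b c :: "'a endo" and r :: real
 show "a * b * c = a * (b * c)" by transfer (auto intro!: blinfun_eqI)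
 show "(a + b) * c = a * c + b * c" by transfer (auto intro!: blinfun_eqI simp: blinfun.bilinear_simps)
 show "a * (b + c) = a * b + a * c" by transfer (auto intro!: blinfun_eqI simp: blinfun.bilinear_simps)
 show "r *\<^sub>R a * b = r *\<^sub>R (a * b)" by transfer (auto intro!: blinfun_eqI simp: blinfun.bilinear_simps)
 show "a * r *\<^sub>R b = r *\<^sub>R (a * b)" by transfer (auto intro!: blinfun_eqI simp: blinfun.bilinear_simps)
 show "1 * a = a" by transfer (auto intro!: blinfun_eqI)
 show "a * 1 = a" by transfer (auto intro!: blinfun_eqI)
 show "norm (a * b) \<le> norm a * norm b" by transfer (rule norm_blinfun_compose)
 show n: "norm (1 :: 'a endo) = 1" by transfer simp
 show "(0 :: 'a endo) \<noteq> 1" using n by (metis norm_zero zero_neq_one)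
qed
end

instance endo :: ("{banach, perfect_space}") banach
proof
 fix X :: "nat => 'a endo"
 assume "Cauchy X"
 then have "Cauchy (\<lambda>n. blinfun_of_endo (X n))"
  by (simp add: Cauchy_def dist_norm norm_endo.rep_eq minus_endo.rep_eq)
 then obtain L where "(\<lambda>n. blinfun_of_endo (X n)) \<longlonglongrightarrow> L"
  using Cauchy_convergent convergent_def by blast
 then have "X \<longlonglongrightarrow> Endo L"
  by (simp add: LIMSEQ_def dist_norm norm_endo.rep_eq minus_endo.rep_eq Endo_inverse)
 then show "convergent X" by (auto simp: convergent_def)
qed

definition endo_apply :: "'a::real_normed_vector endo => 'a => 'a" (infixr "\<cdot>" 75) where
 "e \<cdot> x = blinfun_apply (blinfun_of_endo e) x"

lemma endo_apply_simps [simp]: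
 "(a + b) \<cdot> x = a \<cdot> x + b \<cdot> x" "(a - b) \<cdot> x = a \<cdot> x - b \<cdot> x" "(r *\<^sub>R a) \<cdot> x = r *\<^sub>R (a \<cdot> x)"
 by (simp_all add: endo_apply_def plus_endo.rep_eq minus_endo.rep_eq scaleR_endo.rep_eq
   blinfun.bilinear_simps)

lemma endo_apply_mult [simp]:
 fixes a b :: "'a::{real_normed_vector, perfect_space} endo"
 shows "(a * b) \<cdot> x = a \<cdot> b \<cdot> x" "1 \<cdot> x = (x::'a)"
 by (simp_all add: endo_apply_def times_endo.rep_eq one_endo.rep_eq)

lemma linear_endo_apply: "linear (\<lambda>x. e \<cdot> x)"
 unfolding endo_apply_def by (rule bounded_linear.linear[OF blinfun.bounded_linear_right])

lemma norm_endo_apply: "norm (e \<cdot> x) \<le> norm e * norm x"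
 unfolding endo_apply_def norm_endo.rep_eq by (rule norm_blinfun)

lemma bounded_linear_endo_eval: "bounded_linear (\<lambda>e. e \<cdot> x)"
 by (rule bounded_linear_intro[where K="norm x"]) (auto simp: norm_endo_apply)

lemma endo_eqI: "(\<And>x. a \<cdot> x = b \<cdot> x) ==> a = b"
 unfolding endo_apply_def by (metis blinfun_eqI blinfun_of_endo_inject)

lemma exp_commute_left:
 fixes x y :: "'a::{real_normed_algebra_1, banach}"
 assumes "x * y = y * x"
 shows "x * exp y = exp y * x"
proof -
 have *: "x * y ^ n = y ^ n * x" for n
  by (induction n) (auto simp: assms mult.assoc, metis assms mult.assoc)
 have "x * exp y = (\<Sum>n. x * (y ^ n /\<^sub>R fact n))"
  unfolding exp_def by (rule suminf_mult[symmetric]) (rule summable_exp_generic)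
 also have "\<dots> = (\<Sum>n. (y ^ n /\<^sub>R fact n) * x)" by (simp add: *)
 also have "\<dots> = exp y * x"
  unfolding exp_def by (rule suminf_mult2[symmetric]) (rule summable_exp_generic)
 finally show ?thesis .
qed

lemma norm_increment_le:
 fixes f :: "real => 'a::real_normed_vector"
 assumes "0 \<le> t" "\<And>s. 0 \<le> s ==> s \<le> t ==> (f has_vector_derivative f' s) (at s)"
  and "\<And>s. 0 \<le> s ==> s \<le> t ==> norm (f' s) \<le> K"
 shows "norm (f t - f 0) \<le> K * t"
proof -
 have "norm (f t - f 0) \<le> K * norm (t - 0)"
 proof (rule differentiable_bound[where S="{0..t}" and f'="\<lambda>s h. h *\<^sub>R f' s"])
  fix s assume s: "s \<in> {0..t}"
  show "(f has_derivative (\<lambda>h. h *\<^sub>R f' s)) (at s within {0..t})"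
   using assms(2)[of s] s by (auto simp: has_vector_derivative_def intro: has_derivative_at_withinI)
  show "onorm (\<lambda>h. h *\<^sub>R f' s) \<le> K"
   using assms(3)[of s] s by (intro onorm_le) (auto simp: mult.commute[of K] mult_left_mono)
 qed (use assms in auto)
 then show ?thesis using assms(1) by simp
qed

lemma norm_add3_le: "norm (a + b + c) \<le> norm a + norm b + norm (c::'a::real_normed_vector)"
 by (meson norm_triangle_le norm_triangle_ineq add_right_mono order_refl order_trans)

lemma damped_le:
 fixes a e :: real
 assumes "0 \<le> a" "0 < e" shows "a * (e / (2 * (a + 1))) \<le> e / 2"
proof -
 have "a * (e / (2 * (a + 1))) = (a / (a + 1)) * (e / 2)" by simp
 also have "\<dots> \<le> 1 * (e / 2)" using assms by (intro mult_right_mono) auto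
 finally show ?thesis by simp
qed

section \<open>Generation of contraction semigroups by maximal dissipative relations\<close>

text \<open>Operators are linear relations here; that \<open>A\<close> is single-valued follows from density of the domain.\<close>

locale maximal_dissipative =
 fixes A :: "('h::{real_inner, banach, perfect_space} \<times> 'h) set"
 assumes subspace: "subspace A"
  and dissip: "(u, v) \<in> A ==> v \<bullet> u \<le> 0"
  and dense: "closure (fst ` A) = UNIV"
  and surj: "\<exists>u v. (u, v) \<in> A \<and> u - v = f"
begin

lemma rel_add: "(u, v) \<in> A ==> (u', v') \<in> A ==> (u + u', v + v') \<in> A"
 using subspace_add[OF subspace, of "(u,v)" "(u',v')"] by simp

lemma rel_diff: "(u, v) \<in> A ==> (u', v') \<in> A ==> (u - u', v - v') \<in> A"
 using subspace_diff[OF subspace, of "(u,v)" "(u',v')"] by simp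

lemma rel_scale: "(u, v) \<in> A ==> (c *\<^sub>R u, c *\<^sub>R v) \<in> A"
 using subspace_scale[OF subspace, of "(u,v)" c] by simp

lemma resolvent_bound:
 assumes "(u, v) \<in> A" "0 < l"
 shows "l * norm u \<le> norm (l *\<^sub>R u - v)"
proof (cases "u = 0")
 case False
 have "l * (norm u)\<^sup>2 \<le> (l *\<^sub>R u - v) \<bullet> u"
  using dissip[OF assms(1)] by (simp add: inner_diff_left power2_norm_eq_inner)
 also have "\<dots> \<le> norm (l *\<^sub>R u - v) * norm u" by (rule norm_cauchy_schwarz)
 finally show ?thesis using False by (simp add: power2_eq_square)
qed simp

text \<open>The sequence of parameters has to be unbounded; ratio \<open>3/2\<close> is small enough for a step of
 \<open>surj_rate\<close>.\<close>

definition rate :: "nat => real" where "rate n = (3/2) ^ n"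

lemma rate_pos [simp]: "0 < rate n" by (simp add: rate_def)

text \<open>The range of \<open>\<lambda> - A\<close> stays everything when \<open>\<lambda>\<close> grows by the factor \<open>3/2\<close>: the equation for
 the new value is a fixed point problem for a contraction with factor \<open>1/2\<close>.\<close>

lemma surj_rate: "\<exists>u v. (u, v) \<in> A \<and> rate n *\<^sub>R u - v = f"
proof (induction n arbitrary: f)
 case 0 show ?case using surj[of f] by (simp add: rate_def)
next
 case (Suc n)
 let ?l = "rate n"
 obtain R W where RW: "\<And>f. (R f, W f) \<in> A \<and> ?l *\<^sub>R R f - W f = f" using Suc.IH by metis
 have lip: "?l * norm (R f - R g) \<le> norm (f - g)" for f g
 proof -
  have "(R f - R g, W f - W g) \<in> A" using RW by (blast intro: rel_diff)
  from resolvent_bound[OF this rate_pos[of n]]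
  have "?l * norm (R f - R g) \<le> norm ((?l *\<^sub>R R f - W f) - (?l *\<^sub>R R g - W g))"
   by (simp add: algebra_simps)
  then show ?thesis using RW by simp
 qed
 let ?T = "\<lambda>u. R (f - (?l/2) *\<^sub>R u)"
 have "dist (?T x) (?T y) \<le> 1/2 * dist x y" for x y
 proof -
  have "?l * norm (?T x - ?T y) \<le> norm ((?l/2) *\<^sub>R (y - x))"
   using lip[of "f - (?l/2) *\<^sub>R x" "f - (?l/2) *\<^sub>R y"] by (simp add: algebra_simps)
  also have "\<dots> = ?l * (1/2 * norm (x - y))" by (simp add: norm_minus_commute less_imp_le)
  finally show ?thesis using rate_pos[of n] by (simp add: dist_norm)
 qed
 then obtain u where u: "?T u = u" using banach_fix_type[of "1/2" ?T] by auto
 let ?v = "W (f - (?l/2) *\<^sub>R u)"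
 have e: "(u, ?v) \<in> A" "?l *\<^sub>R u - ?v = f - (?l/2) *\<^sub>R u"
  using RW[of "f - (?l/2) *\<^sub>R u"] u by auto
 have "rate (Suc n) *\<^sub>R u = ?l *\<^sub>R u + (?l/2) *\<^sub>R u"
  unfolding scaleR_add_left[symmetric] by (simp add: rate_def)
 then have "rate (Suc n) *\<^sub>R u - ?v = f" using e(2) by (simp add: algebra_simps)
 with e(1) show ?case by blast
qed

text \<open>The rescaled resolvent \<open>\<lambda>(\<lambda> - A)\<^sup>-\<^sup>1\<close>, characterised by the pair it contributes to \<open>A\<close>.\<close>

definition contr :: "nat => 'h => 'h" where
 "contr n x = (THE w. (w, rate n *\<^sub>R (w - x)) \<in> A)"

lemma contr_unique:
 assumes "(w, rate n *\<^sub>R (w - x)) \<in> A" "(w', rate n *\<^sub>R (w' - x)) \<in> A"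
 shows "w = w'"
proof -
 have "(w - w', rate n *\<^sub>R (w - w')) \<in> A"
  using rel_diff[OF assms] by (simp add: algebra_simps)
 from dissip[OF this] have "rate n * ((w - w') \<bullet> (w - w')) \<le> 0" by simp
 then show ?thesis using rate_pos[of n]
  by (smt (verit) inner_eq_zero_iff inner_ge_zero mult_pos_pos right_minus_eq)
qed

lemma contr_in: "(contr n x, rate n *\<^sub>R (contr n x - x)) \<in> A"
proof -
 obtain u v where uv: "(u, v) \<in> A" "rate n *\<^sub>R u - v = x" using surj_rate by blast
 have "(rate n *\<^sub>R u, rate n *\<^sub>R (rate n *\<^sub>R u - x)) \<in> A"
  using rel_scale[OF uv(1), of "rate n"] uv(2) by (simp add: algebra_simps)
 then show ?thesis
  using theI[of "\<lambda>w. (w, rate n *\<^sub>R (w - x)) \<in> A" "rate n *\<^sub>R u"] contr_unique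
  unfolding contr_def by blast
qed

lemma contr_eq: "(w, rate n *\<^sub>R (w - x)) \<in> A ==> contr n x = w"
 using contr_unique[OF contr_in] by blast

lemma contr_norm: "norm (contr n x) \<le> norm x"
proof (cases "contr n x = 0")
 case False
 have "rate n * ((contr n x - x) \<bullet> contr n x) \<le> 0" using dissip[OF contr_in[of n x]] by simp
 then have "(contr n x - x) \<bullet> contr n x \<le> 0" using rate_pos[of n] by (simp add: mult_le_0_iff)
 then have "norm (contr n x) * norm (contr n x) \<le> x \<bullet> contr n x"
  by (simp add: inner_diff_left power2_norm_eq_inner flip: power2_eq_square)
 also have "\<dots> \<le> norm x * norm (contr n x)" by (rule norm_cauchy_schwarz)
 finally show ?thesis using False by simp
qed simp

lemma contr_linear: "linear (contr n)"
proof (rule linearI)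
 fix x y :: 'h and c :: real
 show "contr n (x + y) = contr n x + contr n y"
  by (rule contr_eq) (use rel_add[OF contr_in[of n x] contr_in[of n y]] in \<open>simp add: algebra_simps\<close>)
 show "contr n (c *\<^sub>R x) = c *\<^sub>R contr n x"
  by (rule contr_eq) (use rel_scale[OF contr_in[of n x], of c] in \<open>simp add: algebra_simps\<close>)
qed

definition C :: "nat => 'h endo" where "C n = Endo (Blinfun (contr n))"

lemma C_apply [simp]: "C n \<cdot> x = contr n x"
proof -
 have "bounded_linear (contr n)"
  using contr_linear contr_norm by (intro bounded_linear_intro[where K=1]) (auto simp: linear_add linear_scale)
 then show ?thesis by (simp add: C_def endo_apply_def Endo_inverse bounded_linear_Blinfun_apply)
qed

lemma C_norm: "norm (C n) \<le> 1"
 unfolding norm_endo.rep_eq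
 by (rule norm_blinfun_bound) (use contr_norm C_apply in \<open>auto simp: endo_apply_def[symmetric]\<close>)

text \<open>Yosida's bounded approximation of \<open>A\<close>: on the domain it is \<open>C n\<close> applied after \<open>A\<close>.\<close>

definition B :: "nat => 'h endo" where "B n = rate n *\<^sub>R (C n - 1)"

lemma B_apply: "B n \<cdot> x = rate n *\<^sub>R (contr n x - x)" by (simp add: B_def)

lemma B_on_domain:
 assumes "(x, y) \<in> A"
 shows "B n \<cdot> x = contr n y" and "rate n * norm (contr n x - x) \<le> norm y"
proof -
 let ?d = "contr n x - x"
 have d: "(?d, rate n *\<^sub>R ?d - y) \<in> A" using rel_diff[OF contr_in assms] .
 have "(rate n *\<^sub>R ?d, rate n *\<^sub>R (rate n *\<^sub>R ?d - y)) \<in> A" using rel_scale[OF d] .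
 then show "B n \<cdot> x = contr n y" by (simp add: contr_eq B_apply)
 show "rate n * norm ?d \<le> norm y" using resolvent_bound[OF d rate_pos, of n] by simp
qed

lemma approx_dense:
 assumes "e > 0" obtains x y where "(x, y) \<in> A" "norm (z - x) < e"
proof -
 have "z \<in> closure (fst ` A)" using dense by simp
 then obtain x where "x \<in> fst ` A" "dist x z < e" using assms closure_approachable by blast
 then show ?thesis using that by (force simp: dist_norm norm_minus_commute)
qed

lemma rate_LIMSEQ: "filterlim rate at_top sequentially"
 unfolding filterlim_at_top_dense
proof
 fix z :: real
 obtain N where N: "z < (3/2) ^ N" using real_arch_pow[of "3/2" z] by auto
 show "\<forall>\<^sub>F n in sequentially. z < rate n"
  unfolding eventually_sequentially rate_def
  by (intro exI[of _ N] allI impI) (use N in \<open>auto intro: less_le_trans power_increasing\<close>)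
qed

text \<open>On the domain \<open>contr n x - x\<close> is the image of \<open>y\<close> under a contraction divided by \<open>rate n\<close>.\<close>

lemma contr_LIMSEQ: "(\<lambda>n. contr n z) \<longlonglongrightarrow> z"
proof (rule LIMSEQ_I)
 fix r :: real assume "0 < r"
 then obtain x y where xy: "(x, y) \<in> A" "norm (z - x) < r/4" using approx_dense[of "r/4"] by auto
 have "eventually (\<lambda>n. 4 * norm y / r < rate n) sequentially"
  using rate_LIMSEQ by (auto simp: filterlim_at_top_dense)
 then obtain N where N: "\<And>n. n \<ge> N ==> 4 * norm y / r < rate n" by (auto simp: eventually_sequentially)
 have "norm (contr n z - z) < r" if "n \<ge> N" for n
 proof -
  have "contr n z - z = contr n (z - x) + (contr n x - x) + (x - z)"
   by (simp add: linear_diff[OF contr_linear])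
  then have "norm (contr n z - z) \<le> norm (contr n (z - x)) + norm (contr n x - x) + norm (x - z)"
   by (simp only: norm_add3_le)
  also have "\<dots> \<le> 2 * norm (z - x) + norm (contr n x - x)"
   using contr_norm[of n "z - x"] by (simp add: norm_minus_commute)
  also have "norm (contr n x - x) \<le> r/4"
  proof -
   have "rate n * norm (contr n x - x) \<le> norm y" by (rule B_on_domain[OF xy(1)])
   also have "\<dots> \<le> rate n * (r/4)" using N[OF that] \<open>0 < r\<close> by (simp add: field_simps)
   finally show ?thesis using rate_pos[of n] by simp
  qed
  finally show ?thesis using xy(2) \<open>0 < r\<close> by simp
 qed
 then show "\<exists>no. \<forall>n\<ge>no. norm (contr n z - z) < r" by blast
qed

lemma B_LIMSEQ: "(x, y) \<in> A ==> (\<lambda>n. B n \<cdot> x) \<longlonglongrightarrow> y"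
 using contr_LIMSEQ[of y] by (simp add: B_on_domain(1))

lemma C_commute: "C m * C n = C n * C m"
proof (cases "m = n")
 case False
 then have ne: "rate m - rate n \<noteq> 0" by (simp add: rate_def power_inject_exp)
 show ?thesis
 proof (rule endo_eqI, simp)
  fix x
  have 1: "rate m *\<^sub>R (contr m (contr n x) - contr n x) = contr m (rate n *\<^sub>R (contr n x - x))" for m n
   using B_on_domain(1)[OF contr_in[of n x], of m] by (simp add: B_apply)
  have 2: "(rate m - rate n) *\<^sub>R contr m (contr n x) = rate m *\<^sub>R contr n x - rate n *\<^sub>R contr m x" for m n
   using 1[of m n] by (simp add: linear_diff[OF contr_linear] linear_scale[OF contr_linear] algebra_simps)
  have "(rate m - rate n) *\<^sub>R contr n (contr m x) = - ((rate n - rate m) *\<^sub>R contr n (contr m x))"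
   by (simp flip: scaleR_minus_left)
  then have "(rate m - rate n) *\<^sub>R contr m (contr n x) = (rate m - rate n) *\<^sub>R contr n (contr m x)"
   by (simp only: 2[of m n] 2[of n m]) simp
  then show "contr m (contr n x) = contr n (contr m x)" using ne by simp
 qed
qed simp

lemma B_commute: "B m * B n = B n * B m"
 unfolding B_def using C_commute[of m n] by (simp add: algebra_simps)

definition E :: "nat => real => 'h endo" where "E n t = exp (t *\<^sub>R B n)"

text \<open>\<open>B n\<close> is a contraction minus the identity, up to the factor \<open>rate n\<close>; the exponential of the identity
 part exactly damps that of the contraction.\<close>

lemma E_norm: assumes "0 \<le> t" shows "norm (E n t) \<le> 1"
proof -
 let ?a = "t * rate n"
 have a: "?a \<ge> 0" using assms rate_pos[of n] by (intro mult_nonneg_nonneg) (auto simp: less_imp_le)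
 have "t *\<^sub>R B n = ?a *\<^sub>R C n + (of_real (- ?a) :: 'h endo)"
  by (simp add: B_def of_real_def algebra_simps)
 then have "E n t = exp (?a *\<^sub>R C n) * exp (of_real (- ?a) :: 'h endo)"
  unfolding E_def by (simp only:) (rule exp_add_commuting, simp add: of_real_def)
 also have "exp (of_real (- ?a) :: 'h endo) = of_real (exp (- ?a))" by (rule exp_of_real)
 finally have "norm (E n t) \<le> norm (exp (?a *\<^sub>R C n)) * exp (- ?a)"
  by (metis (no_types) norm_mult_ineq norm_of_real abs_exp_cancel)
 also have "norm (exp (?a *\<^sub>R C n)) \<le> exp ?a"
 proof (rule order_trans[OF norm_exp])
  show "exp (norm (?a *\<^sub>R C n)) \<le> exp ?a" using a C_norm[of n] by (simp add: mult_left_le)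
 qed
 finally show ?thesis by (simp add: exp_minus)
qed

lemma E_apply_norm: "0 \<le> t ==> norm (E n t \<cdot> x) \<le> norm x"
 using norm_endo_apply[of "E n t" x] E_norm[of t n] mult_right_mono[OF E_norm[of t n] norm_ge_zero[of x]] by simp

lemma E_add: "E n (s + t) = E n s * E n t"
 unfolding E_def by (simp add: scaleR_add_left exp_add_commuting)

lemma E_0: "E n 0 = 1" by (simp add: E_def)

lemma E_deriv: "(E n has_vector_derivative (E n t * B n)) (at t)"
 unfolding E_def by (rule exp_scaleR_has_vector_derivative_right)

lemma B_E_commute: "B m * E n t = E n t * B m"
 unfolding E_def by (rule exp_commute_left) (simp add: B_commute)

text \<open>Differentiating \<open>E n s * E m (t - s)\<close> in \<open>s\<close> produces the difference of the two bounded
 generators, as everything commutes.\<close>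

lemma E_diff:
 assumes "0 \<le> t" shows "norm (E n t \<cdot> x - E m t \<cdot> x) \<le> norm (B n \<cdot> x - B m \<cdot> x) * t"
proof -
 let ?f = "\<lambda>s. (E n s * E m (t - s)) \<cdot> x"
 have "norm (?f t - ?f 0) \<le> norm (B n \<cdot> x - B m \<cdot> x) * t"
 proof (rule norm_increment_le[OF assms])
  fix s assume s: "0 \<le> s" "s \<le> t"
  have "((\<lambda>s. E m (t - s)) has_vector_derivative (-1) *\<^sub>R (E m (t - s) * B m)) (at s)"
  proof (rule vector_diff_chain_at[of "\<lambda>s. t - s" "-1" s "E m", unfolded o_def, OF _ E_deriv])
   show "((\<lambda>s. t - s) has_vector_derivative - 1) (at s)"
    unfolding has_real_derivative_iff_has_vector_derivative[symmetric]
    by (auto intro!: derivative_eq_intros)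
  qed
  then have "((\<lambda>s. E n s * E m (t - s)) has_vector_derivative
    (E n s * ((-1) *\<^sub>R (E m (t - s) * B m)) + (E n s * B n) * E m (t - s))) (at s)"
   by (intro has_vector_derivative_mult E_deriv)
  moreover have "E n s * ((-1) *\<^sub>R (E m (t - s) * B m)) + (E n s * B n) * E m (t - s)
    = (E n s * E m (t - s)) * (B n - B m)"
   using B_E_commute[of n m "t - s"] by (simp add: algebra_simps)
  ultimately have "((\<lambda>s. E n s * E m (t - s)) has_vector_derivative
    (E n s * E m (t - s)) * (B n - B m)) (at s)" by simp
  from bounded_linear.has_vector_derivative[OF bounded_linear_endo_eval this]
  show "(?f has_vector_derivative ((E n s * E m (t - s)) * (B n - B m)) \<cdot> x) (at s)" .
  show "norm (((E n s * E m (t - s)) * (B n - B m)) \<cdot> x) \<le> norm (B n \<cdot> x - B m \<cdot> x)"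
   using s E_apply_norm[of s n "E m (t - s) \<cdot> (B n \<cdot> x - B m \<cdot> x)"]
    E_apply_norm[of "t - s" m "B n \<cdot> x - B m \<cdot> x"] by simp
 qed
 then show ?thesis by (simp add: E_0)
qed

lemma E_convergent: assumes "0 \<le> t" shows "convergent (\<lambda>n. E n t \<cdot> z)"
proof -
 have "Cauchy (\<lambda>n. E n t \<cdot> z)"
 proof (rule CauchyI)
  fix r :: real assume "0 < r"
  then obtain x y where xy: "(x, y) \<in> A" "norm (z - x) < r/4" using approx_dense[of "r/4"] by auto
  have "Cauchy (\<lambda>n. B n \<cdot> x)" using B_LIMSEQ[OF xy(1)] by (simp add: LIMSEQ_imp_Cauchy)
  then obtain M where M: "\<And>m n. m \<ge> M ==> n \<ge> M ==> norm (B m \<cdot> x - B n \<cdot> x) < r / (2 * (t + 1))"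
   using CauchyD[of "\<lambda>n. B n \<cdot> x" "r / (2 * (t + 1))"] \<open>0 < r\<close> assms by auto
  have "norm (E m t \<cdot> z - E n t \<cdot> z) < r" if "m \<ge> M" "n \<ge> M" for m n
  proof -
   have "E m t \<cdot> z - E n t \<cdot> z = E m t \<cdot> (z - x) + (E m t \<cdot> x - E n t \<cdot> x) + (- (E n t \<cdot> (z - x)))"
    by (simp add: linear_diff[OF linear_endo_apply])
   then have "norm (E m t \<cdot> z - E n t \<cdot> z)
     \<le> norm (E m t \<cdot> (z - x)) + norm (E m t \<cdot> x - E n t \<cdot> x) + norm (E n t \<cdot> (z - x))"
    using norm_add3_le[of "E m t \<cdot> (z - x)" "E m t \<cdot> x - E n t \<cdot> x" "- (E n t \<cdot> (z - x))"] by simp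
   also have "\<dots> \<le> norm (z - x) + norm (B m \<cdot> x - B n \<cdot> x) * t + norm (z - x)"
    by (intro add_mono E_apply_norm E_diff assms)
   also have "norm (B m \<cdot> x - B n \<cdot> x) * t \<le> r / (2 * (t + 1)) * t"
    using M[OF that] assms by (intro mult_right_mono) auto
   also have "r / (2 * (t + 1)) * t \<le> r / 2" using \<open>0 < r\<close> assms by (simp add: field_simps)
   finally show ?thesis using xy(2) by simp
  qed
  then show "\<exists>M. \<forall>m\<ge>M. \<forall>n\<ge>M. norm (E m t \<cdot> z - E n t \<cdot> z) < r" by blast
 qed
 then show ?thesis by (rule Cauchy_convergent)
qed

definition T :: "real => 'h => 'h" where "T t x = lim (\<lambda>n. E n t \<cdot> x)"

lemma E_LIMSEQ: "0 \<le> t ==> (\<lambda>n. E n t \<cdot> x) \<longlonglongrightarrow> T t x"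
 unfolding T_def using E_convergent by (simp add: convergent_LIMSEQ_iff)

lemma T_norm: "0 \<le> t ==> norm (T t x) \<le> norm x"
 by (rule LIMSEQ_le_const2[OF tendsto_norm[OF E_LIMSEQ]]) (auto simp: E_apply_norm)

lemma T_linear: assumes "0 \<le> t" shows "linear (T t)"
proof (rule linearI)
 fix x y :: 'h and c :: real
 show "T t (x + y) = T t x + T t y"
  by (rule LIMSEQ_unique[OF E_LIMSEQ[OF assms]])
   (use tendsto_add[OF E_LIMSEQ[OF assms, of x] E_LIMSEQ[OF assms, of y]] in
    \<open>simp add: linear_add[OF linear_endo_apply]\<close>)
 show "T t (c *\<^sub>R x) = c *\<^sub>R T t x"
  by (rule LIMSEQ_unique[OF E_LIMSEQ[OF assms]])
   (use tendsto_scaleR[OF tendsto_const E_LIMSEQ[OF assms, of x], of c] in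
    \<open>simp add: linear_scale[OF linear_endo_apply]\<close>)
qed

lemma T_0: "T 0 x = x" by (simp add: T_def E_0)

lemma T_add: assumes "0 \<le> s" "0 \<le> t" shows "T (s + t) x = T s (T t x)"
proof -
 have "(\<lambda>n. E n s \<cdot> (E n t \<cdot> x - T t x)) \<longlonglongrightarrow> 0"
 proof (rule tendsto_norm_zero_cancel, rule tendsto_sandwich[OF _ _ tendsto_const])
  show "(\<lambda>n. norm (E n t \<cdot> x - T t x)) \<longlonglongrightarrow> 0"
   using E_LIMSEQ[OF assms(2), of x] by (simp add: LIM_zero tendsto_norm_zero)
 qed (auto simp: E_apply_norm[OF assms(1)])
 then have "(\<lambda>n. E n s \<cdot> (E n t \<cdot> x - T t x) + E n s \<cdot> T t x) \<longlonglongrightarrow> 0 + T s (T t x)"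
  by (intro tendsto_add E_LIMSEQ assms)
 then have "(\<lambda>n. E n (s + t) \<cdot> x) \<longlonglongrightarrow> T s (T t x)"
  by (simp add: E_add linear_diff[OF linear_endo_apply])
 then show ?thesis using E_LIMSEQ[of "s + t" x] assms LIMSEQ_unique by fastforce
qed

lemma E_increment:
 assumes "0 \<le> t" "\<And>s. 0 \<le> s ==> s \<le> t ==> norm (E n s \<cdot> B n \<cdot> x - y) \<le> K"
 shows "norm (E n t \<cdot> x - x - t *\<^sub>R y) \<le> K * t"
proof -
 have "norm ((E n t \<cdot> x - t *\<^sub>R y) - (E n 0 \<cdot> x - 0 *\<^sub>R y)) \<le> K * t"
 proof (rule norm_increment_le[OF assms(1)])
  fix s assume s: "0 \<le> s" "s \<le> t"
  have "((\<lambda>s. E n s \<cdot> x) has_vector_derivative (E n s * B n) \<cdot> x) (at s)"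
   by (rule bounded_linear.has_vector_derivative[OF bounded_linear_endo_eval E_deriv])
  then show "((\<lambda>s. E n s \<cdot> x - s *\<^sub>R y) has_vector_derivative (E n s \<cdot> B n \<cdot> x - y)) (at s)"
   by (auto intro!: derivative_eq_intros simp: has_vector_derivative_def[of "\<lambda>s. s *\<^sub>R y"])
 qed (use assms(2) in auto)
 then show ?thesis by (simp add: E_0 algebra_simps)
qed

lemma E_near_identity:
 assumes "(x, y) \<in> A" "0 \<le> t" shows "norm (E n t \<cdot> z - z) \<le> 2 * norm (z - x) + norm y * t"
proof -
 have "norm (E n t \<cdot> x - x - t *\<^sub>R 0) \<le> norm y * t"
 proof (rule E_increment[OF assms(2)])
  fix s :: real assume "0 \<le> s"
  then have "norm (E n s \<cdot> B n \<cdot> x) \<le> norm (B n \<cdot> x)" by (rule E_apply_norm)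
  then show "norm (E n s \<cdot> B n \<cdot> x - 0) \<le> norm y"
   using B_on_domain(1)[OF assms(1), of n] contr_norm[of n y] by simp
 qed
 moreover have "E n t \<cdot> z - z = E n t \<cdot> (z - x) + (E n t \<cdot> x - x) + (x - z)"
  by (simp add: linear_diff[OF linear_endo_apply])
 then have "norm (E n t \<cdot> z - z) \<le> norm (E n t \<cdot> (z - x)) + norm (E n t \<cdot> x - x) + norm (x - z)"
  by (simp only: norm_add3_le)
 ultimately show ?thesis
  using E_apply_norm[OF assms(2), of n "z - x"] by (simp add: norm_minus_commute)
qed

lemma T_near_identity:
 assumes "(x, y) \<in> A" "0 \<le> t" shows "norm (T t z - z) \<le> 2 * norm (z - x) + norm y * t"
 by (rule LIMSEQ_le_const2[OF tendsto_norm[OF tendsto_diff[OF E_LIMSEQ[OF assms(2)] tendsto_const]]])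
  (auto simp: E_near_identity[OF assms])

text \<open>A mean value estimate for \<open>t \<mapsto> T t x\<close>.  The velocity \<open>T t y\<close> is compared with \<open>y\<close>
 through an element \<open>x'\<close> of the domain near \<open>y\<close>, where \<open>T\<close> is Lipschitz in time.\<close>

lemma T_increment:
 assumes xy: "(x, y) \<in> A" and x'y': "(x', y') \<in> A" and t: "0 \<le> t"
 shows "norm (T t x - x - t *\<^sub>R y) \<le> (2 * norm (y - x') + norm y' * t) * t"
proof (rule LIMSEQ_le)
 show "(\<lambda>n. norm (E n t \<cdot> x - x - t *\<^sub>R y)) \<longlonglongrightarrow> norm (T t x - x - t *\<^sub>R y)"
  by (intro tendsto_intros E_LIMSEQ t)
 show "(\<lambda>n. (norm (B n \<cdot> x - y) + (2 * norm (y - x') + norm y' * t)) * t)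
   \<longlonglongrightarrow> (2 * norm (y - x') + norm y' * t) * t"
  using tendsto_mult[OF tendsto_add[OF tendsto_norm_zero[OF LIM_zero[OF B_LIMSEQ[OF xy]]] tendsto_const] tendsto_const]
  by simp
 have "norm (E n t \<cdot> x - x - t *\<^sub>R y) \<le> (norm (B n \<cdot> x - y) + (2 * norm (y - x') + norm y' * t)) * t" for n
 proof (rule E_increment[OF t])
  fix s assume s: "0 \<le> s" "s \<le> t"
  have "E n s \<cdot> B n \<cdot> x - y = E n s \<cdot> (B n \<cdot> x - y) + (E n s \<cdot> y - y)"
   by (simp add: linear_diff[OF linear_endo_apply])
  then have "norm (E n s \<cdot> B n \<cdot> x - y) \<le> norm (E n s \<cdot> (B n \<cdot> x - y)) + norm (E n s \<cdot> y - y)"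
   by (metis norm_triangle_ineq)
  also have "\<dots> \<le> norm (B n \<cdot> x - y) + (2 * norm (y - x') + norm y' * s)"
   by (intro add_mono E_apply_norm s E_near_identity[OF x'y'])
  also have "\<dots> \<le> norm (B n \<cdot> x - y) + (2 * norm (y - x') + norm y' * t)"
   using s by (simp add: mult_left_mono)
  finally show "norm (E n s \<cdot> B n \<cdot> x - y) \<le> norm (B n \<cdot> x - y) + (2 * norm (y - x') + norm y' * t)" .
 qed
 then show "\<exists>N. \<forall>n\<ge>N. norm (E n t \<cdot> x - x - t *\<^sub>R y)
   \<le> (norm (B n \<cdot> x - y) + (2 * norm (y - x') + norm y' * t)) * t" by blast
qed

lemma T_continuous: "((\<lambda>t. T t z) \<longlongrightarrow> z) (at_right 0)"
proof (rule tendstoI)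
 fix e :: real assume e: "0 < e"
 obtain x y where xy: "(x, y) \<in> A" "norm (z - x) < e/4" using approx_dense[of "e/4"] e by auto
 let ?d = "e / (2 * (norm y + 1))"
 have "?d > 0" using e norm_ge_zero[of y] by (simp add: add_nonneg_pos)
 moreover have "dist (T t z) z < e" if "0 < t" "t < ?d" for t
 proof -
  have "norm y * t \<le> norm y * ?d" using that by (intro mult_left_mono) auto
  also have "\<dots> \<le> e / 2" by (rule damped_le) (use e in auto)
  finally show ?thesis using T_near_identity[OF xy(1), of t z] that xy(2) by (simp add: dist_norm)
 qed
 ultimately show "\<forall>\<^sub>F t in at_right 0. dist (T t z) z < e"
  unfolding eventually_at_right_field by blast
qed

lemma generator_extends:
 assumes xy: "(x, y) \<in> A" shows "((\<lambda>t. (1/t) *\<^sub>R (T t x - x)) \<longlongrightarrow> y) (at_right 0)"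
proof (rule tendstoI)
 fix e :: real assume e: "0 < e"
 obtain x' y' where x'y': "(x', y') \<in> A" "norm (y - x') < e/4" using approx_dense[of "e/4"] e by auto
 let ?d = "e / (2 * (norm y' + 1))"
 have "?d > 0" using e norm_ge_zero[of y'] by (simp add: add_nonneg_pos)
 moreover have "dist ((1/t) *\<^sub>R (T t x - x)) y < e" if "0 < t" "t < ?d" for t
 proof -
  have "norm y' * t \<le> norm y' * ?d" using that by (intro mult_left_mono) auto
  also have "\<dots> \<le> e / 2" by (rule damped_le) (use e in auto)
  finally have b: "2 * norm (y - x') + norm y' * t < e" using x'y'(2) by simp
  have "(1/t) *\<^sub>R (T t x - x) - y = (1/t) *\<^sub>R (T t x - x - t *\<^sub>R y)"
   using that by (simp add: algebra_simps)
  then have "norm ((1/t) *\<^sub>R (T t x - x) - y) = norm (T t x - x - t *\<^sub>R y) / t" using that by simp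
  also have "\<dots> \<le> 2 * norm (y - x') + norm y' * t"
   using T_increment[OF xy x'y'(1), of t] that by (simp add: field_simps)
  finally show ?thesis using b by (simp add: dist_norm)
 qed
 ultimately show "\<forall>\<^sub>F t in at_right 0. dist ((1/t) *\<^sub>R (T t x - x)) y < e"
  unfolding eventually_at_right_field by blast
qed

text \<open>The generator is dissipative since \<open>T\<close> contracts, and a dissipative relation cannot properly
 extend \<open>A\<close> because \<open>I - A\<close> is already onto.\<close>

lemma generator_eq: "((\<lambda>t. (1/t) *\<^sub>R (T t u - u)) \<longlongrightarrow> v) (at_right 0) \<longleftrightarrow> (u, v) \<in> A"
proof
 assume uv: "((\<lambda>t. (1/t) *\<^sub>R (T t u - u)) \<longlongrightarrow> v) (at_right 0)"
 obtain u' v' where u': "(u', v') \<in> A" "u' - v' = u - v" using surj by blast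
 define w where "w = u - u'"
 have w: "w = v - v'" using u'(2) by (simp add: w_def algebra_simps)
 have "((\<lambda>t. (1/t) *\<^sub>R (T t u - u) - (1/t) *\<^sub>R (T t u' - u')) \<longlongrightarrow> v - v') (at_right 0)"
  by (intro tendsto_diff uv generator_extends u')
 moreover have "\<forall>\<^sub>F t in at_right (0::real).
   (1/t) *\<^sub>R (T t u - u) - (1/t) *\<^sub>R (T t u' - u') = (1/t) *\<^sub>R (T t w - w)"
  using eventually_at_right_less
  by eventually_elim (simp add: w_def linear_diff[OF T_linear] algebra_simps)
 ultimately have "((\<lambda>t. (1/t) *\<^sub>R (T t w - w)) \<longlongrightarrow> w) (at_right 0)"
  unfolding w[symmetric] by (rule Lim_transform_eventually)
 then have "((\<lambda>t. ((1/t) *\<^sub>R (T t w - w)) \<bullet> w) \<longlongrightarrow> w \<bullet> w) (at_right 0)"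
  by (intro tendsto_intros)
 moreover have "\<forall>\<^sub>F t in at_right (0::real). ((1/t) *\<^sub>R (T t w - w)) \<bullet> w \<le> 0"
  using eventually_at_right_less
 proof eventually_elim
  case (elim t)
  have "T t w \<bullet> w \<le> norm (T t w) * norm w" by (rule norm_cauchy_schwarz)
  also have "\<dots> \<le> norm w * norm w" using T_norm[of t w] elim by (intro mult_right_mono) auto
  also have "\<dots> = w \<bullet> w" by (simp add: power2_norm_eq_inner flip: power2_eq_square)
  finally show ?case using elim by (simp add: inner_diff_left divide_le_0_iff)
 qed
 ultimately have "w \<bullet> w \<le> 0" by (intro tendsto_upperbound) auto
 then have "w = 0" by (metis inner_eq_zero_iff inner_ge_zero order_antisym)
 then show "(u, v) \<in> A" using u'(1) w by (simp add: w_def)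
qed (rule generator_extends)

end

section \<open>Orthogonal complements and essentially maximal dissipative relations\<close>

lemma subspace_closure:
 fixes S :: "'a::real_normed_vector set"
 assumes "subspace S" shows "subspace (closure S)"
proof (rule subspaceI)
 show "0 \<in> closure S" using assms closure_subset subspace_0 by blast
next
 fix x y assume "x \<in> closure S" "y \<in> closure S"
 then obtain a b where "\<And>n. a n \<in> S" "a \<longlonglongrightarrow> x" "\<And>n. b n \<in> S" "b \<longlonglongrightarrow> y"
  unfolding closure_sequential by blast
 then show "x + y \<in> closure S"
  unfolding closure_sequential using assms by (intro exI[of _ "\<lambda>n. a n + b n"]) (simp add: tendsto_add subspace_add)
next
 fix c x assume "x \<in> closure S"
 then obtain a where "\<And>n. a n \<in> S" "a \<longlonglongrightarrow> x" unfolding closure_sequential by blast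
 then show "c *\<^sub>R x \<in> closure S"
  unfolding closure_sequential using assms by (intro exI[of _ "\<lambda>n. c *\<^sub>R a n"]) (simp add: tendsto_scaleR subspace_scale)
qed

lemma norm_diff_scaleR_sq:
 fixes a q :: "'a::real_inner"
 shows "(norm (a - c *\<^sub>R q))\<^sup>2 = a \<bullet> a - 2 * c * (a \<bullet> q) + c * c * (q \<bullet> q)"
proof -
 have "q \<bullet> a = a \<bullet> q" by (rule inner_commute)
 then show ?thesis by (simp add: power2_norm_eq_inner inner_diff_left inner_diff_right algebra_simps)
qed

text \<open>The difference between a point and its nearest point in the closure is orthogonal to the subspace.
 The nearest point exists because minimizing sequences are Cauchy, by the parallelogram identity.\<close>

lemma dense_if_orthogonal_trivial:
 fixes S :: "'h::{real_inner, banach} set"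
 assumes S: "subspace S" and orth: "\<And>g. (\<And>s. s \<in> S ==> g \<bullet> s = 0) ==> g = 0"
 shows "closure S = UNIV"
proof -
 have "x \<in> closure S" for x
 proof -
  define d where "d = infdist x S"
  have ne: "S \<noteq> {}" using subspace_0[OF S] by auto
  have dle: "d \<le> dist x s" if "s \<in> S" for s unfolding d_def using that by (rule infdist_le)
  have d0: "0 \<le> d" unfolding d_def by (rule infdist_nonneg)
  have "\<exists>s\<in>S. dist x s < d + 1 / real (Suc n)" for n
  proof (rule ccontr)
   assume "\<not> ?thesis"
   then have "d + 1 / real (Suc n) \<le> infdist x S"
    unfolding infdist_notempty[OF ne] by (intro cINF_greatest[OF ne]) (auto simp: not_less)
   then show False by (simp add: d_def)
  qed
  then obtain s where s: "\<And>n. s n \<in> S" "\<And>n. dist x (s n) < d + 1 / real (Suc n)" by metis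
  have sq: "(norm (x - s n))\<^sup>2 \<le> d\<^sup>2 + (2 * d + 1) / real (Suc n)" for n
  proof -
   have "(norm (x - s n))\<^sup>2 \<le> (d + 1 / real (Suc n))\<^sup>2"
    using s(2)[of n] by (intro power_mono) (auto simp: dist_norm)
   also have "\<dots> = d\<^sup>2 + 2 * d / real (Suc n) + (1 / real (Suc n)) * (1 / real (Suc n))"
    by (simp add: power2_eq_square algebra_simps)
   also have "(1 / real (Suc n)) * (1 / real (Suc n)) \<le> 1 * (1 / real (Suc n))"
    by (intro mult_right_mono) auto
   finally show ?thesis by (simp add: add_divide_distrib)
  qed
  have par: "(norm (s m - s n))\<^sup>2 \<le> 2 * (2 * d + 1) * (1 / real (Suc m) + 1 / real (Suc n))" for m n
  proof -
   have mid: "(1/2) *\<^sub>R (s m + s n) \<in> S" using S s(1) by (intro subspace_scale subspace_add)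
   have "(norm (s m - s n))\<^sup>2 + 4 * (norm (x - (1/2) *\<^sub>R (s m + s n)))\<^sup>2
     = 2 * (norm (x - s m))\<^sup>2 + 2 * (norm (x - s n))\<^sup>2"
    by (simp add: power2_norm_eq_inner inner_diff_left inner_diff_right inner_add_left inner_add_right inner_commute algebra_simps)
   moreover have "d\<^sup>2 \<le> (norm (x - (1/2) *\<^sub>R (s m + s n)))\<^sup>2"
    using dle[OF mid] d0 by (intro power_mono) (auto simp: dist_norm)
   ultimately have "(norm (s m - s n))\<^sup>2 \<le> 2 * ((2 * d + 1) / real (Suc m)) + 2 * ((2 * d + 1) / real (Suc n))"
    using sq[of m] sq[of n] by linarith
   then show ?thesis by (simp add: distrib_left)
  qed
  have "Cauchy s"
  proof (rule CauchyI)
   fix e :: real assume e: "0 < e"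
   obtain N where N: "4 * (2 * d + 1) / e\<^sup>2 < real N" using reals_Archimedean2 by blast
   have "norm (s m - s n) < e" if "N \<le> m" "N \<le> n" for m n
   proof -
    have "4 * (2 * d + 1) / e\<^sup>2 < real (Suc k)" if "N \<le> k" for k using N that by simp
    then have k: "2 * (2 * d + 1) * (1 / real (Suc k)) < e\<^sup>2 / 2" if "N \<le> k" for k
     using that e by (simp add: field_simps)
    have "(norm (s m - s n))\<^sup>2 < e\<^sup>2"
     using par[of m n] k[OF that(1)] k[OF that(2)] unfolding distrib_left by linarith
    then show ?thesis using e by (simp add: power2_less_imp_less)
   qed
   then show "\<exists>M. \<forall>m\<ge>M. \<forall>n\<ge>M. norm (s m - s n) < e" by blast
  qed
  then obtain p where p: "s \<longlonglongrightarrow> p" using Cauchy_convergent convergent_def by blast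
  have pS: "p \<in> closure S" using p s(1) closure_sequential by blast
  have nd: "norm (x - p) \<le> d"
  proof (rule LIMSEQ_le)
   show "(\<lambda>n. norm (x - s n)) \<longlonglongrightarrow> norm (x - p)" by (intro tendsto_intros p)
   show "(\<lambda>n. d + 1 / real (Suc n)) \<longlonglongrightarrow> d"
    using tendsto_add[OF tendsto_const LIMSEQ_Suc[OF lim_1_over_n], of d] by simp
   show "\<exists>N. \<forall>n\<ge>N. norm (x - s n) \<le> d + 1 / real (Suc n)" using s(2) by (auto simp: dist_norm intro: less_imp_le)
  qed
  have clS: "subspace (closure S)" using S by (rule subspace_closure)
  have dcl: "d \<le> norm (x - q)" if "q \<in> closure S" for q
   proof -
   have "infdist q S = 0" using that unfolding in_closure_iff_infdist_zero[OF ne] .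
   moreover have "d \<le> infdist q S + dist x q" unfolding d_def by (rule infdist_triangle)
   ultimately show ?thesis unfolding dist_norm by linarith
  qed
  have "(x - p) \<bullet> q = 0" if q: "q \<in> S" for q
  proof (cases "q = 0")
   case False
   define c where "c = ((x - p) \<bullet> q) / (q \<bullet> q)"
   have qq: "q \<bullet> q > 0" using False by simp
   have "p + c *\<^sub>R q \<in> closure S"
    using clS pS q closure_subset by (meson in_mono subspace_add subspace_scale)
   then have "d\<^sup>2 \<le> (norm (x - (p + c *\<^sub>R q)))\<^sup>2" by (rule power_mono[OF dcl d0])
   also have "\<dots> = (norm (x - p))\<^sup>2 - ((x - p) \<bullet> q)\<^sup>2 / (q \<bullet> q)"
   proof -
    have "(norm (x - (p + c *\<^sub>R q)))\<^sup>2 = (norm ((x - p) - c *\<^sub>R q))\<^sup>2"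
     by (simp only: diff_diff_eq)
    also have "\<dots> = (x - p) \<bullet> (x - p) - 2 * c * ((x - p) \<bullet> q) + c * c * (q \<bullet> q)"
     by (rule norm_diff_scaleR_sq)
    also have "c * c * (q \<bullet> q) = c * ((x - p) \<bullet> q)" using qq by (simp add: c_def)
    also have "(x - p) \<bullet> (x - p) - 2 * c * ((x - p) \<bullet> q) + c * ((x - p) \<bullet> q)
      = (x - p) \<bullet> (x - p) - c * ((x - p) \<bullet> q)" by (simp only: mult.assoc)
    finally show ?thesis unfolding power2_norm_eq_inner[of "x - p"] by (simp add: c_def power2_eq_square)
   qed
   also have "(norm (x - p))\<^sup>2 \<le> d\<^sup>2" by (rule power_mono[OF nd norm_ge_zero])
   finally have "((x - p) \<bullet> q)\<^sup>2 / (q \<bullet> q) \<le> 0" by simp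
   then show ?thesis using qq by (simp add: divide_le_0_iff)
  qed simp
  then have "x - p = 0" by (rule orth)
  then show ?thesis using pS by simp
 qed
 then show ?thesis by blast
qed

text \<open>For a dissipative relation \<open>I - A\<close> is bounded below, so passing to the closure turns a dense
 range into a full one.\<close>

lemma maximal_dissipative_closure:
 fixes A :: "('h::{real_inner, banach, perfect_space} \<times> 'h) set"
 assumes sub: "subspace A" and dis: "\<And>u v. (u, v) \<in> A ==> v \<bullet> u \<le> 0"
  and dense: "closure (fst ` A) = UNIV"
  and range: "closure ((\<lambda>(u, v). u - v) ` A) = UNIV"
 shows "maximal_dissipative (closure A)"
proof (rule maximal_dissipative.intro)
 show "subspace (closure A)" using sub by (rule subspace_closure)
 have dis': "v \<bullet> u \<le> 0" if uv: "(u, v) \<in> closure A" for u v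
 proof -
  obtain a where a: "\<And>n. a n \<in> A" "a \<longlonglongrightarrow> (u, v)"
   using uv unfolding closure_sequential by auto
  have lim: "(\<lambda>n. snd (a n) \<bullet> fst (a n)) \<longlonglongrightarrow> v \<bullet> u"
   using tendsto_inner[OF tendsto_snd[OF a(2)] tendsto_fst[OF a(2)]] by simp
  have "snd (a n) \<bullet> fst (a n) \<le> 0" for n
   using dis[of "fst (a n)" "snd (a n)"] a(1)[of n] by simp
  then show ?thesis by (intro LIMSEQ_le_const2[OF lim]) auto
 qed
 then show "\<And>u v. (u, v) \<in> closure A ==> v \<bullet> u \<le> 0" .
 show "closure (fst ` closure A) = UNIV"
  using dense closure_mono[OF image_mono[OF closure_subset[of A]], of fst] by (simp add: top.extremum_unique)
 fix f :: 'h
 obtain g where g: "\<And>n. g n \<in> (\<lambda>(u, v). u - v) ` A" "g \<longlonglongrightarrow> f"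
  using UNIV_I[of f] unfolding range[symmetric] closure_sequential by auto
 have "\<exists>a\<in>A. g n = fst a - snd a" for n using g(1)[of n] by (auto simp: case_prod_beta)
 then obtain a where a: "\<And>n. a n \<in> A" "\<And>n. g n = fst (a n) - snd (a n)" by metis
 have bound: "norm u \<le> norm (u - v)" if "(u, v) \<in> A" for u v
 proof (cases "u = 0")
  case False
  have "norm u * norm u \<le> (u - v) \<bullet> u"
   using dis[OF that] by (simp add: inner_diff_left power2_norm_eq_inner flip: power2_eq_square)
  also have "\<dots> \<le> norm (u - v) * norm u" by (rule norm_cauchy_schwarz)
  finally show ?thesis using False by simp
 qed simp
 have "Cauchy (\<lambda>n. fst (a n))"
 proof (rule CauchyI)
  fix e :: real assume "0 < e"
  moreover have "Cauchy g" using g(2) by (simp add: LIMSEQ_imp_Cauchy)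
  ultimately obtain M where M: "\<And>m n. M \<le> m ==> M \<le> n ==> norm (g m - g n) < e" using CauchyD by blast
  have "norm (fst (a m) - fst (a n)) \<le> norm (g m - g n)" for m n
  proof -
   have "(fst (a m) - fst (a n), snd (a m) - snd (a n)) \<in> A"
    using subspace_diff[OF sub a(1)[of m] a(1)[of n]] by (simp only: minus_prod_def)
   from bound[OF this] show ?thesis by (simp add: a(2) algebra_simps)
  qed
  then show "\<exists>M. \<forall>m\<ge>M. \<forall>n\<ge>M. norm (fst (a m) - fst (a n)) < e" using M order_le_less_trans by blast
 qed
 then obtain u where u: "(\<lambda>n. fst (a n)) \<longlonglongrightarrow> u" using Cauchy_convergent convergent_def by blast
 have "(\<lambda>n. fst (a n) - g n) \<longlonglongrightarrow> u - f" by (intro tendsto_diff u g)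
 then have "(\<lambda>n. snd (a n)) \<longlonglongrightarrow> u - f" by (simp add: a(2))
 then have "a \<longlonglongrightarrow> (u, u - f)" using tendsto_Pair[of "\<lambda>n. fst (a n)" u sequentially "\<lambda>n. snd (a n)" "u - f"] u by simp
 then have "(u, u - f) \<in> closure A" using a(1) unfolding closure_sequential by auto
 then show "\<exists>u v. (u, v) \<in> closure A \<and> u - v = f" by (intro exI[of _ u] exI[of _ "u - f"]) simp
qed

text \<open>The bounded approximations are functions and converge to any value of \<open>A\<close>.\<close>

lemma (in maximal_dissipative) single_valued: "single_valued A"
proof (rule single_valuedI)
 fix x y z assume "(x, y) \<in> A" "(x, z) \<in> A"
 then show "y = z" using B_LIMSEQ LIMSEQ_unique by blast
qed


section \<open>Square-integrable functions modulo null sets\<close>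

lemma L2_funsD: "f \<in> L2_funs M ==> f \<in> borel_measurable M" "f \<in> L2_funs M ==> integrable M (\<lambda>x. (f x)\<^sup>2)"
 by (simp_all add: L2_funs_def)

lemma L2_funs_mult_integrable:
 assumes "f \<in> L2_funs M" "g \<in> L2_funs M" shows "integrable M (\<lambda>x. f x * g x)"
proof (rule Bochner_Integration.integrable_bound[of M "\<lambda>x. (f x)\<^sup>2 + (g x)\<^sup>2"])
 have "\<bar>a * b\<bar> \<le> a\<^sup>2 + b\<^sup>2" for a b :: real
 proof -
  have "0 \<le> \<bar>a\<bar> * \<bar>b\<bar>" by simp
  moreover have "2 * (\<bar>a\<bar> * \<bar>b\<bar>) \<le> a\<^sup>2 + b\<^sup>2" using sum_squares_bound[of "\<bar>a\<bar>" "\<bar>b\<bar>"] by (simp add: mult.assoc)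
  ultimately show ?thesis unfolding abs_mult by linarith
 qed
 then show "AE x in M. norm (f x * g x) \<le> norm ((f x)\<^sup>2 + (g x)\<^sup>2)" by simp
qed (use assms[THEN L2_funsD(1)] assms[THEN L2_funsD(2)] in auto)

lemma L2_funs_add: assumes "f \<in> L2_funs M" "g \<in> L2_funs M" shows "(\<lambda>x. f x + g x) \<in> L2_funs M"
proof -
 have "integrable M (\<lambda>x. (f x)\<^sup>2 + (g x)\<^sup>2 + 2 * (f x * g x))"
  using L2_funs_mult_integrable[OF assms] assms[THEN L2_funsD(2)] by simp
 then show ?thesis using assms[THEN L2_funsD(1)]
  by (simp add: L2_funs_def power2_sum mult.assoc)
qed

lemma L2_funs_scale: "f \<in> L2_funs M ==> (\<lambda>x. c * f x) \<in> L2_funs M"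
 by (auto simp: L2_funs_def power_mult_distrib intro!: borel_measurable_times)

lemma L2_funs_zero: "(\<lambda>x. 0) \<in> L2_funs M"
 by (simp add: L2_funs_def)

lemma L2_funs_diff: "f \<in> L2_funs M ==> g \<in> L2_funs M ==> (\<lambda>x. f x - g x) \<in> L2_funs M"
 using L2_funs_add[of f M "\<lambda>x. (-1) * g x"] L2_funs_scale[of g M "-1"] by simp

lemma L2_class_eq_iff:
 assumes "f \<in> L2_funs M" "g \<in> L2_funs M"
 shows "L2_class M f = L2_class M g \<longleftrightarrow> (AE x in M. f x = g x)"
proof
 assume "L2_class M f = L2_class M g"
 moreover have "f \<in> L2_class M f" using assms by (simp add: L2_class_def)
 ultimately show "AE x in M. f x = g x" by (simp add: L2_class_def)
next
 assume e: "AE x in M. f x = g x"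
 have "(AE x in M. h x = f x) \<longleftrightarrow> (AE x in M. h x = g x)" for h
 proof
  assume "AE x in M. h x = f x" with e show "AE x in M. h x = g x" by eventually_elim simp
 next
  assume "AE x in M. h x = g x" with e show "AE x in M. h x = f x" by eventually_elim simp
 qed
 then show "L2_class M f = L2_class M g" by (simp add: L2_class_def)
qed

lemma L2_rep_class:
 assumes "f \<in> L2_funs M"
 shows "L2_rep (L2_class M f) \<in> L2_funs M" "AE x in M. L2_rep (L2_class M f) x = f x"
proof -
 have "f \<in> L2_class M f" using assms by (simp add: L2_class_def)
 then have "L2_rep (L2_class M f) \<in> L2_class M f" unfolding L2_rep_def by (rule someI[where P="\<lambda>g. g \<in> L2_class M f"])
 then show "L2_rep (L2_class M f) \<in> L2_funs M" "AE x in M. L2_rep (L2_class M f) x = f x"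
  by (simp_all add: L2_class_def)
qed

lemma L2_space_rep:
 assumes "u \<in> L2_space M" shows "L2_rep u \<in> L2_funs M" "L2_class M (L2_rep u) = u"
proof -
 obtain f where f: "f \<in> L2_funs M" "u = L2_class M f" using assms by (auto simp: L2_space_def)
 show "L2_rep u \<in> L2_funs M" using L2_rep_class(1)[OF f(1)] f(2) by simp
 show "L2_class M (L2_rep u) = u"
  using L2_rep_class[OF f(1)] f by (simp add: L2_class_eq_iff)
qed

lemma L2_class_in_space: "f \<in> L2_funs M ==> L2_class M f \<in> L2_space M"
 by (simp add: L2_space_def)

lemma L2_add_class:
 assumes "f \<in> L2_funs M" "g \<in> L2_funs M"
 shows "L2_add M (L2_class M f) (L2_class M g) = L2_class M (\<lambda>x. f x + g x)"
 unfolding L2_add_def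
proof (subst L2_class_eq_iff)
 show "AE x in M. L2_rep (L2_class M f) x + L2_rep (L2_class M g) x = f x + g x"
  using L2_rep_class(2)[OF assms(1)] L2_rep_class(2)[OF assms(2)] by eventually_elim simp
qed (auto intro!: L2_funs_add L2_rep_class assms)

lemma L2_scale_class:
 assumes "f \<in> L2_funs M"
 shows "L2_scale M c (L2_class M f) = L2_class M (\<lambda>x. c * f x)"
 unfolding L2_scale_def
proof (subst L2_class_eq_iff)
 show "AE x in M. c * L2_rep (L2_class M f) x = c * f x"
  using L2_rep_class(2)[OF assms] by eventually_elim simp
qed (auto intro!: L2_funs_scale L2_rep_class assms)

lemma L2_inner_class:
 assumes "f \<in> L2_funs M" "g \<in> L2_funs M"
 shows "L2_inner M (L2_class M f) (L2_class M g) = (\<integral>x. f x * g x \<partial>M)"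
 unfolding L2_inner_def
proof (rule integral_cong_AE)
 show "AE x in M. L2_rep (L2_class M f) x * L2_rep (L2_class M g) x = f x * g x"
  using L2_rep_class(2)[OF assms(1)] L2_rep_class(2)[OF assms(2)] by eventually_elim simp
qed (use assms[THEN L2_funsD(1)] assms[THEN L2_rep_class(1), THEN L2_funsD(1)] in auto)

lemma Cauchy_Schwarz_integral:
 assumes "f \<in> L2_funs M" "g \<in> L2_funs M"
 shows "\<bar>\<integral>x. f x * g x \<partial>M\<bar> \<le> sqrt (\<integral>x. (f x)\<^sup>2 \<partial>M) * sqrt (\<integral>x. (g x)\<^sup>2 \<partial>M)"
proof -
 let ?a = "\<integral>x. (f x)\<^sup>2 \<partial>M" and ?b = "\<integral>x. f x * g x \<partial>M" and ?c = "\<integral>x. (g x)\<^sup>2 \<partial>M"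
 have pos: "0 \<le> ?a * s\<^sup>2 + 2 * ?b * s * t + ?c * t\<^sup>2" for s t
 proof -
  have i: "integrable M (\<lambda>x. f x * g x)" by (rule L2_funs_mult_integrable[OF assms])
  have "0 \<le> (\<integral>x. (s * f x + t * g x)\<^sup>2 \<partial>M)" by simp
  also have "(\<lambda>x. (s * f x + t * g x)\<^sup>2) = (\<lambda>x. s\<^sup>2 * (f x)\<^sup>2 + (2 * s * t) * (f x * g x) + t\<^sup>2 * (g x)\<^sup>2)"
   by (simp add: power2_sum power_mult_distrib algebra_simps)
  also have "(\<integral>x. s\<^sup>2 * (f x)\<^sup>2 + (2 * s * t) * (f x * g x) + t\<^sup>2 * (g x)\<^sup>2 \<partial>M)
    = s\<^sup>2 * ?a + (2 * s * t) * ?b + t\<^sup>2 * ?c"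
   using i assms[THEN L2_funsD(2)] by simp
  finally show ?thesis by (simp add: algebra_simps)
 qed
 have a: "0 \<le> ?a" "0 \<le> ?c" by simp_all
 have "?b\<^sup>2 \<le> ?a * ?c"
 proof (cases "?a = 0")
  case True
  have "?b = 0"
  proof (rule ccontr)
   assume "?b \<noteq> 0"
   then show False using pos[of "- (?c + 1) / (2 * ?b)" 1] True by simp
  qed
  then show ?thesis using True by simp
 next
  case False
  then have "0 < ?a" using a by linarith
  have "0 \<le> ?a * (- ?b)\<^sup>2 + 2 * ?b * (- ?b) * ?a + ?c * ?a\<^sup>2" by (rule pos)
  then have "?a * ?b\<^sup>2 \<le> ?a * (?a * ?c)" by (simp add: power2_eq_square algebra_simps)
  then show ?thesis using \<open>0 < ?a\<close> by simp
 qed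
 then have "sqrt (?b\<^sup>2) \<le> sqrt (?a * ?c)" by (rule real_sqrt_le_mono)
 then show ?thesis by (simp add: real_sqrt_mult)
qed

text \<open>Completeness.  On a \<open>\<sigma>\<close>-finite space some \<open>h\<close> in \<open>L\<^sup>2\<close> is strictly positive; multiplying
 by it turns an \<open>L\<^sup>2\<close>-Cauchy sequence into an \<open>L\<^sup>1\<close>-Cauchy one, which has a subsequence
 converging almost everywhere, and Fatou's lemma identifies the limit.\<close>

lemma L2_complete:
 assumes sf: "sigma_finite_measure M" and s: "\<And>n::nat. s n \<in> L2_funs M"
  and C: "\<And>e. 0 < e ==> \<exists>N. \<forall>i\<ge>N. \<forall>j\<ge>N. (\<integral>x. (s i x - s j x)\<^sup>2 \<partial>M) < e"
 shows "\<exists>f\<in>L2_funs M. \<forall>e>0. \<exists>N. \<forall>n\<ge>N. (\<integral>x. (s n x - f x)\<^sup>2 \<partial>M) \<le> e"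
proof -
 have [measurable]: "s n \<in> borel_measurable M" for n using s by (rule L2_funsD)
 obtain h0 where h0[measurable]: "h0 \<in> borel_measurable M" and h0i: "integral\<^sup>N M h0 \<noteq> \<infinity>"
  and h0p: "\<And>x. x \<in> space M ==> 0 < h0 x \<and> h0 x < \<infinity>"
  using sigma_finite_measure.Ex_finite_integrable_function[OF sf] by blast
 define h where "h x = sqrt (enn2real (h0 x))" for x
 have hp: "0 < h x" if "x \<in> space M" for x
  using h0p[OF that] by (simp add: h_def enn2real_positive_iff)
 have hm[measurable]: "h \<in> borel_measurable M" unfolding h_def by measurable
 have "integrable M (\<lambda>x. enn2real (h0 x))"
 proof (rule integrableI_bounded)
  have "(\<integral>\<^sup>+x. ennreal (norm (enn2real (h0 x))) \<partial>M) = integral\<^sup>N M h0"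
   using h0p by (intro nn_integral_cong) (auto simp: less_top)
  then show "(\<integral>\<^sup>+x. ennreal (norm (enn2real (h0 x))) \<partial>M) < \<infinity>" using h0i by (simp add: less_top)
 qed simp
 then have h: "h \<in> L2_funs M" by (simp add: L2_funs_def h_def)
 have "\<exists>N. \<forall>i\<ge>N. \<forall>j\<ge>N. (LINT x|M. norm (s i x * h x - s j x * h x)) < e" if e: "0 < e" for e
 proof -
  define H where "H = sqrt (\<integral>x. (h x)\<^sup>2 \<partial>M) + 1"
  have H: "H > 0" unfolding H_def by (simp add: add_nonneg_pos)
  obtain N where N: "\<And>i j. i \<ge> N ==> j \<ge> N ==> (\<integral>x. (s i x - s j x)\<^sup>2 \<partial>M) < (e / H)\<^sup>2"
   using C[of "(e / H)\<^sup>2"] e H by auto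
  have "(LINT x|M. norm (s i x * h x - s j x * h x)) < e" if ij: "i \<ge> N" "j \<ge> N" for i j
  proof -
   have d: "(\<lambda>x. \<bar>s i x - s j x\<bar>) \<in> L2_funs M"
    using L2_funs_diff[OF s[of i] s[of j]] by (simp add: L2_funs_def)
   have "(LINT x|M. norm (s i x * h x - s j x * h x)) = (\<integral>x. \<bar>s i x - s j x\<bar> * h x \<partial>M)"
    using hp by (intro Bochner_Integration.integral_cong) (auto simp: abs_mult less_imp_le simp flip: left_diff_distrib)
   also have "\<dots> \<le> sqrt (\<integral>x. \<bar>s i x - s j x\<bar>\<^sup>2 \<partial>M) * sqrt (\<integral>x. (h x)\<^sup>2 \<partial>M)"
    using Cauchy_Schwarz_integral[OF d h] by linarith
   also have "sqrt (\<integral>x. \<bar>s i x - s j x\<bar>\<^sup>2 \<partial>M) \<le> e / H"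
    using N[OF ij] e H by (intro real_le_lsqrt) auto
   also have "e / H * sqrt (\<integral>x. (h x)\<^sup>2 \<partial>M) < e / H * H"
    using e H by (intro mult_strict_left_mono) (auto simp: H_def)
   also have "\<dots> = e" using H by simp
   finally show ?thesis by (simp add: mult_right_mono)
  qed
  then show ?thesis by blast
 qed
 from cauchy_L1_AE_cauchy_subseq[of M "\<lambda>i x. s i x * h x", OF L2_funs_mult_integrable[OF s h] this]
 obtain r where r: "strict_mono r" "AE x in M. Cauchy (\<lambda>i. s (r i) x * h x)" by blast
 define f where "f x = lim (\<lambda>i. s (r i) x)" for x
 have fm[measurable]: "f \<in> borel_measurable M" unfolding f_def by measurable
 have lim: "AE x in M. (\<lambda>i. s (r i) x) \<longlonglongrightarrow> f x"
  using r(2) AE_space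
 proof eventually_elim
  case (elim x)
  obtain L where "(\<lambda>i. s (r i) x * h x) \<longlonglongrightarrow> L"
   using elim(1) by (auto simp: Cauchy_convergent_iff convergent_def)
  from tendsto_mult[OF this tendsto_const[of "inverse (h x)"]]
  have "(\<lambda>i. s (r i) x) \<longlonglongrightarrow> L * inverse (h x)"
   using hp[OF elim(2)] by (simp only: mult.assoc) (simp del: tendsto_mult_right_iff)
  then have "convergent (\<lambda>i. s (r i) x)" by (auto simp: convergent_def)
  then show ?case by (simp add: f_def convergent_LIMSEQ_iff)
 qed
 have fatou: "integrable M (\<lambda>x. (s n x - f x)\<^sup>2) \<and> (\<integral>x. (s n x - f x)\<^sup>2 \<partial>M) \<le> e"
  if e: "0 < e" and n: "\<And>j. j \<ge> N ==> (\<integral>x. (s n x - s j x)\<^sup>2 \<partial>M) < e" for n N e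
 proof -
  have "(\<integral>\<^sup>+x. ennreal ((s n x - f x)\<^sup>2) \<partial>M) = (\<integral>\<^sup>+x. liminf (\<lambda>i. ennreal ((s n x - s (r i) x)\<^sup>2)) \<partial>M)"
  proof (rule nn_integral_cong_AE, use lim in eventually_elim)
   case (elim x)
   then have "(\<lambda>i. ennreal ((s n x - s (r i) x)\<^sup>2)) \<longlonglongrightarrow> ennreal ((s n x - f x)\<^sup>2)"
    by (intro tendsto_intros)
   from lim_imp_Liminf[OF trivial_limit_sequentially this] show ?case by (rule sym)
  qed
  also have "\<dots> \<le> liminf (\<lambda>i. \<integral>\<^sup>+x. ennreal ((s n x - s (r i) x)\<^sup>2) \<partial>M)"
   by (rule nn_integral_liminf) simp
  also have "\<dots> \<le> ennreal e"
  proof (rule Liminf_le[OF sequentially_bot eventually_sequentiallyI[of N]])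
   fix i assume "N \<le> i"
   then have "N \<le> r i" using seq_suble[OF r(1), of i] by simp
   have "(\<integral>\<^sup>+x. ennreal ((s n x - s (r i) x)\<^sup>2) \<partial>M) = ennreal (\<integral>x. (s n x - s (r i) x)\<^sup>2 \<partial>M)"
    by (rule nn_integral_eq_integral) (use L2_funsD(2)[OF L2_funs_diff[OF s s]] in auto)
   also have "\<dots> \<le> ennreal e" using n[OF \<open>N \<le> r i\<close>] by (intro ennreal_leI) simp
   finally show "(\<integral>\<^sup>+x. ennreal ((s n x - s (r i) x)\<^sup>2) \<partial>M) \<le> ennreal e" .
  qed
  finally have b: "(\<integral>\<^sup>+x. ennreal ((s n x - f x)\<^sup>2) \<partial>M) \<le> ennreal e" .
  have i: "integrable M (\<lambda>x. (s n x - f x)\<^sup>2)"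
   by (rule integrableI_bounded) (use b in \<open>auto simp: le_less_trans[OF b]\<close>)
  have "ennreal (\<integral>x. (s n x - f x)\<^sup>2 \<partial>M) \<le> ennreal e"
   using b nn_integral_eq_integral[OF i] by simp
  then show ?thesis using i e by (simp add: ennreal_le_iff)
 qed
 have conv: "\<exists>N. \<forall>n\<ge>N. integrable M (\<lambda>x. (s n x - f x)\<^sup>2) \<and> (\<integral>x. (s n x - f x)\<^sup>2 \<partial>M) \<le> e"
  if "0 < e" for e
  using C[OF that] fatou[OF that] by meson
 obtain N where N: "integrable M (\<lambda>x. (s N x - f x)\<^sup>2)" using conv[of 1] by auto
 have "(\<lambda>x. s N x - f x) \<in> L2_funs M" using N by (simp add: L2_funs_def)
 from L2_funs_diff[OF s[of N] this] have "f \<in> L2_funs M" by simp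
 then show ?thesis using conv by blast
qed

section \<open>The flat phase space as a Hilbert space type\<close>

lemma sets_sphere_measure [measurable_cong]:
 "sets sphere_measure = sets (restrict_space borel (unit_sphere :: 'a::euclidean_space set))"
 unfolding sphere_measure_def by (rule sets_restrict_space_cong) simp

lemma space_sphere_measure [simp]: "space (sphere_measure :: 'a::euclidean_space measure) = unit_sphere"
 unfolding sphere_measure_def by (simp add: space_restrict_space)

lemma prob_space_sphere_measure: "finite_measure (sphere_measure :: 'a::euclidean_space measure)"
 by (rule finite_measureI) (simp add: emeasure_sphere_measure)

interpretation sphere: finite_measure "sphere_measure :: 'a::euclidean_space measure"
 by (rule prob_space_sphere_measure)

interpretation phase: pair_sigma_finite "lborel :: 'a::euclidean_space measure" "sphere_measure :: 'a measure"
 by unfold_locales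

lemma measure_sphere_measure [simp]: "measure (sphere_measure :: 'a::euclidean_space measure) unit_sphere = 1"
 by (simp add: measure_def emeasure_sphere_measure)

type_synonym 'a phase = "'a \<times> 'a"

definition flat_measure :: "'a::euclidean_space phase measure" where
 "flat_measure = lborel \<Otimes>\<^sub>M sphere_measure"

abbreviation flat_integral :: "('a::euclidean_space phase => real) => real" (binder "\<ointegral>" 10) where
 "flat_integral f \<equiv> integral\<^sup>L flat_measure f"

abbreviation cyl :: "real => 'a::euclidean_space phase set" where
 "cyl R \<equiv> cball 0 R \<times> unit_sphere"

lemma space_flat_measure [simp]: "space (flat_measure :: 'a::euclidean_space phase measure) = state_space"
 by (simp add: flat_measure_def space_pair_measure state_space_def)

lemma sigma_finite_flat: "sigma_finite_measure (flat_measure :: 'a::euclidean_space phase measure)"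
 unfolding flat_measure_def by (rule phase.sigma_finite_measure_axioms)

typedef (overloaded) 'a phase_L2 = "L2_space (flat_measure :: 'a::euclidean_space phase measure)"
 by (auto simp: L2_space_def intro: L2_funs_zero)

definition L2_of :: "('a::euclidean_space phase => real) => 'a phase_L2" where
 "L2_of f = Abs_phase_L2 (L2_class flat_measure f)"

definition fn :: "'a::euclidean_space phase_L2 => 'a phase => real" where
 "fn u = L2_rep (Rep_phase_L2 u)"

lemma fn_L2 [simp]: "fn u \<in> L2_funs flat_measure"
 unfolding fn_def by (rule L2_space_rep) (rule Rep_phase_L2)

lemma L2_of_fn [simp]: "L2_of (fn u) = u"
 unfolding fn_def L2_of_def using Rep_phase_L2[of u] by (simp add: L2_space_rep Rep_phase_L2_inverse)

lemma L2_of_eq_iff: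
 "f \<in> L2_funs flat_measure ==> g \<in> L2_funs flat_measure ==>
  L2_of f = L2_of g \<longleftrightarrow> (AE x in flat_measure. f x = g x)"
 unfolding L2_of_def by (simp add: Abs_phase_L2_inject L2_class_in_space L2_class_eq_iff)

lemma fn_L2_of:
 "f \<in> L2_funs flat_measure ==> AE x in flat_measure. fn (L2_of f) x = f x"
 unfolding fn_def L2_of_def by (simp add: Abs_phase_L2_inverse L2_class_in_space L2_rep_class)

lemma fn_measurable [measurable]: "fn u \<in> borel_measurable flat_measure"
 using fn_L2 by (rule L2_funsD)

instantiation phase_L2 :: (euclidean_space) real_inner
begin
definition zero_phase_L2 :: "'a phase_L2" where "0 = L2_of (\<lambda>_. 0)"
definition plus_phase_L2 :: "'a phase_L2 => 'a phase_L2 => 'a phase_L2" where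
 "u + v = L2_of (\<lambda>x. fn u x + fn v x)"
definition scaleR_phase_L2 :: "real => 'a phase_L2 => 'a phase_L2" where
 "scaleR c u = L2_of (\<lambda>x. c * fn u x)"
definition uminus_phase_L2 :: "'a phase_L2 => 'a phase_L2" where "- u = L2_of (\<lambda>x. - fn u x)"
definition minus_phase_L2 :: "'a phase_L2 => 'a phase_L2 => 'a phase_L2" where
 "u - v = L2_of (\<lambda>x. fn u x - fn v x)"
definition inner_phase_L2 :: "'a phase_L2 => 'a phase_L2 => real" where
 "inner u v = (\<ointegral>x. fn u x * fn v x)"
definition norm_phase_L2 :: "'a phase_L2 => real" where "norm_phase_L2 u = sqrt (inner u u)"
definition dist_phase_L2 :: "'a phase_L2 => 'a phase_L2 => real" where "dist_phase_L2 u v = norm (u - v)"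
definition sgn_phase_L2 :: "'a phase_L2 => 'a phase_L2" where "sgn_phase_L2 u = scaleR (inverse (norm u)) u"
definition uniformity_phase_L2 :: "('a phase_L2 \<times> 'a phase_L2) filter" where
 "uniformity_phase_L2 = (INF e\<in>{0<..}. principal {(x, y). dist x y < e})"
definition open_phase_L2 :: "'a phase_L2 set => bool" where
 "open_phase_L2 S = (\<forall>x\<in>S. \<forall>\<^sub>F (x', y) in uniformity. x' = x \<longrightarrow> y \<in> S)"

lemma L2_of_ops:
 assumes "f \<in> L2_funs flat_measure" "g \<in> L2_funs flat_measure"
 shows "L2_of f + L2_of g = L2_of (\<lambda>x. f x + g x)"
  "inner (L2_of f) (L2_of g) = (\<ointegral>x. f x * g x)"
proof -
 note ae = fn_L2_of[OF assms(1)] fn_L2_of[OF assms(2)]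
 have [measurable]: "f \<in> borel_measurable flat_measure" "g \<in> borel_measurable flat_measure"
  using assms by (auto dest: L2_funsD)
 show "L2_of f + L2_of g = L2_of (\<lambda>x. f x + g x)" unfolding plus_phase_L2_def
  using ae by (subst L2_of_eq_iff) (auto intro!: L2_funs_add assms elim: eventually_elim2)
 show "inner (L2_of f) (L2_of g) = (\<ointegral>x. f x * g x)" unfolding inner_phase_L2_def
  by (rule integral_cong_AE) (use ae in \<open>auto elim: eventually_elim2\<close>)
qed

lemma L2_of_scale:
 assumes "f \<in> L2_funs flat_measure" shows "scaleR c (L2_of f) = L2_of (\<lambda>x. c * f x)"
 unfolding scaleR_phase_L2_def
 using fn_L2_of[OF assms] by (subst L2_of_eq_iff) (auto intro!: L2_funs_scale assms elim: eventually_mono)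

instance
proof
 have um: "- u = scaleR (-1) u" for u :: "'a phase_L2" by (simp add: uminus_phase_L2_def scaleR_phase_L2_def)
 have mi: "u - v = u + - v" for u v :: "'a phase_L2"
 proof -
  have "u + scaleR (-1) v = L2_of (fn u) + L2_of (\<lambda>x. -1 * fn v x)"
   unfolding scaleR_phase_L2_def by simp
  also have "\<dots> = u - v" by (subst L2_of_ops(1)[OF fn_L2 L2_funs_scale[OF fn_L2]]) (simp add: minus_phase_L2_def)
  finally show ?thesis by (simp add: um)
 qed
 have rep: "\<exists>f. f \<in> L2_funs flat_measure \<and> u = L2_of f" for u :: "'a phase_L2"
  by (rule exI[of _ "fn u"]) simp
 have c0: "\<And>x. (\<lambda>x. 0::real) \<in> L2_funs (flat_measure :: 'a phase measure)" by (rule L2_funs_zero)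
 fix u v w :: "'a phase_L2" and r q :: real
 obtain f g h where f: "f \<in> L2_funs flat_measure" "u = L2_of f" and g: "g \<in> L2_funs flat_measure" "v = L2_of g"
  and h: "h \<in> L2_funs flat_measure" "w = L2_of h" using rep by meson
 note L = L2_of_ops L2_of_scale L2_funs_add L2_funs_scale f g h c0
 show "u + v + w = u + (v + w)" by (simp add: L add.assoc)
 show "u + v = v + u" by (simp add: L add.commute)
 show "0 + u = u" by (simp add: L zero_phase_L2_def)
 show "- u + u = 0" unfolding um zero_phase_L2_def f(2) L2_of_scale[OF f(1)] L2_of_ops(1)[OF L2_funs_scale[OF f(1)] f(1)] by simp
 show "u - v = u + - v" by (rule mi)
 show "r *\<^sub>R (u + v) = r *\<^sub>R u + r *\<^sub>R v" by (simp add: L distrib_left)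
 show "(r + q) *\<^sub>R u = r *\<^sub>R u + q *\<^sub>R u" by (simp add: L distrib_right)
 show "r *\<^sub>R q *\<^sub>R u = (r * q) *\<^sub>R u" by (simp add: L mult.assoc)
 show "1 *\<^sub>R u = u" by (simp add: L)
 show "inner u v = inner v u" by (simp add: inner_phase_L2_def mult.commute)
 have i: "integrable flat_measure (\<lambda>x. f x * h x)" "integrable flat_measure (\<lambda>x. g x * h x)"
  by (rule L2_funs_mult_integrable; fact)+
 show "inner (u + v) w = inner u w + inner v w" using i by (simp add: L distrib_right)
 show "inner (r *\<^sub>R u) v = r * inner u v" by (simp add: L mult.assoc)
 show "0 \<le> inner u u" by (simp add: inner_phase_L2_def)
 show "inner u u = 0 \<longleftrightarrow> u = 0"
 proof -
  have "inner u u = (\<ointegral>x. (f x)\<^sup>2)" by (simp add: L power2_eq_square)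
  also have "\<dots> = 0 \<longleftrightarrow> (AE x in flat_measure. (f x)\<^sup>2 = 0)"
   by (rule integral_nonneg_eq_0_iff_AE) (use L2_funsD(2)[OF f(1)] in auto)
  also have "\<dots> \<longleftrightarrow> u = 0" unfolding zero_phase_L2_def f(2) by (subst L2_of_eq_iff) (auto simp: L)
  finally show ?thesis .
 qed
 show "norm u = sqrt (inner u u)" by (rule norm_phase_L2_def)
qed (simp_all add: dist_phase_L2_def sgn_phase_L2_def uniformity_phase_L2_def open_phase_L2_def)
end

lemma inner_fn: "inner u v = (\<ointegral>x. fn u x * fn v x)"
 by (rule inner_phase_L2_def)

lemma inner_L2_of:
 "f \<in> L2_funs flat_measure ==> inner u (L2_of f) = (\<ointegral>x. fn u x * f x)"
 using L2_of_ops(2)[of "fn u" f] by simp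

lemma norm_L2_of_diff:
 assumes "f \<in> L2_funs flat_measure" "g \<in> L2_funs flat_measure"
 shows "(norm (L2_of f - L2_of g))\<^sup>2 = (\<ointegral>x. (f x - g x)\<^sup>2)"
proof -
 have "L2_of f - L2_of g = L2_of f + scaleR (-1) (L2_of g)" by simp
 also have "\<dots> = L2_of (\<lambda>x. f x - g x)"
  unfolding L2_of_scale[OF assms(2)] L2_of_ops(1)[OF assms(1) L2_funs_scale[OF assms(2)]] by simp
 finally show ?thesis
  unfolding power2_norm_eq_inner
  using L2_of_ops(2)[OF L2_funs_diff[OF assms] L2_funs_diff[OF assms]] by (simp add: power2_eq_square)
qed

instance phase_L2 :: (euclidean_space) banach
proof
 fix X :: "nat => 'a phase_L2" assume X: "Cauchy X"
 have "\<exists>N. \<forall>i\<ge>N. \<forall>j\<ge>N. (\<ointegral>x. (fn (X i) x - fn (X j) x)\<^sup>2) < e" if e: "0 < e" for e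
 proof -
  obtain N where N: "\<And>i j. i \<ge> N ==> j \<ge> N ==> norm (X i - X j) < sqrt e"
   using CauchyD[OF X, of "sqrt e"] e by auto
  have "(\<ointegral>x. (fn (X i) x - fn (X j) x)\<^sup>2) < e" if "i \<ge> N" "j \<ge> N" for i j
  proof -
   have "(norm (X i - X j))\<^sup>2 < (sqrt e)\<^sup>2" using N[OF that] by (intro power_strict_mono) auto
   then show ?thesis using norm_L2_of_diff[OF fn_L2[of "X i"] fn_L2[of "X j"]] e by simp
  qed
  then show ?thesis by blast
 qed
 from L2_complete[of flat_measure "\<lambda>n. fn (X n)", OF sigma_finite_flat fn_L2 this]
 obtain f where f: "f \<in> L2_funs flat_measure"
  "\<And>e. 0 < e ==> \<exists>N. \<forall>n\<ge>N. (\<ointegral>x. (fn (X n) x - f x)\<^sup>2) \<le> e"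
  by metis
 have "X \<longlonglongrightarrow> L2_of f"
 proof (rule LIMSEQ_I)
  fix r :: real assume r: "0 < r"
  obtain N where N: "\<And>n. n \<ge> N ==> (\<ointegral>x. (fn (X n) x - f x)\<^sup>2) \<le> (r/2)\<^sup>2"
   using f(2)[of "(r/2)\<^sup>2"] r by auto
  have "norm (X n - L2_of f) < r" if "n \<ge> N" for n
  proof -
   have "(norm (X n - L2_of f))\<^sup>2 \<le> (r/2)\<^sup>2"
    using norm_L2_of_diff[OF fn_L2[of "X n"] f(1)] N[OF that] by simp
   then have "norm (X n - L2_of f) \<le> r/2" by (rule power2_le_imp_le) (use r in auto)
   then show ?thesis using r by simp
  qed
  then show "\<exists>no. \<forall>n\<ge>no. norm (X n - L2_of f) < r" by blast
 qed
 then show "convergent X" by (rule convergentI)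
qed

lemma phase_L2_nontrivial: "\<exists>u :: 'a::euclidean_space phase_L2. u \<noteq> 0"
proof -
 let ?B = "cball (0::'a) 1 \<times> (unit_sphere :: 'a set)"
 let ?f = "indicator ?B :: 'a phase => real"
 have m: "?B \<in> sets flat_measure" unfolding flat_measure_def
  by (rule pair_measureI) (auto simp: sets_sphere_measure sets_restrict_space)
 have em: "emeasure flat_measure ?B = emeasure lborel (cball (0::'a) 1)"
  unfolding flat_measure_def
  by (subst sphere.emeasure_pair_measure_Times) (auto simp: sets_sphere_measure sets_restrict_space emeasure_sphere_measure)
 have fin: "emeasure flat_measure ?B < \<infinity>" unfolding em by (rule emeasure_lborel_cball_finite)
 have sp: "?B \<inter> state_space = ?B" by (auto simp: state_space_def)
 have f: "?f \<in> L2_funs flat_measure"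
  using m fin by (auto simp: L2_funs_def power2_eq_square indicator_inter_arith[symmetric] integrable_indicator_iff sp less_top)
 have "inner (L2_of ?f) (L2_of ?f) = measure flat_measure ?B"
  using m by (simp add: L2_of_ops[OF f f] indicator_inter_arith[symmetric] sp)
 also have "\<dots> = measure lborel (cball (0::'a) 1)" by (simp add: measure_def em)
 also have "\<dots> > 0" by (rule content_cball_pos) simp
 finally show ?thesis by (metis inner_zero_left less_irrefl)
qed

instance phase_L2 :: (euclidean_space) perfect_space
proof
 fix x :: "'a phase_L2"
 obtain u :: "'a phase_L2" where u: "u \<noteq> 0" using phase_L2_nontrivial by blast
 show "\<not> open {x}"
 proof
  assume "open {x}"
  then obtain e where e: "e > 0" "\<And>y. dist y x < e ==> y = x" unfolding open_dist by auto
  let ?y = "x + (e / (2 * norm u)) *\<^sub>R u"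
  have "dist ?y x < e" using u e(1) by (simp add: dist_norm)
  then have "?y = x" by (rule e)
  then show False using u e(1) by simp
 qed
qed

section \<open>Operators on a concrete \<open>L\<^sup>2\<close> space and on a Hilbert space type\<close>

text \<open>The theory above needs a type of vectors, while an \<open>L\<^sup>2\<close> space over a measure that depends on \<open>V\<close> is
 only a set of classes.  Isometries translate between the two.\<close>

locale L2_isometry =
 fixes M :: "'m measure" and J :: "'h::{real_inner, banach, perfect_space} => ('m => real) set"
 assumes bij: "bij_betw J UNIV (L2_space M)"
  and J_add: "J (u + v) = L2_add M (J u) (J v)"
  and J_scale: "J (c *\<^sub>R u) = L2_scale M c (J u)"
  and J_inner: "L2_inner M (J u) (J v) = u \<bullet> v"
begin

lemma J_in [simp]: "J u \<in> L2_space M" using bij by (auto simp: bij_betw_def)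

lemma J_eq_iff [simp]: "J u = J v \<longleftrightarrow> u = v" using bij by (auto simp: bij_betw_def inj_on_def)

lemma J_surj: assumes "a \<in> L2_space M" obtains u where "a = J u"
 using assms bij by (auto simp: bij_betw_def)

definition K :: "('m => real) set => 'h" where "K = inv_into UNIV J"

lemma K_J [simp]: "K (J u) = u"
 unfolding K_def using bij by (simp add: bij_betw_def)

lemma J_diff: "J (u - v) = L2_diff M (J u) (J v)"
proof -
 have "J (u - v) = J (u + (-1) *\<^sub>R v)" by simp
 then show ?thesis by (simp only: L2_diff_def J_add J_scale)
qed

lemma J_norm: "L2_norm M (J u) = norm u"
 by (simp add: L2_norm_def J_inner norm_eq_sqrt_inner)

lemma J_tendsto: "L2_tendsto M (\<lambda>t. J (u t)) (J l) F \<longleftrightarrow> (u \<longlongrightarrow> l) F"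
 unfolding L2_tendsto_def J_diff[symmetric] J_norm using tendsto_norm_zero_iff LIM_zero_iff by metis

abbreviation JJ :: "('h \<times> 'h) set => 'm L2_graph" where "JJ A \<equiv> map_prod J J ` A"

lemma JJ_iff [simp]: "(J u, J v) \<in> JJ A \<longleftrightarrow> (u, v) \<in> A" by (auto simp: map_prod_def)

lemma JJ_cases: assumes "(a, b) \<in> JJ A" obtains u v where "a = J u" "b = J v" "(u, v) \<in> A"
 using assms by (auto simp: map_prod_def)

lemma op_closure_JJ: "op_closure M (JJ A) = JJ (closure A)"
proof (intro equalityI subsetI)
 fix p assume "p \<in> op_closure M (JJ A)"
 then obtain a b w z where p: "p = (a, b)" "a \<in> L2_space M" "b \<in> L2_space M"
  and wz: "\<And>n::nat. (w n, z n) \<in> JJ A" and lim: "L2_tendsto M w a sequentially" "L2_tendsto M z b sequentially"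
  by (auto simp: op_closure_def)
 obtain u v where uv: "a = J u" "b = J v" using p J_surj by metis
 have "\<exists>x y. w n = J x \<and> z n = J y \<and> (x, y) \<in> A" for n using wz[of n] by (auto elim: JJ_cases)
 then obtain x y where xy: "\<And>n. w n = J (x n)" "\<And>n. z n = J (y n)" "\<And>n. (x n, y n) \<in> A" by metis
 have "x \<longlonglongrightarrow> u" "y \<longlonglongrightarrow> v"
  using lim unfolding uv xy(1)[abs_def] xy(2)[abs_def] by (simp_all add: xy uv ext[of w, OF xy(1)] ext[of z, OF xy(2)] J_tendsto)
 then have "(\<lambda>n. (x n, y n)) \<longlonglongrightarrow> (u, v)" by (rule tendsto_Pair)
 then have "(u, v) \<in> closure A" using xy(3) unfolding closure_sequential
  by (intro exI[of _ "\<lambda>n. (x n, y n)"]) simp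
 then show "p \<in> JJ (closure A)" using p uv by simp
next
 fix p assume "p \<in> JJ (closure A)"
 then obtain u v where p: "p = (J u, J v)" "(u, v) \<in> closure A" by (auto simp: map_prod_def)
 then obtain a where a: "\<And>n. a n \<in> A" "a \<longlonglongrightarrow> (u, v)" unfolding closure_sequential by auto
 have "(J (fst (a n)), J (snd (a n))) \<in> JJ A" for n using a(1)[of n] by simp
 moreover have "L2_tendsto M (\<lambda>n. J (fst (a n))) (J u) sequentially"
  "L2_tendsto M (\<lambda>n. J (snd (a n))) (J v) sequentially"
  unfolding J_tendsto using tendsto_fst[OF a(2)] tendsto_snd[OF a(2)] by simp_all
 ultimately show "p \<in> op_closure M (JJ A)" unfolding op_closure_def p(1) mem_Collect_eq prod.case
  by (intro conjI J_in exI[of _ "\<lambda>n. J (fst (a n))"] exI[of _ "\<lambda>n. J (snd (a n))"] allI)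
qed

lemma linear_operator_JJ:
 assumes "subspace A" "single_valued A" shows "linear_operator M (JJ A)"
 unfolding linear_operator_def
proof (intro conjI)
 show "JJ A \<subseteq> L2_space M \<times> L2_space M" by auto
 show "JJ A \<noteq> {}" using subspace_0[OF assms(1)] by auto
 show "single_valued (JJ A)"
 proof (rule single_valuedI)
  fix a b c assume "(a, b) \<in> JJ A" "(a, c) \<in> JJ A"
  then show "b = c" using single_valuedD[OF assms(2)] by (metis JJ_cases J_eq_iff)
 qed
 have "(u + u', v + v') \<in> A" if "(u, v) \<in> A" "(u', v') \<in> A" for u v u' v'
  using subspace_add[OF assms(1) that] by simp
 then show "\<forall>(u, v)\<in>JJ A. \<forall>(u', v')\<in>JJ A. (L2_add M u u', L2_add M v v') \<in> JJ A"
  by (auto simp flip: J_add)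
 have "(c *\<^sub>R u, c *\<^sub>R v) \<in> A" if "(u, v) \<in> A" for c u v
  using subspace_scale[OF assms(1) that, of c] by simp
 then show "\<forall>c. \<forall>(u, v)\<in>JJ A. (L2_scale M c u, L2_scale M c v) \<in> JJ A"
  by (auto simp flip: J_scale)
qed

lemma dissipative_JJ: "(\<And>u v. (u, v) \<in> A ==> v \<bullet> u \<le> 0) ==> dissipative M (JJ A)"
 by (auto simp: dissipative_def J_inner)

text \<open>The Lumer-Phillips theorem, for the image of a relation under an isometry.\<close>

theorem generation:
 assumes sub: "subspace A" and dis: "\<And>u v. (u, v) \<in> A ==> v \<bullet> u \<le> 0"
  and dense: "closure (fst ` A) = UNIV"
  and range: "closure ((\<lambda>(u, v). u - v) ` A) = UNIV"
 shows "essentially_m_dissipative M (JJ A) \<and>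
  (\<exists>T. C0_contraction_semigroup M T \<and> infinitesimal_generator M T = op_closure M (JJ A))"
proof
 interpret G: maximal_dissipative "closure A" by (rule maximal_dissipative_closure[OF assms])
 have sv: "single_valued A" using G.single_valued closure_subset[of A] by (meson single_valued_subset)
 show "essentially_m_dissipative M (JJ A)"
  unfolding essentially_m_dissipative_def m_dissipative_def op_closure_JJ
 proof (intro conjI)
  show "linear_operator M (JJ A)" by (rule linear_operator_JJ[OF sub sv])
  show "dissipative M (JJ A)" using dis by (rule dissipative_JJ)
  show "linear_operator M (JJ (closure A))" by (rule linear_operator_JJ[OF G.subspace G.single_valued])
  show "dissipative M (JJ (closure A))" using G.dissip by (rule dissipative_JJ)
  show "densely_defined M (JJ A)" unfolding densely_defined_def
  proof
   fix a assume "a \<in> L2_space M"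
   then obtain u where u: "a = J u" by (rule J_surj)
   have "u \<in> closure (fst ` A)" using dense by simp
   then obtain x where x: "\<And>n. x n \<in> fst ` A" "x \<longlonglongrightarrow> u" unfolding closure_sequential by auto
   have "J (x n) \<in> Domain (JJ A)" for n using x(1)[of n] by force
   then show "\<exists>w. (\<forall>n::nat. w n \<in> Domain (JJ A)) \<and> L2_tendsto M w a sequentially"
    using x(2) unfolding u by (auto intro!: exI[of _ "\<lambda>n. J (x n)"] simp: J_tendsto)
  qed
  show "{L2_diff M u v |u v. (u, v) \<in> JJ (closure A)} = L2_space M"
  proof (intro equalityI subsetI)
   fix a assume "a \<in> {L2_diff M u v |u v. (u, v) \<in> JJ (closure A)}"
   then show "a \<in> L2_space M" by (auto simp flip: J_diff)
  next
   fix a assume "a \<in> L2_space M"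
   then obtain f where f: "a = J f" by (rule J_surj)
   obtain u v where uv: "(u, v) \<in> closure A" "u - v = f" using G.surj by blast
   then have "a = L2_diff M (J u) (J v)" by (simp add: f flip: J_diff)
   then show "a \<in> {L2_diff M u v |u v. (u, v) \<in> JJ (closure A)}" using uv(1) JJ_iff by blast
  qed
 qed
 define T where "T t a = J (G.T t (K a))" for t a
 have TJ: "T t (J u) = J (G.T t u)" for t u by (simp add: T_def)
 have "C0_contraction_semigroup M T"
  unfolding C0_contraction_semigroup_def
 proof (intro conjI allI impI ballI)
  fix a assume "a \<in> L2_space M"
  then obtain u where u: "a = J u" by (rule J_surj)
  show "T 0 a = a" by (simp add: u TJ G.T_0)
  show "L2_tendsto M (\<lambda>t. T t a) a (at_right 0)" by (simp add: u TJ J_tendsto G.T_continuous)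
  fix t :: real assume t: "0 \<le> t"
  show "T t a \<in> L2_space M" by (simp add: u TJ)
  show "L2_norm M (T t a) \<le> L2_norm M a" by (simp add: u TJ J_norm G.T_norm t)
  show "T t (L2_scale M c a) = L2_scale M c (T t a)" for c
   by (simp add: u TJ linear_scale[OF G.T_linear[OF t]] flip: J_scale)
  show "T t (L2_add M a b) = L2_add M (T t a) (T t b)" if b: "b \<in> L2_space M" for b
  proof -
   obtain v where "b = J v" using b by (rule J_surj)
   then show ?thesis by (simp add: u TJ linear_add[OF G.T_linear[OF t]] flip: J_add)
  qed
  show "T (s + t) a = T s (T t a)" if "0 \<le> s" for s by (simp add: u TJ G.T_add that t)
 qed
 moreover have "infinitesimal_generator M T = op_closure M (JJ A)"
 proof -
  have iff: "L2_tendsto M (\<lambda>t. L2_scale M (1 / t) (L2_diff M (T t (J u)) (J u))) (J v) (at_right 0)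
    \<longleftrightarrow> (u, v) \<in> closure A" for u v
   by (simp only: TJ J_diff[symmetric] J_scale[symmetric] J_tendsto G.generator_eq)
  show ?thesis unfolding op_closure_JJ
  proof (intro equalityI subsetI)
   fix p assume "p \<in> infinitesimal_generator M T"
   then obtain a b where p: "p = (a, b)" "a \<in> L2_space M" "b \<in> L2_space M"
    "L2_tendsto M (\<lambda>t. L2_scale M (1 / t) (L2_diff M (T t a) a)) b (at_right 0)"
    by (auto simp: infinitesimal_generator_def)
   obtain u v where "a = J u" "b = J v" using p J_surj by metis
   then show "p \<in> JJ (closure A)" using p iff by simp
  next
   fix p assume "p \<in> JJ (closure A)"
   then obtain u v where "p = (J u, J v)" "(u, v) \<in> closure A" by (auto simp: map_prod_def)
   then show "p \<in> infinitesimal_generator M T" using iff by (simp add: infinitesimal_generator_def)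
  qed
 qed
 ultimately show "\<exists>T. C0_contraction_semigroup M T \<and> infinitesimal_generator M T = op_closure M (JJ A)" by blast
qed

end


section \<open>Calculus of \<open>C\<^sup>k\<close> functions\<close>

lemma has_derivative_cong_open:
 assumes "open S" "x \<in> S" "\<And>y. y \<in> S ==> f y = g y"
 shows "(f has_derivative D) (at x) \<longleftrightarrow> (g has_derivative D) (at x)"
 using has_derivative_transform_within_open[OF _ assms(1,2), of f D UNIV g]
  has_derivative_transform_within_open[OF _ assms(1,2), of g D UNIV f] assms(3) by auto

lemma frechet_derivative_cong_open:
 assumes "open S" "x \<in> S" "\<And>y. y \<in> S ==> f y = g y"
 shows "frechet_derivative f (at x) = frechet_derivative g (at x)"
 unfolding frechet_derivative_def by (simp only: has_derivative_cong_open[OF assms])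

lemma Ck_on_cong:
 assumes "open S"
 shows "(\<And>x. x \<in> S ==> f x = g x) ==> Ck_on k f S ==> Ck_on k g S"
proof (induction k arbitrary: f g)
 case 0
 then show ?case using continuous_on_cong[of S S f g] by simp
next
 case (Suc k)
 have fd: "frechet_derivative f (at x) = frechet_derivative g (at x)" if "x \<in> S" for x
  by (rule frechet_derivative_cong_open[OF assms that Suc.prems(1)])
 have "g differentiable (at x)" if x: "x \<in> S" for x
 proof -
  obtain D where "(f has_derivative D) (at x)" using Suc.prems(2) x by (auto simp: differentiable_def)
  then have "(g has_derivative D) (at x)"
   using has_derivative_cong_open[of S x f g D, OF assms x Suc.prems(1)] by simp
  then show ?thesis by (auto simp: differentiable_def)
 qed
 moreover have "Ck_on k (\<lambda>x. frechet_derivative g (at x) v) S" for v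
  by (rule Suc.IH[of "\<lambda>x. frechet_derivative f (at x) v"]) (use fd Suc.prems(2) in auto)
 ultimately show ?case by simp
qed

lemma Ck_on_SucI:
 assumes "open S" "\<And>x. x \<in> S ==> (f has_derivative D x) (at x)" "\<And>v. Ck_on k (\<lambda>x. D x v) S"
 shows "Ck_on (Suc k) f S"
proof -
 have "D x v = frechet_derivative f (at x) v" if "x \<in> S" for x v
  using frechet_derivative_at[OF assms(2)[OF that]] by simp
 then have "Ck_on k (\<lambda>x. frechet_derivative f (at x) v) S" for v
  by (intro Ck_on_cong[OF assms(1) _ assms(3)[of v]]) auto
 then show ?thesis using assms(2) by (auto simp: differentiable_def)
qed

lemma Ck_on_SucD:
 assumes "Ck_on (Suc k) f S" "x \<in> S"
 shows "(f has_derivative frechet_derivative f (at x)) (at x)" "f differentiable (at x)"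
 using assms by (auto simp: frechet_derivative_works)

lemma Ck_on_deriv: "Ck_on (Suc k) f S ==> Ck_on k (\<lambda>x. frechet_derivative f (at x) v) S"
 by simp

lemma Ck_on_Suc_imp: "Ck_on (Suc k) f S ==> Ck_on k f S"
proof (induction k arbitrary: f)
 case 0
 then show ?case
  by (auto intro!: continuous_at_imp_continuous_on differentiable_imp_continuous_within)
next
 case (Suc k)
 have "Ck_on k (\<lambda>x. frechet_derivative f (at x) v) S" for v
  by (rule Suc.IH) (rule Ck_on_deriv[OF Suc.prems])
 moreover have "\<forall>x\<in>S. f differentiable (at x)" using Suc.prems by simp
 ultimately show ?case unfolding Ck_on.simps(2)[of k] by blast
qed

lemma Ck_on_mono: "j \<le> k ==> Ck_on k f S ==> Ck_on j f S"
 by (induction k rule: dec_induct) (auto dest: Ck_on_Suc_imp simp del: Ck_on.simps)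

lemma Ck_on_continuous: "Ck_on k f S ==> continuous_on S f"
 using Ck_on_mono[of 0 k f S] by simp

lemma Ck_on_subset: "Ck_on k f S ==> T \<subseteq> S ==> Ck_on k f T"
 by (induction k arbitrary: f) (auto intro: continuous_on_subset)

lemma Ck_on_local:
 assumes "\<And>x. x \<in> W ==> \<exists>U. open U \<and> x \<in> U \<and> Ck_on k f U"
 shows "Ck_on k f W"
 using assms
proof (induction k arbitrary: f)
 case 0
 have "isCont f x" if "x \<in> W" for x
  using 0[OF that] continuous_on_eq_continuous_at by auto
 then show ?case by (simp add: continuous_at_imp_continuous_on)
next
 case (Suc k)
 have "f differentiable (at x)" if "x \<in> W" for x using Suc.prems[OF that] by auto
 moreover have "Ck_on k (\<lambda>x. frechet_derivative f (at x) v) W" for v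
 proof (rule Suc.IH)
  fix x assume "x \<in> W"
  then show "\<exists>U. open U \<and> x \<in> U \<and> Ck_on k (\<lambda>x. frechet_derivative f (at x) v) U"
   using Suc.prems[of x] by auto
 qed
 ultimately show ?case by simp
qed

lemma Ck_on_const: "Ck_on k (\<lambda>x. c) S"
proof (induction k arbitrary: c)
 case (Suc k)
 have "frechet_derivative (\<lambda>x. c) (at x) = (\<lambda>v. 0)" for x :: 'a
  by (rule frechet_derivative_at[symmetric]) simp
 then show ?case using Suc[of 0] by simp
qed simp

lemma Ck_on_bounded_linear:
 assumes "bounded_linear L" "open S" shows "Ck_on k L S"
proof (cases k)
 case 0 then show ?thesis using assms by (simp add: linear_continuous_on)
next
 case (Suc j)
 have "Ck_on (Suc j) L S"
  by (rule Ck_on_SucI[OF assms(2), where D="\<lambda>x. L"]) (auto intro: bounded_linear_imp_has_derivative assms Ck_on_const)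
 then show ?thesis using Suc by simp
qed

lemma Ck_on_add:
 assumes "open S" shows "Ck_on k f S ==> Ck_on k g S ==> Ck_on k (\<lambda>x. f x + g x) S"
proof (induction k arbitrary: f g)
 case 0 then show ?case by (simp add: continuous_on_add)
next
 case (Suc k)
 show ?case
 proof (rule Ck_on_SucI[OF assms])
  fix x assume "x \<in> S"
  then show "((\<lambda>x. f x + g x) has_derivative
    (\<lambda>v. frechet_derivative f (at x) v + frechet_derivative g (at x) v)) (at x)"
   by (intro has_derivative_add Ck_on_SucD[OF Suc.prems(1)] Ck_on_SucD[OF Suc.prems(2)])
 next
  fix v show "Ck_on k (\<lambda>x. frechet_derivative f (at x) v + frechet_derivative g (at x) v) S"
   by (rule Suc.IH) (rule Ck_on_deriv[OF Suc.prems(1)] Ck_on_deriv[OF Suc.prems(2)])+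
 qed
qed

lemma Ck_on_bilinear:
 assumes "open S" "bounded_bilinear p"
 shows "Ck_on k f S ==> Ck_on k g S ==> Ck_on k (\<lambda>x. p (f x) (g x)) S"
proof (induction k arbitrary: f g)
 case 0 then show ?case using bounded_bilinear.continuous_on[OF assms(2)] by auto
next
 case (Suc k)
 show ?case
 proof (rule Ck_on_SucI[OF assms(1)])
  fix x assume "x \<in> S"
  then show "((\<lambda>x. p (f x) (g x)) has_derivative
    (\<lambda>v. p (f x) (frechet_derivative g (at x) v) + p (frechet_derivative f (at x) v) (g x))) (at x)"
   by (intro bounded_bilinear.FDERIV[OF assms(2)] Ck_on_SucD[OF Suc.prems(1)] Ck_on_SucD[OF Suc.prems(2)])
 next
  fix v show "Ck_on k (\<lambda>x. p (f x) (frechet_derivative g (at x) v) + p (frechet_derivative f (at x) v) (g x)) S"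
   by (intro Ck_on_add[OF assms(1)] Suc.IH Ck_on_deriv[OF Suc.prems(1)] Ck_on_deriv[OF Suc.prems(2)]
     Ck_on_Suc_imp[OF Suc.prems(1)] Ck_on_Suc_imp[OF Suc.prems(2)])
 qed
qed

lemma Ck_on_sum:
 assumes "open S" "\<And>i. i \<in> I ==> Ck_on k (f i) S"
 shows "Ck_on k (\<lambda>x. \<Sum>i\<in>I. f i x) S"
proof (cases "finite I")
 case True
 then show ?thesis using assms(2)
  by (induction I rule: finite_induct) (auto intro: Ck_on_const Ck_on_add[OF assms(1)] simp del: Ck_on.simps)
qed (simp add: Ck_on_const del: Ck_on.simps)

lemma linear_euclidean_expand:
 fixes L :: "'b::euclidean_space => 'c::real_vector"
 assumes "linear L" shows "L v = (\<Sum>b\<in>Basis. (v \<bullet> b) *\<^sub>R L b)"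
proof -
 have "L v = L (\<Sum>b\<in>Basis. (v \<bullet> b) *\<^sub>R b)" by (simp add: euclidean_representation)
 also have "\<dots> = (\<Sum>b\<in>Basis. (v \<bullet> b) *\<^sub>R L b)" by (simp add: linear_sum[OF assms] linear_scale[OF assms])
 finally show ?thesis .
qed

text \<open>Written as a sum over a basis, the chain rule produces products to which the induction
 hypothesis applies.\<close>

lemma Ck_on_compose:
 fixes h :: "'a::real_normed_vector => 'b::euclidean_space" and G :: "'b => 'c::real_normed_vector"
 assumes W: "open W" and U: "open U" and hU: "\<And>x. x \<in> W ==> h x \<in> U"
 shows "Ck_on k h W ==> Ck_on k G U ==> Ck_on k (\<lambda>x. G (h x)) W"
proof (induction k arbitrary: G)
 case 0
 then show ?case using continuous_on_compose2[of U G W h] hU by auto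
next
 case (Suc k)
 let ?D = "\<lambda>x v. \<Sum>b\<in>Basis. (frechet_derivative h (at x) v \<bullet> b) *\<^sub>R frechet_derivative G (at (h x)) b"
 show ?case
 proof (rule Ck_on_SucI[OF W])
  fix x assume x: "x \<in> W"
  have G: "(G has_derivative frechet_derivative G (at (h x))) (at (h x))"
   by (rule Ck_on_SucD[OF Suc.prems(2) hU[OF x]])
  have "((\<lambda>x. G (h x)) has_derivative (\<lambda>v. frechet_derivative G (at (h x)) (frechet_derivative h (at x) v))) (at x)"
   using diff_chain_at[OF Ck_on_SucD(1)[OF Suc.prems(1) x] G] by (simp add: o_def)
  moreover have "frechet_derivative G (at (h x)) (frechet_derivative h (at x) v) = ?D x v" for v
   by (rule linear_euclidean_expand) (use G has_derivative_linear in blast)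
  ultimately show "((\<lambda>x. G (h x)) has_derivative ?D x) (at x)" by simp
 next
  fix v
  have "Ck_on k (\<lambda>x. frechet_derivative h (at x) v \<bullet> b) W" for b
   by (rule Ck_on_bilinear[OF W bounded_bilinear_inner Ck_on_deriv[OF Suc.prems(1)] Ck_on_const])
  moreover have "Ck_on k (\<lambda>x. frechet_derivative G (at (h x)) b) W" for b
   by (rule Suc.IH[OF Ck_on_Suc_imp[OF Suc.prems(1)] Ck_on_deriv[OF Suc.prems(2)]])
  ultimately show "Ck_on k (\<lambda>x. ?D x v) W"
   by (intro Ck_on_sum[OF W] Ck_on_bilinear[OF W bounded_bilinear_scaleR])
 qed
qed

lemma Ck_on_mult:
 fixes f g :: "'a::real_normed_vector => real"
 shows "open S ==> Ck_on k f S ==> Ck_on k g S ==> Ck_on k (\<lambda>x. f x * g x) S"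
 by (rule Ck_on_bilinear[OF _ bounded_bilinear_mult])

lemma Ck_on_power:
 fixes f :: "'a::real_normed_vector => real"
 assumes "open S" "Ck_on k f S" shows "Ck_on k (\<lambda>x. f x ^ n) S"
 by (induction n) (auto intro: Ck_on_const Ck_on_mult assms simp del: Ck_on.simps)

lemma Ck_on_linear_intro:
 fixes L :: "'a::euclidean_space => 'b::real_normed_vector"
 assumes "linear L" "open S" shows "Ck_on k L S"
 using assms by (intro Ck_on_bounded_linear) (simp_all add: linear_conv_bounded_linear)

lemma Ck_on_real_SucI:
 fixes f f' :: "real => real"
 assumes "open S" "\<And>x. x \<in> S ==> (f has_field_derivative f' x) (at x)" "Ck_on k f' S"
 shows "Ck_on (Suc k) f S"
proof (rule Ck_on_SucI[OF assms(1)])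
 show "(f has_derivative (\<lambda>v. f' x * v)) (at x)" if "x \<in> S" for x
  using assms(2)[OF that] by (simp add: has_field_derivative_def)
 show "Ck_on k (\<lambda>x. f' x * v) S" for v by (intro Ck_on_mult assms Ck_on_const)
qed

lemma Ck_on_exp: "Ck_on k (exp :: real => real) UNIV"
proof (induction k)
 case 0 show ?case by (simp add: continuous_on_exp)
next
 case (Suc k) then show ?case by (intro Ck_on_real_SucI) auto
qed

lemma Ck_on_powr: "Ck_on k (\<lambda>x::real. x powr a) {0<..}"
proof (induction k arbitrary: a)
 case 0 show ?case by (auto intro!: continuous_intros)
next
 case (Suc k)
 show ?case
 proof (rule Ck_on_real_SucI)
  show "((\<lambda>x. x powr a) has_field_derivative a * x powr (a - 1)) (at x)" if "x \<in> {0<..}" for x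
   using that by (auto intro!: derivative_eq_intros)
  show "Ck_on k (\<lambda>x. a * x powr (a - 1)) {0<..}" by (intro Ck_on_mult Ck_on_const Suc) simp
 qed simp
qed

lemma sgn_eq_powr: "y \<noteq> 0 ==> sgn y = ((y \<bullet> y) powr (-1/2)) *\<^sub>R (y :: 'a::real_inner)"
 by (simp add: sgn_div_norm norm_eq_sqrt_inner powr_minus powr_half_sqrt)

lemma Ck_on_inner_self: "open S ==> Ck_on k (\<lambda>y::'a::euclidean_space. y \<bullet> y) S"
 by (intro Ck_on_bilinear[OF _ bounded_bilinear_inner] Ck_on_linear_intro) (auto simp: linear_iff)

lemma Ck_on_sgn: "Ck_on k (sgn :: 'a::euclidean_space => 'a) (- {0})"
proof -
 have o: "open (- {0::'a})" by auto
 have "Ck_on k (\<lambda>y::'a. (y \<bullet> y) powr (-1/2)) (- {0})"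
  by (rule Ck_on_compose[OF o _ _ Ck_on_inner_self[OF o] Ck_on_powr]) auto
 then have "Ck_on k (\<lambda>y::'a. ((y \<bullet> y) powr (-1/2)) *\<^sub>R y) (- {0})"
  by (rule Ck_on_bilinear[OF o bounded_bilinear_scaleR _ Ck_on_linear_intro[OF _ o]]) (auto simp: linear_iff)
 then show ?thesis by (rule Ck_on_cong[OF o, rotated]) (simp add: sgn_eq_powr)
qed

section \<open>A smooth bump function\<close>

text \<open>The functions \<open>t\<^sup>-\<^sup>p e\<^sup>-\<^sup>1\<^sup>/\<^sup>t\<close>, extended by zero, form a family closed under
 differentiation.\<close>

definition flat_exp :: "nat => real => real" where
 "flat_exp p t = (if 0 < t then exp (- (1 / t)) / t ^ p else 0)"

lemma power_le_fact_exp: "0 \<le> x ==> x ^ n \<le> fact n * exp (x::real)"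
proof (induction n arbitrary: x)
 case 0 then show ?case by simp
next
 case (Suc n)
 let ?h = "\<lambda>y::real. fact (Suc n) * exp y - y ^ Suc n"
 have "?h 0 \<le> ?h x"
 proof (rule DERIV_nonneg_imp_nondecreasing[OF Suc.prems])
  fix y :: real assume y: "0 \<le> y" "y \<le> x"
  have d: "(?h has_real_derivative (fact (Suc n) * exp y - real (Suc n) * y ^ n)) (at y)"
   using DERIV_diff[OF DERIV_cmult[OF DERIV_exp[of y], of "fact (Suc n)"] DERIV_pow[of "Suc n" y]] by simp
  have "real (Suc n) * y ^ n \<le> real (Suc n) * (fact n * exp y)"
   by (rule mult_left_mono[OF Suc.IH[OF y(1)]]) simp
  then have "0 \<le> fact (Suc n) * exp y - real (Suc n) * y ^ n" by (simp add: algebra_simps)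
  with d show "\<exists>z. (?h has_real_derivative z) (at y) \<and> 0 \<le> z" by blast
 qed
 moreover have "0 \<le> ?h 0" by simp
 ultimately show ?case by linarith
qed

lemma flat_exp_le: "\<bar>flat_exp p t\<bar> \<le> fact (p + 2) * t\<^sup>2"
proof (cases "0 < t")
 case True
 have "(1 / t) ^ (p + 2) \<le> fact (p + 2) * exp (1 / t)" using True by (intro power_le_fact_exp) simp
 then have "exp (- (1 / t)) * (1 / t) ^ (p + 2) \<le> exp (- (1 / t)) * (fact (p + 2) * exp (1 / t))"
  by (rule mult_left_mono) simp
 also have "\<dots> = fact (p + 2)" by (simp add: exp_minus del: fact_Suc)
 finally have "exp (- (1 / t)) * ((1 / t) ^ (p + 2)) \<le> fact (p + 2)" .
 then have "exp (- (1 / t)) * ((1 / t) ^ (p + 2)) * t\<^sup>2 \<le> fact (p + 2) * t\<^sup>2" by (rule mult_right_mono) simp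
 moreover have "exp (- (1 / t)) * ((1 / t) ^ (p + 2)) * t\<^sup>2 = flat_exp p t"
 proof -
  have "(1 / t) ^ (p + 2) * t\<^sup>2 = (1 / t) ^ p * ((1 / t * t)\<^sup>2)"
   by (simp only: power_add power_mult_distrib mult.assoc)
  then show ?thesis unfolding mult.assoc using True by (simp add: flat_exp_def power_divide del: power_add_numeral power_Suc)
 qed
 moreover have "0 \<le> flat_exp p t" using True by (simp add: flat_exp_def)
 ultimately show ?thesis by simp
qed (simp add: flat_exp_def)

lemma flat_exp_deriv:
 "(flat_exp p has_field_derivative flat_exp (p + 2) t - real p * flat_exp (p + 1) t) (at t)"
proof -
 consider "0 < t" | "t < 0" | "t = 0" by linarith
 then show ?thesis
 proof cases
  case 1
  have "((\<lambda>t. exp (- (1 / t)) / t ^ p) has_field_derivative flat_exp (p + 2) t - real p * flat_exp (p + 1) t) (at t)"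
  proof -
   have d1: "((\<lambda>t. 1 / t) has_field_derivative - (1 / t\<^sup>2)) (at t)"
    using 1 by (auto intro!: derivative_eq_intros simp: power2_eq_square)
   have d2: "((\<lambda>t. exp (- (1 / t))) has_field_derivative exp (- (1 / t)) * (1 / t\<^sup>2)) (at t)"
    using DERIV_chain2[OF DERIV_exp DERIV_minus[OF d1]] by simp
   have d3: "((\<lambda>t. (1 / t) ^ p) has_field_derivative real p * (1 / t) ^ (p - Suc 0) * - (1 / t\<^sup>2)) (at t)"
    by (rule DERIV_chain2[OF DERIV_pow d1])
   have "exp (- (1 / t)) * (1 / t\<^sup>2) * (1 / t) ^ p + real p * (1 / t) ^ (p - Suc 0) * - (1 / t\<^sup>2) * exp (- (1 / t))
     = flat_exp (p + 2) t - real p * flat_exp (p + 1) t"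
    using 1 by (cases p) (simp_all add: flat_exp_def power_divide power2_eq_square power_add mult.commute)
   then show ?thesis using DERIV_mult[OF d2 d3] by (simp add: power_divide)
  qed
  then show ?thesis
   by (rule has_field_derivative_transform_within_open[of _ _ _ "{0<..}"]) (use 1 in \<open>auto simp: flat_exp_def\<close>)
 next
  case 2
  have "((\<lambda>t. 0) has_field_derivative 0) (at t)" by simp
  then have "(flat_exp p has_field_derivative 0) (at t)"
   by (rule has_field_derivative_transform_within_open[of _ _ _ "{..<0}"]) (use 2 in \<open>auto simp: flat_exp_def\<close>)
  then show ?thesis using 2 by (simp add: flat_exp_def)
 next
  case 3
  have "((\<lambda>h. (flat_exp p (0 + h) - flat_exp p 0) / h) \<longlongrightarrow> 0) (at 0)"
  proof (rule Lim_null_comparison)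
   have "norm ((flat_exp p (0 + h) - flat_exp p 0) / h) \<le> fact (p + 2) * \<bar>h\<bar>" if "h \<noteq> 0" for h
    using flat_exp_le[of p h] that by (simp add: flat_exp_def[of p 0] divide_simps power2_eq_square abs_mult_self_eq mult.assoc)
   then show "\<forall>\<^sub>F h in at 0. norm ((flat_exp p (0 + h) - flat_exp p 0) / h) \<le> fact (p + 2) * \<bar>h\<bar>"
    by (auto simp: eventually_at_filter)
   show "((\<lambda>h. fact (p + 2) * \<bar>h\<bar>) \<longlongrightarrow> (0::real)) (at 0)"
    by (rule tendsto_eq_intros | simp)+
  qed
  then show ?thesis using 3 by (simp add: DERIV_def flat_exp_def)
 qed
qed

lemma Ck_on_flat_exp: "Ck_on k (flat_exp p) UNIV"
proof (induction k arbitrary: p)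
 case 0
 show ?case
  by (simp only: Ck_on.simps) (rule continuous_at_imp_continuous_on, blast intro: DERIV_isCont[OF flat_exp_deriv])
next
 case (Suc k)
 have "Ck_on k (\<lambda>t. flat_exp (p + 2) t + (- real p) * flat_exp (p + 1) t) UNIV"
  by (intro Ck_on_add Ck_on_mult Ck_on_const Suc) auto
 then show ?case by (intro Ck_on_real_SucI[OF open_UNIV flat_exp_deriv]) simp
qed

definition bump :: "'a::euclidean_space => real" where
 "bump x = flat_exp 0 (1 - x \<bullet> x)"

lemma Ck_on_bump: "Ck_on k bump (UNIV :: 'a::euclidean_space set)"
proof -
 have "Ck_on k (\<lambda>x::'a. 1 + (-1) * (x \<bullet> x)) UNIV"
  by (intro Ck_on_add Ck_on_mult Ck_on_const Ck_on_inner_self) auto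
 from Ck_on_compose[OF open_UNIV open_UNIV _ this Ck_on_flat_exp[of k 0]]
 show ?thesis by (simp add: bump_def[abs_def])
qed

lemma bump_nonneg: "0 \<le> bump x" by (simp add: bump_def flat_exp_def)

lemma bump_le_1: "bump x \<le> 1" by (simp add: bump_def flat_exp_def)

lemma bump_eq_0: "1 \<le> norm x ==> bump x = 0"
proof -
 assume "1 \<le> norm x"
 then have "1 \<le> (norm x)\<^sup>2" by simp
 then show ?thesis by (simp add: bump_def flat_exp_def power2_norm_eq_inner)
qed

lemma bump_0_pos: "0 < bump 0" by (simp add: bump_def flat_exp_def)


section \<open>Integration by parts from measure-preserving flows\<close>

text \<open>The integral of \<open>h\<close> is constant along a measure-preserving flow, so the derivative of \<open>h\<close>
 along the flow integrates to zero.  Integrating in time as well turns this into Fubini's theorem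
 and the fundamental theorem of calculus, with no uniform control of difference quotients.\<close>

lemma integral_flow_derivative_eq_0:
 fixes h h' :: "'p => real" and \<phi> :: "real => 'p => 'p"
 assumes sf: "sigma_finite_measure M"
  and \<phi>[measurable]: "\<And>s. \<phi> s \<in> measurable M M" and inv: "\<And>s. distr M M (\<phi> s) = M"
  and \<phi>0: "\<And>p. p \<in> space M ==> \<phi> 0 p = p"
  and joint: "(\<lambda>(s, p). h' (\<phi> s p)) \<in> borel_measurable (lborel \<Otimes>\<^sub>M M)"
  and h: "integrable M h" and h': "integrable M h'"
  and deriv: "\<And>s p. p \<in> space M ==> ((\<lambda>s. h (\<phi> s p)) has_real_derivative h' (\<phi> s p)) (at s)"
  and cont: "\<And>s p. p \<in> space M ==> isCont (\<lambda>s. h' (\<phi> s p)) s"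
 shows "(\<integral>p. h' p \<partial>M) = 0"
proof -
 interpret pair_sigma_finite lborel M using sf by (intro pair_sigma_finite.intro sigma_finite_lborel)
 have int_flow: "integrable M (\<lambda>p. k (\<phi> s p))" "(\<integral>p. k (\<phi> s p) \<partial>M) = (\<integral>p. k p \<partial>M)"
  if k: "integrable M k" for k :: "'p => real" and s
 proof -
  have km: "k \<in> borel_measurable M" using k by simp
  show "integrable M (\<lambda>p. k (\<phi> s p))"
   using integrable_distr_eq[OF \<phi> km, of s] k inv[of s] by simp
  show "(\<integral>p. k (\<phi> s p) \<partial>M) = (\<integral>p. k p \<partial>M)"
   using integral_distr[OF \<phi> km, of s] inv[of s] by simp
 qed
 let ?F = "\<lambda>s p. indicator {0..1} s * h' (\<phi> s p)"
 have m: "(\<lambda>(s, p). ?F s p) \<in> borel_measurable (lborel \<Otimes>\<^sub>M M)"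
  using joint by (simp add: case_prod_beta)
 have F: "integrable (lborel \<Otimes>\<^sub>M M) (\<lambda>(s, p). ?F s p)"
 proof (rule Fubini_integrable[OF m])
  have "(\<lambda>s. \<integral>p. norm (case (s, p) of (s, p) => ?F s p) \<partial>M) = (\<lambda>s. indicator {0..1} s * (\<integral>p. \<bar>h' p\<bar> \<partial>M))"
   using int_flow(2)[of "\<lambda>p. \<bar>h' p\<bar>"] h' by (simp add: abs_mult)
  then show "integrable lborel (\<lambda>s. \<integral>p. norm (case (s, p) of (s, p) => ?F s p) \<partial>M)" by simp
  show "AE s in lborel. integrable M (\<lambda>p. case (s, p) of (s, p) => ?F s p)"
   using int_flow(1)[OF h'] by simp
 qed
 have "(\<integral>p. h' p \<partial>M) = (\<integral>s. indicator {0..1::real} s * (\<integral>p. h' p \<partial>M) \<partial>lborel)" by simp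
 also have "\<dots> = (\<integral>s. (\<integral>p. ?F s p \<partial>M) \<partial>lborel)" by (simp add: int_flow(2)[OF h'])
 also have "\<dots> = (\<integral>p. (\<integral>s. ?F s p \<partial>lborel) \<partial>M)" by (rule Fubini_integral[OF F, symmetric])
 also have "\<dots> = (\<integral>p. h (\<phi> 1 p) - h p \<partial>M)"
 proof (rule lint_cong)
  fix p assume p: "p \<in> space M"
  have "(\<integral>s. h' (\<phi> s p) * indicator {0..1} s \<partial>lborel) = h (\<phi> 1 p) - h (\<phi> 0 p)"
   by (rule integral_FTC_Icc_real) (use deriv[OF p] cont[OF p] in auto)
  then show "(\<integral>s. ?F s p \<partial>lborel) = h (\<phi> 1 p) - h p" using \<phi>0[OF p] by (simp add: mult.commute)
 qed
 also have "\<dots> = 0" using int_flow[OF h, of 1] h by simp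
 finally show ?thesis .
qed

lemma integrable_continuous_bounded_support:
 fixes f :: "'a::euclidean_space => real"
 assumes "continuous_on UNIV f" "\<And>x. R < norm x ==> f x = 0"
 shows "integrable lborel f"
proof -
 have "integrable lborel (\<lambda>x. indicator (cball 0 R) x *\<^sub>R f x)"
  by (rule borel_integrable_compact[OF compact_cball continuous_on_subset[OF assms(1)]]) simp
 moreover have "(\<lambda>x. indicator (cball 0 R) x *\<^sub>R f x) = f" by (intro ext) (use assms(2) in \<open>auto simp: indicator_def not_le\<close>)
 ultimately show ?thesis by simp
qed

lemma frechet_derivative_eq_0_outside:
 fixes f :: "'a::euclidean_space => real"
 assumes "\<And>x. R < norm x ==> f x = 0" "R < norm x"
 shows "frechet_derivative f (at x) v = 0"
proof -
 have "frechet_derivative f (at x) = frechet_derivative (\<lambda>x. 0) (at x)"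
  by (rule frechet_derivative_cong_open[of "{x. R < norm x}"]) (use assms in \<open>auto intro!: open_Collect_less continuous_intros\<close>)
 also have "\<dots> = (\<lambda>v. 0)" by (rule frechet_derivative_at[symmetric]) simp
 finally show ?thesis by simp
qed

lemma integral_directional_derivative_eq_0:
 fixes h :: "'a::euclidean_space => real"
 assumes h: "Ck_on 1 h UNIV" and supp: "\<And>x. R < norm x ==> h x = 0"
 shows "(\<integral>x. frechet_derivative h (at x) v \<partial>lborel) = 0"
proof (rule integral_flow_derivative_eq_0[where \<phi>="\<lambda>s x. x + s *\<^sub>R v" and h=h])
 let ?h' = "\<lambda>x. frechet_derivative h (at x) v"
 have h1: "Ck_on (Suc 0) h UNIV" using h by simp
 have c: "continuous_on UNIV ?h'" using Ck_on_deriv[OF h1] by simp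
 have [measurable]: "?h' \<in> borel_measurable borel" using c by (rule borel_measurable_continuous_onI)
 show "sigma_finite_measure (lborel :: 'a measure)" by (rule sigma_finite_lborel)
 show "(\<lambda>x. x + s *\<^sub>R v) \<in> measurable lborel lborel" for s by measurable
 show "distr lborel lborel (\<lambda>x. x + s *\<^sub>R v) = lborel" for s
  using lborel_distr_plus[of "s *\<^sub>R v"] by (simp add: add.commute cong: distr_cong)
 show "(\<lambda>(s, x). ?h' (x + s *\<^sub>R v)) \<in> borel_measurable (lborel \<Otimes>\<^sub>M lborel)" by measurable
 show "integrable lborel h"
  by (rule integrable_continuous_bounded_support[OF Ck_on_continuous[OF h] supp])
 show "integrable lborel ?h'"
  by (rule integrable_continuous_bounded_support[OF c frechet_derivative_eq_0_outside[OF supp]])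
 show "((\<lambda>s. h (x + s *\<^sub>R v)) has_real_derivative ?h' (x + s *\<^sub>R v)) (at s)" for s x
 proof -
  let ?D = "frechet_derivative h (at (x + s *\<^sub>R v))"
  have D: "(h has_derivative ?D) (at (x + s *\<^sub>R v))" by (rule Ck_on_SucD[OF h1]) simp
  have "((\<lambda>s. x + s *\<^sub>R v) has_derivative (\<lambda>t. t *\<^sub>R v)) (at s)" by (auto intro!: derivative_eq_intros)
  from diff_chain_at[OF this D]
  have "((\<lambda>s. h (x + s *\<^sub>R v)) has_derivative (\<lambda>t. ?D (t *\<^sub>R v))) (at s)" by (simp add: o_def)
  moreover have "?D (t *\<^sub>R v) = ?D v * t" for t using has_derivative_linear[OF D] by (simp add: linear_scale)
  ultimately show ?thesis by (simp add: has_field_derivative_def)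
 qed
 show "isCont (\<lambda>s. ?h' (x + s *\<^sub>R v)) s" for s x
  by (rule continuous_at_compose[of s "\<lambda>s. x + s *\<^sub>R v" ?h', unfolded o_def])
   (use c in \<open>auto intro!: continuous_intros simp: continuous_on_eq_continuous_at\<close>)
qed auto

section \<open>Rotation invariance of the surface measure\<close>

text \<open>An orthogonal map preserves the unit ball.  Convolving the image measure with the ball and exchanging
 the integrals replaces the map by translations, under which Lebesgue measure is invariant.\<close>

lemma lborel_distr_orthogonal:
 fixes f :: "'a::euclidean_space => 'a"
 assumes f: "orthogonal_transformation f"
 shows "distr lborel borel f = lborel"
proof (rule measure_eqI)
 have lin: "linear f" and nrm: "norm (f z) = norm z" for z
  using f by (auto simp: orthogonal_transformation)
 have fm[measurable]: "f \<in> measurable borel borel"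
  using lin by (intro borel_measurable_continuous_onI linear_continuous_on) (simp add: linear_conv_bounded_linear[symmetric])
 obtain g where g: "\<And>y. f (g y) = y" using orthogonal_transformation_surj[OF f] by (metis surj_def)
 have shift: "(\<integral>\<^sup>+z. h (c + z) \<partial>lborel) = (\<integral>\<^sup>+z. h z \<partial>lborel)"
  if [measurable]: "h \<in> borel_measurable borel" for h :: "'a => ennreal" and c
  by (subst (2) lborel_distr_plus[of c, symmetric]) (simp add: nn_integral_distr)
 fix A assume "A \<in> sets (distr lborel borel f)"
 then have A[measurable]: "A \<in> sets borel" by simp
 let ?B = "ball (0::'a) 1"
 let ?l = "emeasure lborel ?B"
 define iA iB where "iA = (indicator A :: 'a => ennreal)" and "iB = (indicator ?B :: 'a => ennreal)"
 have [measurable]: "iA \<in> borel_measurable borel" "iB \<in> borel_measurable borel"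
  unfolding iA_def iB_def by (rule borel_measurable_indicator, simp)+
 have iBl: "(\<integral>\<^sup>+y. iB y \<partial>lborel) = ?l" by (simp add: iB_def)
 have "?l * emeasure (distr lborel borel f) A = (\<integral>\<^sup>+z. iA (f z) * ?l \<partial>lborel)"
 proof -
  have "(\<integral>\<^sup>+z. iA (f z) * ?l \<partial>lborel) = (\<integral>\<^sup>+z. iA (f z) \<partial>lborel) * ?l" by (rule nn_integral_multc) simp
  also have "(\<integral>\<^sup>+z. iA (f z) \<partial>lborel) = (\<integral>\<^sup>+z. iA z \<partial>distr lborel borel f)" by (simp add: nn_integral_distr)
  also have "\<dots> = emeasure (distr lborel borel f) A" unfolding iA_def by simp
  finally show ?thesis by (simp add: mult.commute)
 qed
 also have "\<dots> = (\<integral>\<^sup>+z. (\<integral>\<^sup>+y. iA (f z) * iB (- f z + y) \<partial>lborel) \<partial>lborel)"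
 proof (rule nn_integral_cong)
  fix z
  have "(\<integral>\<^sup>+y. iA (f z) * iB (- f z + y) \<partial>lborel) = iA (f z) * (\<integral>\<^sup>+y. iB (- f z + y) \<partial>lborel)"
   by (rule nn_integral_cmult) simp
  then show "iA (f z) * ?l = (\<integral>\<^sup>+y. iA (f z) * iB (- f z + y) \<partial>lborel)"
   using shift[of iB "- f z"] by (simp add: iBl)
 qed
 also have "\<dots> = (\<integral>\<^sup>+y. (\<integral>\<^sup>+z. iA (f z) * iB (- f z + y) \<partial>lborel) \<partial>lborel)"
  by (rule lborel_pair.Fubini') measurable
 also have "\<dots> = (\<integral>\<^sup>+y. (\<integral>\<^sup>+z. iA (f z + y) * iB z \<partial>lborel) \<partial>lborel)"
 proof (rule nn_integral_cong)
  fix y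
  have "(\<integral>\<^sup>+z. iA (f z) * iB (- f z + y) \<partial>lborel)
    = (\<integral>\<^sup>+z. iA (f (g y + z)) * iB (- f (g y + z) + y) \<partial>lborel)"
   by (rule shift[symmetric]) simp
  also have "\<dots> = (\<integral>\<^sup>+z. iA (f z + y) * iB z \<partial>lborel)"
   by (rule nn_integral_cong) (simp add: linear_add[OF lin] g nrm iB_def indicator_def add.commute)
  finally show "(\<integral>\<^sup>+z. iA (f z) * iB (- f z + y) \<partial>lborel) = (\<integral>\<^sup>+z. iA (f z + y) * iB z \<partial>lborel)" .
 qed
 also have "\<dots> = (\<integral>\<^sup>+z. (\<integral>\<^sup>+y. iA (f z + y) * iB z \<partial>lborel) \<partial>lborel)"
  by (rule lborel_pair.Fubini') measurable
 also have "\<dots> = (\<integral>\<^sup>+z. emeasure lborel A * iB z \<partial>lborel)"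
 proof (rule nn_integral_cong)
  fix z
  have "(\<integral>\<^sup>+y. iA (f z + y) * iB z \<partial>lborel) = (\<integral>\<^sup>+y. iA (f z + y) \<partial>lborel) * iB z"
   by (rule nn_integral_multc) simp
  then show "(\<integral>\<^sup>+y. iA (f z + y) * iB z \<partial>lborel) = emeasure lborel A * iB z"
   using shift[of iA "f z"] by (simp add: iA_def)
 qed
 also have "\<dots> = ?l * emeasure lborel A" by (subst nn_integral_cmult) (simp_all add: iBl mult.commute[of ?l])
 finally have eq: "?l * emeasure (distr lborel borel f) A = ?l * emeasure lborel A" .
 have "?l \<noteq> 0" "?l \<noteq> \<infinity>"
  using emeasure_lborel_ball_finite[of "0::'a" 1] content_ball_pos[of 1 "0::'a"] by (auto simp: measure_def)
 then show "emeasure (distr lborel borel f) A = emeasure lborel A"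
  using eq by (metis ennreal_mult_cancel_left infinity_ennreal_def)
qed simp

lemma sgn_measurable [measurable]: "(sgn :: 'a::euclidean_space => 'a) \<in> measurable borel borel"
 unfolding sgn_div_norm[abs_def] by measurable

lemma emeasure_sphere_measure_cone:
 assumes "A \<subseteq> unit_sphere" "A \<in> sets borel"
 shows "emeasure (sphere_measure :: 'a::euclidean_space measure) A =
  emeasure lborel (ball 0 1 \<inter> sgn -` A) / emeasure lborel (ball (0::'a) 1)"
proof -
 have "sgn -` A \<in> sets borel" using measurable_sets[OF sgn_measurable assms(2)] by simp
 then show ?thesis using assms unfolding sphere_measure_def
  by (subst emeasure_restrict_space) (auto simp: emeasure_distr)
qed

lemma sphere_measure_distr_orthogonal:
 fixes f :: "'a::euclidean_space => 'a"
 assumes f: "orthogonal_transformation f"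
 shows "f \<in> measurable sphere_measure sphere_measure" "distr sphere_measure sphere_measure f = sphere_measure"
proof -
 have lin: "linear f" and nrm: "norm (f y) = norm y" for y
  using f by (auto simp: orthogonal_transformation)
 have fb[measurable]: "f \<in> measurable borel borel"
  using lin by (intro borel_measurable_continuous_onI linear_continuous_on) (simp add: linear_conv_bounded_linear[symmetric])
 show fm: "f \<in> measurable sphere_measure sphere_measure"
 proof -
  have "f \<in> measurable (restrict_space borel unit_sphere) (restrict_space borel unit_sphere)"
   by (rule measurable_restrict_space3[OF fb]) (simp add: nrm)
  then show ?thesis by (simp cong: measurable_cong_sets add: sets_sphere_measure)
 qed
 have sg: "sgn (f y) = f (sgn y)" for y by (simp add: sgn_div_norm nrm linear_scale[OF lin])
 show "distr sphere_measure sphere_measure f = sphere_measure"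
 proof (rule measure_eqI)
  fix A assume "A \<in> sets (distr sphere_measure sphere_measure f)"
  then have A: "A \<subseteq> unit_sphere" "A \<in> sets borel"
   by (auto simp: sets_sphere_measure sets_restrict_space)
  let ?A = "f -` A \<inter> unit_sphere"
  have fA: "?A \<in> sets borel" using measurable_sets[OF fb A(2)] by simp
  have "emeasure (distr sphere_measure sphere_measure f) A = emeasure sphere_measure ?A"
   using fm A by (subst emeasure_distr) (auto simp: sets_sphere_measure sets_restrict_space)
  also have "\<dots> = emeasure lborel (ball 0 1 \<inter> sgn -` ?A) / emeasure lborel (ball (0::'a) 1)"
   by (rule emeasure_sphere_measure_cone) (use fA in auto)
  also have "ball 0 1 \<inter> sgn -` ?A = f -` (ball 0 1 \<inter> sgn -` A)"
   using A(1) by (auto simp: sg nrm subset_iff norm_sgn split: if_splits)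
  also have "emeasure lborel (f -` (ball 0 1 \<inter> sgn -` A)) = emeasure (distr lborel borel f) (ball 0 1 \<inter> sgn -` A)"
   using measurable_sets[OF sgn_measurable A(2)] by (subst emeasure_distr) auto
  also have "\<dots> = emeasure lborel (ball 0 1 \<inter> sgn -` A)" by (simp add: lborel_distr_orthogonal[OF f])
  also have "\<dots> / emeasure lborel (ball (0::'a) 1) = emeasure sphere_measure A"
   by (rule emeasure_sphere_measure_cone[OF A, symmetric])
  finally show "emeasure (distr sphere_measure sphere_measure f) A = emeasure sphere_measure A" .
 qed simp
qed

text \<open>The rotation by the angle \<open>s\<close> in the plane of \<open>u\<close> and \<open>v\<close>.  Rotations preserve the surface measure
 and their generators span the tangent spaces, which gives integration by parts on the sphere.\<close>

definition plane_rotation :: "'a::real_inner => 'a => real => 'a => 'a" where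
 "plane_rotation u v s y = y + ((cos s - 1) * (y \<bullet> u) - sin s * (y \<bullet> v)) *\<^sub>R u
  + (sin s * (y \<bullet> u) + (cos s - 1) * (y \<bullet> v)) *\<^sub>R v"

context
 fixes u v :: "'a::real_inner"
 assumes uv: "u \<bullet> u = 1" "v \<bullet> v = 1" "u \<bullet> v = 0"
begin

lemma plane_rotation_inner:
 "plane_rotation u v s y \<bullet> u = cos s * (y \<bullet> u) - sin s * (y \<bullet> v)"
 "plane_rotation u v s y \<bullet> v = sin s * (y \<bullet> u) + cos s * (y \<bullet> v)"
 using uv by (simp_all add: plane_rotation_def inner_add_left inner_commute[of v u] algebra_simps)

lemma orthogonal_plane_rotation: "orthogonal_transformation (plane_rotation u v s)"
 unfolding orthogonal_transformation
proof (intro conjI allI)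
 show "linear (plane_rotation u v s)"
 proof -
  have "linear (\<lambda>y. y + (c * (y \<bullet> u) - d * (y \<bullet> v)) *\<^sub>R u + (d * (y \<bullet> u) + c * (y \<bullet> v)) *\<^sub>R v)" for c d
   by (rule linearI) (simp_all add: inner_add_left algebra_simps)
  then show ?thesis unfolding plane_rotation_def[abs_def] .
 qed
 fix y
 let ?a = "y \<bullet> u" and ?b = "y \<bullet> v" and ?R = "plane_rotation u v s y"
 let ?p = "(cos s - 1) * ?a - sin s * ?b" and ?q = "sin s * ?a + (cos s - 1) * ?b"
 have "?R \<bullet> ?R = ?R \<bullet> y + ?p * (?R \<bullet> u) + ?q * (?R \<bullet> v)"
  unfolding plane_rotation_def[of u v s y] by (simp only: inner_add_right inner_scaleR_right)
 also have "?R \<bullet> y = y \<bullet> y + ?p * ?a + ?q * ?b"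
  unfolding plane_rotation_def by (simp only: inner_add_left inner_scaleR_left inner_commute[of u y] inner_commute[of v y])
 also have "y \<bullet> y + ?p * ?a + ?q * ?b + ?p * (?R \<bullet> u) + ?q * (?R \<bullet> v)
   = y \<bullet> y + ((sin s)\<^sup>2 + (cos s)\<^sup>2 - 1) * (?a\<^sup>2 + ?b\<^sup>2)"
 proof -
  have "Y + ((c - 1) * a - d * b) * a + (d * a + (c - 1) * b) * b + ((c - 1) * a - d * b) * (c * a - d * b)
    + (d * a + (c - 1) * b) * (d * a + c * b) = Y + (d\<^sup>2 + c\<^sup>2 - 1) * (a\<^sup>2 + b\<^sup>2)" for Y a b c d :: real
   by (simp add: algebra_simps power2_eq_square)
  then show ?thesis unfolding plane_rotation_inner .
 qed
 also have "\<dots> = y \<bullet> y" by simp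
 finally show "norm ?R = norm y" by (simp add: norm_eq_sqrt_inner)
qed

lemma has_derivative_plane_rotation:
 "((\<lambda>s. plane_rotation u v s y) has_derivative
  (\<lambda>t. t *\<^sub>R ((plane_rotation u v s y \<bullet> u) *\<^sub>R v - (plane_rotation u v s y \<bullet> v) *\<^sub>R u))) (at s)"
 unfolding plane_rotation_inner unfolding plane_rotation_def
 by (auto intro!: derivative_eq_intros simp: algebra_simps)

end

section \<open>Integration by parts on the sphere\<close>

lemma measurable_ident_sphere [measurable]: "(\<lambda>x. x) \<in> measurable sphere_measure (borel :: 'a::euclidean_space measure)"
proof -
 have "(\<lambda>x. x) \<in> measurable (restrict_space borel unit_sphere) (borel :: 'a measure)"
  by (rule measurable_restrict_space1) simp
 then show ?thesis by (simp cong: measurable_cong_sets add: sets_sphere_measure)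
qed

lemma continuous_on_sphere_extend:
 fixes K :: "'a::euclidean_space => real"
 assumes "continuous_on (- {0}) K"
 shows "(\<lambda>y. indicator (- {0}) y * K y) \<in> borel_measurable borel"
 using borel_measurable_continuous_on_indicator[OF _ assms] by simp

lemma sphere_measurable_continuous:
 fixes K :: "'a::euclidean_space => real"
 assumes "continuous_on unit_sphere K"
 shows "K \<in> borel_measurable sphere_measure"
proof -
 have [measurable]: "(\<lambda>y. indicator unit_sphere y * K y) \<in> borel_measurable borel"
  using borel_measurable_continuous_on_indicator[OF _ assms] by simp
 have "(\<lambda>y. indicator unit_sphere y * K y) \<in> borel_measurable sphere_measure"
  by (rule measurable_compose[OF measurable_ident_sphere]) simp
 then show ?thesis by (rule measurable_cong[THEN iffD1, rotated]) simp
qed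

lemma sphere_integrable_continuous:
 fixes K :: "'a::euclidean_space => real"
 assumes "continuous_on unit_sphere K"
 shows "integrable sphere_measure K"
proof -
 have "compact (K ` unit_sphere)" by (rule compact_continuous_image[OF assms]) simp
 then obtain B where "\<And>y. y \<in> unit_sphere ==> norm (K y) \<le> B"
  by (meson bounded_iff compact_imp_bounded imageI)
 then show ?thesis
  by (intro sphere.integrable_const_bound[of K B] AE_I2 sphere_measurable_continuous assms) simp
qed

context
 fixes g :: "'a::euclidean_space => real"
 assumes g: "Ck_on 1 (\<lambda>y. g (sgn y)) (- {0})"
begin

lemma sphere_g1: "Ck_on (Suc 0) (\<lambda>y. g (sgn y)) (- {0})" using g by simp

lemma sphere_deriv_has_derivative:
 assumes "y \<noteq> 0" shows "((\<lambda>y. g (sgn y)) has_derivative sphere_deriv g y) (at y)"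
 using Ck_on_SucD(1)[OF sphere_g1, of y] assms by (simp add: sphere_deriv_def[abs_def])

lemma sphere_deriv_linear: "y \<noteq> 0 ==> linear (sphere_deriv g y)"
 using sphere_deriv_has_derivative has_derivative_linear by blast

lemma sphere_deriv_continuous: "continuous_on (- {0}) (\<lambda>y. sphere_deriv g y v)"
 using Ck_on_deriv[OF sphere_g1, of v] by (simp add: sphere_deriv_def)

lemma sphere_continuous: "continuous_on (- {0}) (\<lambda>y. g (sgn y))"
 using Ck_on_continuous[OF g] .

lemma sphere_deriv_radial:
 assumes "norm \<omega> = 1" shows "sphere_deriv g \<omega> \<omega> = 0"
proof -
 have nz: "\<omega> \<noteq> 0" using assms by auto
 have s: "sgn \<omega> = \<omega>" using assms by (simp add: sgn_div_norm)
 have ss: "sgn (sgn y) = sgn y" for y :: 'a by (cases "y = 0") (simp_all add: sgn_div_norm)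
 have d: "((\<lambda>y. g (sgn y)) has_derivative sphere_deriv g \<omega>) (at (sgn \<omega>))"
  using sphere_deriv_has_derivative[OF nz] s by simp
 have "((\<lambda>y. g (sgn y)) has_derivative (\<lambda>v. sphere_deriv g \<omega> (v - (v \<bullet> \<omega>) *\<^sub>R \<omega>))) (at \<omega>)"
  using diff_chain_at[OF has_derivative_sgn_unit[OF assms] d] by (simp add: o_def ss)
 from has_derivative_unique[OF sphere_deriv_has_derivative[OF nz] this]
 have "sphere_deriv g \<omega> \<omega> = sphere_deriv g \<omega> (\<omega> - (\<omega> \<bullet> \<omega>) *\<^sub>R \<omega>)" by metis
 also have "\<omega> - (\<omega> \<bullet> \<omega>) *\<^sub>R \<omega> = 0" using assms by (simp add: dot_square_norm)
 finally show ?thesis using linear_0[OF sphere_deriv_linear[OF nz]] by simp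
qed

lemma integral_rotation_field_eq_0:
 assumes uv: "u \<bullet> u = 1" "v \<bullet> v = 1" "u \<bullet> v = 0"
 shows "(\<integral>\<omega>. (\<omega> \<bullet> u) * sphere_deriv g \<omega> v - (\<omega> \<bullet> v) * sphere_deriv g \<omega> u \<partial>sphere_measure) = 0"
proof (rule integral_flow_derivative_eq_0[where \<phi>="plane_rotation u v" and h=g])
 let ?K = "\<lambda>\<omega>. (\<omega> \<bullet> u) * sphere_deriv g \<omega> v - (\<omega> \<bullet> v) * sphere_deriv g \<omega> u"
 note orth = orthogonal_plane_rotation[OF uv]
 have nrm: "norm (plane_rotation u v s \<omega>) = norm \<omega>" for s \<omega>
  using orth[of s] by (simp add: orthogonal_transformation)
 have cK: "continuous_on (- {0}) ?K"
  by (intro continuous_intros sphere_deriv_continuous)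
 have sub: "unit_sphere \<subseteq> - {0::'a}" by auto
 show "sigma_finite_measure (sphere_measure :: 'a measure)" by unfold_locales
 show "plane_rotation u v s \<in> measurable sphere_measure sphere_measure"
  "distr sphere_measure sphere_measure (plane_rotation u v s) = sphere_measure" for s
  using sphere_measure_distr_orthogonal[OF orth] by auto
 show "plane_rotation u v 0 p = p" for p by (simp add: plane_rotation_def)
 show "(\<lambda>(s, p). ?K (plane_rotation u v s p)) \<in> borel_measurable (lborel \<Otimes>\<^sub>M sphere_measure)"
 proof -
  note [measurable] = continuous_on_sphere_extend[OF cK]
  have "(\<lambda>x. indicator (- {0}) (plane_rotation u v (fst x) (snd x)) * ?K (plane_rotation u v (fst x) (snd x)))
    \<in> borel_measurable (lborel \<Otimes>\<^sub>M sphere_measure)"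
  proof (rule measurable_compose[OF _ continuous_on_sphere_extend[OF cK]])
   show "(\<lambda>x. plane_rotation u v (fst x) (snd x)) \<in> measurable (lborel \<Otimes>\<^sub>M sphere_measure) borel"
    unfolding plane_rotation_def by measurable
  qed
  then show ?thesis
  proof (rule measurable_cong[THEN iffD1, rotated])
   fix x :: "real \<times> 'a" assume "x \<in> space (lborel \<Otimes>\<^sub>M sphere_measure)"
   then have "norm (plane_rotation u v (fst x) (snd x)) = 1" by (auto simp: space_pair_measure nrm)
   then have "plane_rotation u v (fst x) (snd x) \<noteq> 0" by auto
   then show "indicator (- {0}) (plane_rotation u v (fst x) (snd x)) * ?K (plane_rotation u v (fst x) (snd x))
    = (case x of (s, p) => ?K (plane_rotation u v s p))" by (simp add: case_prod_beta)
  qed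
 qed
 show "integrable sphere_measure ?K"
  by (rule sphere_integrable_continuous[OF continuous_on_subset[OF cK sub]])
 have "continuous_on unit_sphere (\<lambda>y. g (sgn y))" by (rule continuous_on_subset[OF sphere_continuous sub])
 then have "continuous_on unit_sphere g"
  by (rule continuous_on_eq) (simp add: sgn_div_norm)
 then show "integrable sphere_measure g" by (rule sphere_integrable_continuous)
 fix s and p :: 'a assume "p \<in> space sphere_measure"
 then have p: "norm p = 1" by simp
 have "norm (plane_rotation u v s p) = 1" for s using p by (simp add: nrm)
 then have nz: "plane_rotation u v s p \<noteq> 0" and sg: "sgn (plane_rotation u v s p) = plane_rotation u v s p" for s
  by (auto simp: sgn_div_norm) (metis norm_zero zero_neq_one)
 let ?D = "sphere_deriv g (plane_rotation u v s p)"
 from diff_chain_at[OF has_derivative_plane_rotation[OF uv] sphere_deriv_has_derivative[OF nz]]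
 have "((\<lambda>s. g (plane_rotation u v s p)) has_derivative
  (\<lambda>t. ?D (t *\<^sub>R ((plane_rotation u v s p \<bullet> u) *\<^sub>R v - (plane_rotation u v s p \<bullet> v) *\<^sub>R u)))) (at s)"
  by (simp add: o_def sg)
 moreover have "?D (t *\<^sub>R ((plane_rotation u v s p \<bullet> u) *\<^sub>R v - (plane_rotation u v s p \<bullet> v) *\<^sub>R u))
   = ?K (plane_rotation u v s p) * t" for t
  using sphere_deriv_linear[OF nz, of s] by (simp add: linear_scale linear_diff) (simp add: algebra_simps)
 ultimately show "((\<lambda>s. g (plane_rotation u v s p)) has_real_derivative ?K (plane_rotation u v s p)) (at s)"
  by (simp add: has_field_derivative_def)
 show "isCont (\<lambda>s. ?K (plane_rotation u v s p)) s"
 proof (rule continuous_at_compose[of s "\<lambda>s. plane_rotation u v s p" ?K, unfolded o_def])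
  show "isCont (\<lambda>s. plane_rotation u v s p) s"
   using has_derivative_continuous[OF has_derivative_plane_rotation[OF uv]] .
  show "isCont ?K (plane_rotation u v s p)"
   using cK nz[of s] by (subst (asm) continuous_on_eq_continuous_at) auto
 qed
qed

end

text \<open>Contracting the rotation fields with \<open>\<omega>\<^sub>u\<close> recovers the tangential derivative
 along a basis vector, and differentiating the weight \<open>\<omega>\<^sub>u\<close> produces the mean curvature term.\<close>

lemma integral_sphere_deriv_Basis:
 fixes g :: "'a::euclidean_space => real"
 assumes g: "Ck_on 1 (\<lambda>y. g (sgn y)) (- {0})" and v: "v \<in> Basis"
 shows "(\<integral>\<omega>. sphere_deriv g \<omega> v \<partial>sphere_measure)
  = (real DIM('a) - 1) * (\<integral>\<omega>. (\<omega> \<bullet> v) * g \<omega> \<partial>sphere_measure)"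
proof -
 have o: "open (- {0::'a})" by auto
 have sub: "unit_sphere \<subseteq> - {0::'a}" by auto
 have "continuous_on unit_sphere (\<lambda>y. g (sgn y))"
  by (rule continuous_on_subset[OF sphere_continuous[OF g] sub])
 then have cg: "continuous_on unit_sphere g" by (rule continuous_on_eq) (simp add: sgn_div_norm)
 have cD: "continuous_on unit_sphere (\<lambda>\<omega>. sphere_deriv g \<omega> w)" for w
  by (rule continuous_on_subset[OF sphere_deriv_continuous[OF g] sub])
 have Z: "(\<integral>\<omega>. ((\<omega> \<bullet> u)\<^sup>2 * sphere_deriv g \<omega> v - (\<omega> \<bullet> v) * ((\<omega> \<bullet> u) * sphere_deriv g \<omega> u)) \<partial>sphere_measure)
   = (\<integral>\<omega>. (\<omega> \<bullet> v) * g \<omega> \<partial>sphere_measure)" if u: "u \<in> Basis" "u \<noteq> v" for u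
 proof -
  let ?h = "\<lambda>\<omega>. g \<omega> * (\<omega> \<bullet> u)"
  have uv: "u \<bullet> u = 1" "v \<bullet> v = 1" "u \<bullet> v = 0" using u v by (auto simp: inner_Basis)
  have "Ck_on 1 (\<lambda>y. sgn y \<bullet> u) (- {0})"
   by (rule Ck_on_bilinear[OF o bounded_bilinear_inner Ck_on_sgn Ck_on_const])
  then have h: "Ck_on 1 (\<lambda>y. ?h (sgn y)) (- {0})" using g by (intro Ck_on_mult o)
  have dh: "sphere_deriv ?h \<omega> w = sphere_deriv g \<omega> w * (\<omega> \<bullet> u) + g \<omega> * ((w \<bullet> u) - (w \<bullet> \<omega>) * (\<omega> \<bullet> u))"
   if w: "norm \<omega> = 1" for \<omega> w
  proof -
   have nz: "\<omega> \<noteq> 0" and s: "sgn \<omega> = \<omega>" using w by (auto simp: sgn_div_norm)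
   have "((\<lambda>y. g (sgn y) * (sgn y \<bullet> u)) has_derivative
     (\<lambda>w. g (sgn \<omega>) * ((w - (w \<bullet> \<omega>) *\<^sub>R \<omega>) \<bullet> u) + sphere_deriv g \<omega> w * (sgn \<omega> \<bullet> u))) (at \<omega>)"
    by (intro has_derivative_mult sphere_deriv_has_derivative[OF g nz] has_derivative_inner_left has_derivative_sgn_unit w)
   from frechet_derivative_at[OF this] show ?thesis
    unfolding sphere_deriv_def[of ?h] by (metis (no_types, lifting) add.commute inner_diff_left inner_scaleR_left s)
  qed
  have "0 = (\<integral>\<omega>. (\<omega> \<bullet> u) * sphere_deriv ?h \<omega> v - (\<omega> \<bullet> v) * sphere_deriv ?h \<omega> u \<partial>sphere_measure)"
   by (rule integral_rotation_field_eq_0[OF h uv, symmetric])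
  also have "\<dots> = (\<integral>\<omega>. ((\<omega> \<bullet> u)\<^sup>2 * sphere_deriv g \<omega> v - (\<omega> \<bullet> v) * ((\<omega> \<bullet> u) * sphere_deriv g \<omega> u))
    - (\<omega> \<bullet> v) * g \<omega> \<partial>sphere_measure)"
  proof (rule lint_cong)
   fix \<omega> :: 'a assume "\<omega> \<in> space sphere_measure"
   then have w: "norm \<omega> = 1" by simp
   show "(\<omega> \<bullet> u) * sphere_deriv ?h \<omega> v - (\<omega> \<bullet> v) * sphere_deriv ?h \<omega> u
    = ((\<omega> \<bullet> u)\<^sup>2 * sphere_deriv g \<omega> v - (\<omega> \<bullet> v) * ((\<omega> \<bullet> u) * sphere_deriv g \<omega> u)) - (\<omega> \<bullet> v) * g \<omega>"
   proof -
    have e: "v \<bullet> u = 0" "v \<bullet> \<omega> = \<omega> \<bullet> v" "u \<bullet> \<omega> = \<omega> \<bullet> u" using uv by (simp_all add: inner_commute)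
    show ?thesis unfolding dh[OF w] e uv by (simp add: algebra_simps power2_eq_square)
   qed
  qed
  also have "\<dots> = (\<integral>\<omega>. ((\<omega> \<bullet> u)\<^sup>2 * sphere_deriv g \<omega> v - (\<omega> \<bullet> v) * ((\<omega> \<bullet> u) * sphere_deriv g \<omega> u)) \<partial>sphere_measure)
    - (\<integral>\<omega>. (\<omega> \<bullet> v) * g \<omega> \<partial>sphere_measure)"
   by (intro lint_diff sphere_integrable_continuous continuous_intros cD cg)
  finally show ?thesis by simp
 qed
 have "sphere_deriv g \<omega> v = (\<Sum>u\<in>Basis - {v}. (\<omega> \<bullet> u)\<^sup>2 * sphere_deriv g \<omega> v - (\<omega> \<bullet> v) * ((\<omega> \<bullet> u) * sphere_deriv g \<omega> u))"
  if w: "\<omega> \<in> space sphere_measure" for \<omega>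
 proof -
  have n: "norm \<omega> = 1" and nz: "\<omega> \<noteq> 0" using w by auto
  have "(\<Sum>u\<in>Basis - {v}. (\<omega> \<bullet> u)\<^sup>2 * sphere_deriv g \<omega> v - (\<omega> \<bullet> v) * ((\<omega> \<bullet> u) * sphere_deriv g \<omega> u))
   = (\<Sum>u\<in>Basis. (\<omega> \<bullet> u)\<^sup>2 * sphere_deriv g \<omega> v - (\<omega> \<bullet> v) * ((\<omega> \<bullet> u) * sphere_deriv g \<omega> u))"
   by (subst sum.remove[OF finite_Basis v]) (simp add: power2_eq_square)
  also have "\<dots> = (\<Sum>u\<in>Basis. (\<omega> \<bullet> u)\<^sup>2) * sphere_deriv g \<omega> v - (\<omega> \<bullet> v) * (\<Sum>u\<in>Basis. (\<omega> \<bullet> u) * sphere_deriv g \<omega> u)"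
   by (simp add: sum_subtractf sum_distrib_right sum_distrib_left)
  also have "(\<Sum>u\<in>Basis. (\<omega> \<bullet> u)\<^sup>2) = 1"
   using n euclidean_inner[of \<omega> \<omega>] by (simp add: power2_eq_square dot_square_norm)
  also have "(\<Sum>u\<in>Basis. (\<omega> \<bullet> u) * sphere_deriv g \<omega> u) = sphere_deriv g \<omega> \<omega>"
   using linear_euclidean_expand[OF sphere_deriv_linear[OF g nz], of \<omega>] by simp
  finally show ?thesis using sphere_deriv_radial[OF g n] by simp
 qed
 then have "(\<integral>\<omega>. sphere_deriv g \<omega> v \<partial>sphere_measure) = (\<integral>\<omega>. (\<Sum>u\<in>Basis - {v}.
   (\<omega> \<bullet> u)\<^sup>2 * sphere_deriv g \<omega> v - (\<omega> \<bullet> v) * ((\<omega> \<bullet> u) * sphere_deriv g \<omega> u)) \<partial>sphere_measure)"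
  by (intro Bochner_Integration.integral_cong refl)
 also have "\<dots> = (\<Sum>u\<in>Basis - {v}. \<integral>\<omega>. ((\<omega> \<bullet> u)\<^sup>2 * sphere_deriv g \<omega> v - (\<omega> \<bullet> v) * ((\<omega> \<bullet> u) * sphere_deriv g \<omega> u)) \<partial>sphere_measure)"
  by (intro lint_sum sphere_integrable_continuous continuous_intros cD)
 also have "\<dots> = (\<Sum>u\<in>Basis - {v}. \<integral>\<omega>. (\<omega> \<bullet> v) * g \<omega> \<partial>sphere_measure)" using Z by (intro sum.cong) auto
 also have "\<dots> = real (card (Basis - {v})) * (\<integral>\<omega>. (\<omega> \<bullet> v) * g \<omega> \<partial>sphere_measure)" by simp
 also have "real (card (Basis - {v})) = real DIM('a) - 1"
  using v DIM_positive[where 'a='a] by (simp add: card_Diff_singleton of_nat_diff)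
 finally show ?thesis .
qed

lemma integral_sphere_deriv:
 fixes g :: "'a::euclidean_space => real"
 assumes g: "Ck_on 1 (\<lambda>y. g (sgn y)) (- {0})"
 shows "(\<integral>\<omega>. sphere_deriv g \<omega> v \<partial>sphere_measure)
  = (real DIM('a) - 1) * (\<integral>\<omega>. (\<omega> \<bullet> v) * g \<omega> \<partial>sphere_measure)"
proof -
 have sub: "unit_sphere \<subseteq> - {0::'a}" by auto
 have "continuous_on unit_sphere (\<lambda>y. g (sgn y))"
  by (rule continuous_on_subset[OF sphere_continuous[OF g] sub])
 then have cg: "continuous_on unit_sphere g" by (rule continuous_on_eq) (simp add: sgn_div_norm)
 have cD: "continuous_on unit_sphere (\<lambda>\<omega>. sphere_deriv g \<omega> w)" for w
  by (rule continuous_on_subset[OF sphere_deriv_continuous[OF g] sub])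
 have "(\<integral>\<omega>. sphere_deriv g \<omega> v \<partial>sphere_measure) = (\<integral>\<omega>. (\<Sum>b\<in>Basis. (v \<bullet> b) * sphere_deriv g \<omega> b) \<partial>sphere_measure)"
 proof (rule lint_cong)
  fix \<omega> :: 'a assume "\<omega> \<in> space sphere_measure"
  then have "\<omega> \<noteq> 0" by auto
  from linear_euclidean_expand[OF sphere_deriv_linear[OF g this], of v]
  show "sphere_deriv g \<omega> v = (\<Sum>b\<in>Basis. (v \<bullet> b) * sphere_deriv g \<omega> b)" by simp
 qed
 also have "\<dots> = (\<Sum>b\<in>Basis. (v \<bullet> b) * (\<integral>\<omega>. sphere_deriv g \<omega> b \<partial>sphere_measure))"
  by (subst lint_sum) (auto intro!: sphere_integrable_continuous continuous_intros cD)
 also have "\<dots> = (real DIM('a) - 1) * (\<Sum>b\<in>Basis. (v \<bullet> b) * (\<integral>\<omega>. (\<omega> \<bullet> b) * g \<omega> \<partial>sphere_measure))"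
  by (simp add: integral_sphere_deriv_Basis[OF g] sum_distrib_left mult.left_commute)
 also have "(\<Sum>b\<in>Basis. (v \<bullet> b) * (\<integral>\<omega>. (\<omega> \<bullet> b) * g \<omega> \<partial>sphere_measure))
   = (\<integral>\<omega>. (\<Sum>b\<in>Basis. (v \<bullet> b) * ((\<omega> \<bullet> b) * g \<omega>)) \<partial>sphere_measure)"
  by (subst lint_sum) (auto intro!: sphere_integrable_continuous continuous_intros cg)
 also have "\<dots> = (\<integral>\<omega>. (\<omega> \<bullet> v) * g \<omega> \<partial>sphere_measure)"
  by (simp add: euclidean_inner[of _ v] sum_distrib_right mult.assoc mult.left_commute)
 finally show ?thesis .
qed


section \<open>Smooth functions on the state space\<close>

abbreviation retract :: "'a::euclidean_space phase => 'a phase" where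
 "retract p \<equiv> (fst p, sgn (snd p))"

abbreviation off_zero :: "'a::euclidean_space phase set" where
 "off_zero \<equiv> UNIV \<times> (- {0})"

text \<open>Values outside the state space are discarded by composing with the radial retraction, which is smooth
 away from zero velocity.\<close>

definition Cks :: "nat => ('a::euclidean_space phase => real) => bool" where
 "Cks k f \<longleftrightarrow> Ck_on k (\<lambda>p. f (retract p)) off_zero"

lemma open_off_zero: "open (off_zero :: 'a::euclidean_space phase set)"
 by (intro open_Times) auto

lemma retract_state: "p \<in> off_zero ==> retract p \<in> state_space"
 by (auto simp: state_space_def norm_sgn)

lemma retract_id: "p \<in> state_space ==> retract p = p"
 by (auto simp: state_space_def sgn_div_norm)

lemma state_off_zero: "(state_space :: 'a::euclidean_space phase set) \<subseteq> off_zero"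
 by (auto simp: state_space_def)

lemma Ck_on_Pair:
 fixes f :: "'a::real_normed_vector => 'b::euclidean_space" and g :: "'a => 'c::euclidean_space"
 assumes S: "open S" and f: "Ck_on k f S" and g: "Ck_on k g S"
 shows "Ck_on k (\<lambda>x. (f x, g x)) S"
proof -
 have 1: "Ck_on k (\<lambda>x. (f x, 0::'c)) S"
  by (rule Ck_on_compose[OF S open_UNIV _ f Ck_on_linear_intro]) (auto simp: linear_iff)
 have 2: "Ck_on k (\<lambda>x. (0::'b, g x)) S"
  by (rule Ck_on_compose[OF S open_UNIV _ g Ck_on_linear_intro]) (auto simp: linear_iff)
 from Ck_on_add[OF S 1 2] show ?thesis by simp
qed

lemma Ck_on_fst: "open S ==> Ck_on k (fst :: 'a::euclidean_space \<times> 'b::euclidean_space => 'a) S"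
 by (intro Ck_on_linear_intro) (auto simp: linear_iff)

lemma Ck_on_snd: "open S ==> Ck_on k (snd :: 'a::euclidean_space \<times> 'b::euclidean_space => 'b) S"
 by (intro Ck_on_linear_intro) (auto simp: linear_iff)

lemma Ck_on_retract: "Ck_on k (retract :: 'a::euclidean_space phase => _) off_zero"
proof -
 have o: "open (- {0::'a})" by auto
 have "Ck_on k (\<lambda>p::'a phase. sgn (snd p)) off_zero"
  by (rule Ck_on_compose[OF open_off_zero o _ Ck_on_snd[OF open_off_zero] Ck_on_sgn]) auto
 then show ?thesis by (intro Ck_on_Pair open_off_zero Ck_on_fst)
qed

lemma Cks_ambient: assumes "Ck_on k F off_zero" shows "Cks k F"
proof -
 have "retract p \<in> off_zero" if "p \<in> off_zero" for p :: "'a phase" using that by (auto simp: sgn_zero_iff)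
 from Ck_on_compose[OF open_off_zero open_off_zero this Ck_on_retract assms]
 show ?thesis unfolding Cks_def .
qed

lemma Cks_cong:
 assumes "\<And>p. p \<in> state_space ==> f p = g p" "Cks k f" shows "Cks k g"
 unfolding Cks_def
 by (rule Ck_on_cong[OF open_off_zero _ assms(2)[unfolded Cks_def]]) (rule assms(1)[OF retract_state])

lemma Cks_mono: "j \<le> k ==> Cks k f ==> Cks j f"
 unfolding Cks_def by (rule Ck_on_mono)

lemma Cks_continuous: assumes "Cks k f" shows "continuous_on state_space f"
proof -
 have "continuous_on state_space (\<lambda>p. f (retract p))"
  using Ck_on_continuous[OF assms[unfolded Cks_def]] continuous_on_subset state_off_zero by blast
 then show ?thesis by (rule continuous_on_eq) (simp only: retract_id)
qed

lemma Cks_const: "Cks k (\<lambda>p. c)"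
 unfolding Cks_def by (rule Ck_on_const)

lemma Cks_add: "Cks k f ==> Cks k g ==> Cks k (\<lambda>p. f p + g p)"
 unfolding Cks_def by (rule Ck_on_add[OF open_off_zero])

lemma Cks_mult: "Cks k f ==> Cks k g ==> Cks k (\<lambda>p. f p * g p)"
 unfolding Cks_def by (rule Ck_on_mult[OF open_off_zero])

lemma Cks_sum: "(\<And>i. i \<in> I ==> Cks k (f i)) ==> Cks k (\<lambda>p. \<Sum>i\<in>I. f i p)"
 unfolding Cks_def by (rule Ck_on_sum[OF open_off_zero])

lemma Cks_fst: "Ck_on k V UNIV ==> Cks k (\<lambda>p. V (fst p))"
 by (rule Cks_ambient) (rule Ck_on_compose[OF open_off_zero open_UNIV _ Ck_on_fst[OF open_off_zero]], auto)

lemma Cks_snd_inner: "Cks k (\<lambda>p. snd p \<bullet> v)"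
 by (rule Cks_ambient) (intro Ck_on_bilinear[OF open_off_zero bounded_bilinear_inner] Ck_on_snd Ck_on_const open_off_zero)

lemmas Cks_intros = Cks_const Cks_add Cks_mult Cks_sum Cks_fst Cks_snd_inner

lemma Cks_slice_sphere: assumes "Cks k f" shows "Ck_on k (\<lambda>y. f (x, sgn y)) (- {0})"
proof -
 have o: "open (- {0::'a})" by auto
 have "Ck_on k (\<lambda>y::'a. (x, y)) (- {0})"
  by (intro Ck_on_Pair o Ck_on_const Ck_on_linear_intro) (auto simp: linear_iff)
 from Ck_on_compose[OF o open_off_zero _ this assms[unfolded Cks_def]] show ?thesis by simp
qed

lemma Cks_slice_x: assumes "Cks k f" "norm \<omega> = 1" shows "Ck_on k (\<lambda>y. f (y, \<omega>)) UNIV"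
proof -
 have "Ck_on k (\<lambda>y::'a. (y, \<omega>)) UNIV"
  by (intro Ck_on_Pair open_UNIV Ck_on_const Ck_on_linear_intro) (auto simp: linear_iff)
 moreover have "\<omega> \<noteq> 0" using assms(2) by auto
 ultimately show ?thesis
  using Ck_on_compose[OF open_UNIV open_off_zero _ _ assms(1)[unfolded Cks_def], of "\<lambda>y. (y, \<omega>)"] assms(2)
  by (simp add: sgn_div_norm)
qed

text \<open>Partial derivatives in the position and, tangentially, in the velocity.  They keep the function
 on phase space as argument, so that they can be iterated.\<close>

definition dX :: "('a::euclidean_space phase => real) => 'a => 'a phase => real" where
 "dX f v p = frechet_derivative (\<lambda>y. f (y, snd p)) (at (fst p)) v"

definition dS :: "('a::euclidean_space phase => real) => 'a => 'a phase => real" where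
 "dS f v p = sphere_deriv (\<lambda>\<eta>. f (fst p, \<eta>)) (snd p) v"

definition transport :: "('a::euclidean_space phase => real) => 'a phase => real" where
 "transport f p = dX f (snd p) p"

definition sphere_lap :: "('a::euclidean_space phase => real) => 'a phase => real" where
 "sphere_lap f p = (\<Sum>b\<in>Basis. dS (dS f b) b p)"

lemma dX_has_derivative:
 assumes f: "Cks (Suc k) f" and p: "p \<in> state_space"
 shows "((\<lambda>y. f (y, snd p)) has_derivative (\<lambda>v. dX f v p)) (at (fst p))"
proof -
 have "norm (snd p) = 1" using p by (auto simp: state_space_def)
 from Ck_on_SucD(1)[OF Cks_slice_x[OF f this] UNIV_I] show ?thesis by (simp add: dX_def[abs_def])
qed

lemma dS_has_derivative:
 assumes f: "Cks (Suc k) f" and p: "p \<in> state_space"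
 shows "((\<lambda>y. f (fst p, sgn y)) has_derivative (\<lambda>v. dS f v p)) (at (snd p))"
proof -
 have "snd p \<in> - {0}" using p by (auto simp: state_space_def)
 from Ck_on_SucD(1)[OF Cks_slice_sphere[OF f] this] show ?thesis
  by (simp add: dS_def[abs_def] sphere_deriv_def)
qed

lemma dX_eqI:
 assumes "((\<lambda>y. f (y, snd p)) has_derivative D) (at (fst p))" shows "dX f v p = D v"
 using frechet_derivative_at[OF assms] by (simp add: dX_def)

lemma dS_eqI:
 assumes "((\<lambda>y. f (fst p, sgn y)) has_derivative D) (at (snd p))" shows "dS f v p = D v"
 using frechet_derivative_at[OF assms] by (simp add: dS_def sphere_deriv_def)

lemma linear_dX: "Cks (Suc k) f ==> p \<in> state_space ==> linear (\<lambda>v. dX f v p)"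
 using dX_has_derivative has_derivative_linear by blast

lemma linear_dS: "Cks (Suc k) f ==> p \<in> state_space ==> linear (\<lambda>v. dS f v p)"
 using dS_has_derivative has_derivative_linear by blast

lemma Cks_derivatives:
 assumes f: "Cks (Suc k) f" shows "Cks k (dX f v)" "Cks k (dS f v)"
proof -
 let ?F = "\<lambda>p. f (retract p)"
 let ?D = "\<lambda>w p. frechet_derivative ?F (at p) w"
 have F: "Ck_on (Suc k) ?F off_zero" using f by (simp add: Cks_def del: Ck_on.simps)
 have D: "Cks k (?D w)" for w by (rule Cks_ambient[OF Ck_on_deriv[OF F]])
 have hd: "(?F has_derivative (\<lambda>w. ?D w p)) (at p)" if "p \<in> state_space" for p
  using Ck_on_SucD(1)[OF F, of p] that state_off_zero by auto
 have "?D (v, 0) p = dX f v p" if p: "p \<in> state_space" for p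
 proof -
  have "((\<lambda>y. (y, snd p)) has_derivative (\<lambda>v. (v, 0))) (at (fst p))" by (auto intro!: derivative_eq_intros)
  from diff_chain_at[OF this, of ?F "\<lambda>w. ?D w p"] hd[OF p]
  have "((\<lambda>y. f (y, snd p)) has_derivative (\<lambda>v. ?D (v, 0) p)) (at (fst p))"
   using p by (simp add: o_def state_space_def sgn_div_norm mem_Times_iff)
  from dX_eqI[OF this] show ?thesis by simp
 qed
 from Cks_cong[OF this D] show "Cks k (dX f v)" .
 have "?D (0, v) p = dS f v p" if p: "p \<in> state_space" for p
 proof -
  have "((\<lambda>y. (fst p, y)) has_derivative (\<lambda>v. (0, v))) (at (snd p))" by (auto intro!: derivative_eq_intros)
  from diff_chain_at[OF this, of ?F "\<lambda>w. ?D w p"] hd[OF p]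
  have "((\<lambda>y. f (fst p, sgn y)) has_derivative (\<lambda>v. ?D (0, v) p)) (at (snd p))" by (simp add: o_def)
  from dS_eqI[OF this] show ?thesis by simp
 qed
 from Cks_cong[OF this D] show "Cks k (dS f v)" .
qed

lemma dX_mult:
 assumes "Cks (Suc j) f" "Cks (Suc k) g" "p \<in> state_space"
 shows "dX (\<lambda>p. f p * g p) v p = f p * dX g v p + dX f v p * g p"
 by (rule dX_eqI[THEN trans])
  (use has_derivative_mult[OF dX_has_derivative[OF assms(1,3)] dX_has_derivative[OF assms(2,3)]] in auto)

lemma dS_mult:
 assumes "Cks (Suc j) f" "Cks (Suc k) g" "p \<in> state_space"
 shows "dS (\<lambda>p. f p * g p) v p = f p * dS g v p + dS f v p * g p"
proof -
 have s: "sgn (snd p) = snd p" using assms(3) by (auto simp: state_space_def sgn_div_norm)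
 show ?thesis
  by (rule dS_eqI[THEN trans])
   (use has_derivative_mult[OF dS_has_derivative[OF assms(1,3)] dS_has_derivative[OF assms(2,3)]] in \<open>auto simp: s\<close>)
qed

lemma dX_add:
 assumes "Cks (Suc j) f" "Cks (Suc k) g" "p \<in> state_space"
 shows "dX (\<lambda>p. f p + g p) v p = dX f v p + dX g v p"
 by (rule dX_eqI) (rule has_derivative_add[OF dX_has_derivative[OF assms(1,3)] dX_has_derivative[OF assms(2,3)]])

lemma dS_add:
 assumes "Cks (Suc j) f" "Cks (Suc k) g" "p \<in> state_space"
 shows "dS (\<lambda>p. f p + g p) v p = dS f v p + dS g v p"
 by (rule dS_eqI) (rule has_derivative_add[OF dS_has_derivative[OF assms(1,3)] dS_has_derivative[OF assms(2,3)]])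

lemma dS_fst [simp]: "dS (\<lambda>p. c (fst p)) v p = 0"
 by (rule dS_eqI[THEN trans]) auto

lemma dX_fst:
 "Ck_on (Suc k) c UNIV ==> dX (\<lambda>p. c (fst p)) v p = frechet_derivative c (at (fst p)) v"
 by (simp add: dX_def)

lemma dX_snd [simp]: "dX (\<lambda>p. c (snd p)) v p = 0"
 by (rule dX_eqI[THEN trans]) auto

lemma dS_cong:
 assumes "\<And>p. p \<in> state_space ==> f p = g p" "p \<in> state_space" shows "dS f v p = dS g v p"
proof -
 have "frechet_derivative (\<lambda>y. f (fst p, sgn y)) (at (snd p)) = frechet_derivative (\<lambda>y. g (fst p, sgn y)) (at (snd p))"
  by (rule frechet_derivative_cong_open[of "- {0}"]) (use assms in \<open>auto simp: state_space_def norm_sgn\<close>)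
 then show ?thesis by (simp add: dS_def sphere_deriv_def)
qed

lemma dS_radial: assumes "Cks (Suc k) f" "p \<in> state_space" shows "dS f (snd p) p = 0"
 unfolding dS_def
 by (rule sphere_deriv_radial[OF Cks_slice_sphere[OF Cks_mono[OF _ assms(1)]]])
  (use assms(2) in \<open>auto simp: state_space_def\<close>)

lemma dX_expand:
 "Cks (Suc k) f ==> p \<in> state_space ==> dX f v p = (\<Sum>b\<in>Basis. (v \<bullet> b) * dX f b p)"
 using linear_euclidean_expand[OF linear_dX, of k f p v] by simp

lemma dS_expand:
 "Cks (Suc k) f ==> p \<in> state_space ==> dS f v p = (\<Sum>b\<in>Basis. (v \<bullet> b) * dS f b p)"
 using linear_euclidean_expand[OF linear_dS, of k f p v] by simp

lemma Cks_transport: assumes "Cks (Suc k) f" shows "Cks k (transport f)"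
proof (rule Cks_cong)
 show "Cks k (\<lambda>p. \<Sum>b\<in>Basis. (snd p \<bullet> b) * dX f b p)" by (intro Cks_intros Cks_derivatives assms)
qed (simp add: transport_def dX_expand[OF assms, symmetric])

lemma Cks_dS_field:
 assumes "Cks (Suc k) f" "\<And>b. b \<in> Basis ==> Ck_on k (\<lambda>x. c x \<bullet> b) UNIV"
 shows "Cks k (\<lambda>p. dS f (c (fst p)) p)"
proof (rule Cks_cong)
 show "Cks k (\<lambda>p. \<Sum>b\<in>Basis. (c (fst p) \<bullet> b) * dS f b p)"
  by (intro Cks_sum Cks_mult Cks_fst[of k "\<lambda>x. c x \<bullet> _"] Cks_derivatives assms)
qed (simp add: dS_expand[OF assms(1), symmetric])

lemma Cks_sphere_lap: "Cks (Suc (Suc k)) f ==> Cks k (sphere_lap f)"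
 unfolding sphere_lap_def[abs_def] by (intro Cks_sum Cks_derivatives)

text \<open>Support bounded in the position variable; the sphere is compact anyway.\<close>

definition xsupp :: "real => ('a::euclidean_space phase => real) => bool" where
 "xsupp R f \<longleftrightarrow> (\<forall>p\<in>state_space. R < norm (fst p) \<longrightarrow> f p = 0)"

lemma xsupp_mult1: "xsupp R f ==> xsupp R (\<lambda>p. f p * g p)"
 and xsupp_mult2: "xsupp R g ==> xsupp R (\<lambda>p. f p * g p)"
 by (simp_all add: xsupp_def)

lemma xsupp_sum: "(\<And>i. i \<in> I ==> xsupp R (f i)) ==> xsupp R (\<lambda>p. \<Sum>i\<in>I. f i p)"
 by (simp add: xsupp_def)

lemma xsupp_dX: assumes "xsupp R f" shows "xsupp R (dX f v)"
 unfolding xsupp_def dX_def using assms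
 by (auto simp: xsupp_def state_space_def intro!: frechet_derivative_eq_0_outside[of R])

lemma xsupp_dS: assumes "xsupp R f" shows "xsupp R (dS f v)"
 unfolding xsupp_def
proof (intro ballI impI)
 fix p :: "'a phase" assume p: "p \<in> state_space" "R < norm (fst p)"
 have "dS f v p = frechet_derivative (\<lambda>y::'a. 0::real) (at (snd p)) v" unfolding dS_def sphere_deriv_def
  by (rule fun_cong[OF frechet_derivative_cong_open[of "- {0}"]])
   (use assms p in \<open>auto simp: xsupp_def state_space_def norm_sgn\<close>)
 also have "\<dots> = 0" using frechet_derivative_at[of "\<lambda>y. 0" "\<lambda>v. 0" "snd p"] by (metis has_derivative_const)
 finally show "dS f v p = 0" .
qed

lemma xsupp_transport: "xsupp R f ==> xsupp R (transport f)"
 using xsupp_dX unfolding xsupp_def transport_def by blast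

lemma xsupp_dS_field: "xsupp R f ==> xsupp R (\<lambda>p. dS f (c (fst p)) p)"
 using xsupp_dS unfolding xsupp_def by blast

lemma xsupp_sphere_lap: "xsupp R f ==> xsupp R (sphere_lap f)"
 unfolding sphere_lap_def[abs_def] by (intro xsupp_sum xsupp_dS)

section \<open>Integration over phase space\<close>

lemma measurable_ident_flat [measurable]:
 "(\<lambda>p. p) \<in> measurable flat_measure (borel :: 'a::euclidean_space phase measure)"
proof -
 have "(\<lambda>p. (fst p, snd p)) \<in> measurable (lborel \<Otimes>\<^sub>M sphere_measure) ((borel :: 'a measure) \<Otimes>\<^sub>M (borel :: 'a measure))"
 proof (rule measurable_Pair)
  show "fst \<in> measurable (lborel \<Otimes>\<^sub>M (sphere_measure :: 'a measure)) (borel :: 'a measure)" by measurable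
  show "snd \<in> measurable ((lborel :: 'a measure) \<Otimes>\<^sub>M sphere_measure) (borel :: 'a measure)"
   by (rule measurable_compose[OF measurable_snd measurable_ident_sphere])
 qed
 then show ?thesis by (simp add: borel_prod flat_measure_def)
qed

lemma closed_state_space: "closed (state_space :: 'a::euclidean_space phase set)"
 unfolding state_space_def by (intro closed_Times) auto

lemma flat_measurable_continuous:
 fixes f :: "'a::euclidean_space phase => real"
 assumes "continuous_on state_space f" shows "f \<in> borel_measurable flat_measure"
proof -
 have "(\<lambda>p. indicator state_space p *\<^sub>R f p) \<in> borel_measurable borel"
  by (rule borel_measurable_continuous_on_indicator[OF borel_closed[OF closed_state_space] assms])
 from measurable_compose[OF measurable_ident_flat this]
 show ?thesis by (rule measurable_cong[THEN iffD1, rotated]) simp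
qed

lemma Cks_measurable: "Cks k f ==> f \<in> borel_measurable flat_measure"
 by (rule flat_measurable_continuous[OF Cks_continuous])

lemma sets_cylinder: "cyl R \<in> sets (flat_measure :: 'a::euclidean_space phase measure)"
 unfolding flat_measure_def by (rule pair_measureI) (auto simp: sets_sphere_measure sets_restrict_space)

lemma emeasure_cylinder_finite:
 "emeasure (flat_measure :: 'a::euclidean_space phase measure) (cyl R) < \<infinity>"
 unfolding flat_measure_def
 using emeasure_lborel_cball_finite[of "0::'a" R]
 by (subst sphere.emeasure_pair_measure_Times)
  (auto simp: sets_sphere_measure sets_restrict_space emeasure_sphere_measure)

lemma flat_bounded_support:
 fixes f :: "'a::euclidean_space phase => real"
 assumes "continuous_on state_space f" "xsupp R f"
 obtains B where "\<And>p. p \<in> state_space ==> \<bar>f p\<bar> \<le> B * indicator (cyl R) p"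
proof -
 have "compact (f ` (cyl R))"
  by (rule compact_continuous_image[OF continuous_on_subset[OF assms(1)]])
   (auto simp: state_space_def intro: compact_Times)
 then obtain B where B: "\<And>p. p \<in> cyl R ==> norm (f p) \<le> B"
  by (meson bounded_iff compact_imp_bounded imageI)
 have "\<bar>f p\<bar> \<le> B * indicator (cyl R) p" if p: "p \<in> state_space" for p
  using B[of p] p assms(2) by (cases p; cases "norm (fst p) \<le> R") (auto simp: xsupp_def state_space_def indicator_def mem_Times_iff)
 then show thesis by (rule that)
qed

lemma flat_integrable:
 fixes f :: "'a::euclidean_space phase => real"
 assumes c: "continuous_on state_space f" and s: "xsupp R f"
 shows "integrable flat_measure f"
proof -
 obtain B where B: "\<And>p. p \<in> state_space ==> \<bar>f p\<bar> \<le> B * indicator (cyl R) p"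
  using flat_bounded_support[OF c s] by blast
 have ind: "integrable flat_measure (indicator (cyl R) :: 'a phase => real)"
  by (rule integrable_real_indicator[OF sets_cylinder emeasure_cylinder_finite])
 have i: "integrable flat_measure (\<lambda>p :: 'a phase. B * indicator (cyl R) p)"
  by (rule integrable_mult_right) (rule ind)
 show ?thesis
 proof (rule Bochner_Integration.integrable_bound[OF i flat_measurable_continuous[OF c]], rule AE_I2)
  fix p :: "'a phase" assume "p \<in> space flat_measure"
  then have "\<bar>f p\<bar> \<le> B * indicator (cyl R) p" using B by simp
  then show "norm (f p) \<le> norm (B * indicator (cyl R) p)" by simp
 qed
qed

lemma Cks_integrable: "Cks k f ==> xsupp R f ==> integrable flat_measure f"
 by (rule flat_integrable[OF Cks_continuous])

lemma L2_funs_continuous: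
 assumes "continuous_on state_space f" "xsupp R f" shows "f \<in> L2_funs flat_measure"
 unfolding L2_funs_def using assms
 by (auto intro!: flat_measurable_continuous flat_integrable[of _ R] continuous_intros simp: xsupp_def)

lemma integral_transport_eq_0:
 fixes f :: "'a::euclidean_space phase => real"
 assumes f: "Cks (Suc k) f" and s: "xsupp R f"
 shows "(\<ointegral>p. transport f p) = 0"
proof -
 have i: "integrable (lborel \<Otimes>\<^sub>M sphere_measure) (\<lambda>(x, \<omega>). transport f (x, \<omega>))"
  using Cks_integrable[OF Cks_transport[OF f] xsupp_transport[OF s]] by (simp add: flat_measure_def)
 have "(\<ointegral>p. transport f p) = (\<integral>\<omega>. (\<integral>x. transport f (x, \<omega>) \<partial>lborel) \<partial>sphere_measure)"
  using phase.integral_snd[OF i] by (simp add: flat_measure_def)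
 also have "\<dots> = (\<integral>\<omega>. 0 \<partial>(sphere_measure :: 'a measure))"
 proof (rule lint_cong)
  fix \<omega> :: 'a assume w: "\<omega> \<in> space sphere_measure"
  show "(\<integral>x. transport f (x, \<omega>) \<partial>lborel) = 0"
   unfolding transport_def dX_def fst_conv snd_conv
   by (rule integral_directional_derivative_eq_0[of _ R])
    (use w s Cks_slice_x[OF Cks_mono[OF _ f, of 1]] in \<open>auto simp: xsupp_def state_space_def\<close>)
 qed
 finally show ?thesis by simp
qed

text \<open>Tangential derivatives integrate to the mean curvature term, \<open>d - 1\<close> times the normal component.\<close>

lemma integral_dS:
 fixes f :: "'a::euclidean_space phase => real"
 assumes f: "Cks (Suc k) f" and s: "xsupp R f"
 shows "(\<ointegral>p. dS f v p) = (real DIM('a) - 1) * (\<ointegral>p. (snd p \<bullet> v) * f p)"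
proof -
 have i: "integrable (lborel \<Otimes>\<^sub>M sphere_measure) (\<lambda>p. dS f v p)"
  using Cks_integrable[OF Cks_derivatives(2)[OF f] xsupp_dS[OF s]] by (simp add: flat_measure_def)
 have j: "integrable (lborel \<Otimes>\<^sub>M sphere_measure) (\<lambda>p. (snd p \<bullet> v) * f p)"
  using Cks_integrable[OF Cks_mult[OF Cks_snd_inner f] xsupp_mult2[OF s]] by (simp add: flat_measure_def)
 have "(\<ointegral>p. dS f v p) = (\<integral>x. (\<integral>\<omega>. dS f v (x, \<omega>) \<partial>sphere_measure) \<partial>lborel)"
  using phase.integral_fst'[OF i] by (simp add: flat_measure_def)
 also have "\<dots> = (\<integral>x. (real DIM('a) - 1) * (\<integral>\<omega>. (\<omega> \<bullet> v) * f (x, \<omega>) \<partial>sphere_measure) \<partial>lborel)"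
  unfolding dS_def fst_conv snd_conv
  by (intro lint_cong integral_sphere_deriv Cks_slice_sphere Cks_mono[OF _ f]) simp
 also have "\<dots> = (real DIM('a) - 1) * (\<ointegral>p. (snd p \<bullet> v) * f p)"
  using phase.integral_fst'[OF j] by (simp add: flat_measure_def)
 finally show ?thesis .
qed

lemma integral_dS_field:
 fixes f :: "'a::euclidean_space phase => real"
 assumes f: "Cks (Suc k) f" and s: "xsupp R f" and c: "\<And>b. b \<in> Basis ==> Ck_on (Suc k) (\<lambda>x. c x \<bullet> b) UNIV"
 shows "(\<ointegral>p. dS f (c (fst p)) p)
  = (real DIM('a) - 1) * (\<ointegral>p. (snd p \<bullet> c (fst p)) * f p)"
proof -
 let ?h = "\<lambda>b p. (c (fst p) \<bullet> b) * f p"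
 have cf: "Cks (Suc k) (\<lambda>p. c (fst p) \<bullet> b)" if "b \<in> Basis" for b using Cks_fst[OF c[OF that]] .
 have h: "Cks (Suc k) (?h b)" "xsupp R (?h b)" if "b \<in> Basis" for b
  by (intro Cks_mult cf f that, intro xsupp_mult2 s)
 have dh: "dS (?h b) b p = (c (fst p) \<bullet> b) * dS f b p" if "b \<in> Basis" "p \<in> state_space" for b p
  using dS_mult[OF cf[OF that(1)] f that(2), of b] dS_fst[of "\<lambda>x. c x \<bullet> b"] by simp
 have "(\<ointegral>p. dS f (c (fst p)) p) = (\<ointegral>p. (\<Sum>b\<in>Basis. dS (?h b) b p))"
  by (intro Bochner_Integration.integral_cong refl) (simp add: dh dS_expand[OF f, symmetric])
 also have "\<dots> = (\<Sum>b\<in>Basis. (\<ointegral>p. dS (?h b) b p))"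
  by (rule lint_sum) (rule Cks_integrable[OF Cks_derivatives(2)[OF h(1)] xsupp_dS[OF h(2)]])
 also have "\<dots> = (\<Sum>b\<in>Basis. (real DIM('a) - 1) * (\<ointegral>p. (snd p \<bullet> b) * ?h b p))"
  by (auto intro!: sum.cong integral_dS[OF h] simp del: mult_cancel_left)
 also have "\<dots> = (real DIM('a) - 1) * (\<ointegral>p. (\<Sum>b\<in>Basis. (snd p \<bullet> b) * ?h b p))"
  by (subst lint_sum)
   (auto simp: sum_distrib_left intro!: Cks_integrable[OF Cks_mult[OF Cks_snd_inner h(1)] xsupp_mult2[OF h(2)]])
 also have "(\<lambda>p. \<Sum>b\<in>Basis. (snd p \<bullet> b) * ?h b p) = (\<lambda>p. (snd p \<bullet> c (fst p)) * f p)"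
  by (simp add: euclidean_inner[of _ "c _"] sum_distrib_right mult.assoc)
 finally show ?thesis .
qed

text \<open>Green's formula.  The mean curvature terms cancel since a spherical gradient has no normal component.\<close>

lemma integral_sphere_lap:
 fixes f u :: "'a::euclidean_space phase => real"
 assumes f: "Cks (Suc (Suc k)) f" and u: "Cks (Suc k) u" and s: "xsupp R u"
 shows "(\<ointegral>p. u p * sphere_lap f p) = - (\<ointegral>p. (\<Sum>b\<in>Basis. dS u b p * dS f b p))"
proof -
 note df = Cks_derivatives(2)[OF f]
 have f1: "Cks (Suc k) f" by (rule Cks_mono[OF _ f]) simp
 let ?h = "\<lambda>b p. u p * dS f b p"
 have h: "Cks (Suc k) (?h b)" "xsupp R (?h b)" for b
  by (intro Cks_mult u df, intro xsupp_mult1 s)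
 have "(\<Sum>b\<in>Basis. (\<ointegral>p. dS (?h b) b p)) = (\<Sum>b\<in>Basis. (real DIM('a) - 1) * (\<ointegral>p. (snd p \<bullet> b) * ?h b p))"
  by (intro sum.cong refl integral_dS[OF h])
 also have "\<dots> = (real DIM('a) - 1) * (\<ointegral>p. (\<Sum>b\<in>Basis. (snd p \<bullet> b) * ?h b p))"
  by (subst lint_sum)
   (auto simp: sum_distrib_left intro!: Cks_integrable[OF Cks_mult[OF Cks_snd_inner h(1)] xsupp_mult2[OF h(2)]])
 also have "(\<ointegral>p. (\<Sum>b\<in>Basis. (snd p \<bullet> b) * ?h b p)) = (\<integral>p. 0 \<partial>(flat_measure :: 'a phase measure))"
 proof (rule lint_cong)
  fix p :: "'a phase" assume "p \<in> space flat_measure"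
  then have p: "p \<in> state_space" by simp
  have "(\<Sum>b\<in>Basis. (snd p \<bullet> b) * ?h b p) = u p * (\<Sum>b\<in>Basis. (snd p \<bullet> b) * dS f b p)"
   by (simp add: sum_distrib_left mult.left_commute)
  then show "(\<Sum>b\<in>Basis. (snd p \<bullet> b) * ?h b p) = 0"
   using dS_expand[OF f p, of "snd p"] dS_radial[OF f p] by simp
 qed
 finally have z: "(\<Sum>b\<in>Basis. (\<ointegral>p. dS (?h b) b p)) = 0" by simp
 have "(\<Sum>b\<in>Basis. (\<ointegral>p. dS (?h b) b p)) = (\<ointegral>p. (\<Sum>b\<in>Basis. dS (?h b) b p))"
  by (rule lint_sum[symmetric]) (rule Cks_integrable[OF Cks_derivatives(2)[OF h(1)] xsupp_dS[OF h(2)]])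
 also have "\<dots> = (\<ointegral>p. u p * sphere_lap f p + (\<Sum>b\<in>Basis. dS u b p * dS f b p))"
  by (intro Bochner_Integration.integral_cong refl)
   (simp add: dS_mult[OF u df] sphere_lap_def sum.distrib sum_distrib_left)
 also have "\<dots> = (\<ointegral>p. u p * sphere_lap f p) + (\<ointegral>p. (\<Sum>b\<in>Basis. dS u b p * dS f b p))"
 proof (rule lint_add)
  show "integrable flat_measure (\<lambda>p. u p * sphere_lap f p)"
   by (rule Cks_integrable[OF Cks_mult[OF Cks_mono[OF _ u] Cks_sphere_lap[OF f]] xsupp_mult1[OF s]]) simp
  show "integrable flat_measure (\<lambda>p. \<Sum>b\<in>Basis. dS u b p * dS f b p)"
   by (rule Cks_integrable[OF Cks_sum[OF Cks_mult[OF Cks_derivatives(2)[OF u] Cks_derivatives(2)[OF f1]]]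
     xsupp_sum[OF xsupp_mult1[OF xsupp_dS[OF s]]]])
 qed
 finally show ?thesis using z by simp
qed

section \<open>The Langevin operator in these terms\<close>

lemma frechet_derivative_eq_grad:
 assumes "Ck_on (Suc k) V UNIV" shows "frechet_derivative V (at x) v = grad V x \<bullet> v"
proof -
 have "linear (frechet_derivative V (at x))"
  using Ck_on_SucD(1)[OF assms UNIV_I] has_derivative_linear by blast
 from linear_euclidean_expand[OF this, of v] show ?thesis
  unfolding grad_def inner_sum_left inner_scaleR_left by (simp add: inner_commute mult.commute)
qed

lemma Ck_on_grad:
 assumes "Ck_on (Suc k) V UNIV" shows "Ck_on k (\<lambda>x. grad V x \<bullet> v) UNIV"
 using Ck_on_deriv[OF assms, of v] frechet_derivative_eq_grad[OF assms] by simp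

lemma langevin_eq:
 fixes f :: "'a::euclidean_space phase => real"
 assumes f: "Cks (Suc (Suc k)) f" and p: "p \<in> state_space"
 shows "langevin V \<sigma> f p = transport f p - 1 / (real DIM('a) - 1) * dS f (grad V (fst p)) p
  + 1 / 2 * \<sigma>\<^sup>2 * sphere_lap f p"
proof -
 obtain x \<omega> where xw: "p = (x, \<omega>)" by (cases p)
 have w: "norm \<omega> = 1" using p by (auto simp: xw state_space_def)
 have f1: "Cks (Suc k) f" by (rule Cks_mono[OF _ f]) simp
 have 1: "\<omega> \<bullet> grad (\<lambda>y. f (y, \<omega>)) x = transport f p"
  unfolding transport_def dX_expand[OF f p, of "snd p"]
  by (simp add: grad_def dX_def xw inner_sum_right mult.commute)
 have G: "sphere_grad (\<lambda>\<eta>. f (x, \<eta>)) \<eta> = (\<Sum>b\<in>Basis. dS f b (x, \<eta>) *\<^sub>R b)" for \<eta>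
  by (simp add: sphere_grad_def dS_def)
 have sg: "w \<bullet> sphere_grad (\<lambda>\<eta>. f (x, \<eta>)) \<omega> = dS f w p" for w
  unfolding G dS_expand[OF f p, of w] by (simp add: xw inner_sum_right mult.commute)
 have 2: "sphere_grad (potential V x) \<omega> \<bullet> sphere_grad (\<lambda>\<eta>. f (x, \<eta>)) \<omega>
   = 1 / (real DIM('a) - 1) * dS f (grad V (fst p)) p"
 proof -
  have "dS f (grad V x - (grad V x \<bullet> \<omega>) *\<^sub>R \<omega>) p = dS f (grad V x) p"
   using linear_diff[OF linear_dS[OF f p], of "grad V x" "(grad V x \<bullet> \<omega>) *\<^sub>R \<omega>"]
    linear_scale[OF linear_dS[OF f p], of "grad V x \<bullet> \<omega>" \<omega>] dS_radial[OF f p] by (simp add: xw)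
  then show ?thesis
   unfolding sg sphere_grad_potential[OF w]
   using linear_scale[OF linear_dS[OF f p], of "1 / (real DIM('a) - 1)" "grad V x - (grad V x \<bullet> \<omega>) *\<^sub>R \<omega>"]
   by (simp add: xw)
 qed
 have 3: "laplace_beltrami (\<lambda>\<eta>. f (x, \<eta>)) \<omega> = sphere_lap f p"
 proof -
  have "((\<lambda>y. \<Sum>b\<in>Basis. dS f b (x, sgn y) *\<^sub>R b) has_derivative (\<lambda>v. \<Sum>b\<in>Basis. dS (dS f b) v p *\<^sub>R b)) (at \<omega>)"
   using dS_has_derivative[OF Cks_derivatives(2)[OF f] p] unfolding xw
   by (intro has_derivative_sum has_derivative_scaleR_left) simp
  note fd = frechet_derivative_at[OF this]
  have "sphere_deriv (sphere_grad (\<lambda>\<eta>. f (x, \<eta>))) \<omega> v = (\<Sum>b\<in>Basis. dS (dS f b) v p *\<^sub>R b)" for v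
   unfolding sphere_deriv_def G by (rule fun_cong[OF fd[symmetric]])
  then show ?thesis
   by (simp add: laplace_beltrami_def sphere_div_def sphere_lap_def inner_sum_left inner_Basis if_distrib cong: if_cong)
 qed
 show ?thesis by (simp add: langevin_def xw 1[unfolded xw] 2[unfolded xw] 3[unfolded xw])
qed

lemma langevin_continuous:
 assumes V: "Ck_on 1 V UNIV" and f: "Cks 2 f" shows "continuous_on state_space (langevin V \<sigma> f)"
proof -
 have f2: "Cks (Suc (Suc 0)) f" using f by (simp add: numeral_2_eq_2)
 have f1: "Cks (Suc 0) f" by (rule Cks_mono[OF _ f]) simp
 have V1: "Ck_on (Suc 0) V UNIV" using V by simp
 have "Cks 0 (\<lambda>p. transport f p + (- (1 / (real DIM('a) - 1))) * dS f (grad V (fst p)) p + 1 / 2 * \<sigma>\<^sup>2 * sphere_lap f p)"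
  by (intro Cks_add Cks_mult Cks_const Cks_transport Cks_dS_field Cks_sphere_lap f2 f1 Ck_on_grad[OF V1])
 from Cks_continuous[OF this] show ?thesis
  by (rule continuous_on_eq) (simp add: langevin_eq[OF f2])
qed

lemma langevin_xsupp:
 assumes f: "Cks 2 f" and s: "xsupp R f" shows "xsupp R (langevin V \<sigma> f)"
proof -
 have f2: "Cks (Suc (Suc 0)) f" using f by (simp add: numeral_2_eq_2)
 show ?thesis
  using xsupp_transport[OF s] xsupp_dS_field[OF s, of "grad V"] xsupp_sphere_lap[OF s]
  unfolding xsupp_def by (simp add: langevin_eq[OF f2])
qed

lemma test_function_Cks: assumes "f \<in> test_functions" shows "Cks k f"
 unfolding Cks_def
proof (rule Ck_on_local)
 fix p :: "'a phase" assume p: "p \<in> off_zero"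
 have "smooth_on_submanifold state_space f" using assms by (simp add: test_functions_def)
 then obtain U F where U: "open U" "retract p \<in> U" "smooth_on U F" "\<And>q. q \<in> U \<inter> state_space ==> F q = f q"
  using retract_state[OF p] unfolding smooth_on_submanifold_def by meson
 let ?W = "off_zero \<inter> retract -` U"
 have W: "open ?W"
  using continuous_open_preimage[OF Ck_on_continuous[OF Ck_on_retract] open_off_zero U(1)] .
 have "Ck_on k (\<lambda>p. F (retract p)) ?W"
  by (rule Ck_on_compose[OF W U(1) _ Ck_on_subset[OF Ck_on_retract]]) (use U(3) in \<open>auto simp: smooth_on_def\<close>)
 then have "Ck_on k (\<lambda>p. f (retract p)) ?W"
  by (rule Ck_on_cong[OF W, rotated]) (use U(4) retract_state in \<open>auto simp del: mem_Sigma_iff\<close>)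
 then show "\<exists>U. open U \<and> p \<in> U \<and> Ck_on k (\<lambda>p. f (retract p)) U" using W p U(2) by blast
qed

lemma test_function_xsupp: assumes "f \<in> test_functions" obtains R where "xsupp R f"
proof -
 have "bounded (closure {p \<in> state_space. f p \<noteq> 0})"
  using assms by (simp add: test_functions_def compact_imp_bounded)
 then have "bounded {p \<in> state_space. f p \<noteq> 0}" by (rule bounded_subset[OF _ closure_subset])
 then obtain R where R: "\<And>p. p \<in> state_space ==> f p \<noteq> 0 ==> norm p \<le> R" by (auto simp: bounded_iff)
 have "xsupp R f" unfolding xsupp_def
  using R norm_fst_le by (metis leD order_trans prod.collapse)
 then show thesis by (rule that)
qed

lemma test_functionI:
 assumes F: "smooth_on UNIV f" and s: "xsupp R f" shows "f \<in> test_functions"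
proof -
 have "smooth_on_submanifold state_space f"
  unfolding smooth_on_submanifold_def using F by (auto intro!: exI[of _ UNIV] exI[of _ f])
 moreover have "bounded {p \<in> state_space. f p \<noteq> 0}"
 proof (rule bounded_subset)
  show "bounded (cball (0::'a) R \<times> (unit_sphere :: 'a set))" by (intro bounded_Times compact_imp_bounded compact_cball compact_sphere)
  show "{p \<in> state_space. f p \<noteq> 0} \<subseteq> cball (0::'a) R \<times> unit_sphere"
   using s by (force simp: xsupp_def state_space_def not_less)
 qed
 ultimately show ?thesis by (simp add: test_functions_def compact_closure)
qed

text \<open>The drift on the sphere has divergence \<open>\<nabla>V \<bullet> \<omega>\<close>, which is exactly compensated by
 transporting the weight \<open>e\<^sup>-\<^sup>V\<close>; only the Laplacian contributes to the energy.\<close>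

lemma langevin_dissipative:
 fixes f :: "'a::euclidean_space phase => real"
 assumes d: "2 \<le> DIM('a)" and V: "Ck_on 2 V UNIV" and f: "Cks 2 f" and s: "xsupp R f"
 shows "(\<ointegral>p. exp (- V (fst p)) * (f p * langevin V \<sigma> f p)) \<le> 0"
proof -
 have f2: "Cks (Suc (Suc 0)) f" using f by (simp add: numeral_2_eq_2)
 have f1: "Cks (Suc 0) f" by (rule Cks_mono[OF _ f]) simp
 have V2: "Ck_on (Suc (Suc 0)) V UNIV" using V by (simp add: numeral_2_eq_2)
 have V1: "Ck_on (Suc 0) V UNIV" by (rule Ck_on_mono[OF _ V2]) simp
 let ?e = "\<lambda>x. exp (- V x)"
 let ?E = "\<lambda>p::'a phase. exp (- V (fst p))"
 have e: "Ck_on (Suc 0) ?e UNIV"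
 proof -
  have "Ck_on (Suc 0) (\<lambda>x. (-1) * V x) UNIV" by (intro Ck_on_mult Ck_on_const V1 open_UNIV)
  from Ck_on_compose[OF open_UNIV open_UNIV _ this Ck_on_exp] show ?thesis by simp
 qed
 have de: "frechet_derivative ?e (at x) v = - (grad V x \<bullet> v) * ?e x" for x v
 proof -
  have "(?e has_derivative (\<lambda>v. ?e x * (- frechet_derivative V (at x) v))) (at x)"
   by (auto intro!: derivative_eq_intros Ck_on_SucD(1)[OF V1])
  from frechet_derivative_at[OF this] show ?thesis
   by (simp add: frechet_derivative_eq_grad[OF V1] fun_eq_iff mult.commute)
 qed
 have E: "Cks (Suc 0) ?E" by (rule Cks_fst[OF e])
 have ff: "Cks (Suc 0) (\<lambda>p. f p * f p)" by (intro Cks_mult f1)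
 have fE: "Cks (Suc 0) (\<lambda>p. f p * ?E p)" by (intro Cks_mult f1 E)
 let ?h = "\<lambda>p. (f p * f p) * ?E p"
 have h: "Cks (Suc 0) ?h" "xsupp R ?h" by (intro Cks_mult f1 E, intro xsupp_mult1 s)
 let ?I = "\<ointegral>p. (snd p \<bullet> grad V (fst p)) * ?h p"
 have gV: "Ck_on (Suc 0) (\<lambda>x. grad V x \<bullet> b) UNIV" for b by (rule Ck_on_grad[OF V2])
 have iG: "integrable flat_measure (\<lambda>p. (snd p \<bullet> grad V (fst p)) * ?h p)"
 proof (rule Cks_integrable[OF Cks_mult[OF _ h(1)] xsupp_mult2[OF h(2)]])
  have "Cks (Suc 0) (\<lambda>p. \<Sum>b\<in>Basis. (snd p \<bullet> b) * (grad V (fst p) \<bullet> b))"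
   by (intro Cks_sum Cks_mult Cks_snd_inner Cks_fst[OF gV])
  then show "Cks (Suc 0) (\<lambda>p. snd p \<bullet> grad V (fst p))" by (simp add: euclidean_inner[of _ "grad V _"])
 qed
 have i1: "integrable flat_measure (\<lambda>p. ?E p * (f p * transport f p))"
  by (rule Cks_integrable[OF _ xsupp_mult2[OF xsupp_mult1[OF s]], of 0])
   (intro Cks_mult Cks_transport f1 Cks_mono[OF _ f1] Cks_mono[OF _ E], simp_all)
 have i2: "integrable flat_measure (\<lambda>p. ?E p * (f p * dS f (grad V (fst p)) p))"
  by (rule Cks_integrable[OF _ xsupp_mult2[OF xsupp_mult1[OF s]], of 0])
   (intro Cks_mult Cks_dS_field f1 Ck_on_grad[OF V1] Cks_mono[OF _ f1] Cks_mono[OF _ E], simp_all)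
 have i3: "integrable flat_measure (\<lambda>p. (f p * ?E p) * sphere_lap f p)"
  by (rule Cks_integrable[OF _ xsupp_mult1[OF xsupp_mult1[OF s]], of 0])
   (intro Cks_mult Cks_sphere_lap f2 Cks_mono[OF _ f1] Cks_mono[OF _ E], simp_all)
 have 1: "2 * (\<ointegral>p. ?E p * (f p * transport f p)) = ?I"
 proof -
  have "0 = (\<ointegral>p. transport ?h p)" by (rule integral_transport_eq_0[OF h, symmetric])
  also have "\<dots> = (\<ointegral>p. 2 * (?E p * (f p * transport f p)) - (snd p \<bullet> grad V (fst p)) * ?h p)"
  proof (rule lint_cong)
   fix p :: "'a phase" assume "p \<in> space flat_measure"
   then have p: "p \<in> state_space" by simp
   show "transport ?h p = 2 * (?E p * (f p * transport f p)) - (snd p \<bullet> grad V (fst p)) * ?h p"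
    unfolding transport_def dX_mult[OF ff E p] dX_mult[OF f1 f1 p] dX_fst[OF e] de
    by (simp add: algebra_simps inner_commute)
  qed
  also have "\<dots> = 2 * (\<ointegral>p. ?E p * (f p * transport f p)) - ?I" using i1 iG by simp
  finally show ?thesis by simp
 qed
 have 2: "2 * (\<ointegral>p. ?E p * (f p * dS f (grad V (fst p)) p)) = (real DIM('a) - 1) * ?I"
 proof -
  have "(real DIM('a) - 1) * ?I = (\<ointegral>p. dS ?h (grad V (fst p)) p)"
   by (rule integral_dS_field[OF h gV, symmetric])
  also have "\<dots> = (\<ointegral>p. 2 * (?E p * (f p * dS f (grad V (fst p)) p)))"
  proof (rule lint_cong)
   fix p :: "'a phase" assume "p \<in> space flat_measure"
   then have p: "p \<in> state_space" by simp
   show "dS ?h (grad V (fst p)) p = 2 * (?E p * (f p * dS f (grad V (fst p)) p))"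
    unfolding dS_mult[OF ff E p] dS_mult[OF f1 f1 p] dS_fst[of ?e] by (simp add: algebra_simps)
  qed
  finally show ?thesis by simp
 qed
 have 3: "(\<ointegral>p. (f p * ?E p) * sphere_lap f p) \<le> 0"
 proof -
  have "(\<ointegral>p. (f p * ?E p) * sphere_lap f p) = - (\<ointegral>p. (\<Sum>b\<in>Basis. dS (\<lambda>p. f p * ?E p) b p * dS f b p))"
   by (rule integral_sphere_lap[OF f2 fE xsupp_mult1[OF s]])
  also have "(\<ointegral>p. (\<Sum>b\<in>Basis. dS (\<lambda>p. f p * ?E p) b p * dS f b p))
    = (\<ointegral>p. (\<Sum>b\<in>Basis. ?E p * (dS f b p)\<^sup>2))"
   by (intro Bochner_Integration.integral_cong refl)
    (simp add: dS_mult[OF f1 E] dS_fst[of ?e] power2_eq_square algebra_simps)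
  also have "- \<dots> \<le> 0" by (simp add: integral_nonneg_AE sum_nonneg)
  finally show ?thesis .
 qed
 have "(\<ointegral>p. ?E p * (f p * langevin V \<sigma> f p))
  = (\<ointegral>p. ?E p * (f p * transport f p) - 1 / (real DIM('a) - 1) * (?E p * (f p * dS f (grad V (fst p)) p))
    + 1 / 2 * \<sigma>\<^sup>2 * ((f p * ?E p) * sphere_lap f p))"
  by (intro Bochner_Integration.integral_cong refl) (simp add: langevin_eq[OF f2] algebra_simps)
 also have "\<dots> = (\<ointegral>p. ?E p * (f p * transport f p))
   - 1 / (real DIM('a) - 1) * (\<ointegral>p. ?E p * (f p * dS f (grad V (fst p)) p))
   + 1 / 2 * \<sigma>\<^sup>2 * (\<ointegral>p. (f p * ?E p) * sphere_lap f p)"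
  using i1 i2 i3 by simp
 also have "\<dots> = 1 / 2 * \<sigma>\<^sup>2 * (\<ointegral>p. (f p * ?E p) * sphere_lap f p)"
  using 1 2 d by (simp add: field_simps)
 also have "\<dots> \<le> 0" using 3 by (simp add: mult_nonneg_nonpos)
 finally show ?thesis .
qed


section \<open>Zonal kernels on the sphere\<close>

text \<open>The squared cosine of half the angle between two unit vectors.  Its powers concentrate at
 \<open>\<eta> = \<omega>\<close>, and they are polynomials.\<close>

definition cap :: "'a::euclidean_space => 'a => real" where "cap \<omega> \<eta> = (1 + \<omega> \<bullet> \<eta>) / 2"

lemma cap_commute: "cap \<omega> \<eta> = cap \<eta> \<omega>" by (simp add: cap_def inner_commute)

lemma continuous_cap [continuous_intros]:
 "continuous_on S f ==> continuous_on S g ==> continuous_on S (\<lambda>x. cap (f x) (g x))"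
 unfolding cap_def by (intro continuous_intros) auto

lemma cap_bounds:
 assumes "norm \<omega> = 1" "norm \<eta> = 1" shows "0 \<le> cap \<omega> \<eta>" "cap \<omega> \<eta> \<le> 1"
 using norm_cauchy_schwarz[of \<omega> \<eta>] norm_cauchy_schwarz[of \<omega> "-\<eta>"] assms by (simp_all add: cap_def)

lemma norm_diff_cap:
 assumes "norm \<omega> = 1" "norm \<eta> = 1" shows "(norm (\<omega> - \<eta>))\<^sup>2 = 4 * (1 - cap \<omega> \<eta>)"
proof -
 have e: "\<omega> \<bullet> \<omega> = 1" "\<eta> \<bullet> \<eta> = 1" using assms by (simp_all add: dot_square_norm)
 show ?thesis unfolding power2_norm_eq_inner cap_def
  by (simp add: inner_diff_left inner_diff_right e inner_commute[of \<eta> \<omega>] add_divide_distrib)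
qed

lemma sphere_deriv_cap_power:
 assumes "norm \<eta> = 1"
 shows "sphere_deriv (\<lambda>\<eta>. cap \<omega> \<eta> ^ N) \<eta> v
  = real N / 2 * cap \<omega> \<eta> ^ (N - 1) * (\<omega> \<bullet> v - (\<omega> \<bullet> \<eta>) * (\<eta> \<bullet> v))"
proof -
 have s: "sgn \<eta> = \<eta>" using assms by (simp add: sgn_div_norm)
 have "((\<lambda>y. \<omega> \<bullet> sgn y) has_derivative (\<lambda>v. \<omega> \<bullet> (v - (v \<bullet> \<eta>) *\<^sub>R \<eta>))) (at \<eta>)"
  by (intro has_derivative_inner_right has_derivative_sgn_unit assms)
 then have "((\<lambda>y. (1/2) * (1 + \<omega> \<bullet> sgn y)) has_derivative (\<lambda>v. (1/2) * (0 + \<omega> \<bullet> (v - (v \<bullet> \<eta>) *\<^sub>R \<eta>)))) (at \<eta>)"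
  by (intro has_derivative_mult_right has_derivative_add has_derivative_const)
 then have 1: "((\<lambda>y. cap \<omega> (sgn y)) has_derivative (\<lambda>v. (\<omega> \<bullet> v - (\<omega> \<bullet> \<eta>) * (\<eta> \<bullet> v)) / 2)) (at \<eta>)"
  by (simp add: cap_def inner_diff_right inner_commute mult.commute)
 have "((\<lambda>y. cap \<omega> (sgn y) ^ N) has_derivative
   (\<lambda>v. real N * ((\<omega> \<bullet> v - (\<omega> \<bullet> \<eta>) * (\<eta> \<bullet> v)) / 2) * cap \<omega> (sgn \<eta>) ^ (N - 1))) (at \<eta>)"
  using has_derivative_power[OF 1, of N] by simp
 note fd = frechet_derivative_at[OF this]
 have "sphere_deriv (\<lambda>\<eta>. cap \<omega> \<eta> ^ N) \<eta> v
   = real N * ((\<omega> \<bullet> v - (\<omega> \<bullet> \<eta>) * (\<eta> \<bullet> v)) / 2) * cap \<omega> (sgn \<eta>) ^ (N - 1)"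
  unfolding sphere_deriv_def by (rule fun_cong[OF fd[symmetric]])
 then show ?thesis by (simp add: s)
qed

lemma Ck_on_cap_sgn: "Ck_on k (\<lambda>y. cap \<omega> (sgn y) ^ N) (- {0 :: 'a::euclidean_space})"
proof -
 have o: "open (- {0::'a})" by auto
 have "Ck_on k (\<lambda>y::'a. (1/2) * (1 + \<omega> \<bullet> sgn y)) (- {0})"
  by (intro Ck_on_mult Ck_on_add Ck_on_const Ck_on_bilinear[OF o bounded_bilinear_inner] Ck_on_sgn o)
 then show ?thesis by (intro Ck_on_power o) (simp add: cap_def)
qed

lemma sphere_integrable_cap: "integrable sphere_measure (\<lambda>\<eta>. cap \<omega> \<eta> ^ N)"
 by (intro sphere_integrable_continuous continuous_intros)

text \<open>The divergence theorem on the sphere determines all moments of \<open>cap\<close>.\<close>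

lemma integral_cap_deriv:
 fixes \<omega> v :: "'a::euclidean_space"
 shows "(\<integral>\<eta>. real N / 2 * cap \<omega> \<eta> ^ (N - 1) * (\<omega> \<bullet> v - (\<omega> \<bullet> \<eta>) * (\<eta> \<bullet> v)) \<partial>sphere_measure)
  = (real DIM('a) - 1) * (\<integral>\<eta>. (\<eta> \<bullet> v) * cap \<omega> \<eta> ^ N \<partial>sphere_measure)"
proof -
 have "(\<integral>\<eta>. real N / 2 * cap \<omega> \<eta> ^ (N - 1) * (\<omega> \<bullet> v - (\<omega> \<bullet> \<eta>) * (\<eta> \<bullet> v)) \<partial>sphere_measure)
   = (\<integral>\<eta>. sphere_deriv (\<lambda>\<eta>. cap \<omega> \<eta> ^ N) \<eta> v \<partial>sphere_measure)"
  by (intro Bochner_Integration.integral_cong refl) (simp add: sphere_deriv_cap_power)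
 then show ?thesis using integral_sphere_deriv[OF Ck_on_cap_sgn[of 1 \<omega> N], of v] by simp
qed

text \<open>The mass of the powers of \<open>cap\<close> satisfies a two-term recursion with this ratio, by
 \<open>integral_cap_deriv\<close> in the direction \<open>v = \<omega>\<close>.\<close>

definition zratio :: "real => nat => real" where
 "zratio d N = (2 * real N + d - 1) / (2 * real N + 2 * d - 2)"

definition zmass :: "real => nat => real" where "zmass d N = (\<Prod>j<N. zratio d j)"

lemma zratio_bounds:
 assumes "2 \<le> d" shows "1/2 \<le> zratio d N" "zratio d N \<le> 1" "1 - zratio d N = (d - 1) / (2 * (real N + d - 1))"
 using assms by (simp_all add: zratio_def field_simps)

lemma zmass_pos: "2 \<le> d ==> 0 < zmass d N"
 unfolding zmass_def by (intro prod_pos ballI) (use zratio_bounds(1)[of d] in \<open>auto intro: less_le_trans[of _ "1/2"]\<close>)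

lemma zmass_Suc: "zmass d (Suc N) = zratio d N * zmass d N" by (simp add: zmass_def)

lemma integral_cap_power:
 fixes \<omega> :: "'a::euclidean_space"
 assumes d: "2 \<le> DIM('a)" and w: "norm \<omega> = 1"
 shows "(\<integral>\<eta>. cap \<omega> \<eta> ^ N \<partial>sphere_measure) = zmass (real DIM('a)) N"
proof (induction N)
 case 0 show ?case by (simp add: zmass_def)
next
 case (Suc N)
 let ?d = "real DIM('a)"
 let ?I = "\<lambda>N. \<integral>\<eta>. cap \<omega> \<eta> ^ N \<partial>sphere_measure"
 note ic = sphere_integrable_cap[of \<omega>]
 have t: "\<omega> \<bullet> \<eta> = 2 * cap \<omega> \<eta> - 1" for \<eta> by (simp add: cap_def add_divide_distrib)
 have e1: "real N / 2 * cap \<omega> \<eta> ^ (N - 1) * (\<omega> \<bullet> \<omega> - (\<omega> \<bullet> \<eta>) * (\<eta> \<bullet> \<omega>))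
   = 2 * real N * (cap \<omega> \<eta> ^ N - cap \<omega> \<eta> ^ Suc N)" for \<eta>
 proof (cases N)
  case (Suc m)
  have X: "\<omega> \<bullet> \<omega> - (\<omega> \<bullet> \<eta>) * (\<eta> \<bullet> \<omega>) = 4 * cap \<omega> \<eta> * (1 - cap \<omega> \<eta>)"
   using w by (simp add: inner_commute[of \<eta>] t dot_square_norm algebra_simps)
  show ?thesis unfolding X using Suc by (simp add: algebra_simps add_divide_distrib diff_divide_distrib)
 qed simp
 have e2: "(\<eta> \<bullet> \<omega>) * cap \<omega> \<eta> ^ N = 2 * cap \<omega> \<eta> ^ Suc N - cap \<omega> \<eta> ^ N" for \<eta>
  by (simp add: inner_commute[of \<eta>] t algebra_simps)
 have "2 * real N * (?I N - ?I (Suc N)) = (\<integral>\<eta>. 2 * real N * (cap \<omega> \<eta> ^ N - cap \<omega> \<eta> ^ Suc N) \<partial>sphere_measure)"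
  using ic[of N] ic[of "Suc N"] by (simp del: power_Suc)
 also have "\<dots> = (?d - 1) * (\<integral>\<eta>. 2 * cap \<omega> \<eta> ^ Suc N - cap \<omega> \<eta> ^ N \<partial>sphere_measure)"
  using integral_cap_deriv[of N \<omega> \<omega>] unfolding e1 e2 .
 also have "(\<integral>\<eta>. 2 * cap \<omega> \<eta> ^ Suc N - cap \<omega> \<eta> ^ N \<partial>sphere_measure) = 2 * ?I (Suc N) - ?I N"
  using ic[of N] ic[of "Suc N"] by (simp del: power_Suc)
 finally have "2 * real N * (?I N - ?I (Suc N)) = (?d - 1) * (2 * ?I (Suc N) - ?I N)" .
 then have "(2 * real N + 2 * ?d - 2) * ?I (Suc N) = (2 * real N + ?d - 1) * ?I N" by (simp add: algebra_simps)
 moreover have "2 * real N + 2 * ?d - 2 \<noteq> 0" using d by simp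
 ultimately have "?I (Suc N) = zratio ?d N * ?I N" by (simp add: zratio_def field_simps)
 then show ?case by (simp add: Suc zmass_Suc)
qed

text \<open>As \<open>\<omega> \<bullet> \<eta> = 2 cap \<omega> \<eta> - 1\<close>, \<open>integral_cap_deriv\<close> relates these integrals for consecutive exponents.\<close>

lemma integral_cap_power_orthogonal:
 fixes \<omega> v :: "'a::euclidean_space"
 assumes d: "2 \<le> DIM('a)" and o: "\<omega> \<bullet> v = 0"
 shows "(\<integral>\<eta>. cap \<omega> \<eta> ^ N * (\<eta> \<bullet> v) \<partial>sphere_measure) = 0"
proof (induction N)
 case 0
 show ?case using integral_cap_deriv[of 0 \<omega> v] d by simp
next
 case (Suc N)
 let ?Q = "\<lambda>N. \<integral>\<eta>. cap \<omega> \<eta> ^ N * (\<eta> \<bullet> v) \<partial>sphere_measure"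
 have i: "integrable sphere_measure (\<lambda>\<eta>. cap \<omega> \<eta> ^ N * (\<eta> \<bullet> v))" for N
  by (intro sphere_integrable_continuous continuous_intros)
 have t: "\<omega> \<bullet> \<eta> = 2 * cap \<omega> \<eta> - 1" for \<eta> by (simp add: cap_def add_divide_distrib)
 have "(\<integral>\<eta>. real (Suc N) / 2 * cap \<omega> \<eta> ^ (Suc N - 1) * (\<omega> \<bullet> v - (\<omega> \<bullet> \<eta>) * (\<eta> \<bullet> v)) \<partial>sphere_measure)
   = (\<integral>\<eta>. (real (Suc N) / 2) * (cap \<omega> \<eta> ^ N * (\<eta> \<bullet> v)) - real (Suc N) * (cap \<omega> \<eta> ^ Suc N * (\<eta> \<bullet> v)) \<partial>sphere_measure)"
 proof (rule lint_cong)
  fix \<eta> :: 'a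
  show "real (Suc N) / 2 * cap \<omega> \<eta> ^ (Suc N - 1) * (\<omega> \<bullet> v - (\<omega> \<bullet> \<eta>) * (\<eta> \<bullet> v))
   = (real (Suc N) / 2) * (cap \<omega> \<eta> ^ N * (\<eta> \<bullet> v)) - real (Suc N) * (cap \<omega> \<eta> ^ Suc N * (\<eta> \<bullet> v))"
   unfolding o t[of \<eta>] by (simp add: algebra_simps add_divide_distrib diff_divide_distrib)
 qed
 also have "\<dots> = (real (Suc N) / 2) * ?Q N - real (Suc N) * ?Q (Suc N)"
  by (subst lint_diff) (auto intro!: integrable_mult_right i simp del: power_Suc of_nat_Suc)
 finally have fin: "(\<integral>\<eta>. real (Suc N) / 2 * cap \<omega> \<eta> ^ (Suc N - 1) * (\<omega> \<bullet> v - (\<omega> \<bullet> \<eta>) * (\<eta> \<bullet> v)) \<partial>sphere_measure)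
   = (real (Suc N) / 2) * ?Q N - real (Suc N) * ?Q (Suc N)" .
 have c: "(\<lambda>\<eta>. (\<eta> \<bullet> v) * cap \<omega> \<eta> ^ Suc N) = (\<lambda>\<eta>. cap \<omega> \<eta> ^ Suc N * (\<eta> \<bullet> v))"
  by (simp only: mult.commute)
 have "(real (Suc N) / 2) * ?Q N - real (Suc N) * ?Q (Suc N) = (real DIM('a) - 1) * ?Q (Suc N)"
  by (rule trans[OF sym[OF fin] integral_cap_deriv[of "Suc N" \<omega> v, unfolded c]])
 then have "- (real (Suc N) * ?Q (Suc N)) = (real DIM('a) - 1) * ?Q (Suc N)" unfolding Suc by simp
 then have "(real N + real DIM('a)) * ?Q (Suc N) = 0" unfolding of_nat_Suc left_diff_distrib distrib_right by linarith
 then show ?case using d by simp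
qed

text \<open>A rotation invariant probability density of width \<open>N\<^sup>-\<^sup>1\<^sup>/\<^sup>2\<close> (\<open>zonal_moments_le\<close>).\<close>

definition zonal :: "nat => 'a::euclidean_space => 'a => real" where
 "zonal N \<omega> \<eta> = cap \<omega> \<eta> ^ N / zmass (real DIM('a)) N"

lemma continuous_zonal [continuous_intros]:
 "continuous_on S f ==> continuous_on S g ==> continuous_on S (\<lambda>x. zonal N (f x) (g x))"
 unfolding zonal_def divide_inverse by (intro continuous_intros) auto

lemma zonal_commute: "zonal N \<omega> \<eta> = zonal N \<eta> \<omega>" by (simp add: zonal_def cap_commute)

context
 assumes d2: "2 \<le> DIM('a::euclidean_space)"
begin

lemma zm_pos: "0 < zmass (real DIM('a)) N" using zmass_pos d2 by simp

lemma zonal_nonneg: "norm \<omega> = 1 ==> norm \<eta> = 1 ==> 0 \<le> zonal N \<omega> (\<eta> :: 'a)"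
 using cap_bounds[of \<omega> \<eta>] zm_pos[of N] by (simp add: zonal_def)

lemma zonal_Suc_le: "norm \<omega> = 1 ==> norm \<eta> = 1 ==> zonal (Suc N) \<omega> (\<eta> :: 'a) \<le> 2 * zonal N \<omega> \<eta>"
proof -
 assume w: "norm \<omega> = 1" "norm \<eta> = 1"
 let ?z = "zratio (real DIM('a)) N"
 have z: "1/2 \<le> ?z" using zratio_bounds(1) d2 by simp
 have "zonal (Suc N) \<omega> \<eta> = zonal N \<omega> \<eta> * (cap \<omega> \<eta> / ?z)" by (simp add: zonal_def zmass_Suc mult.commute)
 also have "cap \<omega> \<eta> / ?z \<le> 1 / (1/2)" using cap_bounds[OF w] z by (intro frac_le) auto
 then have "zonal N \<omega> \<eta> * (cap \<omega> \<eta> / ?z) \<le> zonal N \<omega> \<eta> * 2" using zonal_nonneg[OF w] by (intro mult_left_mono) auto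
 finally show ?thesis by simp
qed

lemma integral_zonal: "norm \<omega> = 1 ==> (\<integral>\<eta>. zonal N \<omega> (\<eta> :: 'a) \<partial>sphere_measure) = 1"
 using integral_cap_power[OF d2, of \<omega> N] zm_pos[of N] by (simp add: zonal_def)

lemma integral_zonal_moment2:
 assumes w: "norm \<omega> = 1"
 shows "(\<integral>\<eta>. (norm (\<omega> - \<eta>))\<^sup>2 * zonal N \<omega> (\<eta> :: 'a) \<partial>sphere_measure) = 4 * (1 - zratio (real DIM('a)) N)"
proof -
 let ?m = "zmass (real DIM('a)) N"
 have "(\<integral>\<eta>. (norm (\<omega> - \<eta>))\<^sup>2 * zonal N \<omega> \<eta> \<partial>sphere_measure)
   = (\<integral>\<eta>. (4 / ?m) * (cap \<omega> \<eta> ^ N - cap \<omega> \<eta> ^ Suc N) \<partial>sphere_measure)"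
  by (intro Bochner_Integration.integral_cong refl) (simp add: norm_diff_cap[OF w] zonal_def field_simps)
 also have "\<dots> = (4 / ?m) * (?m - zmass (real DIM('a)) (Suc N))"
  using sphere_integrable_cap[of \<omega> N] sphere_integrable_cap[of \<omega> "Suc N"] integral_cap_power[OF d2 w] by (simp del: power_Suc)
 also have "\<dots> = 4 * (1 - zratio (real DIM('a)) N)" using zm_pos[of N] by (simp add: zmass_Suc field_simps)
 finally show ?thesis .
qed

lemma integral_zonal_moment4:
 assumes w: "norm \<omega> = 1"
 shows "(\<integral>\<eta>. (norm (\<omega> - \<eta>)) ^ 4 * zonal N \<omega> (\<eta> :: 'a) \<partial>sphere_measure)
  = 16 * (1 - 2 * zratio (real DIM('a)) N + zratio (real DIM('a)) N * zratio (real DIM('a)) (Suc N))"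
proof -
 let ?m = "zmass (real DIM('a)) N"
 have "(\<integral>\<eta>. (norm (\<omega> - \<eta>)) ^ 4 * zonal N \<omega> \<eta> \<partial>sphere_measure)
   = (\<integral>\<eta>. (16 / ?m) * (cap \<omega> \<eta> ^ N - 2 * cap \<omega> \<eta> ^ Suc N + cap \<omega> \<eta> ^ Suc (Suc N)) \<partial>sphere_measure)"
 proof (rule lint_cong)
  fix \<eta> :: 'a assume "\<eta> \<in> space sphere_measure"
  then have e: "norm \<eta> = 1" by simp
  have X: "(norm (\<omega> - \<eta>)) ^ 4 = 16 * (1 - 2 * cap \<omega> \<eta> + cap \<omega> \<eta> * cap \<omega> \<eta>)"
  proof -
  have "(norm (\<omega> - \<eta>)) ^ 4 = ((norm (\<omega> - \<eta>))\<^sup>2)\<^sup>2" by simp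
  also have "\<dots> = 16 * (1 - 2 * cap \<omega> \<eta> + cap \<omega> \<eta> * cap \<omega> \<eta>)"
   unfolding norm_diff_cap[OF w e] by (simp add: power2_eq_square algebra_simps)
  finally show ?thesis .
  qed
  show "(norm (\<omega> - \<eta>)) ^ 4 * zonal N \<omega> \<eta>
   = (16 / ?m) * (cap \<omega> \<eta> ^ N - 2 * cap \<omega> \<eta> ^ Suc N + cap \<omega> \<eta> ^ Suc (Suc N))"
   unfolding X zonal_def by (simp add: algebra_simps diff_divide_distrib add_divide_distrib)
 qed
 also have "\<dots> = (16 / ?m) * (?m - 2 * zmass (real DIM('a)) (Suc N) + zmass (real DIM('a)) (Suc (Suc N)))"
  using sphere_integrable_cap[of \<omega> N] sphere_integrable_cap[of \<omega> "Suc N"] sphere_integrable_cap[of \<omega> "Suc (Suc N)"]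
   integral_cap_power[OF d2 w] by (simp del: power_Suc)
 also have "\<dots> = 16 * (1 - 2 * zratio (real DIM('a)) N + zratio (real DIM('a)) N * zratio (real DIM('a)) (Suc N))"
  using zm_pos[of N] by (simp add: zmass_Suc field_simps)
 finally show ?thesis .
qed

text \<open>The square of \<open>norm (\<omega> - \<eta>)\<close> is \<open>4 (1 - cap \<omega> \<eta>)\<close>, so moments are differences of masses of
 consecutive powers.\<close>

lemma zonal_moments_le:
 assumes w: "norm \<omega> = 1" and N: "1 \<le> N"
 shows "(\<integral>\<eta>. (norm (\<omega> - \<eta>))\<^sup>2 * zonal N \<omega> (\<eta> :: 'a) \<partial>sphere_measure) \<le> 2 * real DIM('a) / real N"
  and "(\<integral>\<eta>. (norm (\<omega> - \<eta>)) ^ 4 * zonal N \<omega> (\<eta> :: 'a) \<partial>sphere_measure) \<le> 16 * (real DIM('a))\<^sup>2 / (real N)\<^sup>2"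
proof -
 let ?d = "real DIM('a)"
 let ?a = "\<lambda>N. 1 - zratio ?d N"
 have dd: "2 \<le> ?d" using d2 by simp
 have a: "?a N = (?d - 1) / (2 * (real N + ?d - 1))" for N by (rule zratio_bounds(3)[OF dd])
 have an: "0 \<le> ?a N" for N using zratio_bounds(2)[OF dd, of N] by simp
 have al: "?a K \<le> ?d / (2 * real N)" if "N \<le> K" for K
 proof -
  have "(?d - 1) / (2 * (real K + ?d - 1)) \<le> ?d / (2 * real N)" using dd N that by (intro frac_le) auto
  then show ?thesis by (simp only: a)
 qed
 have "4 * ?a N \<le> 2 * ?d / real N" using al[of N] N by (simp add: field_simps)
 then show "(\<integral>\<eta>. (norm (\<omega> - \<eta>))\<^sup>2 * zonal N \<omega> (\<eta> :: 'a) \<partial>sphere_measure) \<le> 2 * ?d / real N"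
  by (simp only: integral_zonal_moment2[OF w])
 have "1 - 2 * zratio ?d N + zratio ?d N * zratio ?d (Suc N) = (?a N - ?a (Suc N)) + ?a N * ?a (Suc N)"
  by (simp add: algebra_simps)
 also have "?a N - ?a (Suc N) = (?d - 1) / (2 * ((real N + ?d - 1) * (real N + ?d)))"
  unfolding a using dd by (simp add: divide_simps) (simp add: algebra_simps)
 also have "\<dots> \<le> ?d / (2 * (real N * real N))" using dd N by (intro frac_le mult_left_mono mult_mono) auto
 also have "?a N * ?a (Suc N) \<le> (?d / (2 * real N)) * (?d / (2 * real N))"
  by (intro mult_mono al an) (use dd in auto)
 also have "?d / (2 * (real N * real N)) + (?d / (2 * real N)) * (?d / (2 * real N)) \<le> ?d\<^sup>2 / (real N)\<^sup>2"
 proof -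
  have "?d / (2 * (real N * real N)) + (?d / (2 * real N)) * (?d / (2 * real N)) = (2 * ?d + ?d\<^sup>2) / (4 * (real N)\<^sup>2)"
   using N by (simp add: power2_eq_square divide_simps)
  also have "\<dots> \<le> (4 * ?d\<^sup>2) / (4 * (real N)\<^sup>2)"
   using dd by (intro divide_right_mono) (auto simp: power2_eq_square mult_right_mono)
  finally show ?thesis by simp
 qed
 finally have "16 * (1 - 2 * zratio ?d N + zratio ?d N * zratio ?d (Suc N)) \<le> 16 * (?d\<^sup>2 / (real N)\<^sup>2)"
  by (intro mult_left_mono) auto
 then show "(\<integral>\<eta>. (norm (\<omega> - \<eta>)) ^ 4 * zonal N \<omega> (\<eta> :: 'a) \<partial>sphere_measure) \<le> 16 * ?d\<^sup>2 / (real N)\<^sup>2"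
  by (simp only: integral_zonal_moment4[OF w] times_divide_eq_right)
qed

end

section \<open>Mollifiers in the position variable\<close>

definition mollmass :: "nat => 'a::euclidean_space itself => real" where
 "mollmass n T = (\<integral>z. bump (real n *\<^sub>R (z :: 'a)) \<partial>lborel)"

definition moll :: "nat => 'a::euclidean_space => real" where
 "moll n z = bump (real n *\<^sub>R z) / mollmass n TYPE('a)"

text \<open>A multiple of a probability density that dominates the mollifier and, up to a factor \<open>n\<close>, its gradient.\<close>

definition box_weight :: "nat => 'a::euclidean_space => real" where
 "box_weight n z = real n ^ DIM('a) * indicator (cball 0 (1 / real n)) z"

lemma Ck_on_bump_scaled: "Ck_on k (\<lambda>z::'a::euclidean_space. bump (c *\<^sub>R z)) UNIV"
 by (rule Ck_on_compose[OF open_UNIV open_UNIV _ Ck_on_linear_intro Ck_on_bump]) (auto simp: linear_iff algebra_simps)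

lemma Ck_on_moll: "Ck_on k (moll n :: 'a::euclidean_space => real) UNIV"
proof -
 have "Ck_on k (\<lambda>z::'a. bump (real n *\<^sub>R z) * (1 / mollmass n TYPE('a))) UNIV"
  by (intro Ck_on_mult Ck_on_bump_scaled Ck_on_const open_UNIV)
 then show ?thesis by (simp add: moll_def[abs_def])
qed

context
 fixes n :: nat assumes n: "1 \<le> n"
begin

lemma bump_scaled_eq_0: "1 / real n < norm z ==> bump (real n *\<^sub>R (z :: 'a::euclidean_space)) = 0"
 using n by (intro bump_eq_0) (simp add: field_simps)

lemma integrable_bump_scaled: "integrable lborel (\<lambda>z::'a::euclidean_space. bump (real n *\<^sub>R z))"
 by (rule integrable_continuous_bounded_support[OF Ck_on_continuous[OF Ck_on_bump_scaled[of 0 "real n"]] bump_scaled_eq_0])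

lemma integrable_box_weight: "integrable lborel (box_weight n :: 'a::euclidean_space => real)"
 unfolding box_weight_def
 by (intro integrable_mult_right integrable_real_indicator) (use emeasure_lborel_cball_finite in auto)

lemma integral_box_weight: "(\<integral>z. box_weight n (z :: 'a::euclidean_space) \<partial>lborel) = unit_ball_vol (real DIM('a))"
 using n by (simp add: box_weight_def content_cball power_divide)

lemma box_weight_nonneg: "0 \<le> box_weight n z" by (simp add: box_weight_def)

end

lemma mollmass_lower:
 obtains c where "0 < c" "\<And>n. 1 \<le> n ==> c \<le> mollmass n TYPE('a::euclidean_space) * real n ^ DIM('a)"
proof -
 let ?b = "flat_exp 0 (1/2)"
 have b: "0 < ?b" by (simp add: flat_exp_def)
 have low: "?b * indicator (cball 0 (1/2)) z \<le> bump (z :: 'a)" for z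
 proof (cases "norm z \<le> 1/2")
  case True
  have "z \<bullet> z = (norm z)\<^sup>2" by (simp add: power2_norm_eq_inner)
  also have "\<dots> \<le> (1/2)\<^sup>2" using True by (intro power_mono) auto
  finally have zz: "z \<bullet> z \<le> 1/2" by (simp add: power2_eq_square)
  then have "1 / (1 - z \<bullet> z) \<le> 2" by (simp add: field_simps)
  then show ?thesis using True zz by (simp add: bump_def flat_exp_def)
 qed (simp add: bump_nonneg)
 let ?c = "?b * unit_ball_vol (real DIM('a)) / 2 ^ DIM('a)"
 have "?c \<le> mollmass n TYPE('a) * real n ^ DIM('a)" if n: "1 \<le> n" for n
 proof -
  have i: "integrable lborel (\<lambda>z::'a. ?b * indicator (cball 0 (1 / (2 * real n))) z)"
   by (intro integrable_mult_right integrable_real_indicator) (use emeasure_lborel_cball_finite in auto)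
  have "?b * measure lborel (cball (0::'a) (1 / (2 * real n))) = (\<integral>z. ?b * indicator (cball (0::'a) (1 / (2 * real n))) z \<partial>lborel)" by simp
  also have "\<dots> \<le> mollmass n TYPE('a)"
   unfolding mollmass_def
  proof (rule integral_mono[OF i integrable_bump_scaled[OF n]])
   fix z :: 'a
   have "indicator (cball 0 (1 / (2 * real n))) z = (indicator (cball 0 (1/2)) (real n *\<^sub>R z) :: real)"
    using n by (simp add: indicator_def field_simps)
   then show "?b * indicator (cball 0 (1 / (2 * real n))) z \<le> bump (real n *\<^sub>R z)" using low[of "real n *\<^sub>R z"] by simp
  qed
  finally have "?b * measure lborel (cball (0::'a) (1 / (2 * real n))) * real n ^ DIM('a) \<le> mollmass n TYPE('a) * real n ^ DIM('a)"
   by (rule mult_right_mono) simp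
  moreover have "measure lborel (cball (0::'a) (1 / (2 * real n))) = unit_ball_vol (real DIM('a)) * (1 / (2 * real n)) ^ DIM('a)"
   by (rule content_cball) simp
  ultimately show ?thesis using n by (simp add: power_divide power_mult_distrib)
 qed
 moreover have "0 < ?c" using b unit_ball_vol_pos[of "real DIM('a)"] by simp
 ultimately show thesis by (rule that[rotated])
qed

lemma mollmass_pos: "1 \<le> n ==> 0 < mollmass n TYPE('a::euclidean_space)"
proof -
 assume n: "1 \<le> n"
 obtain c where c: "0 < c" "c \<le> mollmass n TYPE('a) * real n ^ DIM('a)" using mollmass_lower n by metis
 then have "0 < mollmass n TYPE('a) * real n ^ DIM('a)" by simp
 then show ?thesis using n by (simp add: zero_less_mult_iff)
qed

lemma integral_moll: assumes "1 \<le> n" shows "(\<integral>z. moll n (z :: 'a::euclidean_space) \<partial>lborel) = 1"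
 using mollmass_pos[OF assms, where 'a='a] unfolding moll_def by (simp add: mollmass_def)

lemma moll_bounds:
 obtains C where "0 < C"
  "\<And>n z. 1 \<le> n ==> 0 \<le> moll n z \<and> moll n (z :: 'a::euclidean_space) \<le> C * box_weight n z"
  "\<And>n z v. 1 \<le> n ==> \<bar>frechet_derivative (moll n) (at (z :: 'a)) v\<bar> \<le> C * real n * box_weight n z * norm v"
proof -
 obtain c where c: "0 < c" "\<And>n. 1 \<le> n ==> c \<le> mollmass n TYPE('a) * real n ^ DIM('a)" using mollmass_lower by metis
 have b1: "Ck_on (Suc 0) (bump :: 'a => real) UNIV" by (rule Ck_on_bump)
 let ?D = "\<lambda>z v. frechet_derivative bump (at (z :: 'a)) v"
 have "\<exists>B. \<forall>z\<in>cball 0 1. \<bar>?D z b\<bar> \<le> B" for b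
 proof -
  have "continuous_on (cball 0 1) (\<lambda>z. ?D z b)"
   by (rule continuous_on_subset[OF _ subset_UNIV]) (use Ck_on_deriv[OF b1, of b] in simp)
  then have "bounded ((\<lambda>z. ?D z b) ` cball 0 1)"
   by (intro compact_imp_bounded compact_continuous_image compact_cball)
  then obtain B where "\<forall>y\<in>(\<lambda>z. ?D z b) ` cball 0 1. norm y \<le> B" unfolding bounded_iff by blast
  then show ?thesis by (intro exI[of _ B]) auto
 qed
 then obtain B where B: "\<And>b z. z \<in> cball 0 1 ==> \<bar>?D z b\<bar> \<le> B b" by metis
 define B' where "B' = (\<Sum>b\<in>Basis. \<bar>B b\<bar>)"
 have DB: "\<bar>?D z v\<bar> \<le> B' * norm v * indicator (cball 0 1) z" for z v
 proof (cases "z \<in> cball 0 1")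
  case True
  have "linear (?D z)" using Ck_on_SucD(1)[OF b1 UNIV_I] has_derivative_linear by blast
  from linear_euclidean_expand[OF this, of v] have "\<bar>?D z v\<bar> \<le> (\<Sum>b\<in>Basis. \<bar>(v \<bullet> b) * ?D z b\<bar>)"
   by (simp add: sum_abs)
  also have "\<dots> \<le> (\<Sum>b\<in>Basis. norm v * \<bar>B b\<bar>)"
   unfolding abs_mult by (intro sum_mono mult_mono) (use B[OF True] in \<open>auto simp: Basis_le_norm intro: order_trans[OF _ abs_ge_self]\<close>)
  finally show ?thesis using True by (simp add: B'_def sum_distrib_left mult.commute)
 next
  case False
  then have "?D z v = 0" by (intro frechet_derivative_eq_0_outside[of 1]) (auto intro: bump_eq_0)
  then show ?thesis using False by simp
 qed
 have B'0: "0 \<le> B'" unfolding B'_def by (intro sum_nonneg) auto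
 define C where "C = (1 + B') / c"
 show thesis
 proof (rule that[of C])
  show "0 < C" using c B'0 by (simp add: C_def)
  fix n :: nat and z v :: 'a assume n: "1 \<le> n"
  have m: "0 < mollmass n TYPE('a)" by (rule mollmass_pos[OF n])
  have ind: "indicator (cball 0 1) (real n *\<^sub>R z) = (indicator (cball 0 (1 / real n)) z :: real)"
   using n by (simp add: indicator_def field_simps)
  have im: "1 / mollmass n TYPE('a) \<le> real n ^ DIM('a) / c" using c(2)[OF n] m c(1) by (simp add: field_simps)
  have "bump (real n *\<^sub>R z) \<le> indicator (cball 0 1) (real n *\<^sub>R z)"
   using bump_le_1 bump_eq_0[of "real n *\<^sub>R z"] by (auto simp: indicator_def)
  then have "moll n z \<le> indicator (cball 0 (1 / real n)) z * (1 / mollmass n TYPE('a))"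
   unfolding moll_def ind using m by (simp add: divide_right_mono)
  also have "\<dots> \<le> indicator (cball 0 (1 / real n)) z * (real n ^ DIM('a) / c)" by (intro mult_left_mono im) auto
  also have "\<dots> = (1 / c) * box_weight n z" by (simp add: box_weight_def)
  also have "\<dots> \<le> C * box_weight n z"
   unfolding C_def using c B'0 box_weight_nonneg[OF n] by (intro mult_right_mono divide_right_mono) auto
  finally show "0 \<le> moll n z \<and> moll n z \<le> C * box_weight n z" using m bump_nonneg[of "real n *\<^sub>R z"] by (simp add: moll_def zero_le_divide_iff)
  have "((\<lambda>z. real n *\<^sub>R z) has_derivative (\<lambda>v. real n *\<^sub>R v)) (at z)" by (auto intro!: derivative_eq_intros)
  from diff_chain_at[OF this Ck_on_SucD(1)[OF b1 UNIV_I]]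
  have "((\<lambda>z. bump (real n *\<^sub>R z)) has_derivative (\<lambda>v. ?D (real n *\<^sub>R z) (real n *\<^sub>R v))) (at z)" by (simp add: o_def)
  from has_derivative_mult_right[OF this, of "1 / mollmass n TYPE('a)"]
  have "(moll n has_derivative (\<lambda>v. 1 / mollmass n TYPE('a) * ?D (real n *\<^sub>R z) (real n *\<^sub>R v))) (at z)"
   by (simp add: moll_def[abs_def])
  from frechet_derivative_at[OF this]
  have "\<bar>frechet_derivative (moll n) (at z) v\<bar> = 1 / mollmass n TYPE('a) * \<bar>?D (real n *\<^sub>R z) (real n *\<^sub>R v)\<bar>"
   using m by (metis abs_mult abs_of_pos zero_less_divide_1_iff)
  also have "\<dots> \<le> (real n ^ DIM('a) / c) * (B' * norm (real n *\<^sub>R v) * indicator (cball 0 1) (real n *\<^sub>R z))"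
   by (intro mult_mono im DB) (use c in auto)
  also have "\<dots> = (B' / c) * real n * box_weight n z * norm v" by (simp add: ind box_weight_def)
  also have "\<dots> \<le> C * real n * box_weight n z * norm v"
   unfolding C_def using c B'0 box_weight_nonneg[OF n] by (intro mult_right_mono divide_right_mono) auto
  finally show "\<bar>frechet_derivative (moll n) (at z) v\<bar> \<le> C * real n * box_weight n z * norm v" .
 qed
qed


section \<open>Lipschitz functions are dense\<close>

interpretation flat: sigma_finite_measure "flat_measure :: 'a::euclidean_space phase measure"
 by (rule sigma_finite_flat)

interpretation flat2: pair_sigma_finite "flat_measure :: 'a::euclidean_space phase measure"
  "flat_measure :: 'a phase measure"
 by unfold_locales

definition lip_fun :: "('a::euclidean_space phase => real) => bool" where
 "lip_fun \<phi> \<longleftrightarrow> (\<exists>L\<ge>0. \<forall>p q. \<bar>\<phi> p - \<phi> q\<bar> \<le> L * dist p q) \<and> (\<exists>r. \<forall>p. r < norm p \<longrightarrow> \<phi> p = 0)"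

lemma lip_fun_continuous: assumes "lip_fun \<phi>" shows "continuous_on S \<phi>"
proof -
 obtain L where L: "0 \<le> L" "\<And>p q. \<bar>\<phi> p - \<phi> q\<bar> \<le> L * dist p q" using assms by (auto simp: lip_fun_def)
 have "L-lipschitz_on UNIV \<phi>" by (rule lipschitz_onI) (use L in \<open>auto simp: dist_real_def\<close>)
 then show ?thesis using lipschitz_on_continuous_on continuous_on_subset by blast
qed

lemma lip_fun_xsupp: assumes "lip_fun \<phi>" obtains r where "xsupp r \<phi>"
proof -
 obtain r where "\<And>p. r < norm p ==> \<phi> p = 0" using assms by (auto simp: lip_fun_def)
 then have "xsupp r \<phi>" unfolding xsupp_def
  by (metis less_le_trans norm_fst_le prod.collapse)
 then show thesis by (rule that)
qed

lemma lip_fun_L2: "lip_fun \<phi> ==> \<phi> \<in> L2_funs flat_measure"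
 by (metis lip_fun_continuous lip_fun_xsupp L2_funs_continuous)

lemma lip_fun_bounded: assumes "lip_fun \<phi>" obtains B where "\<And>p. \<bar>\<phi> p\<bar> \<le> B"
proof -
 obtain r where r: "\<And>p. r < norm p ==> \<phi> p = 0" using assms by (auto simp: lip_fun_def)
 have "bounded (\<phi> ` cball 0 r)"
  by (intro compact_imp_bounded compact_continuous_image lip_fun_continuous[OF assms] compact_cball)
 then obtain B where B: "\<forall>y\<in>\<phi> ` cball 0 r. norm y \<le> B" unfolding bounded_iff by blast
 have "\<bar>\<phi> p\<bar> \<le> max B 0" for p
  using B r[of p] by (cases "norm p \<le> r") (auto simp: le_max_iff_disj)
 then show thesis by (rule that)
qed

lemma lip_fun_add: assumes "lip_fun \<phi>" "lip_fun \<psi>" shows "lip_fun (\<lambda>p. \<phi> p + \<psi> p)"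
proof -
 obtain L r where 1: "0 \<le> L" "\<And>p q. \<bar>\<phi> p - \<phi> q\<bar> \<le> L * dist p q" "\<And>p. r < norm p ==> \<phi> p = 0"
  using assms(1) by (auto simp: lip_fun_def)
 obtain K s where 2: "0 \<le> K" "\<And>p q. \<bar>\<psi> p - \<psi> q\<bar> \<le> K * dist p q" "\<And>p. s < norm p ==> \<psi> p = 0"
  using assms(2) by (auto simp: lip_fun_def)
 have "\<bar>(\<phi> p + \<psi> p) - (\<phi> q + \<psi> q)\<bar> \<le> (L + K) * dist p q" for p q
  using 1(2)[of p q] 2(2)[of p q] unfolding distrib_right by linarith
 then show ?thesis unfolding lip_fun_def using 1 2
  by (intro conjI exI[of _ "L + K"] exI[of _ "max r s"]) auto
qed

lemma lip_fun_scale: assumes "lip_fun \<phi>" shows "lip_fun (\<lambda>p. c * \<phi> p)"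
proof -
 obtain L r where 1: "0 \<le> L" "\<And>p q. \<bar>\<phi> p - \<phi> q\<bar> \<le> L * dist p q" "\<And>p. r < norm p ==> \<phi> p = 0"
  using assms(1) by (auto simp: lip_fun_def)
 have "\<bar>c * \<phi> p - c * \<phi> q\<bar> \<le> (\<bar>c\<bar> * L) * dist p q" for p q
 proof -
  have "\<bar>c * \<phi> p - c * \<phi> q\<bar> = \<bar>c\<bar> * \<bar>\<phi> p - \<phi> q\<bar>" by (simp add: abs_mult flip: right_diff_distrib)
  also have "\<dots> \<le> \<bar>c\<bar> * (L * dist p q)" by (intro mult_left_mono 1) simp
  finally show ?thesis by (simp add: mult.assoc)
 qed
 then show ?thesis unfolding lip_fun_def using 1
  by (intro conjI exI[of _ "\<bar>c\<bar> * L"] exI[of _ r]) auto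
qed

lemma lip_fun_infdist:
 assumes C: "C \<subseteq> cball 0 r" "C \<noteq> {}" and j: "1 \<le> (j::nat)"
 shows "lip_fun (\<lambda>p. max 0 (1 - real j * infdist p C))"
  and "r + 1 < norm p ==> max 0 (1 - real j * infdist p C) = 0"
proof -
 have far: "max 0 (1 - real j * infdist p C) = 0" if p: "r + 1 < norm p" for p
 proof -
  have "1 \<le> infdist p C" unfolding infdist_notempty[OF C(2)]
  proof (rule cINF_greatest[OF C(2)])
   fix c assume "c \<in> C"
   then have "norm c \<le> r" using C by auto
   then show "1 \<le> dist p c" using p norm_triangle_sub[of p c] by (simp add: dist_norm)
  qed
  then have "1 * 1 \<le> real j * infdist p C" using j by (intro mult_mono) auto
  then show ?thesis by simp
 qed
 then show "r + 1 < norm p ==> max 0 (1 - real j * infdist p C) = 0" .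
 have "\<bar>max 0 (1 - real j * infdist p C) - max 0 (1 - real j * infdist q C)\<bar> \<le> real j * dist p q" for p q
 proof -
  have "\<bar>max 0 (1 - real j * infdist p C) - max 0 (1 - real j * infdist q C)\<bar>
    \<le> \<bar>real j * (infdist p C - infdist q C)\<bar>" unfolding right_diff_distrib by linarith
  also have "\<dots> \<le> real j * dist p q"
   using infdist_triangle_abs[of p C q] by (simp add: abs_mult mult_left_mono)
  finally show ?thesis .
 qed
 then show "lip_fun (\<lambda>p. max 0 (1 - real j * infdist p C))" unfolding lip_fun_def using far
  by (intro conjI exI[of _ "real j"] exI[of _ "r + 1"]) auto
qed

lemma integrable_on_ball:
 assumes g: "g \<in> L2_funs (flat_measure :: 'a::euclidean_space phase measure)"
 shows "integrable flat_measure (\<lambda>p. indicator (cball 0 R) p * g p)"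
proof (rule L2_funs_mult_integrable[OF _ g])
 have m[measurable]: "(indicator (cball 0 R) :: 'a phase => real) \<in> borel_measurable flat_measure"
  by (rule measurable_compose[OF measurable_ident_flat borel_measurable_indicator]) simp
 have "integrable flat_measure (indicator (cyl R) :: 'a phase => real)"
  by (rule integrable_real_indicator[OF sets_cylinder emeasure_cylinder_finite])
 then have "integrable flat_measure (indicator (cball 0 R) :: 'a phase => real)"
 proof (rule Bochner_Integration.integrable_bound[OF _ m], intro AE_I2)
  fix p :: "'a phase" assume "p \<in> space flat_measure"
  then show "norm (indicator (cball 0 R) p :: real) \<le> norm (indicator (cyl R) p :: real)"
   using norm_fst_le[of "fst p" "snd p"] by (auto simp: indicator_def state_space_def)
 qed
 then show "(indicator (cball 0 R) :: 'a phase => real) \<in> L2_funs flat_measure"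
  by (simp add: L2_funs_def power2_eq_square indicator_inter_arith[symmetric])
qed

lemma sets_flat_borel:
 assumes "B \<in> sets (flat_measure :: 'a::euclidean_space phase measure)" shows "B \<in> sets borel"
proof -
 have "sets (flat_measure :: 'a phase measure) \<subseteq> sets (borel :: 'a phase measure)"
  unfolding flat_measure_def sets_pair_measure
 proof (rule sets.sigma_sets_subset')
  show "{a \<times> b |a b. a \<in> sets (lborel :: 'a measure) \<and> b \<in> sets (sphere_measure :: 'a measure)} \<subseteq> sets borel"
   unfolding borel_prod[symmetric]
   by (auto simp: sets_sphere_measure sets_restrict_space intro!: pair_measureI)
  show "space (lborel :: 'a measure) \<times> space (sphere_measure :: 'a measure) \<in> sets (borel :: 'a phase measure)"
   unfolding borel_prod[symmetric] by (intro pair_measureI) auto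
 qed
 then show ?thesis using assms by blast
qed

text \<open>A square-integrable function orthogonal to the Lipschitz functions vanishes: it integrates to
 zero over compact sets, which generate the Borel sets.\<close>

lemma lip_fun_orthogonal:
 fixes g :: "'a::euclidean_space phase => real"
 assumes g: "g \<in> L2_funs flat_measure"
  and orth: "\<And>\<phi>. lip_fun \<phi> ==> (\<ointegral>p. g p * \<phi> p) = 0"
 shows "AE p in flat_measure. g p = 0"
proof -
 have gm[measurable]: "g \<in> borel_measurable flat_measure" using g by (rule L2_funsD)
 have compact0: "(\<ointegral>p. indicator C p * g p) = 0" if C: "compact C" for C :: "'a phase set"
 proof (cases "C = {}")
  case False
  obtain r where r: "C \<subseteq> cball 0 r" using compact_imp_bounded[OF C] by (auto simp: bounded_iff subset_iff)
  let ?\<phi> = "\<lambda>j p. max 0 (1 - real (Suc j) * infdist p C)"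
  have lip: "lip_fun (?\<phi> j)" for j by (rule lip_fun_infdist[OF r False]) simp
  have lim: "(\<lambda>j. (\<ointegral>p. g p * ?\<phi> j p)) \<longlonglongrightarrow> (\<ointegral>p. indicator C p * g p)"
  proof (rule integral_dominated_convergence[where w="\<lambda>p. \<bar>indicator (cball 0 (r + 1)) p * g p\<bar>"])
   have "(indicator C :: _ => real) \<in> borel_measurable flat_measure"
    by (rule measurable_compose[OF measurable_ident_flat borel_measurable_indicator])
     (use C in \<open>auto intro: borel_closed compact_imp_closed\<close>)
   then show "(\<lambda>p. indicator C p * g p) \<in> borel_measurable flat_measure" by simp
   show "(\<lambda>p. g p * ?\<phi> j p) \<in> borel_measurable flat_measure" for j
    using flat_measurable_continuous[OF lip_fun_continuous[OF lip]] by simp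
   show "integrable flat_measure (\<lambda>p. \<bar>indicator (cball 0 (r + 1)) p * g p\<bar>)"
    using integrable_on_ball[OF g] by simp
   show "AE p in flat_measure. (\<lambda>j. g p * ?\<phi> j p) \<longlonglongrightarrow> indicator C p * g p"
   proof (rule AE_I2)
    fix p :: "'a phase"
    have "(\<lambda>j. ?\<phi> j p) \<longlonglongrightarrow> indicator C p"
    proof (cases "p \<in> C")
     case True then show ?thesis by simp
    next
     case False
     then have pos: "0 < infdist p C"
      using infdist_pos_not_in_closed[OF compact_imp_closed[OF C] \<open>C \<noteq> {}\<close>] by blast
     obtain K where K: "1 / infdist p C < real K" using reals_Archimedean2 by blast
     have "?\<phi> j p = 0" if "K \<le> j" for j
     proof -
      have "1 / infdist p C < real (Suc j)" using K that by simp
      then have "1 < real (Suc j) * infdist p C" using pos by (simp add: field_simps)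
      then show ?thesis by simp
     qed
     then have "\<forall>\<^sub>F j in sequentially. ?\<phi> j p = 0" by (auto simp: eventually_sequentially)
     then show ?thesis using False by (simp add: tendsto_eventually)
    qed
    then show "(\<lambda>j. g p * ?\<phi> j p) \<longlonglongrightarrow> indicator C p * g p"
     using tendsto_mult[OF tendsto_const[of "g p"]] by (simp add: mult.commute[of _ "g p"])
   qed
   show "AE p in flat_measure. norm (g p * ?\<phi> j p) \<le> \<bar>indicator (cball 0 (r + 1)) p * g p\<bar>" for j
   proof (rule AE_I2)
    fix p :: "'a phase"
    have "0 \<le> ?\<phi> j p" "?\<phi> j p \<le> 1" using infdist_nonneg[of p C] by auto
    then have "\<bar>g p\<bar> * ?\<phi> j p \<le> \<bar>g p\<bar> * 1" by (intro mult_left_mono) auto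
    then show "norm (g p * ?\<phi> j p) \<le> \<bar>indicator (cball 0 (r + 1)) p * g p\<bar>"
     using lip_fun_infdist(2)[OF r False, of "Suc j" p] \<open>0 \<le> ?\<phi> j p\<close>
     by (cases "norm p \<le> r + 1") (auto simp: abs_mult)
   qed
  qed
  have z: "(\<ointegral>p. g p * ?\<phi> j p) = 0" for j by (rule orth[OF lip])
  show ?thesis using lim unfolding z LIMSEQ_const_iff by (rule sym)
 qed simp
 have ball0: "AE p in flat_measure. indicator (cball 0 R) p * g p = 0" for R
 proof -
  let ?h = "\<lambda>p. indicator (cball 0 R) p * g p"
  have h: "integrable flat_measure ?h" by (rule integrable_on_ball[OF g])
  have ih: "integrable flat_measure (\<lambda>p. indicator A p * ?h p)" if "A \<in> sets borel" for A :: "'a phase set"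
  proof (rule Bochner_Integration.integrable_bound[OF h])
   have "(indicator A :: _ => real) \<in> borel_measurable flat_measure"
    by (rule measurable_compose[OF measurable_ident_flat borel_measurable_indicator[OF that]])
   then show "(\<lambda>p. indicator A p * ?h p) \<in> borel_measurable flat_measure" using h by simp
  qed (simp add: indicator_def)
  have all: "(\<ointegral>p. indicator A p * ?h p) = 0" if A: "A \<in> sets borel" for A :: "'a phase set"
  proof -
   have st: "Int_stable (Collect closed :: 'a phase set set)" by (auto simp: Int_stable_def)
   have "A \<in> sigma_sets UNIV (Collect closed)" using A by (simp add: borel_eq_closed)
   from st subset_UNIV[of "Collect closed :: 'a phase set set", folded Pow_UNIV] this show ?thesis
   proof (induction A rule: sigma_sets_induct_disjoint)
    case (basic A)
    have "compact (A \<inter> cball 0 R)" using basic by (simp add: closed_Int_compact)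
    moreover have e: "indicator A p * ?h p = indicator (A \<inter> cball 0 R) p * g p" for p
     by (simp add: indicator_inter_arith)
    ultimately show ?case unfolding e by (intro compact0)
   next
    case empty show ?case by simp
   next
    case (compl A)
    then have A: "A \<in> sets borel" by (simp add: borel_eq_closed)
    have "(\<ointegral>p. ?h p) = 0" using compact0[of "cball 0 R"] by simp
    moreover have "(\<lambda>p. indicator (UNIV - A) p * ?h p) = (\<lambda>p. ?h p - indicator A p * ?h p)"
     by (auto simp: indicator_def)
    ultimately show ?case using compl(2) h ih[OF A] by simp
   next
    case (union A)
    have Ab: "A i \<in> sets borel" for i using union(2) by (auto simp: borel_eq_closed)
    have s: "(\<lambda>i. indicator (A i) p * ?h p) sums (indicator (\<Union>i. A i) p * ?h p)" for p
    proof (cases "p \<in> (\<Union>i. A i)")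
     case True
     then obtain k where k: "p \<in> A k" by blast
     have "p \<notin> A i" if "i \<noteq> k" for i using union(1) k that by (auto simp: disjoint_family_on_def)
     then have "(\<lambda>i. indicator (A i) p * ?h p) sums (\<Sum>i\<in>{k}. indicator (A i) p * ?h p)"
      by (intro sums_finite) auto
     then show ?thesis using k True by simp
    next
     case False
     then have "(\<lambda>i. indicator (A i) p * ?h p) = (\<lambda>i. 0)" by auto
     then show ?thesis using False by simp
    qed
    have lim: "(\<lambda>k. (\<ointegral>p. (\<Sum>i<k. indicator (A i) p * ?h p))) \<longlonglongrightarrow> (\<ointegral>p. indicator (\<Union>i. A i) p * ?h p)"
    proof (rule integral_dominated_convergence[where w="\<lambda>p. \<bar>?h p\<bar>"])
     have U: "(\<Union>i. A i) \<in> sets borel" using Ab by blast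
     show "(\<lambda>p. indicator (\<Union>i. A i) p * ?h p) \<in> borel_measurable flat_measure" using ih[OF U] by simp
     show "(\<lambda>p. \<Sum>i<k. indicator (A i) p * ?h p) \<in> borel_measurable flat_measure" for k
      using ih[OF Ab] by (intro borel_measurable_sum) simp
     show "integrable flat_measure (\<lambda>p. \<bar>?h p\<bar>)" using h by simp
     show "AE p in flat_measure. (\<lambda>k. \<Sum>i<k. indicator (A i) p * ?h p) \<longlonglongrightarrow> indicator (\<Union>i. A i) p * ?h p"
      using s by (auto simp: sums_def)
     show "AE p in flat_measure. norm (\<Sum>i<k. indicator (A i) p * ?h p) \<le> \<bar>?h p\<bar>" for k
     proof (rule AE_I2)
      fix p :: "'a phase"
      have d: "disjoint_family_on A {..<k}" using union(1) by (auto simp: disjoint_family_on_def)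
      have "(\<Sum>i<k. indicator (A i) p * ?h p) = indicator (\<Union>i<k. A i) p * ?h p"
       by (simp only: indicator_UN_disjoint[OF finite_lessThan d] sum_distrib_right)
      then show "norm (\<Sum>i<k. indicator (A i) p * ?h p) \<le> \<bar>?h p\<bar>"
       by (simp only:) (simp add: indicator_def)
     qed
    qed
    have z: "(\<ointegral>p. (\<Sum>i<k. indicator (A i) p * ?h p)) = 0" for k
     using union by (subst lint_sum) (auto intro: ih[OF Ab])
    show ?case using lim unfolding z LIMSEQ_const_iff by (rule sym)
   qed
  qed
  have hm[measurable]: "?h \<in> borel_measurable flat_measure" using h by simp
  have sgn0: "AE p in flat_measure. \<not> 0 < c * ?h p" for c :: real
  proof -
   let ?B = "{p \<in> space flat_measure. 0 < c * ?h p}"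
   have "?B \<in> sets flat_measure" by measurable
   then have B: "?B \<in> sets borel" by (rule sets_flat_borel)
   have "(\<ointegral>p. indicator ?B p * (c * ?h p)) = c * (\<ointegral>p. indicator ?B p * ?h p)"
    by (subst lint_mult_right_zero[symmetric]) (simp add: mult.left_commute)
   then have z: "(\<ointegral>p. indicator ?B p * (c * ?h p)) = 0" using all[OF B] by simp
   have i: "integrable flat_measure (\<lambda>p. indicator ?B p * (c * ?h p))"
    using integrable_mult_right[OF ih[OF B], of c] by (simp add: mult.left_commute)
   have "AE p in flat_measure. indicator ?B p * (c * ?h p) = 0"
    using integral_nonneg_eq_0_iff_AE[OF i] z by (auto simp: indicator_def)
   then show ?thesis using AE_space by eventually_elim (auto simp: indicator_def split: if_splits)
  qed
  show ?thesis using sgn0[of 1] sgn0[of "-1"] by eventually_elim simp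
 qed
 have "AE p in flat_measure. \<forall>k::nat. indicator (cball 0 (real k)) p * g p = 0"
  unfolding AE_all_countable using ball0 by blast
 then show ?thesis
 proof eventually_elim
  case (elim p)
  obtain k where "norm p \<le> real k" using real_arch_simple by blast
  then show ?case using elim[rule_format, of k] by simp
 qed
qed

text \<open>An element orthogonal to all Lipschitz functions vanishes, so they are dense.\<close>

lemma lip_fun_dense:
 fixes g :: "'a::euclidean_space phase => real"
 assumes g: "g \<in> L2_funs flat_measure" and e: "0 < e"
 obtains \<phi> where "lip_fun \<phi>" "(\<ointegral>p. (g p - \<phi> p)\<^sup>2) < e"
proof -
 let ?S = "L2_of ` Collect lip_fun :: 'a phase_L2 set"
 have "closure ?S = UNIV"
 proof (rule dense_if_orthogonal_trivial)
  show "subspace ?S"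
  proof (rule subspaceI)
   have "lip_fun (\<lambda>p. 0)" by (auto simp: lip_fun_def intro: exI[of _ 0])
   then show "0 \<in> ?S" by (auto simp: zero_phase_L2_def)
   show "x + y \<in> ?S" if "x \<in> ?S" "y \<in> ?S" for x y
    using that by (auto simp: L2_of_ops lip_fun_L2 intro!: imageI lip_fun_add)
   show "c *\<^sub>R x \<in> ?S" if "x \<in> ?S" for c x
    using that by (auto simp: L2_of_scale lip_fun_L2 intro!: imageI lip_fun_scale)
  qed
  fix u :: "'a phase_L2" assume u: "\<And>s. s \<in> ?S ==> u \<bullet> s = 0"
  have "AE p in flat_measure. fn u p = 0"
  proof (rule lip_fun_orthogonal[OF fn_L2])
   fix \<phi> :: "'a phase => real" assume \<phi>: "lip_fun \<phi>"
   show "(\<ointegral>p. fn u p * \<phi> p) = 0"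
    using u[of "L2_of \<phi>"] \<phi> by (simp add: inner_L2_of[OF lip_fun_L2])
  qed
  then have "L2_of (fn u) = L2_of (\<lambda>p. 0)" by (subst L2_of_eq_iff) (auto intro: L2_funs_zero)
  then show "u = 0" by (simp add: zero_phase_L2_def)
 qed
 then have "L2_of g \<in> closure ?S" by simp
 then obtain \<phi> where \<phi>: "lip_fun \<phi>" "dist (L2_of \<phi>) (L2_of g) < sqrt e"
  using closure_approachable[of "L2_of g" ?S] e by (auto dest!: spec[of _ "sqrt e"])
 have "(norm (L2_of g - L2_of \<phi>))\<^sup>2 < (sqrt e)\<^sup>2"
  using \<phi>(2) by (intro power_strict_mono) (auto simp: dist_norm norm_minus_commute)
 then have "(\<ointegral>p. (g p - \<phi> p)\<^sup>2) < e"
  using norm_L2_of_diff[OF g lip_fun_L2[OF \<phi>(1)]] e by simp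
 with \<phi>(1) show thesis by (rule that)
qed

section \<open>Approximation by integral kernels\<close>

text \<open>The common majorant of the kernels below.  As the zonal factor of degree \<open>n\<^sup>2\<close> has width \<open>1/n\<close>, the last
 factor costs no more than a constant in the mass; it absorbs a factor \<open>n * norm (\<omega> - \<eta>)\<close>.\<close>

definition kappa :: "nat => 'a::euclidean_space phase => 'a phase => real" where
 "kappa n p q = box_weight n (fst p - fst q) * (zonal (n\<^sup>2) (snd p) (snd q)
  * (1 + (real n)\<^sup>2 * (norm (snd p - snd q))\<^sup>2))"

text \<open>The extra factor pays for the first moment of \<open>kappa\<close>.\<close>

definition kappa2 :: "nat => 'a::euclidean_space phase => 'a phase => real" where
 "kappa2 n p q = box_weight n (fst p - fst q) * (zonal (n\<^sup>2) (snd p) (snd q)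
  * (1 + (real n)\<^sup>2 * (norm (snd p - snd q))\<^sup>2)\<^sup>2)"

definition kappa_mass :: "'a::euclidean_space itself => real" where
 "kappa_mass T = unit_ball_vol (real DIM('a)) * (1 + 4 * real DIM('a) + 16 * (real DIM('a))\<^sup>2)"

lemma measurable_ident_flat2 [measurable]:
 "(\<lambda>z. z) \<in> measurable (flat_measure \<Otimes>\<^sub>M flat_measure) (borel :: ('a::euclidean_space phase \<times> 'a phase) measure)"
proof -
 have "(\<lambda>z. (fst z, snd z)) \<in> measurable (flat_measure \<Otimes>\<^sub>M flat_measure) ((borel :: 'a phase measure) \<Otimes>\<^sub>M (borel :: 'a phase measure))"
  by (intro measurable_Pair measurable_compose[OF measurable_fst measurable_ident_flat] measurable_compose[OF measurable_snd measurable_ident_flat])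
 then show ?thesis by (simp add: borel_prod)
qed

lemma flat2_measurable:
 fixes f :: "'a::euclidean_space phase \<times> 'a phase => real"
 assumes "f \<in> borel_measurable borel" shows "f \<in> borel_measurable (flat_measure \<Otimes>\<^sub>M flat_measure)"
 by (rule measurable_compose[OF measurable_ident_flat2 assms])

lemma measurable_kappa2: "(\<lambda>(p, q). kappa2 n p (q :: 'a::euclidean_space phase)) \<in> borel_measurable (flat_measure \<Otimes>\<^sub>M flat_measure)"
proof (rule flat2_measurable)
 have [measurable]: "(box_weight n :: 'a => real) \<in> borel_measurable borel" unfolding box_weight_def
  by (intro borel_measurable_times borel_measurable_const borel_measurable_indicator) simp
 have 1: "(\<lambda>z. fst (fst z) - fst (snd z)) \<in> measurable borel (borel :: 'a measure)"
  by (intro borel_measurable_continuous_onI continuous_intros)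
 have 2: "(\<lambda>z. zonal (n\<^sup>2) (snd (fst z)) (snd (snd z)) * (1 + (real n)\<^sup>2 * (norm (snd (fst z) - snd (snd z)))\<^sup>2)\<^sup>2)
   \<in> borel_measurable (borel :: ('a phase \<times> 'a phase) measure)"
  by (intro borel_measurable_continuous_onI continuous_intros)
 show "(\<lambda>(p, q). kappa2 n p q) \<in> borel_measurable (borel :: ('a phase \<times> 'a phase) measure)"
  unfolding kappa2_def case_prod_beta
  by (intro borel_measurable_times 2 measurable_compose[OF 1]) measurable
qed

lemma kappa2_commute: "kappa2 n p q = kappa2 n q p"
 by (simp add: kappa2_def box_weight_def zonal_commute norm_minus_commute indicator_def)

lemma (in pair_sigma_finite) integrable_product_fun:
 fixes f :: "'a => real" and h :: "'b => real"
 assumes f: "integrable M1 f" and h: "integrable M2 h"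
 shows "integrable (M1 \<Otimes>\<^sub>M M2) (\<lambda>z. f (fst z) * h (snd z))"
  and "(\<integral>z. f (fst z) * h (snd z) \<partial>(M1 \<Otimes>\<^sub>M M2)) = (\<integral>x. f x \<partial>M1) * (\<integral>y. h y \<partial>M2)"
proof -
 show i: "integrable (M1 \<Otimes>\<^sub>M M2) (\<lambda>z. f (fst z) * h (snd z))"
 proof (rule Fubini_integrable)
  show "(\<lambda>z. f (fst z) * h (snd z)) \<in> borel_measurable (M1 \<Otimes>\<^sub>M M2)"
   by (intro borel_measurable_times measurable_compose[OF measurable_fst borel_measurable_integrable[OF f]]
     measurable_compose[OF measurable_snd borel_measurable_integrable[OF h]])
 qed (use f h in \<open>auto simp: abs_mult\<close>)
 show "(\<integral>z. f (fst z) * h (snd z) \<partial>(M1 \<Otimes>\<^sub>M M2)) = (\<integral>x. f x \<partial>M1) * (\<integral>y. h y \<partial>M2)"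
  using integral_fst'[OF i] by simp
qed

lemma flat_product:
 fixes f h :: "'a::euclidean_space => real"
 assumes f: "integrable lborel f" and h: "integrable sphere_measure h"
 shows "integrable flat_measure (\<lambda>q. f (fst q) * h (snd q))"
  and "(\<ointegral>q. f (fst q) * h (snd q)) = (\<integral>x. f x \<partial>lborel) * (\<integral>\<omega>. h \<omega> \<partial>sphere_measure)"
 using phase.integrable_product_fun[OF f h] by (simp_all only: flat_measure_def)

lemma lborel_reflect:
 fixes f :: "'a::euclidean_space => real"
 assumes f: "integrable lborel f"
 shows "integrable lborel (\<lambda>y. f (x - y))" "(\<integral>y. f (x - y) \<partial>lborel) = (\<integral>y. f y \<partial>lborel)"
proof -
 have o: "orthogonal_transformation (uminus :: 'a => 'a)"
  using orthogonal_transformation_neg[of "\<lambda>x::'a. x"] by simp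
 have "distr lborel borel (\<lambda>y. x - y) = distr (distr lborel borel uminus) borel ((+) x)"
  by (subst distr_distr) (auto simp: o_def)
 also have "\<dots> = lborel" by (simp only: lborel_distr_orthogonal[OF o] lborel_distr_plus)
 finally have d: "distr lborel borel (\<lambda>y. x - y) = lborel" .
 have fm: "f \<in> borel_measurable borel" using borel_measurable_integrable[OF f] by (simp only: measurable_lborel2)
 have m: "(\<lambda>y. x - y) \<in> measurable lborel (borel :: 'a measure)"
  using borel_measurable_continuous_onI[of "\<lambda>y::'a. x - y"] by (simp add: continuous_on_diff)
 show "integrable lborel (\<lambda>y. f (x - y))" using integrable_distr_eq[OF m fm] f by (simp add: d)
 show "(\<integral>y. f (x - y) \<partial>lborel) = (\<integral>y. f y \<partial>lborel)" using integral_distr[OF m fm] by (simp add: d)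
qed

context
 assumes d2: "2 \<le> DIM('a::euclidean_space)"
begin

lemma kappa2_nonneg: "1 \<le> n ==> p \<in> state_space ==> q \<in> state_space ==> 0 \<le> kappa2 n p (q :: 'a phase)"
 unfolding kappa2_def
 by (intro mult_nonneg_nonneg box_weight_nonneg zonal_nonneg[OF d2]) (auto simp: state_space_def)

lemma kappa_le_kappa2:
 assumes "1 \<le> n" "p \<in> state_space" "q \<in> state_space"
 shows "0 \<le> kappa n p (q :: 'a phase)" "kappa n p q \<le> kappa2 n p q"
proof -
 let ?w = "box_weight n (fst p - fst q)" and ?z = "zonal (n\<^sup>2) (snd p) (snd q)"
  and ?m = "1 + (real n)\<^sup>2 * (norm (snd p - snd q))\<^sup>2"
 have wz: "0 \<le> ?w" "0 \<le> ?z"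
  using assms box_weight_nonneg zonal_nonneg[OF d2] by (auto simp: state_space_def)
 have m: "1 \<le> ?m" by simp
 show "0 \<le> kappa n p q" unfolding kappa_def using wz m by simp
 have "?m * 1 \<le> ?m * ?m" using m by (intro mult_left_mono) auto
 then show "kappa n p q \<le> kappa2 n p q" unfolding kappa_def kappa2_def
  using wz by (intro mult_left_mono) (auto simp: power2_eq_square)
qed

lemma kappa_moment:
 assumes n: "1 \<le> n" and pq: "p \<in> state_space" "q \<in> state_space"
 shows "kappa n p (q :: 'a phase) * dist p q \<le> (2 / real n) * kappa2 n p q"
proof -
 let ?w = "box_weight n (fst p - fst q)" and ?z = "zonal (n\<^sup>2) (snd p) (snd q)"
  and ?r = "norm (snd p - snd q)" and ?x = "norm (fst p - fst q)"
 let ?m = "1 + (real n)\<^sup>2 * ?r\<^sup>2"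
 have m: "1 \<le> ?m" by simp
 have wz: "0 \<le> ?w" "0 \<le> ?z"
  using pq n box_weight_nonneg zonal_nonneg[OF d2] by (auto simp: state_space_def)
 have "dist p q \<le> ?x + ?r"
 proof -
  have "dist p q \<le> dist (fst p) (fst q) + dist (snd p) (snd q)"
   by (cases p; cases q) (simp add: dist_Pair_Pair sqrt_sum_squares_le_sum)
  then show ?thesis by (simp add: dist_norm[of "fst p"] dist_norm[of "snd p"])
 qed
 moreover have "?r \<le> (1 / real n) * ?m"
 proof -
  have "2 * (real n * ?r) * 1 \<le> (real n * ?r)\<^sup>2 + 1\<^sup>2" by (rule sum_squares_bound)
  then have "real n * ?r \<le> ?m" by (simp add: power_mult_distrib)
   (smt (verit) n of_nat_0_le_iff mult_nonneg_nonneg norm_ge_zero)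
  then show ?thesis using n by (simp add: field_simps)
 qed
 moreover have "?w * ?x \<le> ?w * ((1 / real n) * ?m)"
 proof (cases "?x \<le> 1 / real n")
  case True
  have "1 / real n * 1 \<le> 1 / real n * ?m" using m n by (intro mult_left_mono) auto
  then show ?thesis using True wz by (intro mult_left_mono) auto
 qed (simp add: box_weight_def)
 ultimately have "?w * dist p q \<le> ?w * ((2 / real n) * ?m)"
 proof -
  have "?w * dist p q \<le> ?w * ?x + ?w * ?r"
   using \<open>dist p q \<le> ?x + ?r\<close> wz by (simp add: mult_left_mono flip: distrib_left)
  also have "?w * ?r \<le> ?w * ((1 / real n) * ?m)" using \<open>?r \<le> (1 / real n) * ?m\<close> wz by (intro mult_left_mono) auto
  also note \<open>?w * ?x \<le> ?w * ((1 / real n) * ?m)\<close>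
  finally show ?thesis by (simp add: algebra_simps)
 qed
 then have "(?z * ?m) * (?w * dist p q) \<le> (?z * ?m) * (?w * ((2 / real n) * ?m))"
  by (rule mult_left_mono) (use wz m in auto)
 moreover have "kappa n p q * dist p q = (?z * ?m) * (?w * dist p q)" by (simp only: kappa_def mult_ac)
 moreover have "(2 / real n) * kappa2 n p q = (?z * ?m) * (?w * ((2 / real n) * ?m))"
  by (simp only: kappa2_def power2_eq_square[of ?m] mult_ac)
 ultimately show ?thesis by (simp only:)
qed

lemma integral_kappa2:
 assumes n: "1 \<le> n" and p: "p \<in> state_space"
 shows "integrable flat_measure (kappa2 n p :: 'a phase => real)"
  and "(\<ointegral>q. kappa2 n p (q :: 'a phase)) \<le> kappa_mass TYPE('a)"
proof -
 obtain x \<omega> where xw: "p = (x, \<omega>)" by (cases p)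
 have w: "norm \<omega> = 1" using p by (auto simp: xw state_space_def)
 let ?r = "\<lambda>\<eta>. norm (\<omega> - \<eta>)" and ?z = "\<lambda>\<eta>. zonal (n\<^sup>2) \<omega> \<eta>"
 let ?h = "\<lambda>\<eta>. ?z \<eta> * (1 + (real n)\<^sup>2 * (?r \<eta>)\<^sup>2)\<^sup>2"
 note b = lborel_reflect[OF integrable_box_weight[OF n], of x]
 have h: "integrable sphere_measure ?h" by (intro sphere_integrable_continuous continuous_intros)
 have k: "kappa2 n p = (\<lambda>q. box_weight n (x - fst q) * ?h (snd q))" by (rule ext) (simp add: kappa2_def xw)
 show "integrable flat_measure (kappa2 n p)" unfolding k by (rule flat_product(1)[OF b(1) h])
 have N: "1 \<le> n\<^sup>2" using n by simp
 have i: "integrable sphere_measure ?z" "integrable sphere_measure (\<lambda>\<eta>. (?r \<eta>)\<^sup>2 * ?z \<eta>)"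
  "integrable sphere_measure (\<lambda>\<eta>. (?r \<eta>) ^ 4 * ?z \<eta>)"
  by (intro sphere_integrable_continuous continuous_intros)+
 have "(\<integral>\<eta>. ?h \<eta> \<partial>sphere_measure) = (\<integral>\<eta>. ?z \<eta> + (2 * (real n)\<^sup>2) * ((?r \<eta>)\<^sup>2 * ?z \<eta>) + (real n) ^ 4 * ((?r \<eta>) ^ 4 * ?z \<eta>) \<partial>sphere_measure)"
  by (intro Bochner_Integration.integral_cong refl) (simp add: power2_eq_square power4_eq_xxxx algebra_simps)
 also have "\<dots> = (\<integral>\<eta>. ?z \<eta> \<partial>sphere_measure) + (2 * (real n)\<^sup>2) * (\<integral>\<eta>. (?r \<eta>)\<^sup>2 * ?z \<eta> \<partial>sphere_measure)
   + (real n) ^ 4 * (\<integral>\<eta>. (?r \<eta>) ^ 4 * ?z \<eta> \<partial>sphere_measure)"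
  using i by simp
 also have "\<dots> \<le> 1 + (2 * (real n)\<^sup>2) * (2 * real DIM('a) / real (n\<^sup>2)) + (real n) ^ 4 * (16 * (real DIM('a))\<^sup>2 / (real (n\<^sup>2))\<^sup>2)"
  using zonal_moments_le[OF d2 w N] by (intro add_mono mult_left_mono) (auto simp: integral_zonal[OF d2 w])
 also have "\<dots> = 1 + 4 * real DIM('a) + 16 * (real DIM('a))\<^sup>2"
  using n by (simp add: power_mult[symmetric])
 finally have "(\<integral>\<eta>. ?h \<eta> \<partial>sphere_measure) \<le> 1 + 4 * real DIM('a) + 16 * (real DIM('a))\<^sup>2" .
 then show "(\<ointegral>q. kappa2 n p q) \<le> kappa_mass TYPE('a)"
  unfolding k flat_product(2)[OF b(1) h] b(2) integral_box_weight[OF n] kappa_mass_def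
  by (intro mult_left_mono) (auto intro: less_imp_le[OF unit_ball_vol_pos])
qed

text \<open>Schur's test: by Cauchy-Schwarz with respect to the majorant, the square of the image is at most
 the row mass times an average of \<open>g\<^sup>2\<close>; integrating in \<open>p\<close> leaves the column mass, which equals the
 row mass because \<open>kappa2\<close> is symmetric.\<close>

lemma schur_test:
 fixes A :: "'a phase => 'a phase => real"
 assumes n: "1 \<le> n" and C: "0 \<le> C" and E: "E \<in> sets flat_measure"
  and Am: "(\<lambda>(p, q). A p q) \<in> borel_measurable (flat_measure \<Otimes>\<^sub>M flat_measure)"
  and A: "\<And>p q. p \<in> E ==> q \<in> state_space ==> \<bar>A p q\<bar> \<le> C * kappa2 n p q"
  and g: "g \<in> L2_funs flat_measure"
 shows "(\<lambda>p. indicator E p * (\<ointegral>q. A p q * g q)) \<in> L2_funs flat_measure"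
  and "(\<ointegral>p. (indicator E p * (\<ointegral>q. A p q * g q))\<^sup>2)
   \<le> (C * kappa_mass TYPE('a))\<^sup>2 * (\<ointegral>q. (g q)\<^sup>2)"
proof -
 let ?c = "kappa_mass TYPE('a)"
 let ?F = "\<lambda>p. indicator E p * (\<ointegral>q. A p q * g q)"
 have c: "0 \<le> ?c" unfolding kappa_mass_def by (intro mult_nonneg_nonneg) (auto intro: less_imp_le[OF unit_ball_vol_pos])
 have Es: "E \<subseteq> state_space" using sets.sets_into_space[OF E] by simp
 have gm[measurable]: "g \<in> borel_measurable flat_measure" using g by (rule L2_funsD)
 note [measurable] = Am E measurable_kappa2[of n]
 have Fm[measurable]: "?F \<in> borel_measurable flat_measure" by measurable
 let ?k = "\<lambda>p q. ennreal (kappa2 n p q)"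
 have kint: "(\<integral>\<^sup>+q. ?k p q \<partial>flat_measure) \<le> ennreal ?c" if p: "p \<in> state_space" for p :: "'a phase"
 proof -
  have "(\<integral>\<^sup>+q. ?k p q \<partial>flat_measure) = ennreal (\<ointegral>q. kappa2 n p q)"
   by (rule nn_integral_eq_integral[OF integral_kappa2(1)[OF n p]]) (use kappa2_nonneg[OF n p] in auto)
  also have "\<dots> \<le> ennreal ?c" by (intro ennreal_leI integral_kappa2 n p)
  finally show ?thesis .
 qed
 have pw: "ennreal ((?F p)\<^sup>2) \<le> ennreal (C\<^sup>2 * ?c) * (\<integral>\<^sup>+q. ?k p q * ennreal ((g q)\<^sup>2) \<partial>flat_measure)"
  if p: "p \<in> state_space" for p
 proof (cases "p \<in> E")
  case True
  have [measurable]: "A p \<in> borel_measurable flat_measure" "kappa2 n p \<in> borel_measurable flat_measure"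
   using measurable_compose_Pair1[of p flat_measure "\<lambda>(p, q). A p q", OF _ Am]
    measurable_compose_Pair1[of p flat_measure "\<lambda>(p, q). kappa2 n p q", OF _ measurable_kappa2] p by simp_all
  have "ennreal \<bar>?F p\<bar> \<le> (\<integral>\<^sup>+q. ennreal \<bar>A p q * g q\<bar> \<partial>flat_measure)"
  proof (cases "integrable flat_measure (\<lambda>q. A p q * g q)")
   case True
   from integral_norm_bound_ennreal[OF this] show ?thesis using \<open>p \<in> E\<close> by simp
  qed (simp add: not_integrable_integral_eq)
  also have "\<dots> \<le> (\<integral>\<^sup>+q. ennreal C * (ennreal (sqrt (kappa2 n p q)) * ennreal (sqrt (kappa2 n p q) * \<bar>g q\<bar>)) \<partial>flat_measure)"
  proof (rule nn_integral_mono)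
   fix q :: "'a phase" assume "q \<in> space flat_measure"
   then have q: "q \<in> state_space" by simp
   have "\<bar>A p q * g q\<bar> \<le> C * kappa2 n p q * \<bar>g q\<bar>"
    unfolding abs_mult using A[OF True q] by (intro mult_right_mono) auto
   also have "\<dots> = C * (sqrt (kappa2 n p q) * (sqrt (kappa2 n p q) * \<bar>g q\<bar>))"
    using kappa2_nonneg[OF n p q] by (simp add: mult.assoc[symmetric])
   finally show "ennreal \<bar>A p q * g q\<bar> \<le> ennreal C * (ennreal (sqrt (kappa2 n p q)) * ennreal (sqrt (kappa2 n p q) * \<bar>g q\<bar>))"
    using kappa2_nonneg[OF n p q] C by (simp add: ennreal_mult[symmetric] ennreal_leI)
  qed
  also have "\<dots> = ennreal C * (\<integral>\<^sup>+q. ennreal (sqrt (kappa2 n p q)) * ennreal (sqrt (kappa2 n p q) * \<bar>g q\<bar>) \<partial>flat_measure)"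
   by (rule nn_integral_cmult) measurable
  finally have "(ennreal \<bar>?F p\<bar>)\<^sup>2 \<le> (ennreal C * (\<integral>\<^sup>+q. ennreal (sqrt (kappa2 n p q)) * ennreal (sqrt (kappa2 n p q) * \<bar>g q\<bar>) \<partial>flat_measure))\<^sup>2"
   by (rule power_mono) simp
  also have "\<dots> \<le> (ennreal C)\<^sup>2 * ((\<integral>\<^sup>+q. (ennreal (sqrt (kappa2 n p q)))\<^sup>2 \<partial>flat_measure) * (\<integral>\<^sup>+q. (ennreal (sqrt (kappa2 n p q) * \<bar>g q\<bar>))\<^sup>2 \<partial>flat_measure))"
   unfolding power_mult_distrib by (intro mult_left_mono Cauchy_Schwarz_nn_integral) auto
  also have "(\<integral>\<^sup>+q. (ennreal (sqrt (kappa2 n p q)))\<^sup>2 \<partial>flat_measure) = (\<integral>\<^sup>+q. ?k p q \<partial>flat_measure)"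
   by (intro nn_integral_cong) (use kappa2_nonneg[OF n p] in \<open>auto simp: ennreal_power\<close>)
  also have "(\<integral>\<^sup>+q. (ennreal (sqrt (kappa2 n p q) * \<bar>g q\<bar>))\<^sup>2 \<partial>flat_measure) = (\<integral>\<^sup>+q. ?k p q * ennreal ((g q)\<^sup>2) \<partial>flat_measure)"
   by (intro nn_integral_cong) (use kappa2_nonneg[OF n p] in \<open>auto simp: ennreal_power power_mult_distrib ennreal_mult\<close>)
  also have "(ennreal C)\<^sup>2 * ((\<integral>\<^sup>+q. ?k p q \<partial>flat_measure) * (\<integral>\<^sup>+q. ?k p q * ennreal ((g q)\<^sup>2) \<partial>flat_measure))
    \<le> (ennreal C)\<^sup>2 * (ennreal ?c * (\<integral>\<^sup>+q. ?k p q * ennreal ((g q)\<^sup>2) \<partial>flat_measure))"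
   by (intro mult_left_mono mult_right_mono kint p) auto
  also have "\<dots> = ennreal (C\<^sup>2 * ?c) * (\<integral>\<^sup>+q. ?k p q * ennreal ((g q)\<^sup>2) \<partial>flat_measure)"
   using C c by (simp add: ennreal_power ennreal_mult mult.assoc)
  finally show ?thesis by (simp add: ennreal_power)
 qed simp
 have g2: "(\<integral>\<^sup>+q. ennreal ((g q)\<^sup>2) \<partial>flat_measure) = ennreal (\<ointegral>q. (g q)\<^sup>2)"
  by (rule nn_integral_eq_integral[OF L2_funsD(2)[OF g]]) simp
 have "(\<integral>\<^sup>+p. ennreal ((?F p)\<^sup>2) \<partial>flat_measure)
   \<le> (\<integral>\<^sup>+p. ennreal (C\<^sup>2 * ?c) * (\<integral>\<^sup>+q. ?k p q * ennreal ((g q)\<^sup>2) \<partial>flat_measure) \<partial>flat_measure)"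
  by (rule nn_integral_mono) (use pw in simp)
 also have "\<dots> = ennreal (C\<^sup>2 * ?c) * (\<integral>\<^sup>+p. (\<integral>\<^sup>+q. ?k p q * ennreal ((g q)\<^sup>2) \<partial>flat_measure) \<partial>flat_measure)"
  by (rule nn_integral_cmult) measurable
 also have "(\<integral>\<^sup>+p. (\<integral>\<^sup>+q. ?k p q * ennreal ((g q)\<^sup>2) \<partial>flat_measure) \<partial>flat_measure)
   = (\<integral>\<^sup>+q. (\<integral>\<^sup>+p. ?k p q * ennreal ((g q)\<^sup>2) \<partial>flat_measure) \<partial>flat_measure)"
  by (rule flat2.Fubini'[symmetric]) measurable
 also have "\<dots> \<le> (\<integral>\<^sup>+q. ennreal ?c * ennreal ((g q)\<^sup>2) \<partial>flat_measure)"
 proof (rule nn_integral_mono)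
  fix q :: "'a phase" assume "q \<in> space flat_measure"
  then have q: "q \<in> state_space" by simp
  have [measurable]: "kappa2 n q \<in> borel_measurable flat_measure"
   using measurable_compose_Pair1[of q flat_measure "\<lambda>(p, q). kappa2 n p q", OF _ measurable_kappa2] q by simp
  have "(\<integral>\<^sup>+p. ?k p q * ennreal ((g q)\<^sup>2) \<partial>flat_measure) = (\<integral>\<^sup>+p. ?k q p \<partial>flat_measure) * ennreal ((g q)\<^sup>2)"
   unfolding kappa2_commute[of n _ q] by (rule nn_integral_multc) measurable
  also have "\<dots> \<le> ennreal ?c * ennreal ((g q)\<^sup>2)" by (intro mult_right_mono kint q) auto
  finally show "(\<integral>\<^sup>+p. ?k p q * ennreal ((g q)\<^sup>2) \<partial>flat_measure) \<le> ennreal ?c * ennreal ((g q)\<^sup>2)" .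
 qed
 also have "\<dots> = ennreal ?c * ennreal (\<ointegral>q. (g q)\<^sup>2)"
  by (subst nn_integral_cmult) (auto simp: g2)
 finally have "(\<integral>\<^sup>+p. ennreal ((?F p)\<^sup>2) \<partial>flat_measure)
   \<le> ennreal (C\<^sup>2 * ?c) * (ennreal ?c * ennreal (\<ointegral>q. (g q)\<^sup>2))"
  by (meson mult_left_mono order_trans zero_le)
 also have "\<dots> = ennreal ((C * ?c)\<^sup>2 * (\<ointegral>q. (g q)\<^sup>2))"
  using C c by (simp add: ennreal_mult[symmetric] power_mult_distrib power2_eq_square mult_ac)
 finally have b: "(\<integral>\<^sup>+p. ennreal ((?F p)\<^sup>2) \<partial>flat_measure) \<le> ennreal ((C * ?c)\<^sup>2 * (\<ointegral>q. (g q)\<^sup>2))" .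
 have i: "integrable flat_measure (\<lambda>p. (?F p)\<^sup>2)"
 proof (rule integrableI_bounded)
  show "(\<lambda>p. (?F p)\<^sup>2) \<in> borel_measurable flat_measure" by measurable
  show "(\<integral>\<^sup>+p. ennreal (norm ((?F p)\<^sup>2)) \<partial>flat_measure) < \<infinity>" using le_less_trans[OF b] by simp
 qed
 then show "?F \<in> L2_funs flat_measure" using Fm by (simp add: L2_funs_def)
 have "ennreal (\<ointegral>p. (?F p)\<^sup>2) \<le> ennreal ((C * ?c)\<^sup>2 * (\<ointegral>q. (g q)\<^sup>2))"
  using b nn_integral_eq_integral[OF i] by simp
 then show "(\<ointegral>p. (?F p)\<^sup>2) \<le> (C * ?c)\<^sup>2 * (\<ointegral>q. (g q)\<^sup>2)"
  by (subst (asm) ennreal_le_iff) auto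
qed

end


lemma integrable_cylinder: "integrable flat_measure (indicator (cyl R) :: 'a::euclidean_space phase => real)"
 by (rule integrable_real_indicator[OF sets_cylinder emeasure_cylinder_finite])

lemma square_sum3_le: "(a + b + c)\<^sup>2 \<le> 3 * (a\<^sup>2 + b\<^sup>2 + (c::real)\<^sup>2)"
proof -
 have "0 \<le> (a - b)\<^sup>2 + (b - c)\<^sup>2 + (a - c)\<^sup>2" by simp
 then show ?thesis by (simp add: power2_eq_square algebra_simps)
qed

lemma L2_funs_cylinder:
 assumes "g \<in> L2_funs (flat_measure :: 'a::euclidean_space phase measure)"
 shows "(\<lambda>p. indicator (cyl R) p * g p) \<in> L2_funs flat_measure"
proof -
 have gm[measurable]: "g \<in> borel_measurable flat_measure" using assms by (rule L2_funsD)
 have m: "(\<lambda>p. indicator (cyl R) p * g p) \<in> borel_measurable flat_measure"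
  using sets_cylinder by (intro borel_measurable_times borel_measurable_indicator gm)
 have "integrable flat_measure (\<lambda>p. (indicator (cyl R) p * g p)\<^sup>2)"
  by (rule Bochner_Integration.integrable_bound[OF L2_funsD(2)[OF assms]])
   (use m in \<open>auto simp: indicator_def\<close>)
 then show ?thesis using m by (simp add: L2_funs_def)
qed

context
 assumes d2: "2 \<le> DIM('a::euclidean_space)"
begin

lemma kernel_row_L2:
 fixes A :: "'a phase => 'a phase => real"
 assumes n: "1 \<le> n" and cont: "continuous_on UNIV (\<lambda>(p, q). A p q)"
  and bound: "\<And>q. q \<in> state_space ==> \<bar>A p q\<bar> \<le> C * kappa n p q"
  and p: "norm (fst p) \<le> R"
 shows "continuous_on state_space (A p)" "xsupp (R + 1) (A p)" "A p \<in> L2_funs flat_measure"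
proof -
 have "continuous_on UNIV (\<lambda>q. (\<lambda>(p, q). A p q) (p, q))"
  by (rule continuous_on_compose2[OF cont]) (auto intro!: continuous_intros)
 then show c: "continuous_on state_space (A p)" using continuous_on_subset by auto
 show s: "xsupp (R + 1) (A p)" unfolding xsupp_def
 proof (intro ballI impI)
  fix q :: "'a phase" assume q: "q \<in> state_space" "R + 1 < norm (fst q)"
  have "1 < norm (fst p - fst q)" using q(2) p norm_triangle_ineq2[of "fst q" "fst p"] by (simp add: norm_minus_commute)
  moreover have "1 / real n \<le> 1" using n by simp
  ultimately have "kappa n p q = 0" by (simp add: kappa_def box_weight_def)
  then show "A p q = 0" using bound[OF q(1)] by simp
 qed
 show "A p \<in> L2_funs flat_measure" by (rule L2_funs_continuous[OF c s])
qed

text \<open>Kernels controlled by \<open>kappa\<close> whose mass tends to \<open>c\<close> converge strongly to multiplication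
 by \<open>c\<close>: this is clear on Lipschitz functions, by the first moment of \<open>kappa\<close>, and
 Schur's test extends it to all of \<open>L\<^sup>2\<close>.\<close>

lemma kernel_approximation:
 fixes A :: "nat => 'a phase => 'a phase => real" and g :: "'a phase => real"
 assumes cont: "\<And>n. 1 \<le> n ==> continuous_on UNIV (\<lambda>(p, q). A n p q)" and C: "0 \<le> C"
  and bound: "\<And>n p q. 1 \<le> n ==> p \<in> cyl R ==> q \<in> state_space ==> \<bar>A n p q\<bar> \<le> C * kappa n p q"
  and mass: "\<And>n p. 1 \<le> n ==> p \<in> cyl R ==> \<bar>(\<ointegral>q. A n p q) - c\<bar> \<le> C / real n"
  and g: "g \<in> L2_funs flat_measure"
 shows "(\<lambda>n. (\<ointegral>p. (indicator (cyl R) p * ((\<ointegral>q. A n p q * g q) - c * g p))\<^sup>2)) \<longlonglongrightarrow> 0"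
  (is "?X \<longlonglongrightarrow> 0")
proof (rule LIMSEQ_I)
 let ?E = "cyl R :: 'a phase set"
 let ?i = "\<lambda>p. indicator ?E p :: real"
 let ?K = "kappa_mass TYPE('a)"
 let ?T = "\<lambda>n g p. ?i p * ((\<ointegral>q. A n p q * g q) - c * g p)"
 have Es: "p \<in> state_space" if "p \<in> ?E" for p using that by (auto simp: state_space_def)
 have K0: "0 \<le> ?K" unfolding kappa_mass_def by (intro mult_nonneg_nonneg) (auto intro: less_imp_le[OF unit_ball_vol_pos])
 have Am: "(\<lambda>(p, q). A n p q) \<in> borel_measurable (flat_measure \<Otimes>\<^sub>M flat_measure)" if "1 \<le> n" for n
  by (rule flat2_measurable[OF borel_measurable_continuous_onI[OF cont[OF that]]])
 have b2: "\<bar>A n p q\<bar> \<le> C * kappa2 n p q" if "1 \<le> n" "p \<in> ?E" "q \<in> state_space" for n p q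
  using bound[OF that] mult_left_mono[OF kappa_le_kappa2(2)[OF d2 that(1) Es[OF that(2)] that(3)] C] by linarith
 note schur = schur_test[OF d2 _ C sets_cylinder Am b2]
 have row: "A n p \<in> L2_funs flat_measure" if "1 \<le> n" "p \<in> ?E" for n p
  by (rule kernel_row_L2(3)[OF that(1) cont[OF that(1)] bound[OF that], of R]) (use that in auto)
 have row1: "integrable flat_measure (A n p)" if "1 \<le> n" "p \<in> ?E" for n p
  by (rule flat_integrable[OF kernel_row_L2(1,2)[OF that(1) cont[OF that(1)] bound[OF that], of R]]) (use that in auto)
 have TL2: "?T n h \<in> L2_funs flat_measure" if "1 \<le> n" "h \<in> L2_funs flat_measure" for n h
 proof -
  have "(\<lambda>p. ?i p * (\<ointegral>q. A n p q * h q) - c * (?i p * h p)) \<in> L2_funs flat_measure"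
   by (intro L2_funs_diff L2_funs_scale L2_funs_cylinder that schur(1)[OF that(1) that(1) that(1)]) auto
  moreover have "(\<lambda>p. ?i p * (\<ointegral>q. A n p q * h q) - c * (?i p * h p)) = ?T n h"
   by (simp add: fun_eq_iff algebra_simps)
  ultimately show ?thesis by simp
 qed
 fix e :: real assume e: "0 < e"
 \<comment> \<open>so that the part of \<open>g\<close> outside the Lipschitz functions contributes at most \<open>e / 2\<close> below\<close>
 define e1 where "e1 = e / (6 * ((C * ?K)\<^sup>2 + c\<^sup>2 + 1))"
 have den: "0 < (C * ?K)\<^sup>2 + c\<^sup>2 + 1" by (simp add: add_nonneg_pos)
 have e1: "0 < e1" using e den by (simp add: e1_def)
 obtain \<phi> where \<phi>: "lip_fun \<phi>" "(\<ointegral>p. (g p - \<phi> p)\<^sup>2) < e1" using lip_fun_dense[OF g e1] .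
 obtain L where L: "0 \<le> L" "\<And>p q. \<bar>\<phi> p - \<phi> q\<bar> \<le> L * dist p q" using \<phi>(1) by (auto simp: lip_fun_def)
 obtain B where B: "\<And>p. \<bar>\<phi> p\<bar> \<le> B" using lip_fun_bounded[OF \<phi>(1)] by blast
 have \<phi>L2: "\<phi> \<in> L2_funs flat_measure" by (rule lip_fun_L2[OF \<phi>(1)])
 define h where "h p = g p - \<phi> p" for p
 have hL2: "h \<in> L2_funs flat_measure" unfolding h_def by (rule L2_funs_diff[OF g \<phi>L2])
 have h2: "(\<ointegral>p. (h p)\<^sup>2) < e1" using \<phi>(2) by (simp add: h_def)
 define D where "D = 2 * C * L * ?K + B * C"
 have T\<phi>: "\<bar>?T n \<phi> p\<bar> \<le> D / real n * ?i p" if n: "1 \<le> n" for n p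
 proof (cases "p \<in> ?E")
  case True
  have ps: "p \<in> state_space" by (rule Es[OF True])
  have i1: "integrable flat_measure (\<lambda>q. A n p q * \<phi> q)" by (rule L2_funs_mult_integrable[OF row[OF n True] \<phi>L2])
  have i2: "integrable flat_measure (\<lambda>q. A n p q * \<phi> p)" using row1[OF n True] by simp
  have i3: "integrable flat_measure (\<lambda>q. A n p q * (\<phi> q - \<phi> p))"
   using Bochner_Integration.integrable_diff[OF i1 i2] by (simp add: right_diff_distrib)
  have "(\<ointegral>q. A n p q * (\<phi> q - \<phi> p)) = (\<ointegral>q. A n p q * \<phi> q) - (\<ointegral>q. A n p q * \<phi> p)"
   unfolding right_diff_distrib by (rule lint_diff[OF i1 i2])
  then have split: "(\<ointegral>q. A n p q * \<phi> q) - c * \<phi> p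
    = (\<ointegral>q. A n p q * (\<phi> q - \<phi> p)) + \<phi> p * ((\<ointegral>q. A n p q) - c)"
   by (simp add: algebra_simps)
  have "\<bar>\<ointegral>q. A n p q * (\<phi> q - \<phi> p)\<bar> \<le> (\<ointegral>q. \<bar>A n p q * (\<phi> q - \<phi> p)\<bar>)"
   by (rule integral_abs_bound)
  also have "\<dots> \<le> (\<ointegral>q. (2 * C * L / real n) * kappa2 n p q)"
  proof (rule integral_mono)
   show "integrable flat_measure (\<lambda>q. \<bar>A n p q * (\<phi> q - \<phi> p)\<bar>)" using i3 by simp
   show "integrable flat_measure (\<lambda>q. (2 * C * L / real n) * kappa2 n p q)"
    using integral_kappa2(1)[OF d2 n ps] by simp
   fix q :: "'a phase" assume "q \<in> space flat_measure"
   then have q: "q \<in> state_space" by simp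
   have "\<bar>A n p q * (\<phi> q - \<phi> p)\<bar> \<le> (C * kappa n p q) * (L * dist p q)"
    unfolding abs_mult using bound[OF n True q] L(2)[of q p] L(1)
    by (intro mult_mono) (auto simp: dist_commute)
   also have "\<dots> = (C * L) * (kappa n p q * dist p q)" by (simp add: mult_ac)
   also have "\<dots> \<le> (C * L) * ((2 / real n) * kappa2 n p q)"
    using C L(1) by (intro mult_left_mono kappa_moment[OF d2 n ps q]) auto
   finally show "\<bar>A n p q * (\<phi> q - \<phi> p)\<bar> \<le> (2 * C * L / real n) * kappa2 n p q" by (simp add: mult_ac)
  qed
  also have "\<dots> = (2 * C * L / real n) * (\<ointegral>q. kappa2 n p q)" by simp
  also have "\<dots> \<le> (2 * C * L / real n) * ?K"
   using C L(1) by (intro mult_left_mono integral_kappa2(2)[OF d2 n ps]) auto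
  finally have 1: "\<bar>\<ointegral>q. A n p q * (\<phi> q - \<phi> p)\<bar> \<le> (2 * C * L / real n) * ?K" .
  have 2: "\<bar>\<phi> p * ((\<ointegral>q. A n p q) - c)\<bar> \<le> B * (C / real n)"
   unfolding abs_mult using B[of p] mass[OF n True] by (intro mult_mono) auto
  have "\<bar>(\<ointegral>q. A n p q * \<phi> q) - c * \<phi> p\<bar> \<le> (2 * C * L / real n) * ?K + B * (C / real n)"
   unfolding split using 1 2 by linarith
  also have "\<dots> = D / real n" by (simp add: D_def add_divide_distrib)
  finally show ?thesis using True by simp
 qed simp
 have Tadd: "?T n g p = ?T n \<phi> p + ?i p * (\<ointegral>q. A n p q * h q) + (- c) * (?i p * h p)"
  if n: "1 \<le> n" for n p
 proof (cases "p \<in> ?E")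
  case True
  have "(\<ointegral>q. A n p q * h q) = (\<ointegral>q. A n p q * g q) - (\<ointegral>q. A n p q * \<phi> q)"
   unfolding h_def right_diff_distrib
   by (rule lint_diff; rule L2_funs_mult_integrable[OF row[OF n True]]) (rule g \<phi>L2)+
  then show ?thesis using True by (simp add: h_def algebra_simps)
 qed simp
 have est: "?X n \<le> 3 * ((D / real n)\<^sup>2 * measure flat_measure ?E + ((C * ?K)\<^sup>2 + c\<^sup>2) * e1)" if n: "1 \<le> n" for n
 proof -
  let ?a = "?T n \<phi>" and ?b = "\<lambda>p. ?i p * (\<ointegral>q. A n p q * h q)" and ?d = "\<lambda>p. (- c) * (?i p * h p)"
  have bL: "?b \<in> L2_funs flat_measure" and bi: "(\<ointegral>p. (?b p)\<^sup>2) \<le> (C * ?K)\<^sup>2 * (\<ointegral>p. (h p)\<^sup>2)"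
   using schur[OF n n n _ _ hL2] by auto
  have dL: "?d \<in> L2_funs flat_measure" by (intro L2_funs_scale L2_funs_cylinder hL2)
  have aL: "?a \<in> L2_funs flat_measure" by (rule TL2[OF n \<phi>L2])
  have "?X n \<le> (\<ointegral>p. 3 * ((?a p)\<^sup>2 + (?b p)\<^sup>2 + (?d p)\<^sup>2))"
  proof (rule integral_mono)
   show "integrable flat_measure (\<lambda>p. (?T n g p)\<^sup>2)" by (rule L2_funsD(2)[OF TL2[OF n g]])
   show "integrable flat_measure (\<lambda>p. 3 * ((?a p)\<^sup>2 + (?b p)\<^sup>2 + (?d p)\<^sup>2))"
    by (intro integrable_mult_right Bochner_Integration.integrable_add L2_funsD(2)[OF aL] L2_funsD(2)[OF bL] L2_funsD(2)[OF dL])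
   show "(?T n g p)\<^sup>2 \<le> 3 * ((?a p)\<^sup>2 + (?b p)\<^sup>2 + (?d p)\<^sup>2)" for p
    unfolding Tadd[OF n] by (rule square_sum3_le)
  qed
  also have "\<dots> = 3 * ((\<ointegral>p. (?a p)\<^sup>2) + (\<ointegral>p. (?b p)\<^sup>2) + (\<ointegral>p. (?d p)\<^sup>2))"
   using L2_funsD(2)[OF aL] L2_funsD(2)[OF bL] L2_funsD(2)[OF dL]
   by (subst lint_mult_right_zero) (simp only: lint_add Bochner_Integration.integrable_add)
  also have "(\<ointegral>p. (?a p)\<^sup>2) \<le> (\<ointegral>p. (D / real n)\<^sup>2 * ?i p)"
  proof (rule integral_mono[OF L2_funsD(2)[OF aL]])
   show "integrable flat_measure (\<lambda>p. (D / real n)\<^sup>2 * ?i p)"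
    using integrable_cylinder[of R] by (intro integrable_mult_right)
   fix p
   have "\<bar>?a p\<bar>\<^sup>2 \<le> (D / real n * ?i p)\<^sup>2" by (rule power_mono[OF T\<phi>[OF n]]) simp
   then show "(?a p)\<^sup>2 \<le> (D / real n)\<^sup>2 * ?i p"
    by (cases "p \<in> ?E") (simp_all only: indicator_simps power2_abs mult_1 mult_1_right mult_zero_left mult_zero_right order_refl zero_power2 not_False_eq_True)
  qed
  also have "(\<ointegral>p. (D / real n)\<^sup>2 * ?i p) = (D / real n)\<^sup>2 * measure flat_measure ?E"
  proof -
   have "?E \<inter> space flat_measure = ?E" by (auto simp: state_space_def)
   then show ?thesis by (subst lint_mult_right_zero) simp
  qed
  also have "(\<ointegral>p. (?b p)\<^sup>2) \<le> (C * ?K)\<^sup>2 * e1"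
   using bi mult_left_mono[OF less_imp_le[OF h2], of "(C * ?K)\<^sup>2"] by simp
  also have "(\<ointegral>p. (?d p)\<^sup>2) \<le> (\<ointegral>p. c\<^sup>2 * (h p)\<^sup>2)"
   by (rule integral_mono[OF L2_funsD(2)[OF dL]])
    (use L2_funsD(2)[OF hL2] in \<open>auto simp: power_mult_distrib indicator_def\<close>)
  also have "(\<ointegral>p. c\<^sup>2 * (h p)\<^sup>2) \<le> c\<^sup>2 * e1"
   using h2 by (simp add: mult_left_mono)
  finally show ?thesis by (simp add: algebra_simps)
 qed
 let ?v = "measure flat_measure ?E"
 have "(\<lambda>n. 3 * ((D / real n)\<^sup>2 * ?v + ((C * ?K)\<^sup>2 + c\<^sup>2) * e1)) \<longlonglongrightarrow> 3 * (0\<^sup>2 * ?v + ((C * ?K)\<^sup>2 + c\<^sup>2) * e1)"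
  by (intro tendsto_intros lim_const_over_n)
 moreover have "3 * (0\<^sup>2 * ?v + ((C * ?K)\<^sup>2 + c\<^sup>2) * e1) < e"
 proof -
  have "3 * (((C * ?K)\<^sup>2 + c\<^sup>2) * e1) \<le> 3 * (((C * ?K)\<^sup>2 + c\<^sup>2 + 1) * e1)" using e1 by (intro mult_left_mono mult_right_mono) auto
  also have "\<dots> = e / 2"
  proof -
   have "3 * (X * (e / (6 * X))) = e / 2" if "0 < X" for X :: real using that by simp
   from this[OF den] show ?thesis by (simp only: e1_def)
  qed
  finally show ?thesis using e by simp
 qed
 ultimately have "\<forall>\<^sub>F n in sequentially. 3 * ((D / real n)\<^sup>2 * ?v + ((C * ?K)\<^sup>2 + c\<^sup>2) * e1) < e"
  by (rule order_tendstoD)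
 then obtain N where N: "\<And>n. N \<le> n ==> 3 * ((D / real n)\<^sup>2 * ?v + ((C * ?K)\<^sup>2 + c\<^sup>2) * e1) < e"
  by (auto simp: eventually_sequentially)
 have "norm (?X n - 0) < e" if "max N 1 \<le> n" for n
 proof -
  have "?X n < e" using est[of n] N[of n] that by simp
  moreover have "0 \<le> ?X n" by (rule integral_nonneg_AE) simp
  ultimately show ?thesis by simp
 qed
 then show "\<exists>no. \<forall>n\<ge>no. norm (?X n - 0) < e" by blast
qed

end

section \<open>Quadratic expressions in integral operators\<close>

interpretation flat3: pair_sigma_finite "flat_measure :: 'a::euclidean_space phase measure"
  "(flat_measure :: 'a phase measure) \<Otimes>\<^sub>M (flat_measure :: 'a phase measure)"
 by (intro pair_sigma_finite.intro sigma_finite_flat flat2.sigma_finite_measure_axioms)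

text \<open>Continuous kernels that do not look further than one unit beyond the ball of radius \<open>R\<close>; then
 all integrals below are over bounded sets.\<close>

definition local_kernel :: "real => ('a::euclidean_space phase => 'a phase => real) => bool" where
 "local_kernel R A \<longleftrightarrow> continuous_on UNIV (\<lambda>(p, q). A p q) \<and>
  (\<forall>p q. norm (fst p) \<le> R \<longrightarrow> R + 1 < norm (fst q) \<longrightarrow> A p q = 0)"

definition apply_kernel :: "('a::euclidean_space phase => 'a phase => real) => ('a phase => real) => 'a phase => real" where
 "apply_kernel A g p = (\<ointegral>q. A p q * g q)"

lemma local_kernel_eq_0:
 "local_kernel R A ==> norm (fst p) \<le> R ==> \<not> norm (fst q) \<le> R + 1 ==> A p q = 0"
 unfolding local_kernel_def not_le by blast

lemma local_kernel_L2:
 assumes "local_kernel R A" "norm (fst p) \<le> R" shows "A p \<in> L2_funs flat_measure"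
proof (rule L2_funs_continuous)
 have "continuous_on UNIV (\<lambda>q. (\<lambda>(p, q). A p q) (p, q))"
  by (rule continuous_on_compose2[of UNIV "\<lambda>(p, q). A p q"]) (use assms in \<open>auto simp: local_kernel_def intro!: continuous_intros\<close>)
 then show "continuous_on state_space (A p)" using continuous_on_subset by auto
 show "xsupp (R + 1) (A p)" using local_kernel_eq_0[OF assms] by (simp add: xsupp_def)
qed

text \<open>Exchanging the integrals keeps all derivatives on the kernels: an identity for the kernels, integrated in
 \<open>p\<close>, yields one for the functions they produce.\<close>

lemma bilinear_Fubini:
 fixes A1 A2 :: "'a::euclidean_space phase => 'a phase => real"
 assumes A1: "local_kernel R A1" and A2: "local_kernel R A2"
  and w: "continuous_on state_space w" and ws: "xsupp R w"
  and g: "g \<in> L2_funs flat_measure"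
 defines "G \<equiv> \<lambda>z. (indicator (cyl (R + 1)) (fst z) * g (fst z)) *
   (indicator (cyl (R + 1)) (snd z) * g (snd z))"
 shows "integrable flat_measure (\<lambda>p. w p * (apply_kernel A1 g p * apply_kernel A2 g p))"
  and "integrable (flat_measure \<Otimes>\<^sub>M flat_measure) (\<lambda>z. G z * (\<ointegral>p. w p * (A1 p (fst z) * A2 p (snd z))))"
  and "(\<ointegral>p. w p * (apply_kernel A1 g p * apply_kernel A2 g p))
   = (\<integral>z. G z * (\<ointegral>p. w p * (A1 p (fst z) * A2 p (snd z))) \<partial>(flat_measure \<Otimes>\<^sub>M flat_measure))"
proof -
 let ?E = "cyl (R + 1) :: 'a phase set"
 let ?g = "\<lambda>q. indicator ?E q * g q"
 let ?N = "flat_measure :: 'a phase measure"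
 have gL: "?g \<in> L2_funs ?N" by (rule L2_funs_cylinder[OF g])
 have ind: "(\<lambda>q. indicator ?E q :: real) \<in> L2_funs ?N"
  using integrable_cylinder[of "R + 1"] sets_cylinder[of "R + 1"]
  by (auto simp: L2_funs_def power2_eq_square indicator_inter_arith[symmetric])
 have g1: "integrable ?N ?g" using L2_funs_mult_integrable[OF ind gL] by (simp add: mult.assoc[symmetric] indicator_inter_arith[symmetric])
 have G1: "integrable (?N \<Otimes>\<^sub>M ?N) G" unfolding G_def by (rule flat2.integrable_product_fun(1)[OF g1 g1])
 obtain Bw where Bw: "\<And>p. p \<in> state_space ==> \<bar>w p\<bar> \<le> Bw * indicator (cyl R) p"
  using flat_bounded_support[OF w ws] by blast
 have kb: "\<exists>B. \<forall>p\<in>cyl R. \<forall>q\<in>?E. \<bar>A p q\<bar> \<le> B" if "local_kernel R A" for A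
 proof -
  have "continuous_on ((cyl R) \<times> ?E) (\<lambda>(p, q). A p q)"
   using that by (auto simp: local_kernel_def intro: continuous_on_subset)
  then have "bounded ((\<lambda>(p, q). A p q) ` ((cyl R) \<times> ?E))"
   by (intro compact_imp_bounded compact_continuous_image compact_Times compact_cball compact_sphere)
  then obtain B where "\<forall>y\<in>(\<lambda>(p, q). A p q) ` ((cyl R) \<times> ?E). norm y \<le> B"
   unfolding bounded_iff by blast
  then show ?thesis by (intro exI[of _ B]) fastforce
 qed
 obtain B1 where B1: "\<And>p q. p \<in> cyl R ==> q \<in> ?E ==> \<bar>A1 p q\<bar> \<le> B1"
  using kb[OF A1] by blast
 obtain B2 where B2: "\<And>p q. p \<in> cyl R ==> q \<in> ?E ==> \<bar>A2 p q\<bar> \<le> B2"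
  using kb[OF A2] by blast
 let ?F = "\<lambda>p z. w p * ((A1 p (fst z) * ?g (fst z)) * (A2 p (snd z) * ?g (snd z)))"
 have m1: "(\<lambda>x. A (fst x) (fst (snd x))) \<in> borel_measurable (?N \<Otimes>\<^sub>M (?N \<Otimes>\<^sub>M ?N))"
  and m2: "(\<lambda>x. A (fst x) (snd (snd x))) \<in> borel_measurable (?N \<Otimes>\<^sub>M (?N \<Otimes>\<^sub>M ?N))"
  if "local_kernel R A" for A
 proof -
  have "(\<lambda>(p, q). A p q) \<in> borel_measurable (?N \<Otimes>\<^sub>M ?N)"
   using that by (intro flat2_measurable borel_measurable_continuous_onI) (simp add: local_kernel_def)
  then have m: "(\<lambda>z. A (fst z) (snd z)) \<in> borel_measurable (?N \<Otimes>\<^sub>M ?N)" by (simp add: case_prod_beta')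
  have "(\<lambda>x. (fst x, fst (snd x))) \<in> measurable (?N \<Otimes>\<^sub>M (?N \<Otimes>\<^sub>M ?N)) (?N \<Otimes>\<^sub>M ?N)"
   "(\<lambda>x. (fst x, snd (snd x))) \<in> measurable (?N \<Otimes>\<^sub>M (?N \<Otimes>\<^sub>M ?N)) (?N \<Otimes>\<^sub>M ?N)" by measurable
  from measurable_compose[OF this(1) m] measurable_compose[OF this(2) m]
  show "(\<lambda>x. A (fst x) (fst (snd x))) \<in> borel_measurable (?N \<Otimes>\<^sub>M (?N \<Otimes>\<^sub>M ?N))"
   "(\<lambda>x. A (fst x) (snd (snd x))) \<in> borel_measurable (?N \<Otimes>\<^sub>M (?N \<Otimes>\<^sub>M ?N))" by simp_all
 qed
 have gm: "?g \<in> borel_measurable ?N" using gL by (rule L2_funsD)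
 have wm: "w \<in> borel_measurable ?N" by (rule flat_measurable_continuous[OF w])
 have Fm: "(\<lambda>x. ?F (fst x) (snd x)) \<in> borel_measurable (?N \<Otimes>\<^sub>M (?N \<Otimes>\<^sub>M ?N))"
  by (intro borel_measurable_times m1[OF A1] m2[OF A2] measurable_compose[OF measurable_fst wm]
    measurable_compose[OF _ gm] measurable_compose[OF measurable_snd measurable_fst] measurable_compose[OF measurable_snd measurable_snd])
 let ?bound = "\<lambda>p. \<bar>Bw * indicator (cyl R) p\<bar> * \<bar>B1\<bar> * \<bar>B2\<bar>"
 have bi: "integrable ?N ?bound"
  by (intro integrable_mult_left integrable_abs integrable_mult_right integrable_cylinder)
 have "integrable (?N \<Otimes>\<^sub>M (?N \<Otimes>\<^sub>M ?N)) (\<lambda>x. ?bound (fst x) * \<bar>G (snd x)\<bar>)"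
  by (rule flat3.integrable_product_fun(1)[OF bi]) (use G1 in simp)
 then have F: "integrable (?N \<Otimes>\<^sub>M (?N \<Otimes>\<^sub>M ?N)) (\<lambda>x. ?F (fst x) (snd x))"
 proof (rule Bochner_Integration.integrable_bound[OF _ Fm], intro AE_I2)
  fix x :: "'a phase \<times> ('a phase \<times> 'a phase)" assume "x \<in> space (?N \<Otimes>\<^sub>M (?N \<Otimes>\<^sub>M ?N))"
  then have p: "fst x \<in> state_space" by (auto simp: space_pair_measure)
  show "norm (?F (fst x) (snd x)) \<le> norm (?bound (fst x) * \<bar>G (snd x)\<bar>)"
  proof (cases "fst x \<in> cyl R \<and> fst (snd x) \<in> ?E \<and> snd (snd x) \<in> ?E")
   case True
   have "\<bar>w (fst x)\<bar> * ((\<bar>A1 (fst x) (fst (snd x))\<bar> * \<bar>A2 (fst x) (snd (snd x))\<bar>) * \<bar>G (snd x)\<bar>)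
     \<le> \<bar>Bw * indicator (cyl R) (fst x)\<bar> * ((\<bar>B1\<bar> * \<bar>B2\<bar>) * \<bar>G (snd x)\<bar>)"
    using Bw[OF p] B1[of "fst x" "fst (snd x)"] B2[of "fst x" "snd (snd x)"] True
    by (intro mult_mono mult_right_mono) (auto intro: order_trans[OF _ abs_ge_self])
   then show ?thesis by (simp add: G_def abs_mult mult_ac)
  next
   case False
   then have "w (fst x) = 0 \<or> ?g (fst (snd x)) = 0 \<or> ?g (snd (snd x)) = 0" using Bw[OF p] by (auto simp: indicator_def)
   then have "?F (fst x) (snd x) = 0" by (elim disjE) (simp_all only: mult_zero_left mult_zero_right)
   then show ?thesis by (simp only: norm_zero norm_ge_zero)
  qed
 qed
 have inner_z: "(\<integral>z. ?F p z \<partial>(?N \<Otimes>\<^sub>M ?N)) = w p * (apply_kernel A1 g p * apply_kernel A2 g p)" if p: "p \<in> state_space" for p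
 proof (cases "norm (fst p) \<le> R")
  case True
  have ag: "apply_kernel A g p = (\<integral>q. A p q * ?g q \<partial>?N)" if "local_kernel R A" for A
   unfolding apply_kernel_def
  proof (rule lint_cong)
   fix q :: "'a phase" assume "q \<in> space ?N"
   then show "A p q * g q = A p q * ?g q"
    using local_kernel_eq_0[OF that True, of q] by (cases "norm (fst q) \<le> R + 1") (simp_all add: state_space_def indicator_def mem_Times_iff)
  qed
  have i: "integrable ?N (\<lambda>q. A p q * ?g q)" if "local_kernel R A" for A
   by (rule L2_funs_mult_integrable[OF local_kernel_L2[OF that True] gL])
  show ?thesis unfolding ag[OF A1] ag[OF A2]
   by (subst lint_mult_right_zero) (simp only: flat2.integrable_product_fun(2)[OF i[OF A1] i[OF A2]])
 next
  case False
  then have "w p = 0" using ws p by (auto simp: xsupp_def)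
  then show ?thesis by simp
 qed
 have inner_p: "(\<integral>p. ?F p z \<partial>?N) = G z * (\<integral>p. w p * (A1 p (fst z) * A2 p (snd z)) \<partial>?N)" for z
  unfolding G_def by (subst lint_mult_right_zero[symmetric]) (intro Bochner_Integration.integral_cong refl, simp add: mult_ac)
 have F': "integrable (?N \<Otimes>\<^sub>M (?N \<Otimes>\<^sub>M ?N)) (case_prod ?F)" using F by (simp add: case_prod_beta')
 have "integrable ?N (\<lambda>p. \<integral>z. ?F p z \<partial>(?N \<Otimes>\<^sub>M ?N))" using flat3.integrable_fst[OF F'] .
 then show "integrable ?N (\<lambda>p. w p * (apply_kernel A1 g p * apply_kernel A2 g p))"
  by (rule Bochner_Integration.integrable_cong[OF refl, THEN iffD1, rotated]) (simp only: inner_z space_flat_measure)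
 have "integrable (?N \<Otimes>\<^sub>M ?N) (\<lambda>z. \<integral>p. ?F p z \<partial>?N)" using flat3.integrable_snd[OF F'] .
 then show "integrable (?N \<Otimes>\<^sub>M ?N) (\<lambda>z. G z * (\<integral>p. w p * (A1 p (fst z) * A2 p (snd z)) \<partial>?N))" by (simp only: inner_p)
 have "(\<integral>p. w p * (apply_kernel A1 g p * apply_kernel A2 g p) \<partial>?N) = (\<integral>p. (\<integral>z. ?F p z \<partial>(?N \<Otimes>\<^sub>M ?N)) \<partial>?N)"
  by (intro Bochner_Integration.integral_cong refl) (simp only: inner_z space_flat_measure)
 also have "\<dots> = (\<integral>z. (\<integral>p. ?F p z \<partial>?N) \<partial>(?N \<Otimes>\<^sub>M ?N))" by (rule flat3.Fubini_integral[OF F', symmetric])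
 finally show "(\<integral>p. w p * (apply_kernel A1 g p * apply_kernel A2 g p) \<partial>?N)
   = (\<integral>z. G z * (\<integral>p. w p * (A1 p (fst z) * A2 p (snd z)) \<partial>?N) \<partial>(?N \<Otimes>\<^sub>M ?N))" by (simp only: inner_p)
qed


section \<open>The conjugated operator\<close>

lemma grad_works:
 assumes "Ck_on (Suc k) c UNIV" shows "(c has_derivative (\<lambda>v. grad c x \<bullet> v)) (at x)"
proof -
 have "(c has_derivative frechet_derivative c (at x)) (at x)"
  using assms by (simp add: frechet_derivative_works)
 moreover have "frechet_derivative c (at x) = (\<lambda>v. grad c x \<bullet> v)" by (rule ext) (rule frechet_derivative_eq_grad[OF assms])
 ultimately show ?thesis by simp
qed

lemma Ck_on_grad_inner: "Ck_on (Suc k) c UNIV ==> Cks k (\<lambda>p. snd p \<bullet> grad c (fst p :: 'a::euclidean_space))"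
proof -
 assume c: "Ck_on (Suc k) c UNIV"
 have "Cks k (\<lambda>p. \<Sum>b\<in>Basis. (snd p \<bullet> b) * (grad c (fst p) \<bullet> b))"
  by (intro Cks_sum Cks_mult Cks_snd_inner Cks_fst Ck_on_grad c)
 then show ?thesis by (simp only: euclidean_inner[symmetric])
qed

text \<open>The conjugate of the first-order part of the Langevin operator by \<open>e\<^sup>V\<^sup>/\<^sup>2\<close>.\<close>

definition skew :: "('a::euclidean_space => real) => ('a phase => real) => 'a phase => real" where
 "skew V h p = transport h p - 1 / (real DIM('a) - 1) * dS h (grad V (fst p)) p
  + 1 / 2 * (snd p \<bullet> grad V (fst p)) * h p"

context
 fixes V :: "'a::euclidean_space => real"
 assumes d2: "2 \<le> DIM('a)" and V: "\<And>k. Ck_on k V UNIV"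
begin

lemma Cks_skew: assumes h: "Cks (Suc k) h" shows "Cks k (skew V h)"
proof -
 have "Cks k (\<lambda>p. (transport h p + (- 1 / (real DIM('a) - 1)) * dS h (grad V (fst p)) p)
  + (1 / 2 * (snd p \<bullet> grad V (fst p))) * h p)"
  by (intro Cks_add Cks_mult Cks_const Cks_transport Cks_dS_field Ck_on_grad Ck_on_grad_inner V h Cks_mono[OF _ h]) auto
 moreover have "skew V h = (\<lambda>p. (transport h p + (- 1 / (real DIM('a) - 1)) * dS h (grad V (fst p)) p)
  + (1 / 2 * (snd p \<bullet> grad V (fst p))) * h p)"
  by (simp add: skew_def fun_eq_iff)
 ultimately show ?thesis by simp
qed

lemma xsupp_skew: "xsupp R h ==> xsupp R (skew V h)"
 using xsupp_transport[of R h] xsupp_dS_field[of R h "grad V"] by (simp add: xsupp_def skew_def)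

lemma langevin_conjugate:
 assumes h: "Cks 2 h" and p: "p \<in> state_space"
 shows "langevin V \<sigma> (\<lambda>q. exp (V (fst q) / 2) * h q) p
  = exp (V (fst p) / 2) * (skew V h p + 1 / 2 * \<sigma>\<^sup>2 * sphere_lap h p)"
proof -
 let ?e = "\<lambda>q. exp (V (fst q) / 2)" let ?f = "\<lambda>q. ?e q * h q"
 have eC: "Ck_on k (\<lambda>x. exp (V x / 2)) UNIV" for k
  using Ck_on_compose[OF open_UNIV open_UNIV _ Ck_on_mult[OF open_UNIV Ck_on_const[of _ "1/2"] V] Ck_on_exp] by simp
 have e: "Cks k ?e" for k using Cks_fst[OF eC] .
 have h2: "Cks (Suc (Suc 0)) h" using h by (simp add: numeral_2_eq_2)
 have h1: "Cks (Suc 0) h" by (rule Cks_mono[OF _ h2]) simp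
 have f: "Cks (Suc (Suc 0)) ?f" by (rule Cks_mult[OF e h2])
 have dSf: "dS ?f v q = ?e q * dS h v q" if "q \<in> state_space" for v q
  using dS_mult[OF e[of "Suc 0"] h1 that, of v] dS_fst[of "\<lambda>x. exp (V x / 2)" v q] by simp
 have D: "((\<lambda>y. ?e (y, snd p)) has_derivative (\<lambda>v. ?e p * ((grad V (fst p) \<bullet> v) / 2))) (at (fst p))"
  by (auto intro!: derivative_eq_intros grad_works[OF V[of "Suc 0"]] simp: fun_eq_iff mult_ac)
 have dXe: "dX ?e v p = ?e p * ((grad V (fst p) \<bullet> v) / 2)" for v
  by (rule dX_eqI[of ?e p, OF D])
 have tr: "transport ?f p = ?e p * (transport h p + 1 / 2 * (snd p \<bullet> grad V (fst p)) * h p)"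
  unfolding transport_def dX_mult[OF e[of "Suc 0"] h1 p] dXe by (simp add: algebra_simps inner_commute)
 have "dS (dS ?f b) b p = ?e p * dS (dS h b) b p" for b
 proof -
  have "dS (dS ?f b) b p = dS (\<lambda>q. ?e q * dS h b q) b p" by (rule dS_cong[OF dSf p])
  also have "\<dots> = ?e p * dS (dS h b) b p"
   using dS_mult[OF e[of "Suc 0"] Cks_derivatives(2)[OF h2] p, of b b] dS_fst[of "\<lambda>x. exp (V x / 2)" b p] by simp
  finally show ?thesis .
 qed
 then have lap: "sphere_lap ?f p = ?e p * sphere_lap h p" by (simp add: sphere_lap_def sum_distrib_left)
 show ?thesis unfolding langevin_eq[OF f p] tr dSf[OF p] lap skew_def by (simp add: algebra_simps)
qed

text \<open>The vector field has divergence \<open>\<omega> \<bullet> \<nabla>V\<close>; half of it is cancelled by the multiplication term.\<close>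

lemma integral_skew:
 assumes h: "Cks (Suc k) h" and s: "xsupp R h"
 shows "(\<ointegral>p. skew V h p) = - (1 / 2) * (\<ointegral>p. (snd p \<bullet> grad V (fst p)) * h p)"
proof -
 let ?c = "1 / (real DIM('a) - 1)" let ?D = "\<lambda>p. dS h (grad V (fst p)) p" let ?B = "\<lambda>p. (snd p \<bullet> grad V (fst p)) * h p"
 have h0: "Cks k h" by (rule Cks_mono[OF _ h]) simp
 have iT: "integrable flat_measure (transport h)"
  by (rule Cks_integrable[OF Cks_transport[OF h] xsupp_transport[OF s]])
 have iD: "integrable flat_measure ?D"
  by (rule Cks_integrable[OF Cks_dS_field[OF h Ck_on_grad[OF V]] xsupp_dS_field[OF s]])
 have iB: "integrable flat_measure ?B"
  by (rule Cks_integrable[OF Cks_mult[OF Ck_on_grad_inner[OF V] h0] xsupp_mult2[OF s]])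
 have iB': "integrable flat_measure (\<lambda>p. 1 / 2 * ?B p)" and iD': "integrable flat_measure (\<lambda>p. ?c * ?D p)"
  using iB iD by simp_all
 have "(\<ointegral>p. skew V h p) = (\<ointegral>p. (transport h p - ?c * ?D p) + 1 / 2 * ?B p)"
  by (simp add: skew_def mult.assoc)
 also have "\<dots> = (\<ointegral>p. transport h p) - (\<ointegral>p. ?c * ?D p) + (\<ointegral>p. 1 / 2 * ?B p)"
  by (simp only: lint_add[OF Bochner_Integration.integrable_diff[OF iT iD'] iB'] lint_diff[OF iT iD'])
 also have "\<dots> = 0 - ?c * (\<ointegral>p. ?D p) + 1 / 2 * (\<ointegral>p. ?B p)"
  by (simp only: integral_transport_eq_0[OF h s] lint_mult_right_zero)
 also have "(\<ointegral>p. ?D p) = (real DIM('a) - 1) * (\<ointegral>p. ?B p)"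
  by (rule integral_dS_field[OF h s Ck_on_grad[OF V]])
 finally show ?thesis using d2 by simp
qed

text \<open>Apply \<open>integral_skew\<close> to the product \<open>a h\<^sub>1 h\<^sub>2\<close>: a derivation of the product splits the operator
 evenly between the factors, except for the derivative of the cutoff.\<close>

lemma skew_symmetric:
 assumes a: "\<And>k. Ck_on k a UNIV" and s: "xsupp R (\<lambda>p. a (fst p))"
  and h1: "Cks (Suc k) h1" and h2: "Cks (Suc k) h2"
 shows "(\<ointegral>p. a (fst p) * (skew V h1 p * h2 p)) + (\<ointegral>p. a (fst p) * (h1 p * skew V h2 p))
  = - (\<ointegral>p. (grad a (fst p) \<bullet> snd p) * (h1 p * h2 p))"
proof -
 let ?h = "\<lambda>p. a (fst p) * (h1 p * h2 p)" let ?D = "\<lambda>p. (grad a (fst p) \<bullet> snd p) * (h1 p * h2 p)"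
 let ?B = "\<lambda>p. (snd p \<bullet> grad V (fst p)) * ?h p"
 let ?A1 = "\<lambda>p. a (fst p) * (skew V h1 p * h2 p)" and ?A2 = "\<lambda>p. a (fst p) * (h1 p * skew V h2 p)"
 have aC: "Cks j (\<lambda>p. a (fst p))" for j using Cks_fst[OF a] .
 have h12: "Cks (Suc k) (\<lambda>p. h1 p * h2 p)" by (rule Cks_mult[OF h1 h2])
 have h: "Cks (Suc k) ?h" by (rule Cks_mult[OF aC h12])
 have h0: "Cks k h1" "Cks k h2" by (rule Cks_mono[OF _ h1], simp) (rule Cks_mono[OF _ h2], simp)
 have hs: "xsupp R ?h" by (rule xsupp_mult1[OF s])
 have Da: "dX (\<lambda>p. a (fst p)) v p = grad a (fst p) \<bullet> v" for v p
  by (simp only: dX_fst[OF a] frechet_derivative_eq_grad[OF a])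
 have key: "?A1 p + ?A2 p + ?D p = skew V ?h p + 1 / 2 * ?B p" if p: "p \<in> state_space" for p
 proof -
  have tr: "transport ?h p = a (fst p) * (h1 p * transport h2 p + transport h1 p * h2 p) + (grad a (fst p) \<bullet> snd p) * (h1 p * h2 p)"
   unfolding transport_def dX_mult[OF aC h12 p] dX_mult[OF h1 h2 p] Da by simp
  have ds: "dS ?h v p = a (fst p) * (h1 p * dS h2 v p + dS h1 v p * h2 p)" for v
   using dS_mult[OF aC h12 p, of v] dS_fst[of a v p] by (simp add: dS_mult[OF h1 h2 p])
  show ?thesis unfolding skew_def tr ds by (simp add: algebra_simps)
 qed
 have gs: "xsupp R (\<lambda>p. grad a (fst p) \<bullet> snd p)"
  using xsupp_transport[OF s] by (simp add: xsupp_def transport_def Da)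
 have gC: "Cks k (\<lambda>p. grad a (fst p) \<bullet> snd p)" using Ck_on_grad_inner[OF a] by (simp add: inner_commute)
 have i1: "integrable flat_measure ?A1" and i2: "integrable flat_measure ?A2" and i3: "integrable flat_measure ?D"
  by (rule Cks_integrable[OF Cks_mult[OF aC Cks_mult[OF Cks_skew[OF h1] h0(2)]] xsupp_mult1[OF s]],
    rule Cks_integrable[OF Cks_mult[OF aC Cks_mult[OF h0(1) Cks_skew[OF h2]]] xsupp_mult1[OF s]],
    rule Cks_integrable[OF Cks_mult[OF gC Cks_mult[OF h0]] xsupp_mult1[OF gs]])
 have i4: "integrable flat_measure (skew V ?h)" by (rule Cks_integrable[OF Cks_skew[OF h] xsupp_skew[OF hs]])
 have h': "Cks k ?h" by (rule Cks_mono[OF _ h]) simp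
 have i5: "integrable flat_measure ?B"
  by (rule Cks_integrable[OF Cks_mult[OF Ck_on_grad_inner[OF V] h'] xsupp_mult2[OF hs]])
 then have i5': "integrable flat_measure (\<lambda>p. 1 / 2 * ?B p)" by simp
 have "(\<ointegral>p. ?A1 p) + (\<ointegral>p. ?A2 p) + (\<ointegral>p. ?D p) = (\<ointegral>p. ?A1 p + ?A2 p + ?D p)"
  by (simp only: lint_add[OF Bochner_Integration.integrable_add[OF i1 i2] i3] lint_add[OF i1 i2])
 also have "\<dots> = (\<ointegral>p. skew V ?h p + 1 / 2 * ?B p)"
  by (rule lint_cong) (simp only: key space_flat_measure)
 also have "\<dots> = (\<ointegral>p. skew V ?h p) + 1 / 2 * (\<ointegral>p. ?B p)"
  by (simp only: lint_add[OF i4 i5'] lint_mult_right_zero)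
 also have "\<dots> = 0" using integral_skew[OF h hs] by simp
 finally show ?thesis by simp
qed

end

text \<open>The weight depends on the position alone and therefore passes through the spherical derivatives.\<close>

lemma weighted_Green:
 fixes a :: "'a::euclidean_space => real"
 assumes a: "\<And>k. Ck_on k a UNIV" and s: "xsupp R (\<lambda>p. a (fst p))"
  and h1: "Cks (Suc (Suc k)) h1" and h2: "Cks (Suc k) h2"
 shows "(\<ointegral>p. a (fst p) * (sphere_lap h1 p * h2 p))
  = - (\<Sum>e\<in>Basis. (\<ointegral>p. a (fst p) * (dS h1 e p * dS h2 e p)))"
proof -
 have aC: "Cks j (\<lambda>p. a (fst p))" for j using Cks_fst[OF a] .
 let ?u = "\<lambda>p. a (fst p) * h2 p"
 have u: "Cks (Suc k) ?u" by (rule Cks_mult[OF aC h2])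
 have us: "xsupp R ?u" by (rule xsupp_mult1[OF s])
 have du: "dS ?u e p = a (fst p) * dS h2 e p" if "p \<in> state_space" for e p
  using dS_mult[OF aC h2 that, of e] dS_fst[of a e p] by simp
 have h1': "Cks (Suc k) h1" by (rule Cks_mono[OF _ h1]) simp
 have i: "integrable flat_measure (\<lambda>p. a (fst p) * (dS h1 e p * dS h2 e p))" for e
  by (rule Cks_integrable[OF Cks_mult[OF aC Cks_mult[OF Cks_derivatives(2)[OF h1'] Cks_derivatives(2)[OF h2]]] xsupp_mult1[OF s]])
 have "(\<ointegral>p. a (fst p) * (sphere_lap h1 p * h2 p)) = (\<ointegral>p. ?u p * sphere_lap h1 p)"
  by (simp only: mult_ac)
 also have "\<dots> = - (\<ointegral>p. (\<Sum>e\<in>Basis. dS ?u e p * dS h1 e p))"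
  by (rule integral_sphere_lap[OF h1 u us])
 also have "(\<ointegral>p. (\<Sum>e\<in>Basis. dS ?u e p * dS h1 e p)) = (\<ointegral>p. (\<Sum>e\<in>Basis. a (fst p) * (dS h1 e p * dS h2 e p)))"
  by (rule lint_cong, rule sum.cong[OF refl]) (simp only: space_flat_measure du, simp only: mult_ac)
 also have "\<dots> = (\<Sum>e\<in>Basis. (\<ointegral>p. a (fst p) * (dS h1 e p * dS h2 e p)))"
  by (rule lint_sum) (rule i)
 finally show ?thesis .
qed

section \<open>The smoothing kernels\<close>

text \<open>The derivative of the zonal kernel with respect to the inner product of its arguments.\<close>

definition zonal_slope :: "nat => 'a::euclidean_space => 'a => real" where
 "zonal_slope N \<omega> \<eta> = real N / 2 * cap \<omega> \<eta> ^ (N - 1) / zmass (real DIM('a)) N"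

lemma zonal_slope_commute: "zonal_slope N \<omega> \<eta> = zonal_slope N \<eta> \<omega>" by (simp add: zonal_slope_def cap_commute)

lemma Cks_cap_power: "Cks k (\<lambda>p. cap \<eta> (snd p) ^ N)"
proof (induction N)
 case (Suc N)
 have "Cks k (\<lambda>p. 1 / 2 + 1 / 2 * (snd p \<bullet> \<eta>))" by (intro Cks_add Cks_mult Cks_const Cks_snd_inner)
 then have "Cks k (\<lambda>p. cap \<eta> (snd p))" by (simp add: cap_def inner_commute add_divide_distrib)
 from Cks_mult[OF this Suc] show ?case by simp
qed (simp add: Cks_const)

lemma dS_snd_inner:
 assumes "p \<in> state_space" shows "dS (\<lambda>p. snd p \<bullet> w) v p = w \<bullet> v - (w \<bullet> snd p) * (snd p \<bullet> v)"
proof (rule dS_eqI[where D = "\<lambda>v. w \<bullet> v - (w \<bullet> snd p) * (snd p \<bullet> v)"], simp)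
 have "norm (snd p) = 1" using assms by (auto simp: state_space_def)
 from has_derivative_inner_left[OF has_derivative_sgn_unit[OF this], of w]
 show "((\<lambda>y. sgn y \<bullet> w) has_derivative (\<lambda>v. w \<bullet> v - w \<bullet> snd p * (snd p \<bullet> v))) (at (snd p))"
  by (rule has_derivative_eq_rhs) (simp add: fun_eq_iff inner_diff_left inner_diff_right algebra_simps inner_commute)
qed

context
 fixes c :: "'a::euclidean_space => real" and \<eta> :: 'a and N :: nat and h :: "'a phase => real"
 assumes c: "\<And>k. Ck_on k c UNIV"
 defines "h \<equiv> \<lambda>p. c (fst p) * cap \<eta> (snd p) ^ N"
begin

lemma Cks_cap_profile: "Cks k h" unfolding h_def by (rule Cks_mult[OF Cks_fst[OF c] Cks_cap_power])

lemma dX_cap_profile: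
 assumes "p \<in> state_space" shows "dX h v p = (grad c (fst p) \<bullet> v) * cap \<eta> (snd p) ^ N"
 using dX_mult[OF Cks_fst[OF c[of "Suc 0"]] Cks_cap_power[of "Suc 0" \<eta> N] assms, of v]
 by (simp add: h_def dX_fst[OF c] frechet_derivative_eq_grad[OF c] dX_snd[of "\<lambda>\<omega>. cap \<eta> \<omega> ^ N"])

lemma dS_cap_power:
 assumes "p \<in> state_space"
 shows "dS (\<lambda>p. cap \<eta> (snd p) ^ M) v p = real M / 2 * cap \<eta> (snd p) ^ (M - 1) * (\<eta> \<bullet> v - (\<eta> \<bullet> snd p) * (snd p \<bullet> v))"
proof -
 have "norm (snd p) = 1" using assms by (auto simp: state_space_def)
 then show ?thesis by (simp add: dS_def sphere_deriv_cap_power)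
qed

lemma dS_cap_profile:
 assumes "p \<in> state_space"
 shows "dS h v p = c (fst p) * (real N / 2 * cap \<eta> (snd p) ^ (N - 1) * (\<eta> \<bullet> v - (\<eta> \<bullet> snd p) * (snd p \<bullet> v)))"
 using dS_mult[OF Cks_fst[OF c[of "Suc 0"]] Cks_cap_power[of "Suc 0" \<eta> N] assms, of v] dS_fst[of c v p]
 by (simp add: h_def dS_cap_power[OF assms])

text \<open>Trace of the second tangential derivatives.  The three sums over a basis are the squared length of the
 tangential part of \<open>\<eta>\<close>, the dimension \<open>d - 1\<close> of the tangent space, and zero.\<close>

lemma sphere_lap_cap_profile:
 assumes p: "p \<in> state_space" and \<eta>: "norm \<eta> = 1"
 shows "sphere_lap h p = c (fst p) * (real N / 2 * (real (N - 1) / 2 * cap \<eta> (snd p) ^ (N - 1 - 1) * (1 - (\<eta> \<bullet> snd p)\<^sup>2)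
  - (real DIM('a) - 1) * (\<eta> \<bullet> snd p) * cap \<eta> (snd p) ^ (N - 1)))"
proof -
 let ?w = "snd p" let ?t = "\<eta> \<bullet> snd p" let ?C = "\<lambda>p. cap \<eta> (snd p) ^ (N - 1)"
 let ?m = "\<lambda>e p. \<eta> \<bullet> e + (- 1) * ((snd p \<bullet> \<eta>) * (snd p \<bullet> e))"
 have w: "?w \<bullet> ?w = 1" using p by (auto simp: state_space_def norm_eq_1)
 have mC: "Cks k (?m e)" for k e by (intro Cks_add Cks_mult Cks_const Cks_snd_inner)
 have dm: "dS (?m e) e p = - (?t * (e \<bullet> e - (?w \<bullet> e)\<^sup>2) + (\<eta> \<bullet> e - ?t * (?w \<bullet> e)) * (?w \<bullet> e))" for e
 proof -
  have 1: "dS (?m e) e p = dS (\<lambda>p. \<eta> \<bullet> e) e p + dS (\<lambda>p. (- 1) * ((snd p \<bullet> \<eta>) * (snd p \<bullet> e))) e p"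
   by (rule dS_add[OF Cks_const[of "Suc 0"] Cks_mult[OF Cks_const[of "Suc 0" "-1"]
      Cks_mult[OF Cks_snd_inner[of "Suc 0" \<eta>] Cks_snd_inner[of "Suc 0" e]]] p])
  have 2: "dS (\<lambda>p. (- 1) * ((snd p \<bullet> \<eta>) * (snd p \<bullet> e))) e p = (- 1) * dS (\<lambda>p. (snd p \<bullet> \<eta>) * (snd p \<bullet> e)) e p"
   using dS_mult[OF Cks_const[of "Suc 0" "- 1"] Cks_mult[OF Cks_snd_inner[of "Suc 0" \<eta>] Cks_snd_inner[of "Suc 0" e]] p, of e]
    dS_fst[of "\<lambda>_. - 1" e p] by simp
  show ?thesis unfolding 1 2 dS_mult[OF Cks_snd_inner[of "Suc 0"] Cks_snd_inner[of "Suc 0"] p] dS_snd_inner[OF p]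
   using dS_fst[of "\<lambda>_. \<eta> \<bullet> e" e p] by (simp add: algebra_simps inner_commute power2_eq_square)
 qed
 have one: "dS (dS h e) e p = c (fst p) * (real N / 2 * (real (N - 1) / 2 * cap \<eta> ?w ^ (N - 1 - 1) * (\<eta> \<bullet> e - ?t * (?w \<bullet> e))\<^sup>2
   - cap \<eta> ?w ^ (N - 1) * (?t * (e \<bullet> e - (?w \<bullet> e)\<^sup>2) + (\<eta> \<bullet> e - ?t * (?w \<bullet> e)) * (?w \<bullet> e))))" for e
 proof -
  have K: "Cks (Suc 0) (\<lambda>p. c (fst p) * (real N / 2))"
   by (rule Cks_fst[OF Ck_on_mult[OF open_UNIV c Ck_on_const]])
  have "dS (dS h e) e p = dS (\<lambda>p. c (fst p) * (real N / 2) * (?C p * ?m e p)) e p"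
   by (rule dS_cong[OF _ p]) (simp add: dS_cap_profile inner_commute field_simps)
  also have "\<dots> = c (fst p) * (real N / 2) * (?C p * dS (?m e) e p + dS ?C e p * ?m e p)"
   by (simp only: dS_mult[OF K Cks_mult[OF Cks_cap_power[of "Suc 0" \<eta> "N - 1"] mC[of "Suc 0" e]] p]
     dS_mult[OF Cks_cap_power[of "Suc 0" \<eta> "N - 1"] mC[of "Suc 0" e] p] dS_fst[of "\<lambda>x. c x * (real N / 2)"] mult_zero_left add_0_right)
  finally show ?thesis unfolding dm dS_cap_power[OF p] inner_commute[of ?w \<eta>]
   by (simp add: field_simps power2_eq_square)
 qed
 have s1: "(\<Sum>e\<in>Basis. (\<eta> \<bullet> e - ?t * (?w \<bullet> e))\<^sup>2) = 1 - ?t\<^sup>2"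
 proof -
  have "(\<Sum>e\<in>Basis. (\<eta> \<bullet> e - ?t * (?w \<bullet> e))\<^sup>2) = (\<eta> - ?t *\<^sub>R ?w) \<bullet> (\<eta> - ?t *\<^sub>R ?w)"
   by (subst euclidean_inner[of "\<eta> - ?t *\<^sub>R ?w" "\<eta> - ?t *\<^sub>R ?w"]) (simp add: inner_diff_left power2_eq_square)
  also have "\<dots> = 1 - ?t\<^sup>2" using w \<eta> by (simp add: inner_diff_left inner_diff_right norm_eq_1 power2_eq_square inner_commute)
  finally show ?thesis .
 qed
 have s2: "(\<Sum>e\<in>Basis. (\<eta> \<bullet> e - ?t * (?w \<bullet> e)) * (?w \<bullet> e)) = 0"
 proof -
  have "(\<Sum>e\<in>Basis. (\<eta> \<bullet> e - ?t * (?w \<bullet> e)) * (?w \<bullet> e)) = (\<eta> - ?t *\<^sub>R ?w) \<bullet> ?w"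
   by (subst euclidean_inner[of "\<eta> - ?t *\<^sub>R ?w" ?w]) (simp add: inner_diff_left)
  then show ?thesis using w by (simp add: inner_diff_left)
 qed
 have s3: "(\<Sum>e\<in>(Basis :: 'a set). e \<bullet> e - (?w \<bullet> e)\<^sup>2) = real DIM('a) - 1"
 proof -
  have "(\<Sum>e\<in>(Basis :: 'a set). e \<bullet> e) = real DIM('a)" by simp
  moreover have "(\<Sum>e\<in>(Basis :: 'a set). (?w \<bullet> e)\<^sup>2) = 1" using w by (simp add: euclidean_inner[of ?w ?w] power2_eq_square)
  ultimately show ?thesis by (simp only: sum_subtractf)
 qed
 have lin: "(\<Sum>e\<in>I. x * (k * (l * A e - m * (t * B e + D e))))
   = x * (k * (l * sum A I - m * (t * sum B I + sum D I)))" for x k l m t :: real and A B D :: "'a => real" and I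
  by (simp add: sum_distrib_left[symmetric] sum_subtractf sum.distrib)
 have "sphere_lap h p = c (fst p) * (real N / 2 * (real (N - 1) / 2 * cap \<eta> ?w ^ (N - 1 - 1) * (\<Sum>e\<in>Basis. (\<eta> \<bullet> e - ?t * (?w \<bullet> e))\<^sup>2)
   - cap \<eta> ?w ^ (N - 1) * (?t * (\<Sum>e\<in>(Basis :: 'a set). e \<bullet> e - (?w \<bullet> e)\<^sup>2) + (\<Sum>e\<in>Basis. (\<eta> \<bullet> e - ?t * (?w \<bullet> e)) * (?w \<bullet> e)))))"
  unfolding sphere_lap_def one by (rule lin)
 then show ?thesis unfolding s1 s2 s3 by (simp add: mult_ac)
qed

end


lemma continuous_on_grad [continuous_intros]:
 fixes c :: "'a::euclidean_space => real"
 assumes c: "Ck_on (Suc k) c UNIV" and f: "continuous_on S f"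
 shows "continuous_on S (\<lambda>x. grad c (f x))"
proof -
 have "continuous_on UNIV (\<lambda>x. frechet_derivative c (at x) b)" for b
  using Ck_on_continuous[OF Ck_on_deriv[OF c]] .
 then have "continuous_on UNIV (grad c)" unfolding grad_def[abs_def] by (intro continuous_intros)
 from continuous_on_compose2[OF this f] show ?thesis by simp
qed

lemma C1_Lipschitz_on_cball:
 fixes f :: "'a::euclidean_space => real"
 assumes f: "Ck_on (Suc 0) f UNIV"
 obtains K where "0 \<le> K" "\<And>x. norm x \<le> R ==> \<bar>f x\<bar> \<le> K"
  "\<And>x y. norm x \<le> R ==> norm y \<le> R ==> \<bar>f x - f y\<bar> \<le> K * norm (x - y)"
proof -
 have bdd: "\<exists>B. \<forall>x\<in>cball 0 R. h x \<le> B" if "continuous_on UNIV h" for h :: "'a => real"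
 proof -
  have "bounded (h ` cball 0 R)"
   by (intro compact_imp_bounded compact_continuous_image compact_cball continuous_on_subset[OF that]) simp
  then obtain B where "\<forall>y\<in>h ` cball 0 R. norm y \<le> B" unfolding bounded_iff by blast
  then show ?thesis by (intro exI[of _ B]) (auto intro: order_trans[OF abs_ge_self])
 qed
 have "continuous_on UNIV (\<lambda>x. \<bar>f x\<bar>)" using Ck_on_continuous[OF f] by (rule continuous_on_rabs)
 from bdd[OF this] obtain B where B: "\<And>x. norm x \<le> R ==> \<bar>f x\<bar> \<le> B" unfolding Ball_def mem_cball_0 by blast
 have "continuous_on UNIV (\<lambda>x. norm (grad f x))" by (intro continuous_on_norm continuous_on_grad[OF f] continuous_on_id)
 from bdd[OF this] obtain G where G: "\<And>x. norm x \<le> R ==> norm (grad f x) \<le> G" unfolding Ball_def mem_cball_0 by blast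
 define K where "K = max 0 (max B G)"
 have "\<bar>f x - f y\<bar> \<le> K * norm (x - y)" if xy: "norm x \<le> R" "norm y \<le> R" for x y
 proof -
  have "norm (f x - f y) \<le> K * norm (x - y)"
  proof (rule differentiable_bound[where S = "cball 0 R" and f' = "\<lambda>x v. grad f x \<bullet> v"])
   show "(f has_derivative (\<lambda>v. grad f x \<bullet> v)) (at x within cball 0 R)" for x
    by (rule has_derivative_at_withinI[OF grad_works[OF f]])
   show "onorm (\<lambda>v. grad f x \<bullet> v) \<le> K" if "x \<in> cball 0 R" for x
   proof (rule onorm_le)
    fix v
    have "norm (grad f x \<bullet> v) \<le> norm (grad f x) * norm v" using Cauchy_Schwarz_ineq2[of "grad f x" v] by simp
    also have "\<dots> \<le> K * norm v" using G[of x] that by (intro mult_right_mono) (auto simp: K_def)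
    finally show "norm (grad f x \<bullet> v) \<le> K * norm v" .
   qed
  qed (use xy in auto)
  then show ?thesis by simp
 qed
 moreover have "\<bar>f x\<bar> \<le> K" if "norm x \<le> R" for x using B[OF that] by (simp add: K_def)
 ultimately show thesis by (intro that[of K]) (simp_all add: K_def)
qed

lemma grad_Lipschitz_on_cball:
 fixes V :: "'a::euclidean_space => real"
 assumes V: "Ck_on (Suc (Suc 0)) V UNIV"
 obtains K where "0 \<le> K" "\<And>x. norm x \<le> R ==> norm (grad V x) \<le> K"
  "\<And>x y. norm x \<le> R ==> norm y \<le> R ==> norm (grad V x - grad V y) \<le> K * norm (x - y)"
proof -
 have "\<exists>K\<ge>0. (\<forall>x. norm x \<le> R \<longrightarrow> \<bar>grad V x \<bullet> e\<bar> \<le> K) \<and>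
  (\<forall>x y. norm x \<le> R \<longrightarrow> norm y \<le> R \<longrightarrow> \<bar>grad V x \<bullet> e - grad V y \<bullet> e\<bar> \<le> K * norm (x - y))" for e
  using C1_Lipschitz_on_cball[OF Ck_on_grad[OF V], of R e] by metis
 then obtain K where K: "\<And>e. 0 \<le> K e" "\<And>e x. norm x \<le> R ==> \<bar>grad V x \<bullet> e\<bar> \<le> K e"
  "\<And>e x y. norm x \<le> R ==> norm y \<le> R ==> \<bar>grad V x \<bullet> e - grad V y \<bullet> e\<bar> \<le> K e * norm (x - y)"
  by metis
 show thesis
 proof (rule that[of "\<Sum>e\<in>Basis. K e"])
  show "0 \<le> (\<Sum>e\<in>Basis. K e)" using K(1) by (simp add: sum_nonneg)
  show "norm (grad V x) \<le> (\<Sum>e\<in>Basis. K e)" if "norm x \<le> R" for x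
   using norm_le_l1[of "grad V x"] sum_mono[of Basis "\<lambda>e. \<bar>grad V x \<bullet> e\<bar>" K] K(2)[OF that] by fastforce
  show "norm (grad V x - grad V y) \<le> (\<Sum>e\<in>Basis. K e) * norm (x - y)" if "norm x \<le> R" "norm y \<le> R" for x y
  proof -
   have "norm (grad V x - grad V y) \<le> (\<Sum>e\<in>Basis. \<bar>grad V x \<bullet> e - grad V y \<bullet> e\<bar>)"
    using norm_le_l1[of "grad V x - grad V y"] by (simp add: inner_diff_left)
   also have "\<dots> \<le> (\<Sum>e\<in>Basis. K e * norm (x - y))" by (intro sum_mono K(3) that)
   finally show ?thesis by (simp add: sum_distrib_right)
  qed
 qed
qed

lemma moll_even: "moll n (- z) = moll n z"
 by (simp add: moll_def bump_def)

lemma moll_diff_commute: "moll n (x - y) = moll n (y - x)"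
 using moll_even[of n "x - y"] by simp

lemma grad_moll_odd: "grad (moll n) (- z) \<bullet> v = - (grad (moll n) (z :: 'a::euclidean_space) \<bullet> v)"
proof -
 have D: "(moll n has_derivative (\<lambda>v. grad (moll n) x \<bullet> v)) (at x)" for x :: 'a
  by (rule grad_works[OF Ck_on_moll[of "Suc 0"]])
 have "((\<lambda>x::'a. - x) has_derivative (\<lambda>v. - v)) (at z)" by (auto intro!: derivative_eq_intros)
 from diff_chain_at[OF this D] have "(moll n has_derivative (\<lambda>v. grad (moll n) (- z) \<bullet> (- v))) (at z)"
  by (simp add: o_def moll_even)
 from has_derivative_unique[OF this D] show ?thesis by (metis (no_types, lifting) inner_minus_right minus_minus)
qed

lemma moll_far:
 assumes "1 \<le> n" "1 / real n < norm (z :: 'a::euclidean_space)"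
 shows "moll n z = 0" "grad (moll n) z = 0"
proof -
 obtain C where C: "0 \<le> moll n z \<and> moll n z \<le> C * box_weight n z"
  "\<And>v. \<bar>frechet_derivative (moll n) (at z) v\<bar> \<le> C * real n * box_weight n z * norm v"
  using moll_bounds assms(1) by metis
 have b: "box_weight n z = 0" using assms by (simp add: box_weight_def)
 show "moll n z = 0" using C(1) b by simp
 show "grad (moll n) z = 0" using C(2) by (simp add: grad_def b)
qed

text \<open>The widths in the two variables have to match: in the commutator the gradient of the mollifier, of size
 \<open>n\<close>, meets a factor \<open>norm (\<omega> - \<eta>)\<close>, while the slope of the zonal kernel, of size
 \<open>n\<^sup>2 norm (\<omega> - \<eta>)\<close>, meets a factor \<open>norm (x - y) \<le> 1/n\<close>.  Hence the degree \<open>n\<^sup>2 + 1\<close>, whose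
 slope is governed by the density of degree \<open>n\<^sup>2\<close>.\<close>

definition smoother :: "nat => 'a::euclidean_space phase => 'a phase => real" where
 "smoother n p q = moll n (fst p - fst q) * zonal (n\<^sup>2 + 1) (snd p) (snd q)"

text \<open>This and the next two kernels are the images of \<open>smoother\<close> under \<open>skew\<close>, the Laplacian and a
 tangential derivative acting on the first argument.  The closed forms exhibit joint continuity,
 sizes, and the symmetry of the Laplacian in both arguments.\<close>

definition smoother_skew :: "('a::euclidean_space => real) => nat => 'a phase => 'a phase => real" where
 "smoother_skew V n p q = (grad (moll n) (fst p - fst q) \<bullet> snd p) * zonal (n\<^sup>2 + 1) (snd p) (snd q)
  - 1 / (real DIM('a) - 1) * (moll n (fst p - fst q) * zonal_slope (n\<^sup>2 + 1) (snd p) (snd q)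
    * ((snd q - (snd p \<bullet> snd q) *\<^sub>R snd p) \<bullet> grad V (fst p)))
  + 1 / 2 * (snd p \<bullet> grad V (fst p)) * smoother n p q"

definition smoother_lap :: "nat => 'a::euclidean_space phase => 'a phase => real" where
 "smoother_lap n p q = moll n (fst p - fst q) / zmass (real DIM('a)) (n\<^sup>2 + 1) *
  (real (n\<^sup>2 + 1) / 2 * (real (n\<^sup>2) / 2 * cap (snd p) (snd q) ^ (n\<^sup>2 - 1) * (1 - (snd p \<bullet> snd q)\<^sup>2)
   - (real DIM('a) - 1) * (snd p \<bullet> snd q) * cap (snd p) (snd q) ^ n\<^sup>2))"

definition smoother_dS :: "nat => 'a::euclidean_space => 'a phase => 'a phase => real" where
 "smoother_dS n e p q = moll n (fst p - fst q) * zonal_slope (n\<^sup>2 + 1) (snd p) (snd q)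
  * ((snd q - (snd p \<bullet> snd q) *\<^sub>R snd p) \<bullet> e)"

lemma smoother_commute: "smoother n p q = smoother n q p"
 unfolding smoother_def by (simp only: moll_diff_commute[of n "fst p"] zonal_commute[of _ "snd p"])

lemma smoother_lap_commute: "smoother_lap n p q = smoother_lap n q p"
 unfolding smoother_lap_def by (simp only: moll_diff_commute[of n "fst p"] cap_commute[of "snd p"] inner_commute[of "snd p"])

lemma continuous_on_moll [continuous_intros]:
 "continuous_on S f ==> continuous_on S (\<lambda>x. moll n (f x :: 'a::euclidean_space))"
 using continuous_on_compose2[OF Ck_on_continuous[OF Ck_on_moll[of 0 n]], of S f] by simp

lemma continuous_on_zonal_slope [continuous_intros]:
 "continuous_on S f ==> continuous_on S g ==> continuous_on S (\<lambda>x. zonal_slope N (f x) (g x))"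
 unfolding zonal_slope_def divide_inverse by (intro continuous_intros)

lemma Ck_on_moll_shift:
 "Ck_on k (\<lambda>x::'a::euclidean_space. moll n (x - y) / z) UNIV"
proof -
 have "Ck_on k (\<lambda>x::'a. x + (- y)) UNIV"
  by (intro Ck_on_add Ck_on_const Ck_on_linear_intro[of "\<lambda>x. x"]) (auto simp: linear_iff)
 from Ck_on_compose[OF open_UNIV open_UNIV _ this Ck_on_moll] have "Ck_on k (\<lambda>x. moll n (x - y)) UNIV" by simp
 from Ck_on_mult[OF open_UNIV this Ck_on_const, of "1 / z"] show ?thesis by simp
qed

lemma grad_moll_shift:
 "grad (\<lambda>x::'a::euclidean_space. moll n (x - y) / z) x \<bullet> v = grad (moll n) (x - y) \<bullet> v / z"
proof -
 have "((\<lambda>x. x - y) has_derivative (\<lambda>v. v)) (at x)" by (auto intro!: derivative_eq_intros)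
 from diff_chain_at[OF this grad_works[OF Ck_on_moll[of "Suc 0"]]]
 have "((\<lambda>x. moll n (x - y)) has_derivative (\<lambda>v. grad (moll n) (x - y) \<bullet> v)) (at x)" by (simp add: o_def)
 from has_derivative_mult_left[OF this, of "1 / z"]
 have "((\<lambda>x. moll n (x - y) / z) has_derivative (\<lambda>v. grad (moll n) (x - y) \<bullet> v / z)) (at x)" by simp
 from has_derivative_unique[OF grad_works[OF Ck_on_moll_shift[of "Suc 0"]] this] show ?thesis by meson
qed

lemma smoother_profile:
 "(\<lambda>p. smoother n p q) = (\<lambda>p. moll n (fst p - fst q) / zmass (real DIM('a)) (n\<^sup>2 + 1) * cap (snd q) (snd p :: 'a::euclidean_space) ^ (n\<^sup>2 + 1))"
 by (simp add: fun_eq_iff smoother_def zonal_def cap_commute del: power_Suc)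

lemma Cks_smoother: "Cks k (\<lambda>p. smoother n p q)"
 unfolding smoother_profile by (rule Cks_cap_profile[OF Ck_on_moll_shift])

lemma skew_smoother:
 fixes V :: "'a::euclidean_space => real"
 assumes p: "p \<in> state_space" shows "skew V (\<lambda>p. smoother n p q) p = smoother_skew V n p q"
proof -
 have 1: "transport (\<lambda>p. smoother n p q) p = (grad (moll n) (fst p - fst q) \<bullet> snd p) * zonal (n\<^sup>2 + 1) (snd p) (snd q)"
  unfolding transport_def smoother_profile dX_cap_profile[OF Ck_on_moll_shift p] grad_moll_shift zonal_def
  by (simp add: cap_commute)
 have 2: "dS (\<lambda>p. smoother n p q) v p = moll n (fst p - fst q) * zonal_slope (n\<^sup>2 + 1) (snd p) (snd q)
    * ((snd q - (snd p \<bullet> snd q) *\<^sub>R snd p) \<bullet> v)" for v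
  unfolding smoother_profile dS_cap_profile[OF Ck_on_moll_shift p] zonal_slope_def
  by (simp add: cap_commute[of "snd p"] inner_commute[of "snd p" "snd q"] inner_diff_left)
 show ?thesis unfolding skew_def 1 2 smoother_skew_def ..
qed

lemma dS_smoother:
 assumes p: "p \<in> state_space" shows "dS (\<lambda>p. smoother n p q) e p = smoother_dS n e p q"
 unfolding smoother_profile dS_cap_profile[OF Ck_on_moll_shift p] zonal_slope_def smoother_dS_def
 by (simp add: cap_commute[of "snd p"] inner_commute[of "snd p" "snd q"] inner_diff_left)

lemma sphere_lap_smoother:
 assumes p: "p \<in> state_space" and q: "q \<in> state_space"
 shows "sphere_lap (\<lambda>p. smoother n p q) p = smoother_lap n p q"
proof -
 have "norm (snd q) = 1" using q by (auto simp: state_space_def)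
 show ?thesis unfolding smoother_profile smoother_lap_def
  by (subst sphere_lap_cap_profile[OF Ck_on_moll_shift p \<open>norm (snd q) = 1\<close>])
   (simp add: cap_commute[of "snd p"] inner_commute[of "snd p"] del: power_Suc)
qed

lemma smoother_far:
 assumes n: "1 \<le> n" and far: "1 / real n < norm (fst p - fst q)"
 shows "smoother n p q = 0" "smoother_skew V n p q = 0" "smoother_lap n p q = 0" "smoother_dS n e p q = 0"
 using moll_far[OF n far] by (simp_all add: smoother_def smoother_skew_def smoother_lap_def smoother_dS_def)

lemma far_from_ball:
 assumes "1 \<le> (n::nat)" "norm x \<le> R" "R + 1 < norm y" shows "1 / real n < norm (x - y)"
proof -
 have "1 < norm (x - y)" using assms(2,3) norm_triangle_ineq2[of y x] by (simp add: norm_minus_commute)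
 moreover have "1 / real n \<le> 1" using assms(1) by simp
 ultimately show ?thesis by simp
qed

lemma xsupp_smoother:
 assumes n: "1 \<le> n" shows "xsupp (norm (fst p) + 1) (\<lambda>q. smoother n q p)"
 unfolding xsupp_def
proof (intro ballI impI)
 fix q :: "'a::euclidean_space phase" assume "norm (fst p) + 1 < norm (fst q)"
 from smoother_far(1)[OF n far_from_ball[OF n order_refl this]] show "smoother n q p = 0" by (simp only: smoother_commute[of n q])
qed

lemma local_kernel_smoother:
 fixes V :: "'a::euclidean_space => real"
 assumes n: "1 \<le> n" and V: "Ck_on (Suc 0) V UNIV"
 shows "local_kernel R (smoother n :: 'a phase => _)" "local_kernel R (smoother_skew V n)"
  "local_kernel R (\<lambda>p q. smoother_skew V n q p)" "local_kernel R (smoother_lap n :: 'a phase => _)"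
  "local_kernel R (smoother_dS n (e :: 'a))"
proof -
 note mg = continuous_on_grad[OF Ck_on_moll[of "Suc 0" n]] and vg = continuous_on_grad[OF V]
 have c: "continuous_on S (\<lambda>z. smoother n (f z) (g z :: 'a phase))"
  "continuous_on S (\<lambda>z. smoother_skew V n (f z) (g z))"
  "continuous_on S (\<lambda>z. smoother_lap n (f z) (g z))"
  "continuous_on S (\<lambda>z. smoother_dS n e (f z) (g z))"
  if "continuous_on S f" "continuous_on S g" for S :: "('a phase \<times> 'a phase) set" and f g
  unfolding smoother_def smoother_skew_def smoother_lap_def smoother_dS_def divide_inverse
  by (intro continuous_on_add continuous_on_diff continuous_on_mult continuous_on_const continuous_on_inner continuous_on_scaleR continuous_on_power
    continuous_on_fst continuous_on_snd continuous_on_moll continuous_zonal continuous_on_zonal_slope continuous_cap mg vg that)+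
 have far: "1 / real n < norm (fst p - fst q)" "1 / real n < norm (fst q - fst p)"
  if "norm (fst p) \<le> R" "R + 1 < norm (fst q)" for p q :: "'a phase"
  using far_from_ball[OF n that] by (simp_all add: norm_minus_commute)
 have lk: "local_kernel R K" if "continuous_on UNIV (\<lambda>z. K (fst z) (snd z))"
  "\<And>p q. norm (fst p) \<le> R ==> R + 1 < norm (fst q) ==> K p q = 0" for K :: "'a phase => 'a phase => real"
  using that unfolding local_kernel_def case_prod_beta by blast
 have fs: "continuous_on UNIV (fst :: 'a phase \<times> ('a phase) => _)" "continuous_on UNIV (snd :: 'a phase \<times> ('a phase) => _)"
  by (intro continuous_intros)+
 show "local_kernel R (smoother n :: 'a phase => _)"
  by (rule lk[OF c(1)[OF fs]]) (rule smoother_far(1)[OF n far(1)])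
 show "local_kernel R (smoother_skew V n)"
  by (rule lk[OF c(2)[OF fs]]) (rule smoother_far(2)[OF n far(1)])
 show "local_kernel R (\<lambda>p q. smoother_skew V n q p)"
  by (rule lk[OF c(2)[OF fs(2,1)]]) (rule smoother_far(2)[OF n far(2)])
 show "local_kernel R (smoother_lap n :: 'a phase => _)"
  by (rule lk[OF c(3)[OF fs]]) (rule smoother_far(3)[OF n far(1)])
 show "local_kernel R (smoother_dS n e)"
  by (rule lk[OF c(4)[OF fs]]) (rule smoother_far(4)[OF n far(1)])
qed

lemma local_kernel_integrable:
 assumes "local_kernel R A" "norm (fst p) \<le> R" shows "integrable flat_measure (A p)"
proof (rule flat_integrable)
 have "continuous_on UNIV (\<lambda>q. (\<lambda>(p, q). A p q) (p, q))"
  by (rule continuous_on_compose2[of UNIV "\<lambda>(p, q). A p q"]) (use assms in \<open>auto simp: local_kernel_def intro!: continuous_intros\<close>)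
 then show "continuous_on state_space (A p)" using continuous_on_subset by auto
 show "xsupp (R + 1) (A p)" using local_kernel_eq_0[OF assms] by (simp add: xsupp_def)
qed

section \<open>Bounds for the kernels\<close>

context
 assumes d2: "2 \<le> DIM('a::euclidean_space)"
begin

lemma zonal_slope_bounds:
 assumes "norm \<omega> = 1" "norm \<eta> = 1"
 shows "0 \<le> zonal_slope (Suc M) \<omega> (\<eta> :: 'a)" "zonal_slope (Suc M) \<omega> \<eta> \<le> (real M + 1) * zonal M \<omega> \<eta>"
proof -
 let ?z = "zmass (real DIM('a)) M" and ?r = "zratio (real DIM('a)) M"
 have r: "1 / 2 \<le> ?r" using zratio_bounds(1)[of "real DIM('a)" M] d2 by simp
 have z: "0 < ?z" by (rule zm_pos[OF d2])
 have c: "0 \<le> cap \<omega> \<eta> ^ M" using cap_bounds(1)[OF assms] by simp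
 have eq: "zonal_slope (Suc M) \<omega> \<eta> = (real M + 1) * zonal M \<omega> \<eta> * (1 / (2 * ?r))"
  using r z by (simp add: zonal_slope_def zonal_def zmass_Suc field_simps)
 have nn: "0 \<le> (real M + 1) * zonal M \<omega> \<eta>" using zonal_nonneg[OF d2 assms, of M] by simp
 show "0 \<le> zonal_slope (Suc M) \<omega> \<eta>" unfolding eq using r by (intro mult_nonneg_nonneg[OF nn]) simp
 have "1 / (2 * ?r) \<le> 1" using r by simp
 from mult_left_mono[OF this nn] show "zonal_slope (Suc M) \<omega> \<eta> \<le> (real M + 1) * zonal M \<omega> \<eta>" unfolding eq by simp
qed

lemma smoother_bound:
 obtains C where "0 \<le> C" "\<And>n p q. 1 \<le> n ==> p \<in> state_space ==> q \<in> state_space ==> \<bar>smoother n p (q :: 'a phase)\<bar> \<le> C * kappa n p q"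
proof -
 obtain C where C: "0 < C" "\<And>n z. 1 \<le> n ==> 0 \<le> moll n z \<and> moll n (z :: 'a) \<le> C * box_weight n z"
  "\<And>n z v. 1 \<le> n ==> \<bar>frechet_derivative (moll n) (at (z :: 'a)) v\<bar> \<le> C * real n * box_weight n z * norm v"
  by (rule moll_bounds) (rule that)
 show thesis
 proof (rule that[of "2 * C"])
  fix n :: nat and p q :: "'a phase" assume n: "1 \<le> n" and pq: "p \<in> state_space" "q \<in> state_space"
  have u: "norm (snd p) = 1" "norm (snd q) = 1" using pq by (auto simp: state_space_def)
  let ?Z = "zonal (n\<^sup>2) (snd p) (snd q)" and ?b = "box_weight n (fst p - fst q)"
   and ?s = "1 + (real n)\<^sup>2 * (norm (snd p - snd q))\<^sup>2"
  have Z: "0 \<le> ?Z" by (rule zonal_nonneg[OF d2 u])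
  have "\<bar>smoother n p q\<bar> = moll n (fst p - fst q) * zonal (n\<^sup>2 + 1) (snd p) (snd q)"
   using C(2)[OF n] zonal_nonneg[OF d2 u] by (simp add: smoother_def)
  also have "\<dots> \<le> (C * ?b) * (2 * ?Z)"
   using C(2)[OF n, of "fst p - fst q"] zonal_Suc_le[OF d2 u, of "n\<^sup>2"] zonal_nonneg[OF d2 u, of "n\<^sup>2 + 1"]
   by (intro mult_mono) auto
  also have "\<dots> = 2 * C * (?b * ?Z) * 1" by simp
  also have "\<dots> \<le> 2 * C * (?b * ?Z) * ?s"
   using C(1) Z box_weight_nonneg[OF n, of "fst p - fst q"] by (intro mult_left_mono mult_nonneg_nonneg) auto
  finally show "\<bar>smoother n p q\<bar> \<le> 2 * C * kappa n p q" by (simp add: kappa_def mult_ac)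
 qed (use C(1) in simp)
qed

lemma integral_smoother:
 assumes n: "1 \<le> n" and p: "p \<in> state_space"
 shows "(\<ointegral>q. smoother n p (q :: 'a phase)) = 1"
proof -
 have u: "norm (snd p) = 1" using p by (auto simp: state_space_def)
 have i: "integrable lborel (moll n :: 'a => real)"
 proof (rule integrable_continuous_bounded_support)
  show "continuous_on UNIV (moll n :: 'a => real)" using continuous_on_moll[OF continuous_on_id] .
  show "moll n z = 0" if "1 / real n < norm z" for z :: 'a using moll_far(1)[OF n that] .
 qed
 have z: "integrable sphere_measure (\<lambda>\<eta>. zonal (n\<^sup>2 + 1) (snd p) (\<eta> :: 'a))"
  by (intro sphere_integrable_continuous continuous_intros)
 have "(\<ointegral>q. smoother n p q) = (\<integral>y. moll n (fst p - y) \<partial>lborel) * (\<integral>\<eta>. zonal (n\<^sup>2 + 1) (snd p) \<eta> \<partial>sphere_measure)"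
  unfolding smoother_def by (rule flat_product(2)[OF lborel_reflect(1)[OF i] z])
 then show ?thesis by (simp only: lborel_reflect(2)[OF i] integral_moll[OF n] integral_zonal[OF d2 u] mult_1)
qed

text \<open>Both derivatives integrate to zero in the second argument, as the integral of \<open>smoother\<close> does not depend
 on the first one.\<close>

lemma integral_smoother_skew:
 fixes V :: "'a => real"
 assumes n: "1 \<le> n" and p: "p \<in> state_space" and V: "\<And>k. Ck_on k V UNIV"
 shows "(\<ointegral>q. smoother_skew V n p q) = 1 / 2 * (snd p \<bullet> grad V (fst p))"
proof -
 define v where "v = grad V (fst p) - (snd p \<bullet> grad V (fst p)) *\<^sub>R snd p"
 have u: "snd p \<bullet> snd p = 1" using p by (auto simp: state_space_def norm_eq_1)
 have o: "snd p \<bullet> v = 0" using u by (simp add: v_def inner_diff_right)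
 have b1: "Ck_on 1 (moll n :: 'a => real) UNIV" by (rule Ck_on_moll)
 have b2: "Ck_on (Suc 0) (moll n :: 'a => real) UNIV" by (rule Ck_on_moll)
 let ?f1 = "\<lambda>z. grad (moll n) z \<bullet> snd p" and ?h1 = "\<lambda>\<eta>. zonal (n\<^sup>2 + 1) (snd p) (\<eta> :: 'a)"
 let ?f2 = "moll n :: 'a => real" and ?h2 = "\<lambda>\<eta>. zonal_slope (n\<^sup>2 + 1) (snd p) \<eta> * ((\<eta> - (snd p \<bullet> \<eta>) *\<^sub>R snd p) \<bullet> grad V (fst p))"
 have f1: "integrable lborel ?f1"
  by (rule integrable_continuous_bounded_support[of _ "1 / real n"])
   (intro continuous_intros continuous_on_grad[OF b2], simp add: moll_far(2)[OF n])
 have f2: "integrable lborel ?f2"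
  by (rule integrable_continuous_bounded_support[of _ "1 / real n"])
   (intro continuous_intros, simp add: moll_far(1)[OF n])
 have h1: "integrable sphere_measure ?h1" and h2: "integrable sphere_measure ?h2"
  by (intro sphere_integrable_continuous continuous_intros)+
 have "(\<integral>z. ?f1 z \<partial>lborel) = (\<integral>z. frechet_derivative (moll n) (at z) (snd p) \<partial>lborel)"
  by (simp only: frechet_derivative_eq_grad[OF b2])
 also have "\<dots> = 0" by (rule integral_directional_derivative_eq_0[OF b1, of "1 / real n"]) (rule moll_far(1)[OF n])
 finally have z1: "(\<integral>z. ?f1 z \<partial>lborel) = 0" .
 have "(\<integral>\<eta>. ?h2 \<eta> \<partial>sphere_measure) = (\<integral>\<eta>. (real (n\<^sup>2 + 1) / 2 / zmass (real DIM('a)) (n\<^sup>2 + 1)) * (cap (snd p) \<eta> ^ n\<^sup>2 * (\<eta> \<bullet> v)) \<partial>sphere_measure)"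
  by (rule lint_cong)
   (simp add: zonal_slope_def v_def inner_diff_left inner_diff_right inner_commute)
 also have "\<dots> = 0" by (simp only: lint_mult_right_zero integral_cap_power_orthogonal[OF d2 o] mult_zero_right)
 finally have z2: "(\<integral>\<eta>. ?h2 \<eta> \<partial>sphere_measure) = 0" .
 let ?A = "\<lambda>q. ?f1 (fst p - fst q) * ?h1 (snd q)" and ?B = "\<lambda>q. ?f2 (fst p - fst q) * ?h2 (snd q)" and ?C = "\<lambda>q. smoother n p q"
 let ?k = "1 / (real DIM('a) - 1)" and ?l = "1 / 2 * (snd p \<bullet> grad V (fst p))"
 have A: "integrable flat_measure ?A" "(\<ointegral>q. ?A q) = 0"
  using flat_product[OF lborel_reflect(1)[OF f1, of "fst p"] h1] by (simp_all only: lborel_reflect(2)[OF f1] z1 mult_zero_left)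
 have B: "integrable flat_measure ?B" "(\<ointegral>q. ?B q) = 0"
  using flat_product[OF lborel_reflect(1)[OF f2, of "fst p"] h2] by (simp_all only: z2 mult_zero_right)
 have C: "integrable flat_measure ?C"
  by (rule local_kernel_integrable[OF local_kernel_smoother(1)[OF n V, of "norm (fst p)"]]) simp
 have "smoother_skew V n p q = ?A q - ?k * ?B q + ?l * ?C q" for q
  by (simp only: smoother_skew_def mult.assoc)
 then have "(\<ointegral>q. smoother_skew V n p q) = (\<ointegral>q. ?A q - ?k * ?B q + ?l * ?C q)" by simp
 also have "\<dots> = (\<ointegral>q. ?A q) - ?k * (\<ointegral>q. ?B q) + ?l * (\<ointegral>q. ?C q)"
 proof -
  have B': "integrable flat_measure (\<lambda>q. ?k * ?B q)" and C': "integrable flat_measure (\<lambda>q. ?l * ?C q)"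
   using B(1) C by (auto intro: integrable_mult_right)
  show ?thesis
   by (simp only: lint_add[OF Bochner_Integration.integrable_diff[OF A(1) B'] C']
     lint_diff[OF A(1) B'] lint_mult_right_zero)
 qed
 finally show ?thesis by (simp only: A B integral_smoother[OF n p] mult_zero_right diff_self add_0_left mult_1_right)
qed

lemma integral_smoother_skew_adjoint:
 fixes V :: "'a => real"
 assumes n: "1 \<le> n" and V: "\<And>k. Ck_on k V UNIV"
 shows "(\<ointegral>q. smoother_skew V n q p) = - (1 / 2) * (\<ointegral>q. (snd q \<bullet> grad V (fst q)) * smoother n p q)"
proof -
 note s = xsupp_smoother[OF n, of p]
 have "(\<ointegral>q. smoother_skew V n q p) = (\<ointegral>q. skew V (\<lambda>q. smoother n q p) q)"
  by (rule lint_cong) (simp only: skew_smoother space_flat_measure)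
 also have "\<dots> = - (1 / 2) * (\<ointegral>q. (snd q \<bullet> grad V (fst q)) * smoother n q p)"
  by (rule integral_skew[OF d2 V Cks_smoother[of "Suc 0"] s])
 finally show ?thesis by (simp only: smoother_commute[of n _ p])
qed

text \<open>By symmetry of \<open>smoother\<close>, the operator acts on the second argument with exchanged roles.  In the sum
 the large factors only occur with small differences: \<open>\<omega> - \<eta>\<close>, the increment of \<open>\<nabla>V\<close>, and
 \<open>1 - \<omega> \<bullet> \<eta> = norm (\<omega> - \<eta>)\<^sup>2 / 2\<close>.\<close>

lemma commutator_identity:
 fixes V :: "'a => real"
 shows "smoother_skew V n p q + smoother_skew V n q p
  = (grad (moll n) (fst p - fst q) \<bullet> (snd p - snd q)) * zonal (n\<^sup>2 + 1) (snd p) (snd q)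
  - 1 / (real DIM('a) - 1) * (moll n (fst p - fst q) * zonal_slope (n\<^sup>2 + 1) (snd p) (snd q)
    * ((snd p - (snd p \<bullet> snd q) *\<^sub>R snd q) \<bullet> (grad V (fst q) - grad V (fst p))
     + (1 - snd p \<bullet> snd q) * ((snd p + snd q) \<bullet> grad V (fst p))))
  + 1 / 2 * (snd p \<bullet> grad V (fst p) + snd q \<bullet> grad V (fst q)) * smoother n p q"
proof -
 have 1: "moll n (fst q - fst p) = moll n (fst p - fst q)" by (rule moll_diff_commute)
 have 2: "grad (moll n) (fst q - fst p) \<bullet> v = - (grad (moll n) (fst p - fst q) \<bullet> v)" for v
  using grad_moll_odd[of n "fst p - fst q" v] by simp
 define k where "k = 1 / (real DIM('a) - 1)"
 show ?thesis unfolding k_def[symmetric] smoother_skew_def smoother_commute[of n q p] 1 2 zonal_commute[of _ "snd q" "snd p"]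
   zonal_slope_commute[of _ "snd q" "snd p"] inner_commute[of "snd q" "snd p"]
  by (simp add: inner_diff_left inner_diff_right inner_add_left algebra_simps)
qed

lemma commutator_bound:
 fixes V :: "'a => real"
 assumes V: "\<And>k. Ck_on k V UNIV"
 obtains C where "0 \<le> C"
  "\<And>n p q. 1 \<le> n ==> p \<in> cyl R ==> q \<in> state_space ==>
   \<bar>smoother_skew V n p q + smoother_skew V n q p\<bar> \<le> C * kappa n p q"
proof -
 obtain C where C: "0 < C" "\<And>n z. 1 \<le> n ==> 0 \<le> moll n z \<and> moll n (z :: 'a) \<le> C * box_weight n z"
  "\<And>n z v. 1 \<le> n ==> \<bar>frechet_derivative (moll n) (at (z :: 'a)) v\<bar> \<le> C * real n * box_weight n z * norm v"
  by (rule moll_bounds) (rule that)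
 obtain K where K: "0 \<le> K" "\<And>x. norm x \<le> R + 1 ==> norm (grad V x) \<le> K"
  "\<And>x y. norm x \<le> R + 1 ==> norm y \<le> R + 1 ==> norm (grad V x - grad V y) \<le> K * norm (x - y)"
  by (rule grad_Lipschitz_on_cball[OF V]) (rule that)
 show thesis
 proof (rule that[of "C * (1 + 5 * K)"])
  show "0 \<le> C * (1 + 5 * K)" using C(1) K(1) by simp
  fix n :: nat and p q :: "'a phase"
  assume n: "1 \<le> n" and p: "p \<in> cyl R" and q: "q \<in> state_space"
  have w: "norm (snd p) = 1" "norm (snd q) = 1" "norm (fst p) \<le> R" using p q by (auto simp: state_space_def)
  let ?m = "moll n (fst p - fst q)" and ?b = "box_weight n (fst p - fst q)" and ?Z = "zonal (n\<^sup>2) (snd p) (snd q)"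
  let ?u = "norm (snd p - snd q)" and ?t = "snd p \<bullet> snd q"
  let ?s = "1 + (real n)\<^sup>2 * ?u\<^sup>2"
  have Z: "0 \<le> ?Z" by (rule zonal_nonneg[OF d2 w(1,2)])
  have b: "0 \<le> ?b" by (rule box_weight_nonneg[OF n])
  have kap: "0 \<le> kappa n p q" unfolding kappa_def using b Z by (intro mult_nonneg_nonneg) auto
  show "\<bar>smoother_skew V n p q + smoother_skew V n q p\<bar> \<le> C * (1 + 5 * K) * kappa n p q"
  proof (cases "1 / real n < norm (fst p - fst q)")
   case True
   then have "1 / real n < norm (fst q - fst p)" by (simp add: norm_minus_commute)
   then show ?thesis using smoother_far(2)[OF n True] smoother_far(2)[OF n, of q p] C(1) K(1) kap by simp
  next
   case False
   have near: "norm (fst q - fst p) \<le> 1 / real n" using False by (simp add: norm_minus_commute)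
   also have "1 / real n \<le> 1" using n by simp
   finally have y: "norm (fst q) \<le> R + 1" using norm_triangle_ineq2[of "fst q" "fst p"] w(3) by linarith
   have x: "norm (fst p) \<le> R + 1" using w(3) by simp
   have n1: "1 \<le> real n" using n by simp
   have nu: "2 * (real n * ?u) \<le> ?s"
    using zero_le_power2[of "real n * ?u - 1"] by (simp add: power2_eq_square algebra_simps)
   have Z1: "\<bar>zonal (n\<^sup>2 + 1) (snd p) (snd q)\<bar> \<le> 2 * ?Z"
    using zonal_Suc_le[OF d2 w(1,2), of "n\<^sup>2"] zonal_nonneg[OF d2 w(1,2), of "n\<^sup>2 + 1"] by simp
   have S: "\<bar>zonal_slope (n\<^sup>2 + 1) (snd p) (snd q)\<bar> \<le> 2 * (real n)\<^sup>2 * ?Z"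
   proof -
    have "\<bar>zonal_slope (n\<^sup>2 + 1) (snd p) (snd q)\<bar> \<le> (real (n\<^sup>2) + 1) * ?Z"
     using zonal_slope_bounds[OF w(1,2), of "n\<^sup>2"] by simp
    also have "\<dots> \<le> (2 * (real n)\<^sup>2) * ?Z" using n1 by (intro mult_right_mono Z) simp
    finally show ?thesis .
   qed
   have m: "\<bar>?m\<bar> \<le> C * ?b" using C(2)[OF n, of "fst p - fst q"] by simp
   have g: "\<bar>grad (moll n) (fst p - fst q) \<bullet> (snd p - snd q)\<bar> \<le> C * real n * ?b * ?u"
    using C(3)[OF n, of "fst p - fst q" "snd p - snd q"] by (simp only: frechet_derivative_eq_grad[OF Ck_on_moll[of "Suc 0"]])
   have tu: "?u\<^sup>2 = 2 * (1 - ?t)"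
    using w by (simp add: power2_norm_eq_inner inner_diff_left inner_diff_right norm_eq_1 inner_commute)
   have t1: "\<bar>?t\<bar> \<le> 1" using Cauchy_Schwarz_ineq2[of "snd p" "snd q"] w by simp
   have T: "norm (snd p - ?t *\<^sub>R snd q) \<le> ?u"
   proof (rule power2_le_imp_le)
    have "(norm (snd p - ?t *\<^sub>R snd q))\<^sup>2 = 1 - ?t * ?t"
     using w by (simp add: power2_norm_eq_inner inner_diff_left inner_diff_right norm_eq_1 inner_commute)
    also have "\<dots> = (1 + ?t) * (1 - ?t)" by (simp add: algebra_simps)
    also have "\<dots> \<le> 2 * (1 - ?t)" using t1 by (intro mult_right_mono) auto
    finally show "(norm (snd p - ?t *\<^sub>R snd q))\<^sup>2 \<le> ?u\<^sup>2" by (simp only: tu)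
   qed simp
   let ?E1 = "(snd p - ?t *\<^sub>R snd q) \<bullet> (grad V (fst q) - grad V (fst p))"
   let ?E2 = "(1 - ?t) * ((snd p + snd q) \<bullet> grad V (fst p))"
   have E1: "\<bar>?E1\<bar> \<le> ?u * (K * (1 / real n))"
   proof -
    have "\<bar>?E1\<bar> \<le> norm (snd p - ?t *\<^sub>R snd q) * norm (grad V (fst q) - grad V (fst p))" by (rule Cauchy_Schwarz_ineq2)
    also have "\<dots> \<le> ?u * (K * (1 / real n))"
     by (intro mult_mono T order_trans[OF K(3)[OF y x]] mult_left_mono near K(1)) auto
    finally show ?thesis .
   qed
   have E2: "\<bar>?E2\<bar> \<le> ?u\<^sup>2 / 2 * (2 * K)"
   proof -
    have "\<bar>(snd p + snd q) \<bullet> grad V (fst p)\<bar> \<le> norm (snd p + snd q) * norm (grad V (fst p))" by (rule Cauchy_Schwarz_ineq2)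
    also have "\<dots> \<le> 2 * K" using norm_triangle_ineq[of "snd p" "snd q"] w K(2)[OF x] by (intro mult_mono) auto
    finally have 1: "\<bar>(snd p + snd q) \<bullet> grad V (fst p)\<bar> \<le> 2 * K" .
    have 2: "\<bar>1 - ?t\<bar> = ?u\<^sup>2 / 2" unfolding tu using t1 by simp
    show ?thesis unfolding abs_mult 2 by (intro mult_left_mono 1) simp
   qed
   have E: "2 * (real n)\<^sup>2 * \<bar>?E1 + ?E2\<bar> \<le> 3 * K * ?s"
   proof -
    have "2 * (real n)\<^sup>2 * \<bar>?E1 + ?E2\<bar> \<le> 2 * (real n)\<^sup>2 * (?u * (K * (1 / real n)) + ?u\<^sup>2 / 2 * (2 * K))"
     using E1 E2 by (intro mult_left_mono) auto
    also have "\<dots> = K * (2 * (real n * ?u)) + 2 * K * ((real n)\<^sup>2 * ?u\<^sup>2)"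
     using n1 by (simp add: power2_eq_square field_simps)
    also have "\<dots> \<le> K * ?s + 2 * K * ?s" using nu K(1) by (intro add_mono mult_left_mono) auto
    finally show ?thesis by simp
   qed
   have dk: "\<bar>1 / (real DIM('a) - 1)\<bar> \<le> 1" using d2 by simp
   have P1: "\<bar>(grad (moll n) (fst p - fst q) \<bullet> (snd p - snd q)) * zonal (n\<^sup>2 + 1) (snd p) (snd q)\<bar> \<le> C * kappa n p q"
   proof -
    have "\<bar>(grad (moll n) (fst p - fst q) \<bullet> (snd p - snd q)) * zonal (n\<^sup>2 + 1) (snd p) (snd q)\<bar> \<le> (C * real n * ?b * ?u) * (2 * ?Z)"
     unfolding abs_mult using C(1) b by (intro mult_mono g Z1 mult_nonneg_nonneg) auto
    also have "\<dots> = (C * ?b * ?Z) * (2 * (real n * ?u))" by (simp add: mult_ac)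
    also have "\<dots> \<le> (C * ?b * ?Z) * ?s" using C(1) b Z by (intro mult_left_mono nu mult_nonneg_nonneg) auto
    finally show ?thesis by (simp add: kappa_def mult_ac)
   qed
   have P2: "\<bar>1 / (real DIM('a) - 1) * (?m * zonal_slope (n\<^sup>2 + 1) (snd p) (snd q) * (?E1 + ?E2))\<bar> \<le> 3 * K * C * kappa n p q"
   proof -
    have "\<bar>1 / (real DIM('a) - 1) * (?m * zonal_slope (n\<^sup>2 + 1) (snd p) (snd q) * (?E1 + ?E2))\<bar>
      \<le> 1 * ((C * ?b) * (2 * (real n)\<^sup>2 * ?Z) * \<bar>?E1 + ?E2\<bar>)"
     unfolding abs_mult[of "1 / (real DIM('a) - 1)"] abs_mult[of "?m * _"] abs_mult[of ?m]
     using C(1) b Z by (intro mult_mono m S dk mult_nonneg_nonneg) auto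
    also have "\<dots> = (C * ?b * ?Z) * (2 * (real n)\<^sup>2 * \<bar>?E1 + ?E2\<bar>)" by (simp add: mult_ac)
    also have "\<dots> \<le> (C * ?b * ?Z) * (3 * K * ?s)" using C(1) b Z by (intro mult_left_mono E mult_nonneg_nonneg) auto
    finally show ?thesis unfolding kappa_def by (simp only: mult_ac mult_1)
   qed
   have P3: "\<bar>1 / 2 * (snd p \<bullet> grad V (fst p) + snd q \<bullet> grad V (fst q)) * smoother n p q\<bar> \<le> 2 * K * C * kappa n p q"
   proof -
    have "\<bar>snd p \<bullet> grad V (fst p)\<bar> \<le> K" "\<bar>snd q \<bullet> grad V (fst q)\<bar> \<le> K"
     using Cauchy_Schwarz_ineq2[of "snd p" "grad V (fst p)"] Cauchy_Schwarz_ineq2[of "snd q" "grad V (fst q)"] w K(2)[OF x] K(2)[OF y] by auto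
    then have 1: "\<bar>1 / 2 * (snd p \<bullet> grad V (fst p) + snd q \<bullet> grad V (fst q))\<bar> \<le> K" by simp
    have "\<bar>smoother n p q\<bar> \<le> (C * ?b) * (2 * ?Z)"
     unfolding smoother_def abs_mult using C(1) b by (intro mult_mono m Z1) auto
    also have "\<dots> = 2 * (C * ?b * ?Z) * 1" by simp
    also have "\<dots> \<le> 2 * (C * ?b * ?Z) * ?s" using C(1) b Z by (intro mult_left_mono mult_nonneg_nonneg) auto
    finally have 2: "\<bar>smoother n p q\<bar> \<le> 2 * C * kappa n p q" by (simp add: kappa_def mult_ac)
    have "\<bar>1 / 2 * (snd p \<bullet> grad V (fst p) + snd q \<bullet> grad V (fst q)) * smoother n p q\<bar> \<le> K * (2 * C * kappa n p q)"
     unfolding abs_mult[of "1 / 2 * _"] by (intro mult_mono 1 2 K(1)) simp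
    then show ?thesis by (simp add: mult_ac)
   qed
   have "\<bar>smoother_skew V n p q + smoother_skew V n q p\<bar> \<le> C * kappa n p q + 3 * K * C * kappa n p q + 2 * K * C * kappa n p q"
    unfolding commutator_identity using P1 P2 P3 by linarith
   then show ?thesis by (simp add: algebra_simps)
  qed
 qed
qed

text \<open>What survives the integration is the average of \<open>1/2 (\<omega> \<bullet> \<nabla>V(x) - \<eta> \<bullet> \<nabla>V(y))\<close>, and the
 integrand is Lipschitz on bounded sets.\<close>

lemma commutator_mass:
 fixes V :: "'a => real"
 assumes V: "\<And>k. Ck_on k V UNIV"
 obtains C where "0 \<le> C"
  "\<And>n p. 1 \<le> n ==> p \<in> cyl R ==>
   \<bar>\<ointegral>q. smoother_skew V n p q + smoother_skew V n q p\<bar> \<le> C / real n"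
proof -
 obtain C where C: "0 \<le> C" "\<And>n p q. 1 \<le> n ==> p \<in> state_space ==> q \<in> state_space ==> \<bar>smoother n p (q :: 'a phase)\<bar> \<le> C * kappa n p q"
  by (rule smoother_bound) (rule that)
 obtain K where K: "0 \<le> K" "\<And>x. norm x \<le> R + 1 ==> norm (grad V x) \<le> K"
  "\<And>x y. norm x \<le> R + 1 ==> norm y \<le> R + 1 ==> norm (grad V x - grad V y) \<le> K * norm (x - y)"
  by (rule grad_Lipschitz_on_cball[OF V]) (rule that)
 have km: "0 \<le> kappa_mass TYPE('a)"
  unfolding kappa_mass_def by (intro mult_nonneg_nonneg) (auto intro: less_imp_le[OF unit_ball_vol_pos])
 show thesis
 proof (rule that[of "4 * K * C * kappa_mass TYPE('a)"])
  show "0 \<le> 4 * K * C * kappa_mass TYPE('a)" using C K km by simp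
  fix n :: nat and p :: "'a phase" assume n: "1 \<le> n" and p: "p \<in> cyl R"
  have ps: "p \<in> state_space" and w: "norm (snd p) = 1" "norm (fst p) \<le> R" using p by (auto simp: state_space_def)
  note lk = local_kernel_smoother[OF n V, of "norm (fst p)"]
  let ?v = "\<lambda>q. snd q \<bullet> grad V (fst q)"
  have i0: "integrable flat_measure (smoother n p)" by (rule local_kernel_integrable[OF lk(1)]) simp
  have i1: "integrable flat_measure (\<lambda>q. smoother_skew V n p q)" by (rule local_kernel_integrable[OF lk(2)]) simp
  have i2: "integrable flat_measure (\<lambda>q. smoother_skew V n q p)" by (rule local_kernel_integrable[OF lk(3)]) simp
  note s = xsupp_smoother[OF n, of p]
  have "integrable flat_measure (\<lambda>q. ?v q * smoother n q p)"
   by (rule Cks_integrable[OF Cks_mult[OF Ck_on_grad_inner[OF V] Cks_smoother[of 0]] xsupp_mult2[OF s]])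
  then have i3: "integrable flat_measure (\<lambda>q. ?v q * smoother n p q)" by (simp only: smoother_commute[of n p])
  have i4: "integrable flat_measure (\<lambda>q. ?v p * smoother n p q)" using i0 by simp
  have i5: "integrable flat_measure (\<lambda>q. ?v p * smoother n p q - ?v q * smoother n p q)"
   by (rule Bochner_Integration.integrable_diff[OF i4 i3])
  have "(\<ointegral>q. smoother_skew V n p q + smoother_skew V n q p)
    = 1 / 2 * ?v p * (\<ointegral>q. smoother n p q) - 1 / 2 * (\<ointegral>q. ?v q * smoother n p q)"
   unfolding lint_add[OF i1 i2] integral_smoother_skew[OF n ps V] integral_smoother_skew_adjoint[OF n V] integral_smoother[OF n ps]
   by simp
  also have "\<dots> = 1 / 2 * (\<ointegral>q. ?v p * smoother n p q - ?v q * smoother n p q)"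
   unfolding lint_diff[OF i4 i3] by simp
  finally have eq: "\<bar>\<ointegral>q. smoother_skew V n p q + smoother_skew V n q p\<bar>
    = 1 / 2 * \<bar>\<ointegral>q. ?v p * smoother n p q - ?v q * smoother n p q\<bar>" by (simp add: abs_mult)
  have "\<bar>\<ointegral>q. ?v p * smoother n p q - ?v q * smoother n p q\<bar> \<le> (\<ointegral>q. \<bar>?v p * smoother n p q - ?v q * smoother n p q\<bar>)"
   by (rule integral_abs_bound)
  also have "\<dots> \<le> (\<ointegral>q. (4 * K * C / real n) * kappa2 n p q)"
  proof (rule integral_mono)
   show "integrable flat_measure (\<lambda>q. \<bar>?v p * smoother n p q - ?v q * smoother n p q\<bar>)" using i5 by simp
   show "integrable flat_measure (\<lambda>q. (4 * K * C / real n) * kappa2 n p q)" using integral_kappa2(1)[OF d2 n ps] by simp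
   fix q :: "'a phase" assume "q \<in> space flat_measure"
   then have q: "q \<in> state_space" by simp
   have wq: "norm (snd q) = 1" using q by (auto simp: state_space_def)
   have k0: "0 \<le> kappa n p q" by (rule kappa_le_kappa2(1)[OF d2 n ps q])
   have k2: "0 \<le> kappa2 n p q" by (rule kappa2_nonneg[OF d2 n ps q])
   show "\<bar>?v p * smoother n p q - ?v q * smoother n p q\<bar> \<le> (4 * K * C / real n) * kappa2 n p q"
   proof (cases "1 / real n < norm (fst p - fst q)")
    case True
    then show ?thesis using smoother_far(1)[OF n True] K(1) C(1) k2 by simp
   next
    case False
    have "1 / real n \<le> 1" using n by simp
    then have y: "norm (fst q) \<le> R + 1" using False norm_triangle_ineq2[of "fst q" "fst p"] w(2) by (simp add: norm_minus_commute)
    have x: "norm (fst p) \<le> R + 1" using w(2) by simp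
    have "?v p - ?v q = (snd p - snd q) \<bullet> grad V (fst p) + snd q \<bullet> (grad V (fst p) - grad V (fst q))"
     by (simp add: inner_diff_left inner_diff_right)
    also have "\<bar>\<dots>\<bar> \<le> norm (snd p - snd q) * norm (grad V (fst p)) + norm (snd q) * norm (grad V (fst p) - grad V (fst q))"
     by (intro order_trans[OF abs_triangle_ineq] add_mono Cauchy_Schwarz_ineq2)
    also have "\<dots> \<le> dist p q * K + 1 * (K * dist p q)"
    proof (intro add_mono mult_mono order_trans[OF K(3)[OF x y]] K mult_left_mono x)
     show "norm (snd p - snd q) \<le> dist p q" using dist_snd_le[of p q] by (simp add: dist_norm)
     show "norm (fst p - fst q) \<le> dist p q" using dist_fst_le[of p q] by (simp add: dist_norm)
    qed (use wq in auto)
    finally have v: "\<bar>?v p - ?v q\<bar> \<le> 2 * K * dist p q" by simp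
    have "\<bar>?v p * smoother n p q - ?v q * smoother n p q\<bar> = \<bar>?v p - ?v q\<bar> * \<bar>smoother n p q\<bar>"
     by (simp only: left_diff_distrib[symmetric] abs_mult)
    also have "\<dots> \<le> (2 * K * dist p q) * (C * kappa n p q)" using K(1) by (intro mult_mono v C(2)[OF n ps q]) auto
    also have "\<dots> = (2 * K * C) * (kappa n p q * dist p q)" by (simp add: mult_ac)
    also have "\<dots> \<le> (2 * K * C) * ((2 / real n) * kappa2 n p q)"
     using K(1) C(1) by (intro mult_left_mono kappa_moment[OF d2 n ps q]) auto
    finally show ?thesis by simp
   qed
  qed
  also have "\<dots> = (4 * K * C / real n) * (\<ointegral>q. kappa2 n p q)" by simp
  also have "\<dots> \<le> (4 * K * C / real n) * kappa_mass TYPE('a)"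
   using K(1) C(1) by (intro mult_left_mono integral_kappa2(2)[OF d2 n ps]) auto
  finally have "\<bar>\<ointegral>q. ?v p * smoother n p q - ?v q * smoother n p q\<bar> \<le> 4 * K * C * kappa_mass TYPE('a) / real n" by simp
  moreover have "0 \<le> 4 * K * C * kappa_mass TYPE('a) / real n" using K(1) C(1) km by simp
  ultimately show "\<bar>\<ointegral>q. smoother_skew V n p q + smoother_skew V n q p\<bar> \<le> 4 * K * C * kappa_mass TYPE('a) / real n"
   unfolding eq by simp
 qed
qed

end


section \<open>Uniqueness of weak solutions\<close>

text \<open>The test functions to be inserted into the weak equation.\<close>

lemma smooth_smoother:
 fixes V :: "'a::euclidean_space => real"
 assumes V: "\<And>k. Ck_on k V UNIV" and n: "1 \<le> n"
 shows "(\<lambda>q. exp (V (fst q) / 2) * smoother n q p) \<in> test_functions"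
proof (rule test_functionI[where R = "norm (fst p) + 1"])
 show "xsupp (norm (fst p) + 1) (\<lambda>q. exp (V (fst q) / 2) * smoother n q p)"
  by (rule xsupp_mult2[OF xsupp_smoother[OF n]])
 have "Ck_on k (\<lambda>q. exp (V (fst q) / 2) * smoother n q p) UNIV" for k
 proof -
  have eC: "Ck_on k (\<lambda>x. exp (V x / 2)) UNIV"
   using Ck_on_compose[OF open_UNIV open_UNIV _ Ck_on_mult[OF open_UNIV Ck_on_const[of _ "1/2"] V] Ck_on_exp] by simp
  have f: "Ck_on k (\<lambda>q::'a phase. c (fst q)) UNIV" if "Ck_on k c UNIV" for c :: "'a => real"
   by (rule Ck_on_compose[OF open_UNIV open_UNIV UNIV_I Ck_on_fst[OF open_UNIV] that])
  have "Ck_on k (\<lambda>q::'a phase. 1 / 2 + 1 / 2 * (snd q \<bullet> snd p)) UNIV"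
   by (intro Ck_on_add Ck_on_mult Ck_on_const Ck_on_linear_intro[of "\<lambda>q. snd q \<bullet> snd p"] open_UNIV)
    (simp add: linear_iff inner_add_left)
  then have "Ck_on k (\<lambda>q::'a phase. cap (snd p) (snd q)) UNIV" by (simp add: cap_def inner_commute add_divide_distrib)
  from Ck_on_power[OF open_UNIV this, of "n\<^sup>2 + 1"]
  show ?thesis unfolding fun_cong[OF smoother_profile]
   by (intro Ck_on_mult open_UNIV f eC Ck_on_moll_shift)
 qed
 then show "smooth_on UNIV (\<lambda>q. exp (V (fst q) / 2) * smoother n q p)" by (simp add: smooth_on_def)
qed

lemma local_kernel_add:
 "local_kernel R A ==> local_kernel R B ==> local_kernel R (\<lambda>p q. A p q + B p q)"
 unfolding local_kernel_def case_prod_beta by (intro conjI continuous_on_add) (blast, blast, metis add_0)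

lemma apply_kernel_add:
 assumes "local_kernel R A" "local_kernel R B" "norm (fst p) \<le> R" "g \<in> L2_funs flat_measure"
 shows "apply_kernel (\<lambda>p q. A p q + B p q) g p = apply_kernel A g p + apply_kernel B g p"
 unfolding apply_kernel_def distrib_right
 by (rule lint_add; rule L2_funs_mult_integrable[OF local_kernel_L2]) (fact assms)+

text \<open>The weight is bounded, so both factors converge in the Hilbert space and the integral is an inner
 product.\<close>

lemma weighted_limit:
 fixes u v :: "nat => 'a::euclidean_space phase => real" and R :: real
 defines "i \<equiv> \<lambda>p::'a phase. indicator (cyl R) p :: real"
 assumes w: "continuous_on state_space w" "xsupp R w"
  and u: "\<And>n. (\<lambda>p. i p * u n p) \<in> L2_funs flat_measure" "(\<lambda>p. i p * u0 p) \<in> L2_funs flat_measure"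
   "(\<lambda>n. (\<ointegral>p. (i p * (u n p - u0 p))\<^sup>2)) \<longlonglongrightarrow> 0"
  and v: "\<And>n. (\<lambda>p. i p * v n p) \<in> L2_funs flat_measure" "(\<lambda>p. i p * v0 p) \<in> L2_funs flat_measure"
   "(\<lambda>n. (\<ointegral>p. (i p * (v n p - v0 p))\<^sup>2)) \<longlonglongrightarrow> 0"
 shows "(\<lambda>n. (\<ointegral>p. w p * (u n p * v n p))) \<longlonglongrightarrow> (\<ointegral>p. w p * (u0 p * v0 p))"
proof -
 obtain B where "\<And>p. p \<in> state_space ==> \<bar>w p\<bar> \<le> B * indicator (cyl R) p"
  by (rule flat_bounded_support[OF w]) (rule that)
 then have B: "\<And>p. p \<in> state_space ==> \<bar>w p\<bar> \<le> B * i p" by (simp only: i_def)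
 have wm: "w \<in> borel_measurable flat_measure" by (rule flat_measurable_continuous[OF w(1)])
 have wB: "\<bar>w p\<bar> \<le> \<bar>B\<bar>" if "p \<in> state_space" for p
  by (rule order_trans[OF B[OF that]], cases "p \<in> cyl R") (simp_all add: i_def)
 have sq: "(w p * x)\<^sup>2 \<le> B\<^sup>2 * x\<^sup>2" if "p \<in> state_space" for p x
  using power_mono[OF wB[OF that] abs_ge_zero, of 2] by (simp add: power_mult_distrib mult_right_mono)
 have wL: "(\<lambda>p. w p * h p) \<in> L2_funs flat_measure" if h: "h \<in> L2_funs flat_measure" for h
 proof -
  have m: "(\<lambda>p. w p * h p) \<in> borel_measurable flat_measure" by (rule borel_measurable_times[OF wm L2_funsD(1)[OF h]])
  have "integrable flat_measure (\<lambda>p. B\<^sup>2 * (h p)\<^sup>2)" using L2_funsD(2)[OF h] by simp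
  then have "integrable flat_measure (\<lambda>p. (w p * h p)\<^sup>2)"
   by (rule Bochner_Integration.integrable_bound) (use m sq in auto)
  then show ?thesis using m by (simp add: L2_funs_def)
 qed
 have conv: "(\<lambda>n. L2_of (f n)) \<longlonglongrightarrow> L2_of f0"
  if f: "\<And>n. f n \<in> L2_funs flat_measure" "f0 \<in> L2_funs flat_measure"
   and le: "\<And>n. (\<ointegral>p. (f n p - f0 p)\<^sup>2) \<le> c n" and c: "c \<longlonglongrightarrow> 0" for f f0 and c :: "nat => real"
 proof -
  have "(\<lambda>n. (norm (L2_of (f n) - L2_of f0))\<^sup>2) \<longlonglongrightarrow> 0"
   by (rule tendsto_sandwich[OF _ _ tendsto_const c]) (use le in \<open>simp_all add: norm_L2_of_diff f\<close>)
  from tendsto_real_sqrt[OF this] have "(\<lambda>n. norm (L2_of (f n) - L2_of f0)) \<longlonglongrightarrow> 0" by simp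
  from LIM_zero_cancel[OF tendsto_norm_zero_cancel[OF this]] show ?thesis .
 qed
 have U: "(\<lambda>n. L2_of (\<lambda>p. i p * u n p)) \<longlonglongrightarrow> L2_of (\<lambda>p. i p * u0 p)"
  by (rule conv[OF u(1,2) _ u(3)]) (simp add: right_diff_distrib)
 have W: "(\<lambda>n. L2_of (\<lambda>p. w p * (i p * v n p))) \<longlonglongrightarrow> L2_of (\<lambda>p. w p * (i p * v0 p))"
 proof (rule conv[OF wL[OF v(1)] wL[OF v(2)]])
  show "(\<lambda>n. B\<^sup>2 * (\<ointegral>p. (i p * (v n p - v0 p))\<^sup>2)) \<longlonglongrightarrow> 0"
   using tendsto_mult_right_zero[OF v(3)] .
  fix n
  have d: "(\<lambda>p. i p * v n p - i p * v0 p) \<in> L2_funs flat_measure" by (rule L2_funs_diff[OF v(1,2)])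
  have "(\<ointegral>p. (w p * (i p * v n p) - w p * (i p * v0 p))\<^sup>2) = (\<ointegral>p. (w p * (i p * v n p - i p * v0 p))\<^sup>2)"
   by (simp only: right_diff_distrib)
  also have "\<dots> \<le> (\<ointegral>p. B\<^sup>2 * (i p * v n p - i p * v0 p)\<^sup>2)"
   by (rule integral_mono) (use L2_funsD(2)[OF wL[OF d]] L2_funsD(2)[OF d] sq in auto)
  finally show "(\<ointegral>p. (w p * (i p * v n p) - w p * (i p * v0 p))\<^sup>2) \<le> B\<^sup>2 * (\<ointegral>p. (i p * (v n p - v0 p))\<^sup>2)"
   by (simp add: right_diff_distrib)
 qed
 have eq: "inner (L2_of (\<lambda>p. i p * f p)) (L2_of (\<lambda>p. w p * (i p * h p))) = (\<ointegral>p. w p * (f p * h p))"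
  if "(\<lambda>p. i p * f p) \<in> L2_funs flat_measure" "(\<lambda>p. i p * h p) \<in> L2_funs flat_measure" for f h
  unfolding L2_of_ops(2)[OF that(1) wL[OF that(2)]]
 proof (rule lint_cong)
  fix p :: "'a phase" assume "p \<in> space flat_measure"
  then have p: "p \<in> state_space" by simp
  show "i p * f p * (w p * (i p * h p)) = w p * (f p * h p)"
  proof (cases "i p = 0")
   case True then show ?thesis using B[OF p] by simp
  next
   case False
   then have "i p = 1" by (auto simp: i_def indicator_def split: if_splits)
   then show ?thesis by simp
  qed
 qed
 show ?thesis using tendsto_inner[OF U W] by (simp only: eq[OF u(1) v(1)] eq[OF u(2) v(2)])
qed

lemma kernel_cylinder_L2:
 fixes A :: "'a::euclidean_space phase => 'a phase => real"
 assumes d2: "2 \<le> DIM('a)" and n: "1 \<le> n" and C: "0 \<le> C" and lk: "local_kernel R A"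
  and bound: "\<And>p q. p \<in> cyl R ==> q \<in> state_space ==> \<bar>A p q\<bar> \<le> C * kappa n p q"
  and g: "g \<in> L2_funs flat_measure"
 shows "(\<lambda>p. indicator (cyl R) p * apply_kernel A g p) \<in> L2_funs flat_measure"
 unfolding apply_kernel_def
proof (rule schur_test(1)[OF d2 n C sets_cylinder _ _ g])
 have "continuous_on UNIV (\<lambda>(p, q). A p q)" using lk unfolding local_kernel_def by blast
 then show "(\<lambda>(p, q). A p q) \<in> borel_measurable (flat_measure \<Otimes>\<^sub>M flat_measure)"
  by (intro flat2_measurable borel_measurable_continuous_onI)
 fix p q :: "'a phase" assume p: "p \<in> cyl R" and q: "q \<in> state_space"
 have "p \<in> state_space" using p by (auto simp: state_space_def)
 from kappa_le_kappa2(2)[OF d2 n this q] bound[OF p q] mult_left_mono[OF _ C]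
 show "\<bar>A p q\<bar> \<le> C * kappa2 n p q" by (meson order_trans)
qed

lemma cutoff_continuous:
 fixes a :: "'a::euclidean_space => real"
 assumes a: "\<And>k. Ck_on k a UNIV"
 shows "continuous_on state_space (\<lambda>p. a (fst p))"
 by (rule Cks_continuous[OF Cks_fst[OF a[of 0]]])

lemma cutoff_grad:
 assumes a: "\<And>k. Ck_on k a UNIV" and s: "xsupp R (\<lambda>p. a (fst p))"
 shows "continuous_on state_space (\<lambda>p. grad a (fst p) \<bullet> snd p)" "xsupp R (\<lambda>p. grad a (fst p) \<bullet> snd p)"
proof -
 show "continuous_on state_space (\<lambda>p. grad a (fst p) \<bullet> snd p)"
  using Cks_continuous[OF Ck_on_grad_inner[OF a[of "Suc 0"]]] by (simp only: inner_commute)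
 have "dX (\<lambda>p. a (fst p)) v p = grad a (fst p) \<bullet> v" for v p
  by (simp only: dX_fst[OF a] frechet_derivative_eq_grad[OF a])
 then show "xsupp R (\<lambda>p. grad a (fst p) \<bullet> snd p)"
  using xsupp_transport[OF s] by (simp add: xsupp_def transport_def)
qed

context
 fixes V :: "'a::euclidean_space => real" and \<sigma> :: real and g :: "'a phase => real"
 assumes d2: "2 \<le> DIM('a)" and V: "\<And>k. Ck_on k V UNIV" and g: "g \<in> L2_funs flat_measure"
begin

text \<open>The derivatives act on the second argument of the symmetric kernel.  For the Laplacian this is the same
 as acting on the first one; for the skew part it is not, whence the commutator.\<close>

lemma weak_equation:
 assumes weak: "\<And>f. f \<in> test_functions ==>
   (\<ointegral>p. g p * (exp (- V (fst p) / 2) * (f p - langevin V \<sigma> f p))) = 0"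
  and n: "1 \<le> n" and p: "p \<in> state_space"
 shows "apply_kernel (smoother n) g p = apply_kernel (\<lambda>p q. smoother_skew V n q p) g p
  + 1 / 2 * \<sigma>\<^sup>2 * apply_kernel (smoother_lap n) g p"
proof -
 let ?h = "\<lambda>q. smoother n q p" and ?s = "1 / 2 * \<sigma>\<^sup>2"
 let ?f = "\<lambda>q. exp (V (fst q) / 2) * ?h q"
 note lk = local_kernel_smoother[OF n V, of "norm (fst p)"]
 have i: "integrable flat_measure (\<lambda>q. A p q * g q)" if "local_kernel (norm (fst p)) A" for A
  by (rule L2_funs_mult_integrable[OF local_kernel_L2[OF that order_refl] g])
 have "0 = (\<ointegral>q. g q * (exp (- V (fst q) / 2) * (?f q - langevin V \<sigma> ?f q)))"
  using weak[OF smooth_smoother[OF V n]] by simp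
 also have "\<dots> = (\<ointegral>q. (smoother n p q * g q - smoother_skew V n q p * g q) - ?s * (smoother_lap n p q * g q))"
 proof (rule lint_cong)
  fix q :: "'a phase" assume "q \<in> space flat_measure"
  then have q: "q \<in> state_space" by simp
  have "langevin V \<sigma> ?f q = exp (V (fst q) / 2) * (smoother_skew V n q p + ?s * smoother_lap n p q)"
   by (simp only: langevin_conjugate[OF d2 V Cks_smoother q] skew_smoother[OF q] sphere_lap_smoother[OF q p] smoother_lap_commute[of n q p])
  then have "exp (- V (fst q) / 2) * (?f q - langevin V \<sigma> ?f q)
   = (exp (- V (fst q) / 2) * exp (V (fst q) / 2)) * (smoother n p q - smoother_skew V n q p - ?s * smoother_lap n p q)"
   by (simp add: algebra_simps smoother_commute[of n q p])
  also have "exp (- V (fst q) / 2) * exp (V (fst q) / 2) = 1" by (simp add: mult_exp_exp)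
  finally have eq: "exp (- V (fst q) / 2) * (?f q - langevin V \<sigma> ?f q)
   = 1 * (smoother n p q - smoother_skew V n q p - ?s * smoother_lap n p q)" .
  show "g q * (exp (- V (fst q) / 2) * (?f q - langevin V \<sigma> ?f q))
   = (smoother n p q * g q - smoother_skew V n q p * g q) - ?s * (smoother_lap n p q * g q)"
   unfolding eq by (simp add: algebra_simps)
 qed
 also have "\<dots> = apply_kernel (smoother n) g p - apply_kernel (\<lambda>p q. smoother_skew V n q p) g p - ?s * apply_kernel (smoother_lap n) g p"
 proof -
  have l: "integrable flat_measure (\<lambda>q. ?s * (smoother_lap n p q * g q))"
   using i[OF lk(4)] by simp
  show ?thesis unfolding apply_kernel_def
   by (simp only: lint_diff[OF Bochner_Integration.integrable_diff[OF i[OF lk(1)] i[OF lk(3)]] l]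
    lint_diff[OF i[OF lk(1)] i[OF lk(3)]] lint_mult_right_zero)
 qed
 finally show ?thesis by simp
qed

context
 fixes a :: "'a => real" and R :: real and n :: nat
 assumes a: "\<And>k. Ck_on k a UNIV" and s: "xsupp R (\<lambda>p. a (fst p))" and n: "1 \<le> n"
begin

lemma skew_form:
 "2 * (\<ointegral>p. a (fst p) * (apply_kernel (smoother_skew V n) g p * apply_kernel (smoother n) g p))
  = - (\<ointegral>p. (grad a (fst p) \<bullet> snd p) * (apply_kernel (smoother n) g p * apply_kernel (smoother n) g p))"
proof -
 note lk = local_kernel_smoother[OF n V, of R]
 note F1 = bilinear_Fubini[OF lk(2) lk(1) cutoff_continuous[OF a] s g]
 note F2 = bilinear_Fubini[OF lk(1) lk(2) cutoff_continuous[OF a] s g]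
 note F3 = bilinear_Fubini[OF lk(1) lk(1) cutoff_grad[OF a s] g]
 have key: "(\<ointegral>p. a (fst p) * (smoother_skew V n p q * smoother n p q'))
   + (\<ointegral>p. a (fst p) * (smoother n p q * smoother_skew V n p q'))
   = - (\<ointegral>p. (grad a (fst p) \<bullet> snd p) * (smoother n p q * smoother n p q'))" for q q'
 proof -
  have "(\<ointegral>p. a (fst p) * (smoother_skew V n p q * smoother n p q')) = (\<ointegral>p. a (fst p) * (skew V (\<lambda>p. smoother n p q) p * smoother n p q'))"
   "(\<ointegral>p. a (fst p) * (smoother n p q * smoother_skew V n p q')) = (\<ointegral>p. a (fst p) * (smoother n p q * skew V (\<lambda>p. smoother n p q') p))"
   by (rule lint_cong, simp only: skew_smoother space_flat_measure)+
  then show ?thesis using skew_symmetric[OF d2 V a s Cks_smoother[of "Suc 0" n q] Cks_smoother[of "Suc 0" n q']] by simp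
 qed
 have "2 * (\<ointegral>p. a (fst p) * (apply_kernel (smoother_skew V n) g p * apply_kernel (smoother n) g p))
  = (\<ointegral>p. a (fst p) * (apply_kernel (smoother_skew V n) g p * apply_kernel (smoother n) g p))
  + (\<ointegral>p. a (fst p) * (apply_kernel (smoother n) g p * apply_kernel (smoother_skew V n) g p))"
  by (simp add: mult.commute[of "apply_kernel (smoother n) g _"])
 also have "\<dots> = - (\<ointegral>p. (grad a (fst p) \<bullet> snd p) * (apply_kernel (smoother n) g p * apply_kernel (smoother n) g p))"
  unfolding F1(3) F2(3) F3(3) lint_add[OF F1(2) F2(2), symmetric] distrib_left[symmetric] key
  by simp
 finally show ?thesis .
qed

text \<open>Green's formula inside the double integral displays the form as minus the integral of a sum of squares.\<close>

lemma lap_form: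
 assumes a0: "\<And>x. 0 \<le> a x"
 shows "(\<ointegral>p. a (fst p) * (apply_kernel (smoother_lap n) g p * apply_kernel (smoother n) g p)) \<le> 0"
proof -
 note lk = local_kernel_smoother[OF n V, of R]
 note F1 = bilinear_Fubini[OF lk(4) lk(1) cutoff_continuous[OF a] s g]
 note F2 = bilinear_Fubini[OF lk(5) lk(5) cutoff_continuous[OF a] s g]
 let ?G = "\<lambda>z. (indicator (cyl (R + 1)) (fst z) * g (fst z)) *
   (indicator (cyl (R + 1)) (snd z) * g (snd z))"
 let ?I = "\<lambda>e z. (\<ointegral>p. a (fst p) * (smoother_dS n e p (fst z) * smoother_dS n e p (snd z)))"
 have key: "(\<ointegral>p. a (fst p) * (smoother_lap n p q * smoother n p q')) = - (\<Sum>e\<in>Basis. ?I e (q, q'))"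
  if q: "q \<in> state_space" for q q'
 proof -
  have "(\<ointegral>p. a (fst p) * (smoother_lap n p q * smoother n p q')) = (\<ointegral>p. a (fst p) * (sphere_lap (\<lambda>p. smoother n p q) p * smoother n p q'))"
   by (rule lint_cong) (simp only: sphere_lap_smoother[OF _ q] space_flat_measure)
  also have "\<dots> = - (\<Sum>e\<in>Basis. (\<ointegral>p. a (fst p) * (dS (\<lambda>p. smoother n p q) e p * dS (\<lambda>p. smoother n p q') e p)))"
   by (rule weighted_Green[OF a s Cks_smoother Cks_smoother])
  also have "\<dots> = - (\<Sum>e\<in>Basis. ?I e (q, q'))"
   unfolding fst_conv snd_conv
   by (intro arg_cong[of _ _ uminus] sum.cong refl Bochner_Integration.integral_cong) (simp only: dS_smoother space_flat_measure)
  finally show ?thesis .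
 qed
 have "(\<ointegral>p. a (fst p) * (apply_kernel (smoother_lap n) g p * apply_kernel (smoother n) g p))
   = (\<integral>z. - (\<Sum>e\<in>Basis. ?G z * ?I e z) \<partial>(flat_measure \<Otimes>\<^sub>M flat_measure))"
  unfolding F1(3)
 proof (rule lint_cong)
  fix z :: "'a phase \<times> 'a phase" assume "z \<in> space (flat_measure \<Otimes>\<^sub>M flat_measure)"
  then have z: "fst z \<in> state_space" by (auto simp: space_pair_measure)
  show "?G z * (\<ointegral>p. a (fst p) * (smoother_lap n p (fst z) * smoother n p (snd z))) = - (\<Sum>e\<in>Basis. ?G z * ?I e z)"
   unfolding key[OF z] by (simp only: sum_distrib_left mult_minus_right prod.collapse)
 qed
 also have "\<dots> = - (\<Sum>e\<in>Basis. \<integral>z. ?G z * ?I e z \<partial>(flat_measure \<Otimes>\<^sub>M flat_measure))"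
  by (simp only: Bochner_Integration.integral_minus) (simp only: lint_sum[OF F2(2)])
 also have "\<dots> = - (\<Sum>e\<in>Basis. (\<ointegral>p. a (fst p) * (apply_kernel (smoother_dS n e) g p * apply_kernel (smoother_dS n e) g p)))"
  by (simp only: F2(3))
 also have "\<dots> \<le> 0"
  unfolding neg_le_0_iff_le by (intro sum_nonneg integral_nonneg_AE AE_I2 mult_nonneg_nonneg a0 zero_le_square)
 finally show ?thesis .
qed

text \<open>The commutator replaces the operator acting on the second argument by the one acting on the first,
 whose quadratic form reduces to the derivative of the cutoff.\<close>

lemma energy_estimate:
 assumes a0: "\<And>x. 0 \<le> a x"
  and weak: "\<And>f. f \<in> test_functions ==>
   (\<ointegral>p. g p * (exp (- V (fst p) / 2) * (f p - langevin V \<sigma> f p))) = 0"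
 shows "(\<ointegral>p. a (fst p) * (apply_kernel (smoother n) g p * apply_kernel (smoother n) g p))
  \<le> (\<ointegral>p. a (fst p) * (apply_kernel (\<lambda>p q. smoother_skew V n p q + smoother_skew V n q p) g p * apply_kernel (smoother n) g p))
   + 1 / 2 * (\<ointegral>p. (grad a (fst p) \<bullet> snd p) * (apply_kernel (smoother n) g p * apply_kernel (smoother n) g p))"
  (is "?X \<le> ?Y + 1 / 2 * ?Z")
proof -
 note lk = local_kernel_smoother[OF n V, of R]
 note lr = local_kernel_add[OF lk(2) lk(3)]
 let ?J = "apply_kernel (smoother n) g" and ?A = "apply_kernel (smoother_skew V n) g" and ?L = "apply_kernel (smoother_lap n) g"
  and ?r = "apply_kernel (\<lambda>p q. smoother_skew V n p q + smoother_skew V n q p) g" and ?s = "1 / 2 * \<sigma>\<^sup>2"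
 note iA = bilinear_Fubini(1)[OF lk(2) lk(1) cutoff_continuous[OF a] s g]
  and iL = bilinear_Fubini(1)[OF lk(4) lk(1) cutoff_continuous[OF a] s g]
  and ir = bilinear_Fubini(1)[OF lr lk(1) cutoff_continuous[OF a] s g]
 have "?X = (\<ointegral>p. (a (fst p) * (?r p * ?J p) - a (fst p) * (?A p * ?J p)) + ?s * (a (fst p) * (?L p * ?J p)))"
 proof (rule lint_cong)
  fix p :: "'a phase" assume "p \<in> space flat_measure"
  then have p: "p \<in> state_space" by simp
  show "a (fst p) * (?J p * ?J p) = (a (fst p) * (?r p * ?J p) - a (fst p) * (?A p * ?J p)) + ?s * (a (fst p) * (?L p * ?J p))"
  proof (cases "norm (fst p) \<le> R")
   case True
   have "?r p = ?A p + apply_kernel (\<lambda>p q. smoother_skew V n q p) g p" by (rule apply_kernel_add[OF lk(2,3) True g])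
   then have "?J p = ?r p - ?A p + ?s * ?L p" using weak_equation[OF weak n p] by simp
   then have "a (fst p) * (?J p * ?J p) = a (fst p) * ((?r p - ?A p + ?s * ?L p) * ?J p)" by simp
   then show ?thesis by (simp only: algebra_simps)
  next
   case False
   then have "a (fst p) = 0" using s p by (simp add: xsupp_def)
   then show ?thesis by simp
  qed
 qed
 also have "\<dots> = (\<ointegral>p. a (fst p) * (?r p * ?J p)) - (\<ointegral>p. a (fst p) * (?A p * ?J p))
   + ?s * (\<ointegral>p. a (fst p) * (?L p * ?J p))"
 proof -
  have iL': "integrable flat_measure (\<lambda>p. ?s * (a (fst p) * (?L p * ?J p)))" using iL by simp
  show ?thesis
   by (simp only: lint_add[OF Bochner_Integration.integrable_diff[OF ir iA] iL']
    lint_diff[OF ir iA] lint_mult_right_zero)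
 qed
 also have "\<dots> \<le> ?Y + 1 / 2 * ?Z"
 proof -
  have "?s * (\<ointegral>p. a (fst p) * (?L p * ?J p)) \<le> 0"
   by (rule mult_nonneg_nonpos[OF _ lap_form[OF a0]]) simp
  then show ?thesis using skew_form by simp
 qed
 finally show ?thesis .
qed

end

lemma smoother_approximation:
 shows "(\<lambda>n. (\<ointegral>p. (indicator (cyl R) p * (apply_kernel (smoother (Suc n)) g p - g p))\<^sup>2)) \<longlonglongrightarrow> 0"
  and "(\<lambda>p. indicator (cyl R) p * apply_kernel (smoother (Suc n)) g p) \<in> L2_funs flat_measure"
proof -
 obtain C where C: "0 \<le> C" "\<And>n p q. 1 \<le> n ==> p \<in> state_space ==> q \<in> state_space ==> \<bar>smoother n p (q :: 'a phase)\<bar> \<le> C * kappa n p q"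
  by (rule smoother_bound[OF d2]) (rule that)
 have ps: "p \<in> state_space" if "p \<in> cyl R" for p :: "'a phase" using that by (auto simp: state_space_def)
 note lk = local_kernel_smoother(1)[OF _ V, of _ R]
 have cont: "continuous_on UNIV (\<lambda>(p, q). smoother n p (q :: 'a phase))" if "1 \<le> n" for n
  using lk[OF that] unfolding local_kernel_def by blast
 have mass: "\<bar>(\<ointegral>q. smoother n p q) - 1\<bar> \<le> C / real n" if "1 \<le> n" "p \<in> cyl R" for n and p :: "'a phase"
  using integral_smoother[OF d2 that(1) ps[OF that(2)]] C(1) by simp
 note approx = kernel_approximation[OF d2 cont C(1) C(2)[OF _ ps] mass g, THEN LIMSEQ_Suc]
 show "(\<lambda>n. (\<ointegral>p. (indicator (cyl R) p * (apply_kernel (smoother (Suc n)) g p - g p))\<^sup>2)) \<longlonglongrightarrow> 0"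
  using approx by (simp add: apply_kernel_def)
 show "(\<lambda>p. indicator (cyl R) p * apply_kernel (smoother (Suc n)) g p) \<in> L2_funs flat_measure"
  by (rule kernel_cylinder_L2[OF d2 _ C(1) lk C(2)[OF _ ps] g]) simp_all
qed

lemma commutator_approximation:
 defines "r \<equiv> \<lambda>n. apply_kernel (\<lambda>p q. smoother_skew V (Suc n) p q + smoother_skew V (Suc n) q p) g"
 shows "(\<lambda>n. (\<ointegral>p. (indicator (cyl R) p * (r n p - 0))\<^sup>2)) \<longlonglongrightarrow> 0"
  and "(\<lambda>p. indicator (cyl R) p * r n p) \<in> L2_funs flat_measure"
proof -
 let ?A = "\<lambda>n p q. smoother_skew V n p q + smoother_skew V n q p"
 obtain C1 where C1: "0 \<le> C1" "\<And>n p q. 1 \<le> n ==> p \<in> cyl R ==> q \<in> state_space ==> \<bar>?A n p q\<bar> \<le> C1 * kappa n p q"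
  by (rule commutator_bound[OF d2 V]) (rule that)
 obtain C2 where C2: "0 \<le> C2" "\<And>n p. 1 \<le> n ==> p \<in> cyl R ==> \<bar>\<ointegral>q. ?A n p q\<bar> \<le> C2 / real n"
  by (rule commutator_mass[OF d2 V]) (rule that)
 define C where "C = max C1 C2"
 have C: "0 \<le> C" "C1 \<le> C" "C2 \<le> C" using C1(1) by (auto simp: C_def)
 have ps: "p \<in> state_space" if "p \<in> cyl R" for p :: "'a phase" using that by (auto simp: state_space_def)
 have lk: "local_kernel R (?A n)" if "1 \<le> n" for n
  by (rule local_kernel_add[OF local_kernel_smoother(2,3)[OF that V]])
 have cont: "continuous_on UNIV (\<lambda>(p, q). ?A n p q)" if "1 \<le> n" for n
  using lk[OF that] unfolding local_kernel_def by blast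
 have bound: "\<bar>?A n p q\<bar> \<le> C * kappa n p q" if "1 \<le> n" "p \<in> cyl R" "q \<in> state_space" for n p q
  using C1(2)[OF that] mult_right_mono[OF C(2) kappa_le_kappa2(1)[OF d2 that(1) ps[OF that(2)] that(3)]] by linarith
 have mass: "\<bar>(\<ointegral>q. ?A n p q) - 0\<bar> \<le> C / real n" if "1 \<le> n" "p \<in> cyl R" for n p
  using C2(2)[OF that] divide_right_mono[OF C(3), of "real n"] by simp
 note approx = kernel_approximation[OF d2 cont C(1) bound mass g, THEN LIMSEQ_Suc]
 show "(\<lambda>n. (\<ointegral>p. (indicator (cyl R) p * (r n p - 0))\<^sup>2)) \<longlonglongrightarrow> 0"
  using approx by (simp add: apply_kernel_def r_def)
 show "(\<lambda>p. indicator (cyl R) p * r n p) \<in> L2_funs flat_measure"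
  unfolding r_def by (rule kernel_cylinder_L2[OF d2 _ C(1) lk bound g]) simp_all
qed

lemma energy_inequality:
 assumes a: "\<And>k. Ck_on k a UNIV" and s: "xsupp R (\<lambda>p. a (fst p))" and a0: "\<And>x. 0 \<le> a x"
  and weak: "\<And>f. f \<in> test_functions ==>
   (\<ointegral>p. g p * (exp (- V (fst p) / 2) * (f p - langevin V \<sigma> f p))) = 0"
 shows "(\<ointegral>p. a (fst p) * (g p * g p)) \<le> 1 / 2 * (\<ointegral>p. (grad a (fst p) \<bullet> snd p) * (g p * g p))"
proof -
 let ?i = "\<lambda>p::'a phase. indicator (cyl R) p :: real"
 let ?J = "\<lambda>n. apply_kernel (smoother (Suc n)) g"
  and ?r = "\<lambda>n. apply_kernel (\<lambda>p q. smoother_skew V (Suc n) p q + smoother_skew V (Suc n) q p) g"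
 have g': "(\<lambda>p. ?i p * g p) \<in> L2_funs flat_measure" by (rule L2_funs_cylinder[OF g])
 have z: "(\<lambda>p. ?i p * 0) \<in> L2_funs flat_measure" using L2_funs_zero by simp
 note wc = cutoff_continuous[OF a] and wg = cutoff_grad[OF a s]
 note SA = smoother_approximation[of R] and CA = commutator_approximation[of R]
 have 1: "(\<lambda>n. (\<ointegral>p. a (fst p) * (?J n p * ?J n p))) \<longlonglongrightarrow> (\<ointegral>p. a (fst p) * (g p * g p))"
  by (rule weighted_limit[OF wc s SA(2) g' SA(1) SA(2) g' SA(1)])
 have 2: "(\<lambda>n. (\<ointegral>p. (grad a (fst p) \<bullet> snd p) * (?J n p * ?J n p))) \<longlonglongrightarrow> (\<ointegral>p. (grad a (fst p) \<bullet> snd p) * (g p * g p))"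
  by (rule weighted_limit[OF wg SA(2) g' SA(1) SA(2) g' SA(1)])
 have 3: "(\<lambda>n. (\<ointegral>p. a (fst p) * (?r n p * ?J n p))) \<longlonglongrightarrow> (\<ointegral>p. a (fst p) * (0 * g p))"
  by (rule weighted_limit[OF wc s CA(2) z CA(1) SA(2) g' SA(1)])
 have "(\<ointegral>p. a (fst p) * (g p * g p)) \<le> (\<ointegral>p. a (fst p) * (0 * g p)) + 1 / 2 * (\<ointegral>p. (grad a (fst p) \<bullet> snd p) * (g p * g p))"
  by (rule LIMSEQ_le[OF 1 tendsto_add[OF 3 tendsto_mult[OF tendsto_const 2]]])
   (use energy_estimate[OF a s _ a0 weak] in auto)
 then show ?thesis by simp
qed

lemma L2_zero_AE:
 assumes "(\<ointegral>p. (g p)\<^sup>2) \<le> 0" shows "AE p in flat_measure. g p = 0"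
proof -
 have "(\<ointegral>p. (g p)\<^sup>2) = 0" using assms by (intro antisym integral_nonneg_AE) auto
 then show ?thesis using integral_nonneg_eq_0_iff_AE[OF L2_funsD(2)[OF g]] by simp
qed

theorem range_orthogonal_trivial:
 assumes weak: "\<And>f. f \<in> test_functions ==>
   (\<ointegral>p. g p * (exp (- V (fst p) / 2) * (f p - langevin V \<sigma> f p))) = 0"
 shows "AE p in flat_measure. g p = 0"
proof (rule L2_zero_AE)
 obtain C where C: "0 < C" "\<And>n z. 1 \<le> n ==> 0 \<le> moll n z \<and> moll n (z :: 'a) \<le> C * box_weight n z"
  "\<And>n z v. 1 \<le> n ==> \<bar>frechet_derivative (moll n) (at (z :: 'a)) v\<bar> \<le> C * real n * box_weight n z * norm v"
  by (rule moll_bounds) (rule that)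
 have bw: "box_weight 1 z \<le> 1" for z :: 'a by (simp add: box_weight_def indicator_def)
 \<comment> \<open>the mollifier of width 1 doubles as cutoff, since its gradient is already bounded\<close>
 define a where "a m x = moll 1 ((1 / real (Suc m)) *\<^sub>R (x :: 'a))" for m x
 have aC: "Ck_on k (a m) UNIV" for k m
  unfolding a_def by (rule Ck_on_compose[OF open_UNIV open_UNIV UNIV_I Ck_on_linear_intro Ck_on_moll]) (auto simp: linear_iff algebra_simps)
 have a0: "0 \<le> a m x" for m x using C(2)[of 1] by (simp add: a_def)
 have aB: "\<bar>a m x\<bar> \<le> C" for m x
 proof -
  have "moll 1 y \<le> C" for y :: 'a
   using conjunct2[OF C(2)[of 1 y, OF order_refl]] mult_left_mono[OF bw[of y] less_imp_le[OF C(1)]] by linarith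
  then show ?thesis using a0[of m x] by (simp add: a_def)
 qed
 have as: "xsupp (real (Suc m)) (\<lambda>p. a m (fst p))" for m
  unfolding xsupp_def a_def by (auto intro!: moll_far(1) simp: field_simps)
 have ga: "grad (a m) x \<bullet> v \<le> C / real (Suc m) * norm v" for m x v
 proof -
  let ?c = "1 / real (Suc m)"
  have "((\<lambda>x::'a. ?c *\<^sub>R x) has_derivative (\<lambda>v. ?c *\<^sub>R v)) (at x)" by (auto intro!: derivative_eq_intros)
  from diff_chain_at[OF this grad_works[OF Ck_on_moll[of "Suc 0"]]]
  have "(a m has_derivative (\<lambda>v. grad (moll 1) (?c *\<^sub>R x) \<bullet> (?c *\<^sub>R v))) (at x)" by (simp add: o_def a_def[abs_def])
  from has_derivative_unique[OF grad_works[OF aC[of "Suc 0"]] this]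
  have "grad (a m) x \<bullet> v = frechet_derivative (moll 1) (at (?c *\<^sub>R x)) (?c *\<^sub>R v)"
   by (simp only: frechet_derivative_eq_grad[OF Ck_on_moll[of "Suc 0"]])
  also have "\<dots> \<le> C * box_weight 1 (?c *\<^sub>R x) * norm (?c *\<^sub>R v)"
   using C(3)[of 1 "?c *\<^sub>R x" "?c *\<^sub>R v"] by simp
  also have "\<dots> \<le> C * 1 * norm (?c *\<^sub>R v)"
   using C(1) by (intro mult_right_mono mult_left_mono bw) auto
  finally show ?thesis by simp
 qed
 let ?I = "\<ointegral>p. (g p)\<^sup>2"
 have g2: "integrable flat_measure (\<lambda>p. (g p)\<^sup>2)" by (rule L2_funsD(2)[OF g])
 have gm: "g \<in> borel_measurable flat_measure" using g by (rule L2_funsD)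
 have le: "(\<ointegral>p. a m (fst p) * (g p)\<^sup>2) \<le> C / real (Suc m) * ?I" for m
 proof -
  have "(\<ointegral>p. a m (fst p) * (g p)\<^sup>2) \<le> 1 / 2 * (\<ointegral>p. (grad (a m) (fst p) \<bullet> snd p) * (g p)\<^sup>2)"
   using energy_inequality[OF aC as a0 weak] by (simp only: power2_eq_square)
  also have "(\<ointegral>p. (grad (a m) (fst p) \<bullet> snd p) * (g p)\<^sup>2) \<le> (\<ointegral>p. C / real (Suc m) * (g p)\<^sup>2)"
  proof (rule integral_mono')
   show "integrable flat_measure (\<lambda>p. C / real (Suc m) * (g p)\<^sup>2)" using g2 by simp
   fix p :: "'a phase" assume "p \<in> space flat_measure"
   then have "norm (snd p) = 1" by (auto simp: state_space_def)
   then show "(grad (a m) (fst p) \<bullet> snd p) * (g p)\<^sup>2 \<le> C / real (Suc m) * (g p)\<^sup>2"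
    using ga[of m "fst p" "snd p"] by (intro mult_right_mono) auto
   show "0 \<le> C / real (Suc m) * (g p)\<^sup>2" using C(1) by simp
  qed
  also have "(\<ointegral>p. C / real (Suc m) * (g p)\<^sup>2) = C / real (Suc m) * ?I" by simp
  finally have "(\<ointegral>p. a m (fst p) * (g p)\<^sup>2) \<le> 1 / 2 * (C / real (Suc m) * ?I)" by simp
  moreover have "0 \<le> C / real (Suc m) * ?I" using C(1) by (intro mult_nonneg_nonneg integral_nonneg_AE) auto
  ultimately show ?thesis by linarith
 qed
 have "(\<lambda>m. (\<ointegral>p. a m (fst p) * (g p)\<^sup>2)) \<longlonglongrightarrow> (\<ointegral>p. moll 1 (0 :: 'a) * (g p)\<^sup>2)"
 proof (rule integral_dominated_convergence[where w = "\<lambda>p. C * (g p)\<^sup>2"])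
  show "(\<lambda>p. moll 1 (0 :: 'a) * (g p)\<^sup>2) \<in> borel_measurable flat_measure" using gm by simp
  show "(\<lambda>p. a m (fst p) * (g p)\<^sup>2) \<in> borel_measurable flat_measure" for m
   by (intro borel_measurable_times Cks_measurable[OF Cks_fst[OF aC[of 0]]] borel_measurable_power gm)
  show "integrable flat_measure (\<lambda>p. C * (g p)\<^sup>2)" using g2 by simp
  show "AE p in flat_measure. norm (a m (fst p) * (g p)\<^sup>2) \<le> C * (g p)\<^sup>2" for m
   by (rule AE_I2) (simp add: abs_mult aB mult_right_mono)
  show "AE p in flat_measure. (\<lambda>m. a m (fst p) * (g p)\<^sup>2) \<longlonglongrightarrow> moll 1 (0 :: 'a) * (g p)\<^sup>2"
  proof (rule AE_I2)
   fix p :: "'a phase"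
   have "(\<lambda>m. (1 / real (Suc m)) *\<^sub>R fst p) \<longlonglongrightarrow> 0 *\<^sub>R fst p"
    by (intro tendsto_scaleR tendsto_const LIMSEQ_Suc[OF lim_const_over_n])
   then have "(\<lambda>m. (1 / real (Suc m)) *\<^sub>R fst p) \<longlonglongrightarrow> 0" by simp
   moreover have "isCont (moll 1) (0 :: 'a)"
    using continuous_on_moll[OF continuous_on_id, of "UNIV :: 'a set" 1] by (simp add: continuous_on_eq_continuous_at)
   ultimately have "(\<lambda>m. a m (fst p)) \<longlonglongrightarrow> moll 1 (0 :: 'a)" unfolding a_def by (rule isCont_tendsto_compose[rotated])
   then show "(\<lambda>m. a m (fst p) * (g p)\<^sup>2) \<longlonglongrightarrow> moll 1 (0 :: 'a) * (g p)\<^sup>2" by (intro tendsto_mult tendsto_const)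
  qed
 qed
 moreover have "(\<lambda>m. C / real (Suc m) * ?I) \<longlonglongrightarrow> 0"
  by (rule tendsto_mult_left_zero[OF LIMSEQ_Suc[OF lim_const_over_n]])
 ultimately have "(\<ointegral>p. moll 1 (0 :: 'a) * (g p)\<^sup>2) \<le> 0"
  by (rule LIMSEQ_le) (use le in auto)
 then have "moll 1 (0 :: 'a) * ?I \<le> 0" by simp
 moreover have "0 < moll 1 (0 :: 'a)" using bump_0_pos[where 'a = 'a] mollmass_pos[of 1, where 'a = 'a] by (simp add: moll_def)
 ultimately show "?I \<le> 0" by (simp add: mult_le_0_iff)
qed

text \<open>Here already \<open>J\<^sub>n g = 0\<close>, while \<open>J\<^sub>n g\<close> approximates \<open>g\<close>.\<close>

theorem domain_orthogonal_trivial: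
 assumes weak: "\<And>f. f \<in> test_functions ==> (\<ointegral>p. g p * (exp (- V (fst p) / 2) * f p)) = 0"
 shows "AE p in flat_measure. g p = 0"
proof -
 have z: "apply_kernel (smoother (Suc n)) g p = 0" for n p
 proof -
  have "apply_kernel (smoother (Suc n)) g p
    = (\<ointegral>q. g q * (exp (- V (fst q) / 2) * (exp (V (fst q) / 2) * smoother (Suc n) q p)))"
  proof -
   have "exp (- V y / 2) * (exp (V y / 2) * x) = x" for x y by (simp add: mult.assoc[symmetric] mult_exp_exp)
   then show ?thesis unfolding apply_kernel_def by (simp only: smoother_commute[of _ _ p] mult.commute[of "g _"])
  qed
  then show ?thesis using weak[OF smooth_smoother[OF V, of "Suc n" p]] by simp
 qed
 have "AE p in flat_measure. indicator (cyl (real R)) p * g p = 0" for R :: nat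
 proof -
  let ?i = "\<lambda>p::'a phase. indicator (cyl (real R)) p :: real"
  have "(\<ointegral>p. (?i p * g p)\<^sup>2) = 0"
   using LIMSEQ_unique[OF smoother_approximation(1)[of "real R", unfolded z] tendsto_const] by simp
  then have "AE p in flat_measure. (?i p * g p)\<^sup>2 = 0"
   using integral_nonneg_eq_0_iff_AE[OF L2_funsD(2)[OF L2_funs_cylinder[OF g, of "real R"]]] by simp
  then show ?thesis by (rule AE_mp) simp
 qed
 then have "AE p in flat_measure. \<forall>R::nat. indicator (cyl (real R)) p * g p = 0"
  by (intro AE_all_countable[THEN iffD2] allI)
 then show ?thesis
 proof (rule AE_mp, intro AE_I2 impI)
  fix p :: "'a phase" assume "p \<in> space flat_measure" and *: "\<forall>R::nat. indicator (cyl (real R)) p * g p = 0"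
  then have p: "norm (snd p) = 1" by (auto simp: state_space_def)
  obtain R :: nat where "norm (fst p) \<le> real R" using real_arch_simple by blast
  then have "indicator (cyl (real R)) p = (1 :: real)" using p by (simp add: indicator_def mem_Times_iff)
  then show "g p = 0" using * by (metis mult_1)
 qed
qed

end


section \<open>Transfer to the weighted space\<close>

lemma state_measure_density:
 fixes V :: "'a::euclidean_space => real"
 assumes V: "continuous_on UNIV V"
 shows "state_measure V = density flat_measure (\<lambda>p. ennreal (exp (- V (fst p))))"
proof -
 have m: "(\<lambda>x. ennreal (exp (- V x))) \<in> borel_measurable lborel"
  using borel_measurable_continuous_onI[OF V] by simp
 have 1: "density sphere_measure (\<lambda>_. 1) = (sphere_measure :: 'a measure)" by (rule density_1)
 have "state_measure V = density lborel (\<lambda>x. ennreal (exp (- V x))) \<Otimes>\<^sub>M density (sphere_measure :: 'a measure) (\<lambda>_. 1)"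
  by (simp only: state_measure_def 1)
 also have "\<dots> = density (lborel \<Otimes>\<^sub>M sphere_measure) (\<lambda>(x, y). ennreal (exp (- V x)) * 1)"
  by (rule pair_measure_density[OF m]) (simp_all add: 1 sphere.sigma_finite_measure_axioms)
 finally show ?thesis by (simp add: flat_measure_def case_prod_beta')
qed

lemma smooth_on_submanifold_add:
 assumes "smooth_on_submanifold M f" "smooth_on_submanifold M g"
 shows "smooth_on_submanifold M (\<lambda>p. f p + g p)"
 unfolding smooth_on_submanifold_def
proof
 fix p assume p: "p \<in> M"
 obtain U F where F: "open U" "p \<in> U" "smooth_on U F" "\<forall>q\<in>U \<inter> M. F q = f q"
  using assms(1) p unfolding smooth_on_submanifold_def by blast
 obtain W G where G: "open W" "p \<in> W" "smooth_on W G" "\<forall>q\<in>W \<inter> M. G q = g q"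
  using assms(2) p unfolding smooth_on_submanifold_def by blast
 have "smooth_on (U \<inter> W) (\<lambda>q. F q + G q)" unfolding smooth_on_def
 proof
  fix k
  have "Ck_on k F U" "Ck_on k G W" using F(3) G(3) by (simp_all add: smooth_on_def)
  then show "Ck_on k (\<lambda>q. F q + G q) (U \<inter> W)"
   by (intro Ck_on_add open_Int F G) (auto intro: Ck_on_subset)
 qed
 then show "\<exists>U F. open U \<and> p \<in> U \<and> smooth_on U F \<and> (\<forall>q\<in>U \<inter> M. F q = f q + g q)"
  using F G by (intro exI[of _ "U \<inter> W"] exI[of _ "\<lambda>q. F q + G q"]) auto
qed

lemma smooth_on_submanifold_scale:
 fixes f :: "'a::real_normed_vector => real"
 assumes "smooth_on_submanifold M f" shows "smooth_on_submanifold M (\<lambda>p. c * f p)"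
 unfolding smooth_on_submanifold_def
proof
 fix p assume p: "p \<in> M"
 obtain U F where F: "open U" "p \<in> U" "smooth_on U F" "\<forall>q\<in>U \<inter> M. F q = f q"
  using assms(1) p unfolding smooth_on_submanifold_def by blast
 have "smooth_on U (\<lambda>q. c * F q)"
  using F(3) unfolding smooth_on_def by (auto intro: Ck_on_mult[OF F(1) Ck_on_const])
 then show "\<exists>U F. open U \<and> p \<in> U \<and> smooth_on U F \<and> (\<forall>q\<in>U \<inter> M. F q = c * f q)"
  using F by (intro exI[of _ U] exI[of _ "\<lambda>q. c * F q"]) auto
qed

lemma test_functions_add:
 assumes f: "f \<in> test_functions" and g: "g \<in> test_functions"
 shows "(\<lambda>p. f p + g p) \<in> test_functions"
proof -
 have "bounded ({p \<in> state_space. f p \<noteq> 0} \<union> {p \<in> state_space. g p \<noteq> 0})"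
  using f g by (simp add: test_functions_def compact_closure)
 then have "bounded {p \<in> state_space. f p + g p \<noteq> 0}" by (rule bounded_subset) auto
 then have "compact (closure {p \<in> state_space. f p + g p \<noteq> 0})" by (simp only: compact_closure)
 then show ?thesis using f g by (simp add: test_functions_def smooth_on_submanifold_add)
qed

lemma test_functions_scale:
 assumes f: "f \<in> test_functions" shows "(\<lambda>p. c * f p) \<in> test_functions"
proof -
 have "bounded {p \<in> state_space. f p \<noteq> 0}" using f by (simp add: test_functions_def compact_closure)
 then have "bounded {p \<in> state_space. c * f p \<noteq> 0}" by (rule bounded_subset) auto
 then have "compact (closure {p \<in> state_space. c * f p \<noteq> 0})" by (simp only: compact_closure)
 then show ?thesis using f by (simp add: test_functions_def smooth_on_submanifold_scale)
qed

lemma test_functions_zero: "(\<lambda>_. 0) \<in> test_functions"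
 by (rule test_functionI[where R = 0]) (simp_all add: smooth_on_def Ck_on_const xsupp_def)

lemma langevin_add:
 assumes f: "Cks (Suc (Suc 0)) f" and g: "Cks (Suc (Suc 0)) g" and p: "p \<in> state_space"
 shows "langevin V \<sigma> (\<lambda>p. f p + g p) p = langevin V \<sigma> f p + langevin V \<sigma> g p"
proof -
 have f1: "Cks (Suc 0) f" and g1: "Cks (Suc 0) g" by (rule Cks_mono[OF _ f], simp, rule Cks_mono[OF _ g], simp)
 have "dS (dS (\<lambda>p. f p + g p) b) b p = dS (dS f b) b p + dS (dS g b) b p" for b
 proof -
  have "dS (dS (\<lambda>p. f p + g p) b) b p = dS (\<lambda>p. dS f b p + dS g b p) b p"
   by (rule dS_cong[OF dS_add[OF f1 g1] p])
  also have "\<dots> = dS (dS f b) b p + dS (dS g b) b p"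
   by (rule dS_add[OF Cks_derivatives(2)[OF f] Cks_derivatives(2)[OF g] p])
  finally show ?thesis .
 qed
 then have "sphere_lap (\<lambda>p. f p + g p) p = sphere_lap f p + sphere_lap g p"
  by (simp add: sphere_lap_def sum.distrib)
 then show ?thesis
  unfolding langevin_eq[OF Cks_add[OF f g] p] langevin_eq[OF f p] langevin_eq[OF g p] transport_def
   dX_add[OF f1 g1 p] dS_add[OF f1 g1 p] by (simp add: algebra_simps)
qed

lemma langevin_scale:
 assumes f: "Cks (Suc (Suc 0)) f" and p: "p \<in> state_space"
 shows "langevin V \<sigma> (\<lambda>p. c * f p) p = c * langevin V \<sigma> f p"
proof -
 have f1: "Cks (Suc 0) f" by (rule Cks_mono[OF _ f]) simp
 have s: "dS (\<lambda>p. c * h p) v p = c * dS h v p" if "Cks (Suc 0) h" "p \<in> state_space" for h v p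
  using dS_mult[OF Cks_const[of "Suc 0" c] that, of v] dS_fst[of "\<lambda>_. c" v p] by simp
 have x: "dX (\<lambda>p. c * f p) v p = c * dX f v p" for v
  using dX_mult[OF Cks_const[of "Suc 0" c] f1 p, of v] dX_snd[of "\<lambda>_. c" v p] by simp
 have "dS (dS (\<lambda>p. c * f p) b) b p = c * dS (dS f b) b p" for b
 proof -
  have "dS (dS (\<lambda>p. c * f p) b) b p = dS (\<lambda>p. c * dS f b p) b p" by (rule dS_cong[OF s[OF f1] p])
  also have "\<dots> = c * dS (dS f b) b p" by (rule s[OF Cks_derivatives(2)[OF f] p])
  finally show ?thesis .
 qed
 then have "sphere_lap (\<lambda>p. c * f p) p = c * sphere_lap f p" by (simp add: sphere_lap_def sum_distrib_left)
 then show ?thesis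
  unfolding langevin_eq[OF Cks_mult[OF Cks_const f] p] langevin_eq[OF f p] transport_def x s[OF f1 p] by (simp add: algebra_simps)
qed

lemma L2_of_cong:
 assumes "f \<in> L2_funs flat_measure" "g \<in> L2_funs flat_measure" "\<And>p. p \<in> state_space ==> f p = g p"
 shows "L2_of f = L2_of g"
 unfolding L2_of_eq_iff[OF assms(1,2)] using assms(3) by (intro AE_I2) simp

lemma L2_of_diff:
 assumes "f \<in> L2_funs flat_measure" "g \<in> L2_funs flat_measure"
 shows "L2_of f - L2_of g = L2_of (\<lambda>p. f p - g p)"
proof -
 have "L2_of f - L2_of g = L2_of f + (- 1) *\<^sub>R L2_of g" by simp
 then show ?thesis unfolding L2_of_scale[OF assms(2)] L2_of_ops(1)[OF assms(1) L2_funs_scale[OF assms(2)]] by simp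
qed

text \<open>Multiplication by \<open>e\<^sup>V\<^sup>/\<^sup>2\<close>, a unitary map onto the weighted space.\<close>

definition unweight :: "('a::euclidean_space => real) => 'a phase_L2 => ('a phase => real) set" where
 "unweight V u = L2_class (state_measure V) (\<lambda>p. exp (V (fst p) / 2) * fn u p)"

context
 fixes V :: "'a::euclidean_space => real" and \<sigma> :: real
 assumes d2: "2 \<le> DIM('a)" and V: "\<And>k. Ck_on k V UNIV"
begin

lemma exp_half: "exp (- V x / 2) * (exp (V x / 2) * y) = y" "exp (V x / 2) * (exp (- V x / 2) * y) = y"
 by (simp_all add: mult.assoc[symmetric] mult_exp_exp)

lemma Cks_exp_potential: "Cks k (\<lambda>p. exp (c * V (fst p)))"
 by (rule Cks_fst[OF Ck_on_compose[OF open_UNIV open_UNIV UNIV_I Ck_on_mult[OF open_UNIV Ck_on_const V] Ck_on_exp]])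

lemma measurable_exp_potential: "(\<lambda>p. exp (c * V (fst p))) \<in> borel_measurable flat_measure"
 by (rule Cks_measurable[OF Cks_exp_potential[of 0]])

lemma density_eq: "state_measure V = density flat_measure (\<lambda>p. ennreal (exp (- V (fst p))))"
 by (rule state_measure_density[OF Ck_on_continuous[OF V]])

lemma measurable_state [simp]: "f \<in> borel_measurable (state_measure V) \<longleftrightarrow> f \<in> borel_measurable flat_measure"
 by (simp add: density_eq)

lemma measurable_weight: "(\<lambda>p. exp (- V (fst p))) \<in> borel_measurable flat_measure"
 using measurable_exp_potential[of "- 1"] by simp

lemma integral_state:
 assumes f: "f \<in> borel_measurable flat_measure"
 shows "integrable (state_measure V) f \<longleftrightarrow> integrable flat_measure (\<lambda>p. exp (- V (fst p)) * f p)"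
  "(\<integral>p. f p \<partial>state_measure V) = (\<ointegral>p. exp (- V (fst p)) * f p)"
 unfolding density_eq
 using integrable_density[OF f measurable_weight] integral_density[OF f measurable_weight] by simp_all

lemma AE_state: "(AE p in state_measure V. P p) \<longleftrightarrow> (AE p in flat_measure. P p)"
proof -
 have "(\<lambda>p. ennreal (exp (- V (fst p)))) \<in> borel_measurable flat_measure"
  by (rule measurable_compose[OF measurable_weight measurable_ennreal])
 from AE_density[OF this] show ?thesis unfolding density_eq by simp
qed

lemma L2_funs_state: "f \<in> L2_funs (state_measure V) \<longleftrightarrow> (\<lambda>p. exp (- V (fst p) / 2) * f p) \<in> L2_funs flat_measure"
proof (cases "f \<in> borel_measurable flat_measure")
 case True
 have e: "(exp (- V (fst p) / 2) * f p)\<^sup>2 = exp (- V (fst p)) * (f p)\<^sup>2" for p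
  by (simp add: power_mult_distrib power2_eq_square[of "exp _"] mult_exp_exp)
 have m: "(\<lambda>p. exp (- V (fst p) / 2) * f p) \<in> borel_measurable flat_measure"
  using borel_measurable_times[OF measurable_exp_potential[of "- 1 / 2"] True] by simp
 have "(\<lambda>p. (f p)\<^sup>2) \<in> borel_measurable flat_measure" using True by simp
 from integral_state(1)[OF this] show ?thesis using True m unfolding L2_funs_def mem_Collect_eq measurable_state e by blast
next
 case False
 have "f \<in> borel_measurable flat_measure" if "(\<lambda>p. exp (- V (fst p) / 2) * f p) \<in> borel_measurable flat_measure"
 proof -
  have "exp (1 / 2 * V x) * (exp (- V x / 2) * y) = y" for x y by (simp add: mult.assoc[symmetric] mult_exp_exp)
  with borel_measurable_times[OF measurable_exp_potential[of "1 / 2"] that] show ?thesis by (simp only:)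
 qed
 then show ?thesis using False by (auto simp: L2_funs_def)
qed

lemma unweight_L2_of:
 assumes h: "h \<in> L2_funs flat_measure"
 shows "unweight V (L2_of h) = L2_class (state_measure V) (\<lambda>p. exp (V (fst p) / 2) * h p)"
 unfolding unweight_def
proof (subst L2_class_eq_iff)
 show "(\<lambda>p. exp (V (fst p) / 2) * fn (L2_of h) p) \<in> L2_funs (state_measure V)"
  "(\<lambda>p. exp (V (fst p) / 2) * h p) \<in> L2_funs (state_measure V)"
  by (simp_all only: L2_funs_state exp_half fn_L2 h)
 show "AE p in state_measure V. exp (V (fst p) / 2) * fn (L2_of h) p = exp (V (fst p) / 2) * h p"
  unfolding AE_state using fn_L2_of[OF h] by simp
qed

lemma weighted_fn: "(\<lambda>p. exp (V (fst p) / 2) * fn u p) \<in> L2_funs (state_measure V)"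
 by (simp only: L2_funs_state exp_half fn_L2)

lemma L2_isometry_unweight: "L2_isometry (state_measure V) (unweight V)"
proof
 show "bij_betw (unweight V) UNIV (L2_space (state_measure V))"
 proof (rule bij_betw_imageI)
  show "inj (unweight V)"
  proof (rule injI)
   fix u v assume "unweight V u = unweight V v"
   then have "AE p in state_measure V. exp (V (fst p) / 2) * fn u p = exp (V (fst p) / 2) * fn v p"
    unfolding unweight_def by (simp only: L2_class_eq_iff[OF weighted_fn weighted_fn])
   then have "AE p in flat_measure. fn u p = fn v p" unfolding AE_state by simp
   then have "L2_of (fn u) = L2_of (fn v)" by (simp only: L2_of_eq_iff[OF fn_L2 fn_L2])
   then show "u = v" by simp
  qed
  show "range (unweight V) = L2_space (state_measure V)"
  proof (intro equalityI subsetI)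
   fix x assume "x \<in> range (unweight V)"
   then show "x \<in> L2_space (state_measure V)" unfolding unweight_def using L2_class_in_space[OF weighted_fn] by auto
  next
   fix x assume "x \<in> L2_space (state_measure V)"
   then obtain f where f: "f \<in> L2_funs (state_measure V)" "x = L2_class (state_measure V) f" by (auto simp: L2_space_def)
   have "unweight V (L2_of (\<lambda>p. exp (- V (fst p) / 2) * f p)) = x"
    using f(1) by (simp only: unweight_L2_of L2_funs_state exp_half f(2))
   then show "x \<in> range (unweight V)" by blast
  qed
 qed
 show "unweight V (u + v) = L2_add (state_measure V) (unweight V u) (unweight V v)" for u v
 proof -
  have "unweight V (u + v) = unweight V (L2_of (\<lambda>p. fn u p + fn v p))"
   using L2_of_ops(1)[of "fn u" "fn v"] by simp
  also have "\<dots> = L2_class (state_measure V) (\<lambda>p. exp (V (fst p) / 2) * fn u p + exp (V (fst p) / 2) * fn v p)"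
   by (simp only: unweight_L2_of[OF L2_funs_add[OF fn_L2 fn_L2]] distrib_left)
  finally show ?thesis unfolding unweight_def by (simp only: L2_add_class[OF weighted_fn weighted_fn])
 qed
 show "unweight V (c *\<^sub>R u) = L2_scale (state_measure V) c (unweight V u)" for c u
 proof -
  have "unweight V (c *\<^sub>R u) = unweight V (L2_of (\<lambda>p. c * fn u p))" using L2_of_scale[of "fn u" c] by simp
  also have "\<dots> = L2_class (state_measure V) (\<lambda>p. c * (exp (V (fst p) / 2) * fn u p))"
   by (simp only: unweight_L2_of[OF L2_funs_scale[OF fn_L2]] mult.left_commute)
  finally show ?thesis unfolding unweight_def by (simp only: L2_scale_class[OF weighted_fn])
 qed
 show "L2_inner (state_measure V) (unweight V u) (unweight V v) = inner u v" for u v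
 proof -
  have m: "(\<lambda>p. exp (V (fst p) / 2) * fn u p * (exp (V (fst p) / 2) * fn v p)) \<in> borel_measurable flat_measure"
   by (intro borel_measurable_times[OF measurable_state[THEN iffD1] measurable_state[THEN iffD1]] L2_funsD(1)[OF weighted_fn])
  have e: "exp (- V x) * (exp (V x / 2) * a * (exp (V x / 2) * b)) = a * b" for x a b
  proof -
   have "exp (- V x) * (exp (V x / 2) * a * (exp (V x / 2) * b)) = (exp (- V x) * (exp (V x / 2) * exp (V x / 2))) * (a * b)"
    by (simp only: mult_ac)
   also have "exp (- V x) * (exp (V x / 2) * exp (V x / 2)) = 1" by (simp add: mult_exp_exp)
   finally show ?thesis by simp
  qed
  show ?thesis unfolding unweight_def L2_inner_class[OF weighted_fn weighted_fn] integral_state(2)[OF m] inner_fn e ..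
 qed
qed

definition flat_langevin :: "('a phase_L2 \<times> 'a phase_L2) set" where
 "flat_langevin = (\<lambda>f. (L2_of (\<lambda>p. exp (- V (fst p) / 2) * f p), L2_of (\<lambda>p. exp (- V (fst p) / 2) * langevin V \<sigma> f p))) ` test_functions"

lemma weighted_continuous_L2:
 assumes c: "continuous_on state_space f" and s: "xsupp R f"
 shows "(\<lambda>p. exp (- V (fst p) / 2) * f p) \<in> L2_funs flat_measure"
proof (rule L2_funs_continuous)
 have "continuous_on state_space (\<lambda>p. exp (- V (fst p) / 2))" using Cks_continuous[OF Cks_exp_potential[of 0 "- 1 / 2"]] by simp
 then show "continuous_on state_space (\<lambda>p. exp (- V (fst p) / 2) * f p)" using c by (rule continuous_on_mult)
 show "xsupp R (\<lambda>p. exp (- V (fst p) / 2) * f p)" by (rule xsupp_mult2[OF s])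
qed

lemma weighted_test_L2:
 assumes "f \<in> test_functions"
 shows "(\<lambda>p. exp (- V (fst p) / 2) * f p) \<in> L2_funs flat_measure"
  "(\<lambda>p. exp (- V (fst p) / 2) * langevin V \<sigma> f p) \<in> L2_funs flat_measure"
proof -
 obtain R where s: "xsupp R f" by (rule test_function_xsupp[OF assms])
 show "(\<lambda>p. exp (- V (fst p) / 2) * f p) \<in> L2_funs flat_measure"
  by (rule weighted_continuous_L2[OF Cks_continuous[OF test_function_Cks[OF assms, of 0]] s])
 show "(\<lambda>p. exp (- V (fst p) / 2) * langevin V \<sigma> f p) \<in> L2_funs flat_measure"
  by (rule weighted_continuous_L2[OF langevin_continuous[OF V test_function_Cks[OF assms]] langevin_xsupp[OF test_function_Cks[OF assms] s]])
qed

lemma langevin_operator_eq: "map_prod (unweight V) (unweight V) ` flat_langevin = langevin_operator V \<sigma>"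
 unfolding flat_langevin_def langevin_operator_def image_image
 by (intro image_cong refl) (simp only: map_prod_simp unweight_L2_of weighted_test_L2 exp_half)

lemma subspace_flat_langevin: "subspace flat_langevin"
proof -
 let ?e = "\<lambda>f p. exp (- V (fst p) / 2) * (f p :: real)" and ?L = "langevin V \<sigma>"
 note C2 = test_function_Cks[where k = "Suc (Suc 0)"]
 have add: "(L2_of (?e f) + L2_of (?e g), L2_of (?e (?L f)) + L2_of (?e (?L g))) \<in> flat_langevin"
  if f: "f \<in> test_functions" and g: "g \<in> test_functions" for f g
 proof -
  note fg = test_functions_add[OF f g]
  have "L2_of (?e f) + L2_of (?e g) = L2_of (?e (\<lambda>p. f p + g p))"
   unfolding L2_of_ops(1)[OF weighted_test_L2(1)[OF f] weighted_test_L2(1)[OF g]] by (simp only: distrib_left)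
  moreover have "L2_of (?e (?L f)) + L2_of (?e (?L g)) = L2_of (?e (?L (\<lambda>p. f p + g p)))"
   unfolding L2_of_ops(1)[OF weighted_test_L2(2)[OF f] weighted_test_L2(2)[OF g]]
   by (rule L2_of_cong[OF L2_funs_add[OF weighted_test_L2(2)[OF f] weighted_test_L2(2)[OF g]] weighted_test_L2(2)[OF fg]])
    (simp only: langevin_add[OF C2[OF f] C2[OF g]] distrib_left)
  ultimately show ?thesis unfolding flat_langevin_def using fg by auto
 qed
 have scale: "(c *\<^sub>R L2_of (?e f), c *\<^sub>R L2_of (?e (?L f))) \<in> flat_langevin" if f: "f \<in> test_functions" for f c
 proof -
  note cf = test_functions_scale[OF f, of c]
  have "c *\<^sub>R L2_of (?e f) = L2_of (?e (\<lambda>p. c * f p))"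
   unfolding L2_of_scale[OF weighted_test_L2(1)[OF f]] by (simp only: mult.left_commute)
  moreover have "c *\<^sub>R L2_of (?e (?L f)) = L2_of (?e (?L (\<lambda>p. c * f p)))"
   unfolding L2_of_scale[OF weighted_test_L2(2)[OF f]]
   by (rule L2_of_cong[OF L2_funs_scale[OF weighted_test_L2(2)[OF f]] weighted_test_L2(2)[OF cf]])
    (simp only: langevin_scale[OF C2[OF f]] mult.left_commute)
  ultimately show ?thesis unfolding flat_langevin_def using cf by auto
 qed
 show ?thesis
  unfolding subspace_def
 proof (intro conjI ballI allI)
  show "0 \<in> flat_langevin" using scale[OF test_functions_zero, of 0] by (simp add: zero_prod_def)
  show "x + y \<in> flat_langevin" if "x \<in> flat_langevin" "y \<in> flat_langevin" for x y
   using that add unfolding flat_langevin_def by auto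
  show "c *\<^sub>R x \<in> flat_langevin" if "x \<in> flat_langevin" for c x
   using that scale unfolding flat_langevin_def by auto
 qed
qed

lemma flat_langevin_dissipative:
 assumes "(u, v) \<in> flat_langevin" shows "inner v u \<le> 0"
proof -
 obtain f where f: "f \<in> test_functions" and uv: "u = L2_of (\<lambda>p. exp (- V (fst p) / 2) * f p)" "v = L2_of (\<lambda>p. exp (- V (fst p) / 2) * langevin V \<sigma> f p)"
  using assms by (auto simp: flat_langevin_def)
 obtain R where s: "xsupp R f" by (rule test_function_xsupp[OF f])
 have "inner v u = (\<ointegral>p. exp (- V (fst p)) * (f p * langevin V \<sigma> f p))"
  unfolding uv L2_of_ops(2)[OF weighted_test_L2(2)[OF f] weighted_test_L2(1)[OF f]]
 proof (rule lint_cong)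
  fix p :: "'a phase"
  have "exp (- V (fst p)) = exp (- V (fst p) / 2) * exp (- V (fst p) / 2)" by (simp add: mult_exp_exp)
  then show "exp (- V (fst p) / 2) * langevin V \<sigma> f p * (exp (- V (fst p) / 2) * f p) = exp (- V (fst p)) * (f p * langevin V \<sigma> f p)"
   by (simp only: mult_ac)
 qed
 also have "\<dots> \<le> 0" by (rule langevin_dissipative[OF d2 V test_function_Cks[OF f] s])
 finally show ?thesis .
qed

lemma phase_L2_eq_0:
 assumes "AE p in flat_measure. fn g p = 0" shows "g = (0 :: 'a phase_L2)"
proof -
 have "L2_of (fn g) = L2_of (\<lambda>_. 0)" using assms by (simp only: L2_of_eq_iff[OF fn_L2 L2_funs_zero])
 then show ?thesis by (simp add: zero_phase_L2_def)
qed

lemma flat_langevin_dense: "closure (fst ` flat_langevin) = UNIV"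
proof (rule dense_if_orthogonal_trivial)
 show "subspace (fst ` flat_langevin)"
  by (rule linear_subspace_image[OF _ subspace_flat_langevin]) (simp add: linear_iff)
 fix g :: "'a phase_L2" assume o: "\<And>s. s \<in> fst ` flat_langevin ==> inner g s = 0"
 show "g = 0"
 proof (rule phase_L2_eq_0, rule domain_orthogonal_trivial[OF d2 V fn_L2])
  fix f :: "'a phase => real" assume f: "f \<in> test_functions"
  have "inner g (L2_of (\<lambda>p. exp (- V (fst p) / 2) * f p)) = 0"
   by (rule o) (use f in \<open>force simp: flat_langevin_def\<close>)
  then show "(\<ointegral>p. fn g p * (exp (- V (fst p) / 2) * f p)) = 0"
   by (simp only: inner_L2_of[OF weighted_test_L2(1)[OF f]])
 qed
qed

lemma flat_langevin_range: "closure ((\<lambda>(u, v). u - v) ` flat_langevin) = UNIV"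
proof (rule dense_if_orthogonal_trivial)
 show "subspace ((\<lambda>(u, v). u - v) ` flat_langevin)"
  by (rule linear_subspace_image[OF _ subspace_flat_langevin]) (auto simp: linear_iff algebra_simps)
 fix g :: "'a phase_L2" assume o: "\<And>s. s \<in> (\<lambda>(u, v). u - v) ` flat_langevin ==> inner g s = 0"
 show "g = 0"
 proof (rule phase_L2_eq_0, rule range_orthogonal_trivial[OF d2 V fn_L2])
  fix f :: "'a phase => real" assume f: "f \<in> test_functions"
  note w = weighted_test_L2[OF f]
  have "inner g (L2_of (\<lambda>p. exp (- V (fst p) / 2) * f p) - L2_of (\<lambda>p. exp (- V (fst p) / 2) * langevin V \<sigma> f p)) = 0"
   by (rule o) (use f in \<open>force simp: flat_langevin_def\<close>)
  then have "(\<ointegral>p. fn g p * (exp (- V (fst p) / 2) * f p - exp (- V (fst p) / 2) * langevin V \<sigma> f p)) = 0"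
   by (simp only: L2_of_diff[OF w] inner_L2_of[OF L2_funs_diff[OF w]])
  then show "(\<ointegral>p. fn g p * (exp (- V (fst p) / 2) * (f p - langevin V \<sigma> f p))) = 0"
   by (simp only: right_diff_distrib)
 qed
qed

end

theorem theorem4p2:
 fixes V :: "real ^ 'd \<Rightarrow> real" and \<sigma> :: real
 assumes "CARD('d) \<ge> 2" and "\<sigma> > 0" and "smooth_on UNIV V"
 shows "essentially_m_dissipative (state_measure V) (langevin_operator V \<sigma>) \<and>
  (\<exists>T. C0_contraction_semigroup (state_measure V) T \<and>
    infinitesimal_generator (state_measure V) T =
     op_closure (state_measure V) (langevin_operator V \<sigma>))"
proof -
 have d: "2 \<le> DIM(real ^ 'd)" using assms(1) by simp
 have V: "Ck_on k V UNIV" for k using assms(3) by (simp add: smooth_on_def)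
 interpret L2_isometry "state_measure V" "unweight V" by (rule L2_isometry_unweight[OF d V])
 show ?thesis
  using generation[OF subspace_flat_langevin[OF d V] flat_langevin_dissipative[OF d V] flat_langevin_dense[OF d V] flat_langevin_range[OF d V]]
  unfolding langevin_operator_eq[OF d V] .
qed

end
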